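(* Let $s\in(0,1)$ and $n,m\in\mathbb{N}$ (with $n,m\ge 1$). Let $\Omega\subset\mathbb{R}^n$ be an open, bounded and smooth domain and $\Omega_e:=\mathbb{R}^n\setminus\overline{\Omega}$. Let $W_1,W_2\subset\Omega_e$ be nonempty open Lipschitz domains with $\overline{W}_k\cap\overline{\Omega}=\emptyset$ for $k\in\{1,2\}$. Let $g_1,\dots,g_m\in L^\infty(\Omega)$ be orthonormal with respect to the $L^2(\Omega)$ scalar product, and let $0<C_0<\infty$. Then there exists a constant $C_1>0$, depending only on the geometry of the domains $W_1,W_2$, on the functions $g_1,\dots,g_m$, on $C_0$ and on $m$ (for the fixed $s,n,\Omega$), such that for all $q_1,q_2\in\operatorname{span}\{g_1,\dots,g_m\}$ with $\|q_1\|_{L^\infty(\Omega)},\|q_2\|_{L^\infty(\Omega)}\le C_0$ and such that zero is not a Dirichlet eigenvalue of $(-\Delta)^s+q_k$ in $\Omega$ for $k\in\{1,2\}$, one has $$\|q_1-q_2\|_{L^\infty(\Omega)}\le C_1\|\Lambda_{q_1}-\Lambda_{q_2}\|_*,$$ where $$\|\Lambda_{q_1}-\Lambda_{q_2}\|_*:=\sup\big\{((\Lambda_{q_1}-\Lambda_{q_2})f_1,f_2):\ f_j\in\widetilde H^s(W_j),\ \|f_j\|_{\widetilde H^s(W_j)}=1,\ j\in\{1,2\}\big\}.$$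
   Context: All functions are real valued. $(-\Delta)^s$ is the Fourier multiplier with symbol $|\xi|^{2s}$. For an open set $W\subset\mathbb{R}^n$, $\widetilde H^s(W)$ is the closure of $C_c^\infty(W)$ in $H^s(\mathbb{R}^n)$, with the $H^s(\mathbb{R}^n)$ norm. For $q\in L^\infty(\Omega)$ put $B_q(u,v):=((-\Delta)^{s/2}u,(-\Delta)^{s/2}v)_{L^2(\mathbb{R}^n)}+(qu,v)_{L^2(\Omega)}$ for $u,v\in H^s(\mathbb{R}^n)$. Given $f\in H^s(\mathbb{R}^n)$, a (weak) solution of $((-\Delta)^s+q)u=0$ in $\Omega$, $u=f$ in $\Omega_e$, is $u\in H^s(\mathbb{R}^n)$ with $u-f\in\widetilde H^s(\Omega)$ and $B_q(u,w)=0$ for all $w\in\widetilde H^s(\Omega)$. "Zero is not a Dirichlet eigenvalue of $(-\Delta)^s+q$ in $\Omega$" means: the only solution with $f=0$ is $u\equiv0$. In that case for every $f$ there is a unique solution $u_f$, and the Dirichlet-to-Neumann map is defined by $(\Lambda_q f,g):=B_q(u_f,g)$ for exterior data $f,g$ (formally $\Lambda_qf=(-\Delta)^su_f|_{\Omega_e}$). *)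

theory Defs
  imports "HOL-Analysis.Analysis" "HOL-Probability.Essential_Supremum"
begin

text \<open>
  Elements of \<open>L\<^sup>2\<close>, \<open>L\<^sup>\<infinity>\<close> and \<open>H\<^sup>s\<close> are represented by Lebesgue measurable functions; every
  notion below is invariant under changes on null sets. Functions on an open set \<open>\<Omega>\<close> are total
  functions of which only the values on \<open>\<Omega>\<close> matter.
\<close>

section \<open>Smooth functions and regular domains\<close>

primrec Ck :: "nat \<Rightarrow> ('a::real_normed_vector \<Rightarrow> real) \<Rightarrow> bool" where
  "Ck 0 f \<longleftrightarrow> continuous_on UNIV f"
| "Ck (Suc k) f \<longleftrightarrow> (\<forall>x. f differentiable at x) \<and> (\<forall>v. Ck k (\<lambda>x. frechet_derivative f (at x) v))"

definition smooth :: "('a::real_normed_vector \<Rightarrow> real) \<Rightarrow> bool" where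
  "smooth f \<longleftrightarrow> (\<forall>k. Ck k f)"

definition test_fun :: "(real ^ 'n) set \<Rightarrow> (real ^ 'n \<Rightarrow> real) set" where
  "test_fun W = {\<phi>. smooth \<phi> \<and> compact (closure {x. \<phi> x \<noteq> 0}) \<and> closure {x. \<phi> x \<noteq> 0} \<subseteq> W}"

text \<open>
  A domain is a nonempty connected open set. Its boundary is of class \<open>P\<close> if near every boundary
  point the set is, after a rotation of the axes, the region strictly above the graph of a function
  of class \<open>P\<close>. Instead of choosing coordinates we give the unit vector \<open>\<nu>\<close> of the last axis; a
  function on the hyperplane orthogonal to \<open>\<nu>\<close> is encoded as a function \<open>\<gamma>\<close> on the whole space
  that is evaluated at the orthogonal projection only. For \<open>n = 1\<close> the hyperplane is a point.
\<close>

definition is_domain :: "(real ^ 'n) set \<Rightarrow> bool" where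
  "is_domain W \<longleftrightarrow> open W \<and> connected W \<and> W \<noteq> {}"

definition graph_boundary :: "((real ^ 'n \<Rightarrow> real) \<Rightarrow> bool) \<Rightarrow> (real ^ 'n) set \<Rightarrow> bool" where
  "graph_boundary P W \<longleftrightarrow>
     (\<forall>x0 \<in> frontier W. \<exists>r>0. \<exists>\<nu> \<gamma>. norm \<nu> = 1 \<and> P \<gamma> \<and>
        W \<inter> ball x0 r = {x \<in> ball x0 r. \<gamma> (x - (x \<bullet> \<nu>) *\<^sub>R \<nu>) < x \<bullet> \<nu>})"

definition smooth_domain :: "(real ^ 'n) set \<Rightarrow> bool" where
  "smooth_domain W \<longleftrightarrow> is_domain W \<and> graph_boundary smooth W"

definition lipschitz_domain :: "(real ^ 'n) set \<Rightarrow> bool" where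
  "lipschitz_domain W \<longleftrightarrow> is_domain W \<and> graph_boundary (\<lambda>\<gamma>. \<exists>L. L-lipschitz_on UNIV \<gamma>) W"

section \<open>Lebesgue spaces\<close>

definition L2 :: "(real ^ 'n \<Rightarrow> real) set" where
  "L2 = {u. u \<in> borel_measurable lebesgue \<and> integrable lebesgue (\<lambda>x. (u x)\<^sup>2)}"

text \<open>\<open>esssup\<close> is \<open>\<infinity>\<close> on functions that are not measurable.\<close>

definition Linf_norm :: "(real ^ 'n) set \<Rightarrow> (real ^ 'n \<Rightarrow> real) \<Rightarrow> ereal" where
  "Linf_norm \<Omega> q = esssup (lebesgue_on \<Omega>) (\<lambda>x. ereal \<bar>q x\<bar>)"

definition Linf :: "(real ^ 'n) set \<Rightarrow> (real ^ 'n \<Rightarrow> real) set" where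
  "Linf \<Omega> = {q. q \<in> borel_measurable (lebesgue_on \<Omega>) \<and> Linf_norm \<Omega> q < \<infinity>}"

definition inner_L2_on :: "(real ^ 'n) set \<Rightarrow> (real ^ 'n \<Rightarrow> real) \<Rightarrow> (real ^ 'n \<Rightarrow> real) \<Rightarrow> real" where
  "inner_L2_on \<Omega> f g = (LINT x|lebesgue_on \<Omega>. f x * g x)"

definition orthonormal_L2_on :: "(real ^ 'n) set \<Rightarrow> nat \<Rightarrow> (nat \<Rightarrow> real ^ 'n \<Rightarrow> real) \<Rightarrow> bool" where
  "orthonormal_L2_on \<Omega> m g \<longleftrightarrow>
     (\<forall>i\<in>{1..m}. \<forall>j\<in>{1..m}. inner_L2_on \<Omega> (g i) (g j) = (if i = j then 1 else 0))"

text \<open>The linear span as a space of equivalence classes, hence equality almost everywhere.\<close>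

definition span_on :: "(real ^ 'n) set \<Rightarrow> nat \<Rightarrow> (nat \<Rightarrow> real ^ 'n \<Rightarrow> real) \<Rightarrow> (real ^ 'n \<Rightarrow> real) set" where
  "span_on \<Omega> m g = {q. q \<in> borel_measurable (lebesgue_on \<Omega>) \<and>
     (\<exists>c :: nat \<Rightarrow> real. AE x in lebesgue_on \<Omega>. q x = (\<Sum>i=1..m. c i * g i x))}"

section \<open>Fourier transform, Sobolev spaces and the fractional Laplacian\<close>

definition fourier_L1 :: "(real ^ 'n \<Rightarrow> real) \<Rightarrow> real ^ 'n \<Rightarrow> complex" where
  "fourier_L1 u \<xi> = of_real ((2 * pi) powr (- real CARD('n) / 2)) *
     (LINT x|lebesgue. cis (- (\<xi> \<bullet> x)) * of_real (u x))"

text \<open>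
  The Fourier--Plancherel transform on \<open>L\<^sup>2\<close>: the limit in \<open>L\<^sup>2\<close> of the transforms of the
  truncations to balls. It is determined up to a null set, and \<open>fourier\<close> picks a representative.
\<close>

definition is_fourier :: "(real ^ 'n \<Rightarrow> real) \<Rightarrow> (real ^ 'n \<Rightarrow> complex) \<Rightarrow> bool" where
  "is_fourier u U \<longleftrightarrow> U \<in> borel_measurable lebesgue \<and> integrable lebesgue (\<lambda>\<xi>. (norm (U \<xi>))\<^sup>2) \<and>
     ((\<lambda>R. \<integral>\<^sup>+\<xi>. ennreal ((norm (U \<xi> - fourier_L1 (\<lambda>x. indicator (cball 0 R) x * u x) \<xi>))\<^sup>2) \<partial>lebesgue)
        \<longlongrightarrow> 0) at_top"

definition fourier :: "(real ^ 'n \<Rightarrow> real) \<Rightarrow> real ^ 'n \<Rightarrow> complex" where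
  "fourier u = (SOME U. is_fourier u U)"

definition Hs :: "real \<Rightarrow> (real ^ 'n \<Rightarrow> real) set" where
  "Hs s = {u \<in> L2. integrable lebesgue (\<lambda>\<xi>. (1 + (norm \<xi>)\<^sup>2) powr s * (norm (fourier u \<xi>))\<^sup>2)}"

definition Hs_norm :: "real \<Rightarrow> (real ^ 'n \<Rightarrow> real) \<Rightarrow> real" where
  "Hs_norm s u = sqrt (LINT \<xi>|lebesgue. (1 + (norm \<xi>)\<^sup>2) powr s * (norm (fourier u \<xi>))\<^sup>2)"

definition Hs_tilde :: "real \<Rightarrow> (real ^ 'n) set \<Rightarrow> (real ^ 'n \<Rightarrow> real) set" where
  "Hs_tilde s W = {u \<in> Hs s. \<forall>\<epsilon>>0. \<exists>\<phi> \<in> test_fun W. Hs_norm s (\<lambda>x. u x - \<phi> x) < \<epsilon>}"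

text \<open>
  \<open>frac_laplacian a u\<close> represents \<open>(-\<Delta>)\<^sup>a u\<close> for real valued \<open>u\<close> in \<open>H\<^bsup>2a\<^esup>\<close>, \<open>a \<ge> 0\<close>: the real
  valued \<open>L\<^sup>2\<close> function, unique up to a null set, whose Fourier transform is that of \<open>u\<close> times
  \<open>\<bar>\<xi>\<bar>\<^bsup>2a\<^esup>\<close>.
\<close>

definition frac_laplacian :: "real \<Rightarrow> (real ^ 'n \<Rightarrow> real) \<Rightarrow> real ^ 'n \<Rightarrow> real" where
  "frac_laplacian a u = (SOME w. w \<in> L2 \<and>
     (AE \<xi> in lebesgue. fourier w \<xi> = of_real (norm \<xi> powr (2 * a)) * fourier u \<xi>))"

section \<open>The Dirichlet problem and the Dirichlet-to-Neumann map\<close>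

definition bform :: "real \<Rightarrow> (real ^ 'n) set \<Rightarrow> (real ^ 'n \<Rightarrow> real) \<Rightarrow>
    (real ^ 'n \<Rightarrow> real) \<Rightarrow> (real ^ 'n \<Rightarrow> real) \<Rightarrow> real" where
  "bform s \<Omega> q u v =
     inner_L2_on UNIV (frac_laplacian (s / 2) u) (frac_laplacian (s / 2) v) +
     inner_L2_on \<Omega> (\<lambda>x. q x * u x) v"

definition weak_solution :: "real \<Rightarrow> (real ^ 'n) set \<Rightarrow> (real ^ 'n \<Rightarrow> real) \<Rightarrow>
    (real ^ 'n \<Rightarrow> real) \<Rightarrow> (real ^ 'n \<Rightarrow> real) \<Rightarrow> bool" where
  "weak_solution s \<Omega> q f u \<longleftrightarrow> u \<in> Hs s \<and> (\<lambda>x. u x - f x) \<in> Hs_tilde s \<Omega> \<and>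
     (\<forall>w \<in> Hs_tilde s \<Omega>. bform s \<Omega> q u w = 0)"

definition zero_not_dirichlet_eigenvalue ::
    "real \<Rightarrow> (real ^ 'n) set \<Rightarrow> (real ^ 'n \<Rightarrow> real) \<Rightarrow> bool" where
  "zero_not_dirichlet_eigenvalue s \<Omega> q \<longleftrightarrow>
     (\<forall>u. weak_solution s \<Omega> q (\<lambda>_. 0) u \<longrightarrow> (AE x in lebesgue. u x = 0))"

definition solution :: "real \<Rightarrow> (real ^ 'n) set \<Rightarrow> (real ^ 'n \<Rightarrow> real) \<Rightarrow>
    (real ^ 'n \<Rightarrow> real) \<Rightarrow> real ^ 'n \<Rightarrow> real" where
  "solution s \<Omega> q f = (SOME u. weak_solution s \<Omega> q f u)"

text \<open>The pairing \<open>(\<Lambda>\<^sub>q f, g)\<close>.\<close>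

definition DN_map :: "real \<Rightarrow> (real ^ 'n) set \<Rightarrow> (real ^ 'n \<Rightarrow> real) \<Rightarrow>
    (real ^ 'n \<Rightarrow> real) \<Rightarrow> (real ^ 'n \<Rightarrow> real) \<Rightarrow> real" where
  "DN_map s \<Omega> q f g = bform s \<Omega> q (solution s \<Omega> q f) g"

text \<open>The supremum is taken in \<open>ereal\<close>, where it exists without a boundedness argument.\<close>

definition DN_diff_norm :: "real \<Rightarrow> (real ^ 'n) set \<Rightarrow> (real ^ 'n) set \<Rightarrow> (real ^ 'n) set \<Rightarrow>
    (real ^ 'n \<Rightarrow> real) \<Rightarrow> (real ^ 'n \<Rightarrow> real) \<Rightarrow> ereal" where
  "DN_diff_norm s \<Omega> W1 W2 q1 q2 =
     Sup {ereal (DN_map s \<Omega> q1 f1 f2 - DN_map s \<Omega> q2 f1 f2) | f1 f2.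
       f1 \<in> Hs_tilde s W1 \<and> Hs_norm s f1 = 1 \<and> f2 \<in> Hs_tilde s W2 \<and> Hs_norm s f2 = 1}"

end

theory Submission
  imports Defs "HOL-Complex_Analysis.Great_Picard" "HOL-Probability.Probability"
begin

text \<open>
  The proof is by compactness. If no constant works, there are pairs of potentials whose difference
  is not controlled; along a subsequence the potentials and the direction of their difference
  converge in the finite dimensional space, the latter to some \<open>d \<noteq> 0\<close>. Choose test functions
  \<open>\<psi>\<^sub>1\<close>, \<open>\<psi>\<^sub>2\<close> on \<open>\<Omega>\<close> such that the integral of \<open>d \<psi>\<^sub>1 \<psi>\<^sub>2\<close> does not vanish.
  By the Runge property of the limit potentials, \<open>\<psi>\<^sub>1\<close> and \<open>\<psi>\<^sub>2\<close> are approximated on \<open>\<Omega>\<close>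
  by solutions, with exterior data that stay bounded along the sequence since the bilinear forms are
  a convergent family of perturbations of the identity that are uniformly compact on functions
  supported in \<open>\<Omega>\<close>. The Alessandrini identity then bounds the difference of the
  Dirichlet-to-Neumann maps from below by a multiple of the difference of the potentials.

  The Runge property is dual to unique continuation: a function \<open>v\<close> supported in the closure of
  \<open>\<Omega>\<close> whose fractional Laplacian vanishes on an open set \<open>W\<close> away from \<open>\<Omega>\<close> is zero. On
  \<open>W\<close> the fractional Laplacian of \<open>v\<close> is a multiple of the convolution of \<open>v\<close> with
  \<open>\<bar>x\<bar>\<close> to the power \<open>- (n + 2 s)\<close>. Applying the Laplacian repeatedly, the convolutions with
  the powers \<open>- (n + 2 s + 2 k)\<close> vanish as well, hence by the Weierstrass theorem so do those with
  Gaussians, and the Gaussians centred in a ball of \<open>W\<close> span an algebra that separates points.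
\<close>

section \<open>The Hilbert space of square integrable functions\<close>

text \<open>A limit of admissible potentials may itself have zero as a Dirichlet eigenvalue, so
  solutions with fixed exterior data can blow up along the sequence. Exterior data and solution are
  therefore sought together: the form is tested on functions supported in \<Omega> and also on
  functions supported in W. By unique continuation this overdetermined system is injective for every
  bounded potential, whatever its spectrum; compactness turns injectivity into a lower bound that is
  uniform along the sequence, and duality turns the lower bound into controls of bounded norm.
  Everything takes place in the real Hilbert space L2. The Hartley transform is real, symmetric and
  involutive, and with a weight it makes the Sobolev space isometric to L2; there the bilinear form
  is the inner product minus a form controlled by the L2 norm of the functions. The iteration of the
  Laplacian never stalls: on the power \<open>- b\<close> it produces the factor
  \<open>b * (b + 2 - n)\<close>, which is positive for
  \<open>b = n + 2 * s + 2 * k\<close>.\<close>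

definition sqint :: "('a::euclidean_space \<Rightarrow> real) set" where
  "sqint = {f. f \<in> borel_measurable lebesgue \<and> integrable lebesgue (\<lambda>x. (f x)\<^sup>2)}"

text \<open>The predicate depends on \<open>f\<close> only through its class modulo null sets. The
  choice is thus constant on classes, and L2 can be a type of chosen representatives instead of a
  quotient.\<close>

definition canon :: "('a::euclidean_space \<Rightarrow> real) \<Rightarrow> 'a \<Rightarrow> real" where
  "canon f = (SOME g. g \<in> borel_measurable borel \<and> (AE x in lborel. g x = f x))"

lemma AE_lebesgue_iff: "(AE x in lebesgue. P x) \<longleftrightarrow> (AE x in lborel. P x)"
  by (rule AE_completion_iff)

lemma canon:
  fixes f :: "'a::euclidean_space \<Rightarrow> real"
  assumes "f \<in> borel_measurable lebesgue"
  shows "canon f \<in> borel_measurable borel" and "AE x in lborel. canon f x = f x"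
proof -
  obtain g where "g \<in> borel_measurable lborel" and "AE x in lborel. f x = g x"
    using completion_ex_borel_measurable_real[OF assms] by blast
  then have "g \<in> borel_measurable borel \<and> (AE x in lborel. g x = f x)"
    by (auto elim: eventually_mono)
  from someI[of "\<lambda>g. g \<in> borel_measurable borel \<and> (AE x in lborel. g x = f x)", OF this]
  show "canon f \<in> borel_measurable borel" and "AE x in lborel. canon f x = f x"
    unfolding canon_def by auto
qed

lemma canon_cong:
  assumes "AE x in lborel. f x = g x"
  shows "canon f = canon g"
proof -
  have "(\<lambda>h. h \<in> borel_measurable borel \<and> (AE x in lborel. h x = f x)) =
        (\<lambda>h. h \<in> borel_measurable borel \<and> (AE x in lborel. h x = g x))"
  proof (rule ext, rule conj_cong[OF refl])
    fix h show "(AE x in lborel. h x = f x) = (AE x in lborel. h x = g x)"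
    proof
      assume "AE x in lborel. h x = f x"
      with assms show "AE x in lborel. h x = g x" by eventually_elim simp
    next
      assume "AE x in lborel. h x = g x"
      with assms show "AE x in lborel. h x = f x" by eventually_elim simp
    qed
  qed
  then show ?thesis unfolding canon_def by simp
qed

lemma borel_measurable_lborel_lebesgue: "f \<in> borel_measurable borel \<Longrightarrow> f \<in> borel_measurable lebesgue"
  by (simp add: measurable_completion)

lemma integrable_lborel_cong:
  fixes f g :: "'a::euclidean_space \<Rightarrow> real"
  assumes "integrable lebesgue f" "g \<in> borel_measurable borel" "AE x in lborel. g x = f x"
  shows "integrable lborel g" "(LINT x|lborel. g x) = (LINT x|lebesgue. f x)"
proof -
  have g: "g \<in> borel_measurable lebesgue" "g \<in> borel_measurable lborel"
    using assms by (auto intro: borel_measurable_lborel_lebesgue)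
  have ae: "AE x in lebesgue. f x = g x"
    unfolding AE_lebesgue_iff using assms(3) by (auto elim: eventually_mono)
  have "integrable lebesgue g"
    by (rule Bochner_Integration.integrable_cong_AE_imp[OF assms(1) g(1) ae])
  then show "integrable lborel g"
    using integrable_completion[OF g(2)] by simp
  have "(LINT x|lborel. g x) = (LINT x|lebesgue. g x)"
    using integral_completion[OF g(2)] by simp
  also have "\<dots> = (LINT x|lebesgue. f x)"
    using g assms(1) ae by (intro integral_cong_AE) (auto elim: eventually_mono)
  finally show "(LINT x|lborel. g x) = (LINT x|lebesgue. f x)" .
qed

lemma canon_sqint:
  assumes "f \<in> sqint"
  shows "canon f \<in> borel_measurable borel" and "AE x in lborel. canon f x = f x"
    and "integrable lborel (\<lambda>x. (canon f x)\<^sup>2)" and "canon (canon f) = canon f"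
proof -
  have f: "f \<in> borel_measurable lebesgue" "integrable lebesgue (\<lambda>x. (f x)\<^sup>2)"
    using assms by (auto simp: sqint_def)
  show 1: "canon f \<in> borel_measurable borel" and 2: "AE x in lborel. canon f x = f x"
    using canon[OF f(1)] by auto
  show "integrable lborel (\<lambda>x. (canon f x)\<^sup>2)"
  proof (rule integrable_lborel_cong(1)[OF f(2)])
    show "(\<lambda>x. (canon f x)\<^sup>2) \<in> borel_measurable borel" using 1 by measurable
    show "AE x in lborel. (canon f x)\<^sup>2 = (f x)\<^sup>2" using 2 by eventually_elim simp
  qed
  show "canon (canon f) = canon f" by (rule canon_cong[OF 2])
qed

lemma sqint_borelI:
  "f \<in> borel_measurable borel \<Longrightarrow> integrable lborel (\<lambda>x. (f x)\<^sup>2) \<Longrightarrow> f \<in> sqint"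
  by (auto simp: sqint_def integrable_completion intro!: borel_measurable_lborel_lebesgue)

lemma zero_sqint: "(\<lambda>x. 0) \<in> sqint"
  by (simp add: sqint_def)

text \<open>Representatives are Borel rather than Lebesgue measurable, so that Fubini and
  substitutions take place on \<open>lborel\<close> and its products, without completions.\<close>

typedef (overloaded) 'a l2 = "{f :: 'a::euclidean_space \<Rightarrow> real. f \<in> borel_measurable borel \<and>
    integrable lborel (\<lambda>x. (f x)\<^sup>2) \<and> canon f = f}"
  morphisms fn Abs_l2
  using canon_sqint[OF zero_sqint] by blast

definition cls :: "('a::euclidean_space \<Rightarrow> real) \<Rightarrow> 'a l2" where
  "cls f = Abs_l2 (canon f)"

lemma fn_measurable[measurable]: "fn a \<in> borel_measurable borel"
  using fn[of a] by simp

lemma fn_square_integrable: "integrable lborel (\<lambda>x. (fn a x)\<^sup>2)"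
  using fn[of a] by simp

lemma fn_sqint[simp]: "fn a \<in> sqint"
  by (rule sqint_borelI[OF fn_measurable fn_square_integrable])

lemma fn_cls_canon: "f \<in> sqint \<Longrightarrow> fn (cls f) = canon f"
  unfolding cls_def by (rule Abs_l2_inverse) (auto simp: canon_sqint)

lemma fn_cls: "f \<in> sqint \<Longrightarrow> AE x in lborel. fn (cls f) x = f x"
  by (simp add: fn_cls_canon canon_sqint)

lemma cls_fn[simp]: "cls (fn a) = a"
  unfolding cls_def using fn[of a] by (simp add: fn_inverse)

lemma l2_eqI:
  assumes "AE x in lborel. fn a x = fn b x"
  shows "a = b"
  using canon_cong[OF assms] fn[of a] fn[of b] by (simp add: fn_inject)

lemma cls_cong: "AE x in lborel. f x = g x \<Longrightarrow> cls f = cls g"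
  unfolding cls_def by (simp add: canon_cong)

lemma cls_eqI:
  assumes "f \<in> sqint" "AE x in lborel. f x = fn a x"
  shows "cls f = a"
  using cls_cong[OF assms(2)] by simp

lemma integrable_sq_mult:
  fixes f g :: "'b \<Rightarrow> real"
  assumes "f \<in> borel_measurable M" "g \<in> borel_measurable M"
    "integrable M (\<lambda>x. (f x)\<^sup>2)" "integrable M (\<lambda>x. (g x)\<^sup>2)"
  shows "integrable M (\<lambda>x. f x * g x)"
proof (rule Bochner_Integration.integrable_bound)
  show "integrable M (\<lambda>x. (f x)\<^sup>2 + (g x)\<^sup>2)" using assms by simp
  show "(\<lambda>x. f x * g x) \<in> borel_measurable M" using assms by simp
  show "AE x in M. norm (f x * g x) \<le> norm ((f x)\<^sup>2 + (g x)\<^sup>2)"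
  proof (rule AE_I2)
    fix x
    have "2 * \<bar>f x * g x\<bar> \<le> (f x)\<^sup>2 + (g x)\<^sup>2"
      using sum_squares_bound[of "\<bar>f x\<bar>" "\<bar>g x\<bar>"] by (simp add: abs_mult)
    moreover have "0 \<le> \<bar>f x * g x\<bar>" by simp
    ultimately show "norm (f x * g x) \<le> norm ((f x)\<^sup>2 + (g x)\<^sup>2)" by (simp only: real_norm_def)
  qed
qed

lemma sqint_mult_integrable: "f \<in> sqint \<Longrightarrow> g \<in> sqint \<Longrightarrow> integrable lebesgue (\<lambda>x. f x * g x)"
  by (rule integrable_sq_mult) (auto simp: sqint_def)

lemma fn_mult_integrable: "integrable lborel (\<lambda>x. fn a x * fn b x)"
  by (rule integrable_sq_mult) (auto simp: fn_square_integrable)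

lemma sqint_add:
  fixes f g :: "'a::euclidean_space \<Rightarrow> real"
  assumes "f \<in> sqint" "g \<in> sqint"
  shows "(\<lambda>x. f x + g x) \<in> sqint"
proof -
  have "integrable lebesgue (\<lambda>x. (f x)\<^sup>2 + 2 * (f x * g x) + (g x)\<^sup>2)"
    using assms sqint_mult_integrable[OF assms] by (auto simp: sqint_def)
  moreover have "(\<lambda>x. (f x)\<^sup>2 + 2 * (f x * g x) + (g x)\<^sup>2) = (\<lambda>x. (f x + g x)\<^sup>2)"
    by (auto simp: power2_sum algebra_simps)
  ultimately show ?thesis using assms by (auto simp: sqint_def)
qed

lemma sqint_cmult:
  fixes f :: "'a::euclidean_space \<Rightarrow> real"
  shows "f \<in> sqint \<Longrightarrow> (\<lambda>x. c * f x) \<in> sqint"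
  by (auto simp: sqint_def power_mult_distrib)

lemma sqint_minus: "f \<in> sqint \<Longrightarrow> (\<lambda>x. - f x) \<in> sqint"
  using sqint_cmult[of f "-1"] by simp

lemma sqint_diff: "f \<in> sqint \<Longrightarrow> g \<in> sqint \<Longrightarrow> (\<lambda>x. f x - g x) \<in> sqint"
  using sqint_add[OF _ sqint_minus, of f g] by simp

lemma sqint_bounded_mult:
  fixes f m :: "'a::euclidean_space \<Rightarrow> real"
  assumes "f \<in> sqint" "m \<in> borel_measurable lebesgue" "AE x in lborel. \<bar>m x\<bar> \<le> C"
  shows "(\<lambda>x. m x * f x) \<in> sqint"
proof -
  have "integrable lebesgue (\<lambda>x. (m x * f x)\<^sup>2)"
  proof (rule Bochner_Integration.integrable_bound)
    show "integrable lebesgue (\<lambda>x. C\<^sup>2 * (f x)\<^sup>2)" using assms by (auto simp: sqint_def)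
    show "(\<lambda>x. (m x * f x)\<^sup>2) \<in> borel_measurable lebesgue" using assms by (auto simp: sqint_def)
    show "AE x in lebesgue. norm ((m x * f x)\<^sup>2) \<le> norm (C\<^sup>2 * (f x)\<^sup>2)"
      unfolding AE_lebesgue_iff using assms(3)
    proof eventually_elim
      case (elim x)
      then have "(m x)\<^sup>2 \<le> C\<^sup>2" using abs_le_square_iff[of "m x" C] by force
      then show ?case by (simp add: power_mult_distrib mult_right_mono)
    qed
  qed
  then show ?thesis using assms by (auto simp: sqint_def)
qed

instantiation l2 :: (euclidean_space) real_inner
begin

definition "0 = cls (\<lambda>x::'a. 0)"
definition "a + b = cls (\<lambda>x::'a. fn a x + fn b x)"
definition "a - b = cls (\<lambda>x::'a. fn a x - fn b x)"
definition "- a = cls (\<lambda>x::'a. - fn a x)"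
definition "r *\<^sub>R a = cls (\<lambda>x::'a. r * fn a x)"
definition "inner a b = (LINT x|lborel. fn a x * fn b (x::'a))"
definition "norm (a::'a l2) = sqrt (inner a a)"
definition "dist (a::'a l2) b = norm (a - b)"
definition "sgn a = cls (\<lambda>x::'a. inverse (norm a) * fn a x)"
definition [code del]: "(uniformity :: ('a l2 \<times> 'a l2) filter) = (INF e\<in>{0 <..}. principal {(x, y). dist x y < e})"
definition [code del]: "open (U :: 'a l2 set) \<longleftrightarrow> (\<forall>x\<in>U. eventually (\<lambda>(x', y). x' = x \<longrightarrow> y \<in> U) uniformity)"

lemma fn_zero_aux: "AE x in lborel. fn (0::'a l2) x = 0"
  unfolding zero_l2_def by (rule fn_cls[OF zero_sqint])

lemma fn_add_aux: "AE x in lborel. fn (a + b) x = fn a x + fn (b::'a l2) x"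
  unfolding plus_l2_def by (rule fn_cls) (simp add: sqint_add)

lemma fn_diff_aux: "AE x in lborel. fn (a - b) x = fn a x - fn (b::'a l2) x"
  unfolding minus_l2_def by (rule fn_cls) (simp add: sqint_diff)

lemma fn_minus_aux: "AE x in lborel. fn (- a) x = - fn (a::'a l2) x"
  unfolding uminus_l2_def by (rule fn_cls) (simp add: sqint_minus)

lemma fn_scaleR_aux: "AE x in lborel. fn (r *\<^sub>R a) x = r * fn (a::'a l2) x"
  unfolding scaleR_l2_def by (rule fn_cls) (simp add: sqint_cmult)

instance
proof
  fix a b c :: "'a l2" and r s :: real
  show "a + b + c = a + (b + c)"
    by (rule l2_eqI, use fn_add_aux[of "a + b" c] fn_add_aux[of a b] fn_add_aux[of b c] fn_add_aux[of a "b + c"] in \<open>eventually_elim, simp\<close>)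
  show "a + b = b + a"
    by (rule l2_eqI, use fn_add_aux[of a b] fn_add_aux[of b a] in \<open>eventually_elim, simp\<close>)
  show "0 + a = a"
    by (rule l2_eqI, use fn_add_aux[of 0 a] fn_zero_aux in \<open>eventually_elim, simp\<close>)
  show "- a + a = 0"
    by (rule l2_eqI, use fn_add_aux[of "- a" a] fn_minus_aux[of a] fn_zero_aux in \<open>eventually_elim, simp\<close>)
  show "a - b = a + - b"
    by (rule l2_eqI, use fn_diff_aux[of a b] fn_minus_aux[of b] fn_add_aux[of a "- b"] in \<open>eventually_elim, simp\<close>)
  show "r *\<^sub>R (a + b) = r *\<^sub>R a + r *\<^sub>R b"
    by (rule l2_eqI, use fn_scaleR_aux[of r "a + b"] fn_add_aux[of a b] fn_scaleR_aux[of r a] fn_scaleR_aux[of r b]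
      fn_add_aux[of "r *\<^sub>R a" "r *\<^sub>R b"] in \<open>eventually_elim, simp add: algebra_simps\<close>)
  show "(r + s) *\<^sub>R a = r *\<^sub>R a + s *\<^sub>R a"
    by (rule l2_eqI, use fn_scaleR_aux[of "r + s" a] fn_scaleR_aux[of r a] fn_scaleR_aux[of s a]
      fn_add_aux[of "r *\<^sub>R a" "s *\<^sub>R a"] in \<open>eventually_elim, simp add: algebra_simps\<close>)
  show "r *\<^sub>R s *\<^sub>R a = (r * s) *\<^sub>R a"
    by (rule l2_eqI, use fn_scaleR_aux[of "r * s" a] fn_scaleR_aux[of s a] fn_scaleR_aux[of r "s *\<^sub>R a"] in \<open>eventually_elim, simp\<close>)
  show "1 *\<^sub>R a = a"
    by (rule l2_eqI, use fn_scaleR_aux[of 1 a] in \<open>eventually_elim, simp\<close>)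
  show "dist a b = norm (a - b)" by (rule dist_l2_def)
  show "sgn a = inverse (norm a) *\<^sub>R a" by (simp add: sgn_l2_def scaleR_l2_def)
  show "uniformity = (INF e\<in>{0 <..}. principal {(x, y :: 'a l2). dist x y < e})"
    by (rule uniformity_l2_def)
  show "open U \<longleftrightarrow> (\<forall>x\<in>U. eventually (\<lambda>(x', y). x' = x \<longrightarrow> y \<in> U) uniformity)" for U :: "'a l2 set"
    by (rule open_l2_def)
  show "inner a b = inner b a" by (simp add: inner_l2_def mult.commute)
  have "inner (a + b) c = (LINT x|lborel. fn a x * fn c x + fn b x * fn c x)"
    unfolding inner_l2_def
  proof (rule integral_cong_AE)
    show "AE x in lborel. fn (a + b) x * fn c x = fn a x * fn c x + fn b x * fn c x"
      using fn_add_aux[of a b] by eventually_elim (simp add: algebra_simps)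
  qed measurable
  then show "inner (a + b) c = inner a c + inner b c"
    by (simp add: inner_l2_def fn_mult_integrable)
  have "inner (r *\<^sub>R a) b = (LINT x|lborel. r * (fn a x * fn b x))"
    unfolding inner_l2_def
  proof (rule integral_cong_AE)
    show "AE x in lborel. fn (r *\<^sub>R a) x * fn b x = r * (fn a x * fn b x)"
      using fn_scaleR_aux[of r a] by eventually_elim (simp add: algebra_simps)
  qed measurable
  then show "inner (r *\<^sub>R a) b = r * inner a b"
    by (simp add: inner_l2_def)
  show "0 \<le> inner a a" by (simp add: inner_l2_def)
  show "norm a = sqrt (inner a a)" by (rule norm_l2_def)
  show "inner a a = 0 \<longleftrightarrow> a = 0"
  proof
    assume "inner a a = 0"
    then have "(LINT x|lborel. (fn a x)\<^sup>2) = 0" by (simp add: inner_l2_def power2_eq_square)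
    then have "AE x in lborel. (fn a x)\<^sup>2 = 0"
      using integral_nonneg_eq_0_iff_AE[OF fn_square_integrable[of a]] by simp
    note * = this
    show "a = 0" by (rule l2_eqI, use * fn_zero_aux in \<open>eventually_elim, simp\<close>)
  next
    assume "a = 0"
    then have "AE x in lborel. fn a x * fn a x = 0" using fn_zero_aux by (auto elim!: eventually_mono)
    then show "inner a a = 0" unfolding inner_l2_def by (subst integral_cong_AE[where g="\<lambda>_. 0"]) auto
  qed
qed

end

lemmas fn_zero = fn_zero_aux and fn_add = fn_add_aux and fn_diff = fn_diff_aux
  and fn_minus = fn_minus_aux and fn_scaleR = fn_scaleR_aux

lemma inner_cls:
  assumes "f \<in> sqint" "g \<in> sqint"
  shows "inner (cls f) (cls g) = (LINT x|lebesgue. f x * g x)"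
  unfolding inner_l2_def
proof (rule integrable_lborel_cong(2))
  show "integrable lebesgue (\<lambda>x. f x * g x)" by (rule sqint_mult_integrable[OF assms])
  show "AE x in lborel. fn (cls f) x * fn (cls g) x = f x * g x"
    using fn_cls[OF assms(1)] fn_cls[OF assms(2)] by eventually_elim simp
qed measurable

lemma norm_cls_sq: "f \<in> sqint \<Longrightarrow> (norm (cls f))\<^sup>2 = (LINT x|lebesgue. (f x)\<^sup>2)"
  unfolding power2_norm_eq_inner by (simp add: inner_cls power2_eq_square)

lemma cls_add:
  assumes f: "f \<in> sqint" and g: "g \<in> sqint"
  shows "cls (\<lambda>x. f x + g x) = cls f + cls g"
  by (rule l2_eqI, use fn_cls[OF f] fn_cls[OF g] fn_add[of "cls f" "cls g"] fn_cls[OF sqint_add[OF f g]] in \<open>eventually_elim, simp\<close>)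

lemma cls_diff:
  assumes f: "f \<in> sqint" and g: "g \<in> sqint"
  shows "cls (\<lambda>x. f x - g x) = cls f - cls g"
  by (rule l2_eqI, use fn_cls[OF f] fn_cls[OF g] fn_diff[of "cls f" "cls g"] fn_cls[OF sqint_diff[OF f g]] in \<open>eventually_elim, simp\<close>)

lemma cls_cmult:
  assumes f: "f \<in> sqint"
  shows "cls (\<lambda>x. c * f x) = c *\<^sub>R cls f"
  by (rule l2_eqI, use fn_cls[OF f] fn_scaleR[of c "cls f"] fn_cls[OF sqint_cmult[OF f, of c]] in \<open>eventually_elim, simp\<close>)

text \<open>Fatou's lemma for the squares. Convergence in norm is not assumed; applied to
  differences, the lemma yields it.\<close>

lemma sqint_limit:
  fixes F :: "nat \<Rightarrow> 'a::euclidean_space \<Rightarrow> real"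
  assumes "\<And>n. F n \<in> sqint" "G \<in> borel_measurable lebesgue"
    "AE x in lborel. (\<lambda>n. F n x) \<longlonglongrightarrow> G x" "\<And>n. norm (cls (F n)) \<le> C"
  shows "G \<in> sqint" "norm (cls G) \<le> C"
proof -
  have C: "0 \<le> C" using assms(4)[of 0] norm_ge_zero order_trans by blast
  have F: "F n \<in> borel_measurable lebesgue" for n using assms(1) by (auto simp: sqint_def)
  have "(\<integral>\<^sup>+x. ennreal ((G x)\<^sup>2) \<partial>lebesgue) = (\<integral>\<^sup>+x. liminf (\<lambda>n. ennreal ((F n x)\<^sup>2)) \<partial>lebesgue)"
  proof (rule nn_integral_cong_AE, unfold AE_lebesgue_iff, use assms(3) in eventually_elim)
    case (elim x)
    have "(\<lambda>n. ennreal ((F n x)\<^sup>2)) \<longlonglongrightarrow> ennreal ((G x)\<^sup>2)"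
      using elim by (intro tendsto_ennrealI tendsto_power)
    then show ?case by (intro lim_imp_Liminf[symmetric]) auto
  qed
  also have "\<dots> \<le> liminf (\<lambda>n. \<integral>\<^sup>+x. ennreal ((F n x)\<^sup>2) \<partial>lebesgue)"
    using F by (intro nn_integral_liminf) measurable
  also have "\<dots> \<le> ennreal (C\<^sup>2)"
  proof (rule Liminf_le)
    show "\<forall>\<^sub>F n in sequentially. (\<integral>\<^sup>+x. ennreal ((F n x)\<^sup>2) \<partial>lebesgue) \<le> ennreal (C\<^sup>2)"
    proof (rule always_eventually, rule allI)
      fix n
      have "(\<integral>\<^sup>+x. ennreal ((F n x)\<^sup>2) \<partial>lebesgue) = ennreal ((norm (cls (F n)))\<^sup>2)"
        using assms(1)[of n] by (subst nn_integral_eq_integral) (auto simp: sqint_def norm_cls_sq)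
      also have "\<dots> \<le> ennreal (C\<^sup>2)" using assms(4)[of n] by (intro ennreal_leI power_mono) auto
      finally show "(\<integral>\<^sup>+x. ennreal ((F n x)\<^sup>2) \<partial>lebesgue) \<le> ennreal (C\<^sup>2)" .
    qed
  qed simp
  finally have le: "(\<integral>\<^sup>+x. ennreal ((G x)\<^sup>2) \<partial>lebesgue) \<le> ennreal (C\<^sup>2)" .
  have "integrable lebesgue (\<lambda>x. (G x)\<^sup>2)"
    using assms(2) le_less_trans[OF le] by (intro integrableI_nonneg) auto
  then show G: "G \<in> sqint" using assms(2) by (auto simp: sqint_def)
  have "ennreal ((norm (cls G))\<^sup>2) \<le> ennreal (C\<^sup>2)"
    using le G by (subst (asm) nn_integral_eq_integral) (auto simp: sqint_def norm_cls_sq[OF G])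
  then have "(norm (cls G))\<^sup>2 \<le> C\<^sup>2" by simp
  then show "norm (cls G) \<le> C" using C by (rule power2_le_imp_le)
qed

text \<open>Multiplication by a positive function that is both integrable and bounded turns an
  \<open>L\<^sup>2\<close> Cauchy sequence into an \<open>L\<^sup>1\<close> Cauchy sequence.\<close>

lemma l2_Cauchy_AE_subseq:
  fixes X :: "nat \<Rightarrow> 'a::euclidean_space l2"
  assumes "Cauchy X"
  obtains r G where "strict_mono (r::nat \<Rightarrow> nat)" "G \<in> borel_measurable borel"
    "AE x in lborel. (\<lambda>n. fn (X (r n)) x) \<longlonglongrightarrow> G x"
proof -
  obtain h :: "'a \<Rightarrow> real" where h: "h \<in> borel_measurable lborel" "\<And>x. h x > 0" "\<And>x. h x \<le> 1" "integrable lborel h"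
    using sigma_finite_measure.obtain_positive_integrable_function[OF sigma_finite_lborel] by blast
  have hb[measurable]: "h \<in> borel_measurable borel" using h(1) by simp
  have h2: "integrable lborel (\<lambda>x. (h x)\<^sup>2)"
  proof (rule Bochner_Integration.integrable_bound[OF h(4)])
    show "AE x in lborel. norm ((h x)\<^sup>2) \<le> norm (h x)"
      using h(2,3) by (intro AE_I2) (auto simp: power2_eq_square mult_left_le less_imp_le)
  qed measurable
  define H where "H = cls h"
  have hs: "h \<in> sqint" by (rule sqint_borelI[OF hb h2])
  define S where "S n x = fn (X n) x * h x" for n x
  have S1: "integrable lborel (S n)" for n
    unfolding S_def by (rule integrable_sq_mult) (auto simp: fn_square_integrable h2)
  have S2: "(LINT x|lborel. norm (S i x - S j x)) \<le> dist (X i) (X j) * norm H" for i j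
  proof -
    have A: "(\<lambda>x. \<bar>fn (X i - X j) x\<bar>) \<in> sqint"
      by (rule sqint_borelI) (auto simp: fn_square_integrable)
    have "(LINT x|lborel. norm (S i x - S j x)) = (LINT x|lborel. \<bar>fn (X i - X j) x\<bar> * h x)"
    proof (rule integral_cong_AE)
      show "AE x in lborel. norm (S i x - S j x) = \<bar>fn (X i - X j) x\<bar> * h x"
        using fn_diff[of "X i" "X j"]
      proof eventually_elim
        case (elim x)
        then show ?case using h(2)[of x] 
          by (simp add: S_def abs_mult left_diff_distrib[symmetric] del: left_diff_distrib)
      qed
    qed (auto simp: S_def)
    also have "\<dots> = (LINT x|lebesgue. \<bar>fn (X i - X j) x\<bar> * h x)"
      by (rule integral_completion[symmetric]) measurable
    also have "\<dots> = inner (cls (\<lambda>x. \<bar>fn (X i - X j) x\<bar>)) H"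
      unfolding H_def using inner_cls[OF A hs] by simp
    also have "\<dots> \<le> norm (cls (\<lambda>x. \<bar>fn (X i - X j) x\<bar>)) * norm H"
      by (rule norm_cauchy_schwarz)
    also have "norm (cls (\<lambda>x. \<bar>fn (X i - X j) x\<bar>)) = dist (X i) (X j)"
    proof -
      have "(norm (cls (\<lambda>x. \<bar>fn (X i - X j) x\<bar>)))\<^sup>2 = (norm (cls (fn (X i - X j))))\<^sup>2"
        unfolding norm_cls_sq[OF A] norm_cls_sq[OF fn_sqint] by simp
      then show ?thesis by (simp add: dist_norm)
    qed
    finally show ?thesis .
  qed
  have "\<exists>N. \<forall>i\<ge>N. \<forall>j\<ge>N. (LINT x|lborel. norm (S i x - S j x)) < e" if "e > 0" for e
  proof -
    have pos: "e / (norm H + 1) > 0" using that by (simp add: add_nonneg_pos)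
    obtain N where N: "\<And>i j. i \<ge> N \<Longrightarrow> j \<ge> N \<Longrightarrow> dist (X i) (X j) < e / (norm H + 1)"
      using metric_CauchyD[OF assms pos] by blast
    have "(LINT x|lborel. norm (S i x - S j x)) < e" if ij: "i \<ge> N" "j \<ge> N" for i j
    proof -
      have "dist (X i) (X j) * norm H \<le> dist (X i) (X j) * (norm H + 1)"
        by (intro mult_left_mono) auto
      also have "\<dots> < e" using N[OF ij] by (simp add: pos_less_divide_eq add_nonneg_pos)
      finally show ?thesis using S2[of i j] by linarith
    qed
    then show ?thesis by blast
  qed
  then obtain r where r: "strict_mono r" "AE x in lborel. Cauchy (\<lambda>i. S (r i) x)"
    using cauchy_L1_AE_cauchy_subseq[of lborel S] S1 by blast
  define G where "G x = lim (\<lambda>i. fn (X (r i)) x)" for x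
  have "G \<in> borel_measurable borel" unfolding G_def by measurable
  moreover have "AE x in lborel. (\<lambda>n. fn (X (r n)) x) \<longlonglongrightarrow> G x"
    using r(2)
  proof eventually_elim
    case (elim x)
    then have "convergent (\<lambda>i. S (r i) x)" by (simp add: Cauchy_convergent_iff)
    then have "convergent (\<lambda>i. S (r i) x * inverse (h x))"
      by (intro convergent_mult) (auto simp: convergent_const)
    moreover have "(\<lambda>i. S (r i) x * inverse (h x)) = (\<lambda>i. fn (X (r i)) x)"
      using h(2)[of x] by (auto simp: S_def fun_eq_iff)
    ultimately show ?case unfolding G_def by (simp add: convergent_LIMSEQ_iff)
  qed
  ultimately show ?thesis using that r(1) by blast
qed

instance l2 :: (euclidean_space) complete_space
proof
  fix X :: "nat \<Rightarrow> 'a l2"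
  assume X: "Cauchy X"
  obtain r G where r: "strict_mono (r::nat \<Rightarrow> nat)" "G \<in> borel_measurable borel"
    "AE x in lborel. (\<lambda>n. fn (X (r n)) x) \<longlonglongrightarrow> G x"
    using l2_Cauchy_AE_subseq[OF X] by blast
  have Gm: "G \<in> borel_measurable lebesgue" using r(2) by (rule borel_measurable_lborel_lebesgue)
  have XB: "bounded (range X)" using X by (rule cauchy_imp_bounded)
  then obtain B where B: "\<And>n. norm (X n) \<le> B" by (auto simp: bounded_iff)
  have G: "G \<in> sqint"
    by (rule sqint_limit(1)[OF _ Gm r(3), of B]) (use B in auto)
  have "(\<lambda>n. X (r n)) \<longlonglongrightarrow> cls G"
  proof (rule metric_LIMSEQ_I)
    fix e :: real assume e: "e > 0"
    obtain N where N: "\<And>i j. i \<ge> N \<Longrightarrow> j \<ge> N \<Longrightarrow> dist (X i) (X j) < e / 2"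
      using metric_CauchyD[OF X, of "e/2"] e by auto
    have "dist (X (r n)) (cls G) < e" if n: "n \<ge> N" for n
    proof -
      have rn: "r k \<ge> N" if "k \<ge> N" for k using seq_suble[OF r(1), of k] that by linarith
      have F: "(\<lambda>x. fn (X (r n)) x - fn (X (r (k + N))) x) \<in> sqint" for k by (intro sqint_diff) auto
      have D: "cls (\<lambda>x. fn (X (r n)) x - fn (X (r (k + N))) x) = X (r n) - X (r (k + N))" for k
        by (subst cls_diff) auto
      \<comment> \<open>Fatou with \<open>n\<close> fixed and the second index tending to infinity.
        The shift by \<open>N\<close> makes the Cauchy bound valid for every
        \<open>k\<close>.\<close>
      have "norm (cls (\<lambda>x. fn (X (r n)) x - G x)) \<le> e / 2"
      proof (rule sqint_limit(2)[OF F])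
        show "(\<lambda>x. fn (X (r n)) x - G x) \<in> borel_measurable lebesgue"
          using Gm by (intro borel_measurable_diff) (auto intro: borel_measurable_lborel_lebesgue)
        show "AE x in lborel. (\<lambda>k. fn (X (r n)) x - fn (X (r (k + N))) x) \<longlonglongrightarrow> fn (X (r n)) x - G x"
          using r(3) by eventually_elim (intro tendsto_intros LIMSEQ_ignore_initial_segment)
        show "norm (cls (\<lambda>x. fn (X (r n)) x - fn (X (r (k + N))) x)) \<le> e / 2" for k
          unfolding D using N[OF rn[OF n] rn[of "k + N"]] by (simp add: dist_norm)
      qed
      then have "norm (X (r n) - cls G) \<le> e / 2" by (subst (asm) cls_diff) (auto simp: G)
      then show ?thesis using e by (simp add: dist_norm)
    qed
    then show "\<exists>no. \<forall>n\<ge>no. dist (X (r n)) (cls G) < e" by blast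
  qed
  then have "X \<longlonglongrightarrow> cls G" using Cauchy_converges_subseq[OF X r(1)] by (simp add: o_def)
  then show "convergent X" by (rule convergentI)
qed

section \<open>Symmetric forms on Hilbert spaces\<close>

text \<open>For a symmetric form the equation is the Euler-Lagrange equation of \<open>J\<close>: a
  minimising sequence is Cauchy by the parallelogram identity, and the first variation at its limit
  gives the claim.\<close>

lemma lax_milgram_symmetric:
  fixes X :: "'a::{real_inner,complete_space} set" and a :: "'a \<Rightarrow> 'a \<Rightarrow> real"
  assumes X: "subspace X" "closed X"
    and bil: "bilinear a" and sym: "\<And>x y. a x y = a y x"
    and bnd: "\<And>x y. \<bar>a x y\<bar> \<le> B * norm x * norm y"
    and coer: "\<And>x. x \<in> X \<Longrightarrow> c * (norm x)\<^sup>2 \<le> a x x" and c: "c > 0"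
    and l: "linear l" and lb: "\<And>x. \<bar>l x\<bar> \<le> L * norm x"
  obtains x where "x \<in> X" "\<And>y. y \<in> X \<Longrightarrow> a x y = l y"
proof -
  note simps = bilinear_ladd[OF bil] bilinear_radd[OF bil] bilinear_lsub[OF bil] bilinear_rsub[OF bil]
    bilinear_lmul[OF bil] bilinear_rmul[OF bil] linear_add[OF l] linear_diff[OF l] linear_scale[OF l]
  define J where "J x = a x x - 2 * l x" for x
  have low: "J x \<ge> - (L\<^sup>2 / c)" if "x \<in> X" for x
  proof -
    have "c * (norm x)\<^sup>2 - 2 * (L * norm x) \<le> J x"
      unfolding J_def using coer[OF that] lb[of x] by linarith
    moreover have "c * (norm x)\<^sup>2 - 2 * (L * norm x) + L\<^sup>2 / c = (c * norm x - L)\<^sup>2 / c"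
      using c by (simp add: field_simps power2_eq_square)
    moreover have "(c * norm x - L)\<^sup>2 / c \<ge> 0" using c by simp
    ultimately show ?thesis by linarith
  qed
  define m where "m = (INF x\<in>X. J x)"
  have bdd: "bdd_below (J ` X)" using low by (intro bdd_belowI2[where m="- (L\<^sup>2 / c)"]) auto
  have X0: "0 \<in> X" using X(1) by (rule subspace_0)
  have mle: "m \<le> J x" if "x \<in> X" for x unfolding m_def by (rule cINF_lower[OF bdd that])
  have "\<exists>x\<in>X. J x < m + 1 / Suc n" for n
  proof -
    have "Inf (J ` X) < m + 1 / Suc n" unfolding m_def by simp
    then show ?thesis using X0 cInf_less_iff[OF _ bdd] by auto
  qed
  then obtain u where u: "\<And>n. u n \<in> X" "\<And>n. J (u n) < m + 1 / Suc n" by metis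
  \<comment> \<open>Parallelogram identity: the midpoint \<open>z\<close> lies in \<open>X\<close>,
    so its energy is at least \<open>m\<close>.\<close>
  have par: "c / 2 * (norm (x - y))\<^sup>2 \<le> J x + J y - 2 * m" if "x \<in> X" "y \<in> X" for x y
  proof -
    define z where "z = (1/2) *\<^sub>R (x + y)"
    have z: "z \<in> X" unfolding z_def using X that by (auto intro!: subspace_scale subspace_add)
    have "J x + J y = 2 * J z + a (x - y) (x - y) / 2"
      unfolding J_def z_def by (simp add: simps sym[of y x] field_simps)
    moreover have "c * (norm (x - y))\<^sup>2 \<le> a (x - y) (x - y)"
      using X that by (intro coer subspace_diff)
    ultimately show ?thesis using mle[OF z] by linarith
  qed
  have CauchyU: "Cauchy u"
  proof (rule metric_CauchyI)
    fix e :: real assume e: "e > 0"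
    obtain N :: nat where N: "4 / (c * e\<^sup>2) < real N" using reals_Archimedean2 by blast
    have "4 / (c * e\<^sup>2) > 0" using c e by simp
    then have N0: "N > 0" using N by (cases N) auto
    have "dist (u i) (u j) < e" if "i \<ge> N" "j \<ge> N" for i j
    proof -
      have "1 / Suc i \<le> 1 / real N" "1 / Suc j \<le> 1 / real N"
        using that N0 by (auto intro!: divide_left_mono)
      then have "c / 2 * (norm (u i - u j))\<^sup>2 < 1 / real N + 1 / real N"
        using par[OF u(1) u(1), of i j] u(2)[of i] u(2)[of j] by linarith
      also have "1 / real N + 1 / real N < c / 2 * e\<^sup>2"
        using N N0 c e by (simp add: field_simps)
      finally have "(norm (u i - u j))\<^sup>2 < e\<^sup>2" using c by simp
      then show ?thesis using e by (simp add: dist_norm power_less_imp_less_base)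
    qed
    then show "\<exists>M. \<forall>i\<ge>M. \<forall>j\<ge>M. dist (u i) (u j) < e" by blast
  qed
  then obtain x where ux: "u \<longlonglongrightarrow> x" using Cauchy_convergent_iff convergent_def by blast
  have xX: "x \<in> X" using closed_sequentially[OF X(2) u(1) ux] .
  have "(\<lambda>n. J (u n)) \<longlonglongrightarrow> J x"
  proof -
    have bb: "bounded_bilinear a"
      using bil bnd unfolding bilinear_def 
      by (intro bounded_bilinear.intro exI[of _ B]) 
         (auto simp: simps linear_add linear_scale intro!: order_trans[OF bnd] simp: mult_ac)
    have bl: "bounded_linear l"
      using l lb by (intro bounded_linear_intro[where K=L]) (auto simp: simps mult.commute)
    show ?thesis unfolding J_def
      by (intro tendsto_intros bounded_bilinear.tendsto[OF bb] bounded_linear.tendsto[OF bl] ux)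
  qed
  moreover have "(\<lambda>n. m + 1 / Suc n) \<longlonglongrightarrow> m + 0"
    by (intro tendsto_intros LIMSEQ_inverse_real_of_nat[unfolded inverse_eq_divide])
  ultimately have "J x \<le> m + 0"
    by (rule LIMSEQ_le) (use u(2) less_imp_le in blast)
  then have Jx: "J x \<le> m" by simp
  have "a x y = l y" if y: "y \<in> X" for y
  proof -
    define d where "d = a x y - l y"
    have q: "0 \<le> 2 * t * d + t\<^sup>2 * a y y" for t
    proof -
      have "J x \<le> J (x + t *\<^sub>R y)" using Jx mle[of "x + t *\<^sub>R y"] X xX y
        by (meson order_trans subspace_add subspace_scale)
      then show ?thesis unfolding J_def d_def
        by (simp add: simps sym[of y x] power2_eq_square algebra_simps)
    qed
    have ay: "0 \<le> a y y" using coer[OF y] c by (meson mult_nonneg_nonneg less_imp_le order_trans zero_le_power2)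
    have "d = 0"
    proof (rule ccontr)
      assume "d \<noteq> 0"
      \<comment> \<open>The quadratic in \<open>q\<close> has its minimum at
        \<open>- d / a y y\<close>. Adding 1 keeps the denominator positive, also for
        \<open>y = 0\<close>, and the value is still negative when \<open>d\<close> is not
        zero.\<close>
      define p where "p = a y y + 1"
      define t where "t = - d / p"
      have p: "p > 0" using ay by (simp add: p_def)
      have "2 * t * d + t\<^sup>2 * (p - 1) = - (d\<^sup>2 * (p + 1)) / p\<^sup>2"
        using p unfolding t_def by (simp add: field_simps power2_eq_square)
      then have "2 * t * d + t\<^sup>2 * a y y = - (d\<^sup>2 * (p + 1)) / p\<^sup>2" by (simp add: p_def)
      moreover have "(d\<^sup>2 * (p + 1)) / p\<^sup>2 > 0" using \<open>d \<noteq> 0\<close> ay p by (intro divide_pos_pos mult_pos_pos) auto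
      ultimately show False using q[of t] by simp
    qed
    then show ?thesis by (simp add: d_def)
  qed
  then show ?thesis using that xX by blast
qed

lemma bilinear_inner: "bilinear (inner :: 'a::real_inner \<Rightarrow> 'a \<Rightarrow> real)"
  by (auto simp: bilinear_def inner_add_left inner_add_right intro!: linearI)

lemma riesz_subspace:
  fixes X :: "'a::{real_inner,complete_space} set"
  assumes "subspace X" "closed X" "linear l" "\<And>x. \<bar>l x\<bar> \<le> L * norm x"
  obtains x where "x \<in> X" "\<And>y. y \<in> X \<Longrightarrow> inner x y = l y"
proof (rule lax_milgram_symmetric[OF assms(1,2) bilinear_inner inner_commute _ _ _ assms(3,4), where B=1 and c=1])
  show "\<bar>inner x y\<bar> \<le> 1 * norm x * norm y" for x y :: 'a using Cauchy_Schwarz_ineq2 by simp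
  show "1 * (norm x)\<^sup>2 \<le> inner x x" for x :: 'a by (simp add: power2_norm_eq_inner)
qed (auto intro: that)

text \<open>Only the second argument is restricted to \<open>X\<close>. The operator acts on the
  whole space, so it can later be applied to exterior data as well as to functions in
  \<open>X\<close>.\<close>

lemma riesz_operator:
  fixes X :: "'a::{real_inner,complete_space} set" and b :: "'a \<Rightarrow> 'a \<Rightarrow> real"
  assumes X: "subspace X" "closed X" and b: "bilinear b"
    and bnd: "\<And>x y. \<bar>b x y\<bar> \<le> B * norm x * norm y"
  obtains A where "linear A" "\<And>x. A x \<in> X" "\<And>x y. y \<in> X \<Longrightarrow> inner (A x) y = b x y"
    "\<And>x. norm (A x) \<le> B * norm x"
proof -
  have "\<exists>z\<in>X. \<forall>y\<in>X. inner z y = b x y" for x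
  proof -
    have "linear (b x)" using b by (simp add: bilinear_def)
    then show ?thesis using riesz_subspace[OF X, of "b x" "B * norm x"] bnd by metis
  qed
  then obtain A where A: "\<And>x. A x \<in> X" "\<And>x y. y \<in> X \<Longrightarrow> inner (A x) y = b x y" by metis
  have uniq: "u = v" if "u \<in> X" "v \<in> X" "\<And>y. y \<in> X \<Longrightarrow> inner u y = inner v y" for u v
  proof -
    have "inner (u - v) (u - v) = 0" using that X subspace_diff[OF X(1)] by (simp add: inner_diff_left)
    then show ?thesis by simp
  qed
  have "linear A"
  proof (rule linearI)
    show "A (x + y) = A x + A y" for x y
      by (rule uniq) (auto simp: A subspace_add[OF X(1)] inner_add_left bilinear_ladd[OF b])
    show "A (r *\<^sub>R x) = r *\<^sub>R A x" for r x
      by (rule uniq) (auto simp: A subspace_scale[OF X(1)] bilinear_lmul[OF b])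
  qed
  moreover have "norm (A x) \<le> B * norm x" for x
  proof (cases "A x = 0")
    case True
    have "0 \<le> B * norm x * norm x" using bnd[of x x] by linarith
    then show ?thesis using True by (cases "x = 0") (auto simp: zero_le_mult_iff)
  next
    case False
    have "norm (A x) * norm (A x) = b x (A x)" using A(1)[of x] A(2)[of "A x" x]
      by (simp add: power2_norm_eq_inner[symmetric] power2_eq_square)
    also have "\<dots> \<le> B * norm x * norm (A x)" using bnd[of x "A x"] by linarith
    finally show ?thesis using False by simp
  qed
  ultimately show ?thesis using that A by blast
qed

section \<open>Compact perturbations of the identity and control by exterior data\<close>

lemma subspace_closure:
  fixes S :: "'a::real_normed_vector set"
  assumes S: "subspace S"
  shows "subspace (closure S)"
proof (rule subspaceI)
  show "0 \<in> closure S" using subspace_0[OF S] closure_subset by blast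
  fix x assume "x \<in> closure S"
  then obtain u where u: "\<And>n. u n \<in> S" "u \<longlonglongrightarrow> x" unfolding closure_sequential by blast
  show "c *\<^sub>R x \<in> closure S" for c unfolding closure_sequential
    by (rule exI[of _ "\<lambda>n. c *\<^sub>R u n"]) (auto intro!: tendsto_intros u subspace_scale[OF S])
  fix y assume "y \<in> closure S"
  then obtain v where v: "\<And>n. v n \<in> S" "v \<longlonglongrightarrow> y" unfolding closure_sequential by blast
  show "x + y \<in> closure S" unfolding closure_sequential
    by (rule exI[of _ "\<lambda>n. u n + v n"]) (auto intro!: tendsto_intros u v subspace_add[OF S])
qed

text \<open>The forms \<open>inner u v - k u v\<close> below are perturbations of the identity that are compact
  on \<open>X\<close>: the perturbation is controlled by \<open>norm (J u)\<close> for a map \<open>J\<close> that takes bounded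
  sequences in \<open>X\<close> to sequences with a Cauchy subsequence.\<close>

locale compact_forms =
  fixes X Y :: "'a::{real_inner,complete_space} set" and J :: "'a \<Rightarrow> 'b::real_normed_vector" and C :: real
  assumes X: "subspace X" "closed X" and Y: "subspace Y" "closed Y"
    and J: "linear J" "\<And>x. norm (J x) \<le> norm x" and C: "C \<ge> 0"
    and J_compact: "\<And>x::nat \<Rightarrow> 'a. (\<And>n. x n \<in> X) \<Longrightarrow> (\<And>n. norm (x n) \<le> 1) \<Longrightarrow>
      \<exists>r::nat \<Rightarrow> nat. strict_mono r \<and> Cauchy (\<lambda>n. J (x (r n)))"
begin

definition form :: "('a \<Rightarrow> 'a \<Rightarrow> real) \<Rightarrow> bool" where
  "form k \<longleftrightarrow> bilinear k \<and> (\<forall>u v. k u v = k v u) \<and> (\<forall>u v. \<bar>k u v\<bar> \<le> C * norm (J u) * norm v)"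

text \<open>The functional \<open>inner x w - k x w\<close> of \<open>w\<close>, tested on
  \<open>X\<close> and on \<open>Y\<close>, has dual norm at least \<open>c * norm x\<close>;
  quantifying over \<kappa> replaces the dual norm. Testing on \<open>Y\<close> too is what survives
  when the problem on \<open>X\<close> alone has a kernel.\<close>

definition bounded_below :: "real \<Rightarrow> ('a \<Rightarrow> 'a \<Rightarrow> real) \<Rightarrow> bool" where
  "bounded_below c k \<longleftrightarrow> (\<forall>x\<in>X. \<forall>\<kappa>\<ge>0.
     (\<forall>w\<in>X \<union> Y. \<bar>inner x w - k x w\<bar> \<le> \<kappa> * norm w) \<longrightarrow> c * norm x \<le> \<kappa>)"

lemma form_bound: "form k \<Longrightarrow> \<bar>k u v\<bar> \<le> C * norm u * norm v"
  unfolding form_def using J(2) C by (meson mult_left_mono mult_right_mono norm_ge_zero order_trans)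

lemma form_inner_minus:
  assumes "form k"
  shows "bilinear (\<lambda>u v. inner u v - k u v)" "\<And>u v. inner u v - k u v = inner v u - k v u"
    "\<And>u v. \<bar>inner u v - k u v\<bar> \<le> (1 + C) * norm u * norm v"
proof -
  have b: "bilinear k" and s: "\<And>u v. k u v = k v u" using assms by (auto simp: form_def)
  show "bilinear (\<lambda>u v. inner u v - k u v)"
    unfolding bilinear_def
    by (auto intro!: linearI simp: inner_add_left inner_add_right bilinear_ladd[OF b] bilinear_radd[OF b]
      bilinear_lmul[OF b] bilinear_rmul[OF b] right_diff_distrib)
  show "inner u v - k u v = inner v u - k v u" for u v by (simp add: inner_commute s)
  show "\<bar>inner u v - k u v\<bar> \<le> (1 + C) * norm u * norm v" for u v
    using form_bound[OF assms, of u v] Cauchy_Schwarz_ineq2[of u v] by (simp add: algebra_simps)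
qed

text \<open>Along a subsequence the images under \<open>J\<close> are Cauchy; since the form is the
  identity up to a term controlled by \<open>J\<close>, the unit vectors themselves are then Cauchy.
  Their limit is a unit vector in the kernel of the limit form.\<close>

lemma no_almost_kernel:
  fixes k :: "nat \<Rightarrow> 'a \<Rightarrow> 'a \<Rightarrow> real"
  assumes k: "\<And>n. form (k n)" and k': "form k'"
    and kk: "\<And>n u v. \<bar>k n u v - k' u v\<bar> \<le> \<delta> n * norm u * norm v" "\<delta> \<longlonglongrightarrow> 0"
    and x: "\<And>n. x n \<in> X" "\<And>n. norm (x n) = 1" and \<kappa>: "\<kappa> \<longlonglongrightarrow> 0"
    and xX: "\<And>n w. w \<in> X \<Longrightarrow> \<bar>inner (x n) w - k n (x n) w\<bar> \<le> \<kappa> n * norm w"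
    and xY: "\<And>n w. w \<in> Y \<Longrightarrow> \<bar>inner (x n) w - k n (x n) w\<bar> \<le> \<kappa> n * norm w"
    and inj: "\<And>z. z \<in> X \<Longrightarrow> (\<forall>w\<in>X. inner z w - k' z w = 0) \<Longrightarrow> (\<forall>w\<in>Y. inner z w - k' z w = 0) \<Longrightarrow> z = 0"
  shows False
proof -
  obtain r :: "nat \<Rightarrow> nat" where r: "strict_mono r" and cau: "Cauchy (\<lambda>n. J (x (r n)))"
    using J_compact[of x] x by auto
  define y where "y n = x (r n)" for n
  define \<eta> where "\<eta> n = \<kappa> (r n) + \<delta> (r n)" for n
  have \<eta>: "\<eta> \<longlonglongrightarrow> 0"
    unfolding \<eta>_def using LIMSEQ_subseq_LIMSEQ[OF \<kappa> r] LIMSEQ_subseq_LIMSEQ[OF kk(2) r]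
    by (auto simp: o_def intro!: tendsto_add_zero)
  have y: "y n \<in> X" "norm (y n) = 1" for n using x by (auto simp: y_def)
  have b': "bilinear k'" using k' by (simp add: form_def)
  have est: "\<bar>inner (y n) w - k' (y n) w\<bar> \<le> \<eta> n * norm w" if "w \<in> X \<or> w \<in> Y" for n w
  proof -
    have "\<bar>inner (y n) w - k (r n) (y n) w\<bar> \<le> \<kappa> (r n) * norm w"
      using that xX[of w "r n"] xY[of w "r n"] by (auto simp: y_def)
    moreover have "\<bar>k (r n) (y n) w - k' (y n) w\<bar> \<le> \<delta> (r n) * norm w"
      using kk(1)[of "r n" "y n" w] y(2)[of n] by simp
    ultimately show ?thesis by (simp add: \<eta>_def algebra_simps)
  qed
  \<comment> \<open>Test the difference \<open>z\<close> with itself: the identity gives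
    \<open>norm z\<close> squared, the two almost kernel vectors contribute \<eta>, and the rest is
    controlled by \<open>J\<close>.\<close>
  have dy: "norm (y i - y j) \<le> \<eta> i + \<eta> j + C * norm (J (y i) - J (y j))" for i j
  proof -
    define z where "z = y i - y j"
    have zX: "z \<in> X" unfolding z_def using y X by (auto intro: subspace_diff)
    have kz: "\<bar>k' z z\<bar> \<le> C * norm (J z) * norm z" using k' by (simp add: form_def)
    have "(norm z)\<^sup>2 = (inner (y i) z - k' (y i) z) - (inner (y j) z - k' (y j) z) + k' z z"
      unfolding z_def power2_norm_eq_inner by (simp add: inner_diff_left bilinear_lsub[OF b'])
    also have "\<dots> \<le> \<eta> i * norm z + \<eta> j * norm z + C * norm (J z) * norm z"
      using est[of z i] est[of z j] zX kz by linarith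
    finally have "norm z * norm z \<le> (\<eta> i + \<eta> j + C * norm (J z)) * norm z"
      by (simp add: power2_eq_square algebra_simps)
    moreover have "norm z \<le> (\<eta> i + \<eta> j + C * norm (J z))" if "z \<noteq> 0"
      using calculation that by simp
    moreover have "0 \<le> \<eta> i" for i
    proof -
      have "0 \<le> \<eta> i * norm (y i)" using est[of "y i" i] y(1) by (meson abs_ge_zero order_trans)
      then show ?thesis using y(2) by simp
    qed
    ultimately have "norm z \<le> \<eta> i + \<eta> j + C * norm (J z)" using C by (cases "z = 0") (auto simp: linear_0[OF J(1)])
    then show ?thesis by (simp add: z_def linear_diff[OF J(1)])
  qed
  have "Cauchy y"
  proof (rule metric_CauchyI)
    fix e :: real assume e: "e > 0"
    obtain N1 where N1: "\<And>n. n \<ge> N1 \<Longrightarrow> \<bar>\<eta> n\<bar> < e / 4"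
      using LIMSEQ_D[OF \<eta>, of "e/4"] e by auto
    \<comment> \<open>\<open>C + 1\<close> because \<open>C\<close> may be zero. Together with the
      two terms below \<open>e / 4\<close> the sum stays below \<open>e\<close>.\<close>
    have "e / (4 * (C + 1)) > 0" using e C by simp
    then obtain N2 where N2: "\<And>i j. i \<ge> N2 \<Longrightarrow> j \<ge> N2 \<Longrightarrow> dist (J (x (r i))) (J (x (r j))) < e / (4 * (C + 1))"
      using metric_CauchyD[OF cau] by blast
    have "dist (y i) (y j) < e" if "i \<ge> max N1 N2" "j \<ge> max N1 N2" for i j
    proof -
      have "norm (J (y i) - J (y j)) \<le> e / (4 * (C + 1))"
        using N2[of i j] that by (simp add: y_def dist_norm)
      then have "C * norm (J (y i) - J (y j)) \<le> C * (e / (4 * (C + 1)))" using C by (rule mult_left_mono)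
      also have "\<dots> \<le> (C + 1) * (e / (4 * (C + 1)))" using e C by (intro mult_right_mono) auto
      also have "\<dots> = e / 4"
      proof -
        have "D * (e / (4 * D)) = e / 4" if "D \<noteq> 0" for D :: real using that by simp
        from this[of "C + 1"] show ?thesis using C by linarith
      qed
      finally show ?thesis using dy[of i j] N1[of i] N1[of j] that e by (auto simp: dist_norm)
    qed
    then show "\<exists>M. \<forall>i\<ge>M. \<forall>j\<ge>M. dist (y i) (y j) < e" by blast
  qed
  then obtain z where z: "y \<longlonglongrightarrow> z" using Cauchy_convergent_iff convergent_def by blast
  have zX: "z \<in> X" by (rule closed_sequentially[OF X(2) y(1) z])
  have nz: "norm z = 1"
    using tendsto_norm[OF z] y(2) LIMSEQ_unique[OF _ tendsto_const[of 1]] by simp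
  have "inner z w - k' z w = 0" if w: "w \<in> X \<or> w \<in> Y" for w
  proof -
    have bl: "bounded_linear (\<lambda>u. k' u w)"
      using form_bound[OF k'] b'
      by (intro bounded_linear_intro[where K="C * norm w"])
        (auto simp: bilinear_ladd[OF b'] bilinear_lmul[OF b'] mult_ac)
    have "(\<lambda>n. \<bar>inner (y n) w - k' (y n) w\<bar>) \<longlonglongrightarrow> \<bar>inner z w - k' z w\<bar>"
      by (intro tendsto_intros z bounded_linear.tendsto[OF bl])
    moreover have "(\<lambda>n. \<eta> n * norm w) \<longlonglongrightarrow> 0 * norm w" by (intro tendsto_intros \<eta>)
    ultimately have "\<bar>inner z w - k' z w\<bar> \<le> 0 * norm w"
      by (rule LIMSEQ_le) (use est[OF w] in auto)
    then show ?thesis by simp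
  qed
  then have "z = 0" using inj[OF zX] by blast
  then show False using nz by simp
qed

text \<open>Failure for all constants \<open>1 / Suc j\<close> and all starting indices
  \<open>j\<close> produces an almost kernel. The injectivity assumed for the limit form is that of
  the overdetermined problem, with test vectors from both spaces.\<close>

lemma uniform_lower_bound:
  fixes k :: "nat \<Rightarrow> 'a \<Rightarrow> 'a \<Rightarrow> real"
  assumes k: "\<And>n. form (k n)" and k': "form k'"
    and kk: "\<And>n u v. \<bar>k n u v - k' u v\<bar> \<le> \<delta> n * norm u * norm v" "\<delta> \<longlonglongrightarrow> 0"
    and inj: "\<And>z. z \<in> X \<Longrightarrow> (\<forall>w\<in>X. inner z w - k' z w = 0) \<Longrightarrow> (\<forall>w\<in>Y. inner z w - k' z w = 0) \<Longrightarrow> z = 0"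
  shows "\<exists>c N. c > 0 \<and> (\<forall>n\<ge>N. bounded_below c (k n))"
proof (rule ccontr)
  assume not: "\<not> ?thesis"
  have "\<exists>n x \<kappa>. n \<ge> j \<and> x \<in> X \<and> \<kappa> \<ge> 0 \<and> (\<forall>w\<in>X \<union> Y. \<bar>inner x w - k n x w\<bar> \<le> \<kappa> * norm w) \<and> \<kappa> < 1 / Suc j * norm x" for j
  proof -
    have "\<not> (\<forall>n\<ge>j. bounded_below (1 / Suc j) (k n))" using not by (metis of_nat_0_less_iff zero_less_Suc zero_less_divide_1_iff)
    then show ?thesis unfolding bounded_below_def by (meson not_less)
  qed
  then obtain n x \<kappa> where H: "\<And>j. n j \<ge> j" "\<And>j. x j \<in> X"
    "\<And>j w. w \<in> X \<union> Y \<Longrightarrow> \<bar>inner (x j) w - k (n j) (x j) w\<bar> \<le> \<kappa> j * norm w" "\<And>j. \<kappa> j < 1 / Suc j * norm (x j)" "\<And>j. \<kappa> j \<ge> 0"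
    by metis
  \<comment> \<open>The indices need not increase; tending to infinity is enough for \<delta> to
    vanish along them.\<close>
  have nt: "filterlim n at_top sequentially"
    unfolding filterlim_at_top eventually_sequentially using H(1) by (meson order_trans)
  have x0: "x j \<noteq> 0" for j using H(4)[of j] H(5)[of j] by auto
  define y where "y j = x j /\<^sub>R norm (x j)" for j
  show False
  proof (rule no_almost_kernel[of "\<lambda>j. k (n j)" k' "\<lambda>j. \<delta> (n j)" y "\<lambda>j. 1 / Suc j"])
    show "(\<lambda>j. \<delta> (n j)) \<longlonglongrightarrow> 0" using filterlim_compose[OF kk(2) nt] .
    show "y j \<in> X" for j unfolding y_def using H(2) X by (auto intro: subspace_scale)
    show "norm (y j) = 1" for j unfolding y_def using x0 by simp
    show "(\<lambda>j. 1 / real (Suc j)) \<longlonglongrightarrow> 0" using LIMSEQ_inverse_real_of_nat by (simp add: inverse_eq_divide)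
    have *: "\<bar>inner (y j) w - k (n j) (y j) w\<bar> \<le> 1 / Suc j * norm w" if w: "w \<in> X \<union> Y" for j w
    proof -
      have b: "bilinear (k (n j))" using k by (simp add: form_def)
      have "\<bar>inner (y j) w - k (n j) (y j) w\<bar> = \<bar>inner (x j) w - k (n j) (x j) w\<bar> / norm (x j)"
        unfolding y_def by (simp add: bilinear_lmul[OF b] right_diff_distrib[symmetric] abs_mult divide_inverse_commute del: right_diff_distrib)
      also have "\<dots> \<le> (\<kappa> j * norm w) / norm (x j)" using H(3)[OF w, of j] by (intro divide_right_mono) auto
      also have "\<dots> \<le> (1 / Suc j * norm (x j) * norm w) / norm (x j)"
        using H(4)[of j] by (intro divide_right_mono mult_right_mono) auto
      also have "\<dots> = 1 / Suc j * norm w" using x0[of j] by simp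
      finally show ?thesis .
    qed
    show "\<bar>inner (y j) w - k (n j) (y j) w\<bar> \<le> 1 / Suc j * norm w" if "w \<in> X" for j w using *[of w j] that by simp
    show "\<bar>inner (y j) w - k (n j) (y j) w\<bar> \<le> 1 / Suc j * norm w" if "w \<in> Y" for j w using *[of w j] that by simp
    show "form (k (n j))" for j by (rule k)
    show "form k'" by (rule k')
    show "\<bar>k (n j) u v - k' u v\<bar> \<le> \<delta> (n j) * norm u * norm v" for j u v by (rule kk(1))
    show "z = 0" if "z \<in> X" "\<forall>w\<in>X. inner z w - k' z w = 0" "\<forall>w\<in>Y. inner z w - k' z w = 0" for z
      by (rule inj[OF that])
  qed
qed

text \<open>With \<open>A\<close> and \<open>P\<close> representing the form on \<open>X\<close> and
  on \<open>Y\<close>, the ansatz \<open>w = A x\<close>, \<open>f = P x\<close> with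
  \<open>x\<close> in \<open>X\<close> turns the equation into the normal equation for
  \<open>a\<close>, and the lower bound is exactly coercivity of \<open>a\<close>. The bound
  \<open>L\<close> serves only continuity; the size of the solution is governed by \<open>K\<close>,
  the bound on \<open>X\<close>.\<close>

lemma solve_with_control:
  assumes k: "form k" and c: "c > 0"
    and low: "bounded_below c k"
    and l: "linear l" "\<And>x. \<bar>l x\<bar> \<le> L * norm x"
    and lX: "\<And>x. x \<in> X \<Longrightarrow> \<bar>l x\<bar> \<le> K * norm x" "K \<ge> 0"
  obtains f w where "f \<in> Y" "w \<in> X" "norm f \<le> K / c" "norm w \<le> K / c"
    "\<And>y. y \<in> X \<Longrightarrow> inner (f + w) y - k (f + w) y = l y"
proof -
  define b where "b u v = inner u v - k u v" for u v
  note fm = form_inner_minus[OF k, folded b_def]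
  obtain A where A: "linear A" "\<And>x. A x \<in> X" "\<And>x y. y \<in> X \<Longrightarrow> inner (A x) y = b x y"
    "\<And>x. norm (A x) \<le> (1 + C) * norm x"
    using riesz_operator[OF X fm(1,3)] by blast
  obtain P where P: "linear P" "\<And>x. P x \<in> Y" "\<And>x y. y \<in> Y \<Longrightarrow> inner (P x) y = b x y"
    "\<And>x. norm (P x) \<le> (1 + C) * norm x"
    using riesz_operator[OF Y fm(1,3)] by blast
  define a where "a x y = inner (A x) (A y) + inner (P x) (P y)" for x y
  have "bilinear a" unfolding bilinear_def a_def
    by (auto intro!: linearI simp: linear_add[OF A(1)] linear_add[OF P(1)] linear_scale[OF A(1)] linear_scale[OF P(1)]
      inner_add_left inner_add_right algebra_simps)
  moreover have "a x y = a y x" for x y by (simp add: a_def inner_commute)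
  moreover have "\<bar>a x y\<bar> \<le> (2 * (1 + C)\<^sup>2) * norm x * norm y" for x y
  proof -
    have "\<bar>inner (A x) (A y)\<bar> \<le> ((1 + C) * norm x) * ((1 + C) * norm y)"
      using Cauchy_Schwarz_ineq2[of "A x" "A y"] mult_mono[OF A(4)[of x] A(4)[of y]] C by force
    moreover have "\<bar>inner (P x) (P y)\<bar> \<le> ((1 + C) * norm x) * ((1 + C) * norm y)"
      using Cauchy_Schwarz_ineq2[of "P x" "P y"] mult_mono[OF P(4)[of x] P(4)[of y]] C by force
    ultimately show ?thesis unfolding a_def by (simp add: power2_eq_square algebra_simps)
  qed
  moreover have coer: "c\<^sup>2 * (norm x)\<^sup>2 \<le> a x x" if x: "x \<in> X" for x
  proof -
    define \<kappa> where "\<kappa> = max (norm (A x)) (norm (P x))"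
    have "\<bar>inner x w - k x w\<bar> \<le> \<kappa> * norm w" if "w \<in> X \<union> Y" for w
    proof -
      have "\<bar>inner x w - k x w\<bar> \<le> norm (A x) * norm w \<or> \<bar>inner x w - k x w\<bar> \<le> norm (P x) * norm w"
        using that A(3)[of w x] P(3)[of w x] Cauchy_Schwarz_ineq2[of "A x" w] Cauchy_Schwarz_ineq2[of "P x" w]
        by (auto simp: b_def)
      moreover have "norm (A x) * norm w \<le> \<kappa> * norm w" "norm (P x) * norm w \<le> \<kappa> * norm w"
        unfolding \<kappa>_def by (intro mult_right_mono; simp)+
      ultimately show ?thesis by linarith
    qed
    moreover have "\<kappa> \<ge> 0" unfolding \<kappa>_def by (simp add: le_max_iff_disj)
    ultimately have "c * norm x \<le> \<kappa>" using low x unfolding bounded_below_def by blast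
    then have "(c * norm x)\<^sup>2 \<le> \<kappa>\<^sup>2" using c by (intro power_mono) auto
    also have "\<kappa>\<^sup>2 \<le> (norm (A x))\<^sup>2 + (norm (P x))\<^sup>2" unfolding \<kappa>_def by (auto simp: max_def)
    finally show ?thesis unfolding a_def power2_norm_eq_inner[symmetric] by (simp add: power_mult_distrib)
  qed
  ultimately obtain x where x: "x \<in> X" "\<And>y. y \<in> X \<Longrightarrow> a x y = l y"
    using lax_milgram_symmetric[OF X, of a _ "c\<^sup>2" l L] c l by (metis zero_less_power)
  \<comment> \<open>The energy norm of \<open>x\<close> dominates both \<open>A x\<close> and
    \<open>P x\<close>. Its square is \<open>l x\<close>, at most \<open>K * norm x\<close>, hence
    at most \<open>K * E / c\<close>.\<close>
  define E where "E = sqrt (a x x)"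
  have E2: "E\<^sup>2 = (norm (A x))\<^sup>2 + (norm (P x))\<^sup>2"
    unfolding E_def a_def power2_norm_eq_inner[symmetric] by simp
  have E0: "0 \<le> E" unfolding E_def a_def by (simp add: power2_norm_eq_inner[symmetric])
  have "c * norm x \<le> E" unfolding E_def
    by (rule real_le_rsqrt) (use coer[OF x(1)] in \<open>simp add: power_mult_distrib\<close>)
  have "E\<^sup>2 \<le> K * norm x" using x(2)[OF x(1)] lX(1)[OF x(1)] E2
    unfolding a_def power2_norm_eq_inner by simp
  also have "\<dots> \<le> K * (E / c)" using \<open>c * norm x \<le> E\<close> c lX(2)
    by (intro mult_left_mono) (auto simp: field_simps)
  finally have "E * E \<le> (K / c) * E" by (simp add: power2_eq_square)
  then have EK: "E \<le> K / c" using E0 c lX(2) mult_right_le_imp_le[of E E "K / c"] by (cases "E = 0") auto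
  have "norm (A x) \<le> E" "norm (P x) \<le> E"
    by (rule power2_le_imp_le[OF _ E0], simp add: E2)+
  then have "norm (A x) \<le> K / c" "norm (P x) \<le> K / c" using EK by auto
  moreover have "inner (P x + A x) y - k (P x + A x) y = l y" if y: "y \<in> X" for y
  proof -
    have "inner (P x + A x) y - k (P x + A x) y = b y (P x) + b y (A x)"
      using fm(2)[of y "P x + A x"] bilinear_radd[OF fm(1)] by (simp add: b_def)
    also have "\<dots> = a x y" using A(3)[of "A x" y] P(3)[of "P x" y] A(2) P(2)
      by (simp add: a_def inner_commute)
    finally show ?thesis using x(2)[OF y] by simp
  qed
  ultimately show ?thesis using that A(2) P(2) by blast
qed

text \<open>The duality behind the Runge property: \<open>z\<close> is the projection of
  \<open>A \<psi>\<close> on the closure of \<open>A\<close>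
  Y\<open>. The remainder is orthogonal to\<close>A \<open>Y\<close>, which by symmetry of the form
  says that it is annihilated on \<open>Y\<close>, so it vanishes by the uniqueness
  hypothesis.\<close>

lemma approximate_control:
  assumes k: "form k" and uc: "\<And>z. z \<in> X \<Longrightarrow> (\<forall>w\<in>Y. inner z w - k z w = 0) \<Longrightarrow> z = 0"
    and psi: "\<psi> \<in> X" and e: "e > 0"
  obtains f where "f \<in> Y" "\<And>y. y \<in> X \<Longrightarrow> \<bar>inner (f + \<psi>) y - k (f + \<psi>) y\<bar> \<le> e * norm y"
proof -
  define b where "b u v = inner u v - k u v" for u v
  note fm = form_inner_minus[OF k, folded b_def]
  obtain A where A: "linear A" "\<And>x. A x \<in> X" "\<And>x y. y \<in> X \<Longrightarrow> inner (A x) y = b x y"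
    "\<And>x. norm (A x) \<le> (1 + C) * norm x"
    using riesz_operator[OF X fm(1,3)] by blast
  define Z where "Z = closure (A ` Y)"
  have Z: "subspace Z" "closed Z"
    unfolding Z_def by (auto intro!: subspace_closure linear_subspace_image A Y)
  have ZX: "Z \<subseteq> X" unfolding Z_def using A(2) X(2) by (intro closure_minimal) auto
  obtain z where z: "z \<in> Z" "\<And>y. y \<in> Z \<Longrightarrow> inner z y = inner (A \<psi>) y"
    by (rule riesz_subspace[OF Z bounded_linear.linear[OF bounded_linear_inner_right[of "A \<psi>"]] Cauchy_Schwarz_ineq2]) blast
  have d: "A \<psi> - z \<in> X" using A(2) z(1) ZX X by (auto intro: subspace_diff)
  have "A \<psi> - z = 0"
  proof (rule uc[OF d], rule ballI)
    fix w assume w: "w \<in> Y"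
    have Aw: "A w \<in> Z" unfolding Z_def using w by (intro subsetD[OF closure_subset] imageI)
    have "inner (A w) (A \<psi> - z) = inner (A \<psi> - z) (A w)" by (rule inner_commute)
    also have "\<dots> = 0" unfolding inner_diff_left using z(2)[OF Aw] by linarith
    finally have "inner (A w) (A \<psi> - z) = 0" .
    then show "inner (A \<psi> - z) w - k (A \<psi> - z) w = 0"
      using A(3)[OF d, of w] fm(2)[of w "A \<psi> - z"] by (simp add: b_def)
  qed
  then have "A \<psi> \<in> closure (A ` Y)" using z(1) by (simp add: Z_def)
  then obtain f where f: "f \<in> Y" "dist (A f) (A \<psi>) < e" using e unfolding closure_approachable by blast
  show ?thesis
  \<comment> \<open>\<open>A f\<close> approximates \<open>A \<psi>\<close>, so the datum that
    cancels the residual of \<psi> carries the opposite sign.\<close>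
  proof (rule that[of "- f"])
    show "- f \<in> Y" using f Y(1) by (simp add: subspace_neg)
    fix y assume y: "y \<in> X"
    have "inner (- f + \<psi>) y - k (- f + \<psi>) y = inner (A \<psi> - A f) y"
      using A(3)[OF y, of \<psi>] A(3)[OF y, of f] bilinear_lsub[OF fm(1), of \<psi> f y]
      by (simp add: b_def inner_diff_left)
    also have "\<bar>\<dots>\<bar> \<le> norm (A \<psi> - A f) * norm y" by (rule Cauchy_Schwarz_ineq2)
    also have "\<dots> \<le> e * norm y" using f(2) by (intro mult_right_mono) (auto simp: dist_norm norm_minus_commute)
    finally show "\<bar>inner (- f + \<psi>) y - k (- f + \<psi>) y\<bar> \<le> e * norm y" .
  qed
qed

text \<open>The datum \<open>f0\<close> is chosen once, for the limit form. For large
  \<open>n\<close> the pair \<open>f0 + \<psi>\<close> nearly solves the problem for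
  \<open>k n\<close>, and the small residual is removed by \<open>solve_with_control\<close> with a
  constant independent of \<open>n\<close>.\<close>

lemma uniform_runge:
  fixes k :: "nat \<Rightarrow> 'a \<Rightarrow> 'a \<Rightarrow> real"
  assumes k: "\<And>n. form (k n)" and k': "form k'"
    and kk: "\<And>n u v. \<bar>k n u v - k' u v\<bar> \<le> \<delta> n * norm u * norm v" "\<delta> \<longlonglongrightarrow> 0"
    and uc: "\<And>z. z \<in> X \<Longrightarrow> (\<forall>w\<in>Y. inner z w - k' z w = 0) \<Longrightarrow> z = 0"
    and psi: "\<psi> \<in> X" and e: "e > 0"
  obtains M N where "\<And>n. n \<ge> N \<Longrightarrow> \<exists>f\<in>Y. \<exists>w\<in>X. norm f \<le> M \<and> norm (w - \<psi>) \<le> e \<and>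
     (\<forall>y\<in>X. inner (f + w) y - k n (f + w) y = 0)"
proof -
  obtain c N where c: "c > 0" and low: "\<And>n. n \<ge> N \<Longrightarrow> bounded_below c (k n)"
    using uniform_lower_bound[OF k k' kk] uc by blast
  \<comment> \<open>The residual is at most \<open>2 * e1\<close> on \<open>X\<close>: one half from
    the approximation, one from exchanging the forms. Division by \<open>c\<close> then gives
    \<open>e\<close>.\<close>
  define e1 where "e1 = c * e / 2"
  have e1: "e1 > 0" using c e by (simp add: e1_def)
  obtain f0 where f0: "f0 \<in> Y" "\<And>y. y \<in> X \<Longrightarrow> \<bar>inner (f0 + \<psi>) y - k' (f0 + \<psi>) y\<bar> \<le> e1 * norm y"
    using approximate_control[OF k' uc psi e1] by blast
  have "(\<lambda>n. \<delta> n * norm (f0 + \<psi>)) \<longlonglongrightarrow> 0 * norm (f0 + \<psi>)" by (intro tendsto_intros kk)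
  from LIMSEQ_D[OF this e1] obtain N' where "\<forall>n\<ge>N'. norm (\<delta> n * norm (f0 + \<psi>) - 0 * norm (f0 + \<psi>)) < e1"
    by blast
  then have N': "\<And>n. n \<ge> N' \<Longrightarrow> \<delta> n * norm (f0 + \<psi>) < e1" by (simp add: abs_less_iff)
  show ?thesis
  proof (rule that[of "max N N'" "norm f0 + e"])
    fix n assume n: "max N N' \<le> n"
    define l where "l y = inner (f0 + \<psi>) y - k n (f0 + \<psi>) y" for y
    note fm = form_inner_minus[OF k[of n]]
    have l: "linear l" using fm(1) unfolding bilinear_def l_def by blast
    have lb: "\<bar>l x\<bar> \<le> ((1 + C) * norm (f0 + \<psi>)) * norm x" for x unfolding l_def by (rule fm(3))
    have lX: "\<bar>l x\<bar> \<le> (2 * e1) * norm x" if "x \<in> X" for x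
    proof -
      have "\<bar>k n (f0 + \<psi>) x - k' (f0 + \<psi>) x\<bar> \<le> e1 * norm x"
        using kk(1)[of n "f0 + \<psi>" x] mult_right_mono[OF less_imp_le[OF N'[of n]], of "norm x"] n by auto
      then show ?thesis using f0(2)[OF that] unfolding l_def by linarith
    qed
    have low': "bounded_below c (k n)" using low n by simp
    obtain f1 w1 where fw: "f1 \<in> Y" "w1 \<in> X" "norm f1 \<le> (2 * e1) / c" "norm w1 \<le> (2 * e1) / c"
      "\<And>y. y \<in> X \<Longrightarrow> inner (f1 + w1) y - k n (f1 + w1) y = l y"
      using solve_with_control[OF k c low' l lb lX] e1 by (auto simp del: mult_le_cancel_left)
    have ee: "(2 * e1) / c = e" using c by (simp add: e1_def)
    show "\<exists>f\<in>Y. \<exists>w\<in>X. norm f \<le> norm f0 + e \<and> norm (w - \<psi>) \<le> e \<and>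
       (\<forall>y\<in>X. inner (f + w) y - k n (f + w) y = 0)"
    proof (rule bexI[of _ "f0 - f1"], rule bexI[of _ "\<psi> - w1"], intro conjI ballI)
      show "f0 - f1 \<in> Y" by (rule subspace_diff[OF Y(1) f0(1) fw(1)])
      show "\<psi> - w1 \<in> X" by (rule subspace_diff[OF X(1) psi fw(2)])
      show "norm (f0 - f1) \<le> norm f0 + e" using fw(3) norm_triangle_ineq4[of f0 f1] ee by linarith
      show "norm (\<psi> - w1 - \<psi>) \<le> e" using fw(4) ee by simp
      fix y assume y: "y \<in> X"
      have eq: "f0 - f1 + (\<psi> - w1) = (f0 + \<psi>) - (f1 + w1)" by simp
      show "inner (f0 - f1 + (\<psi> - w1)) y - k n (f0 - f1 + (\<psi> - w1)) y = 0"
        unfolding eq using bilinear_lsub[OF fm(1), of "f0 + \<psi>" "f1 + w1" y] fw(5)[OF y] unfolding l_def by simp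
    qed
  qed
qed

text \<open>The Fredholm alternative: the control lemma with no exterior control,
  \<open>Y = {0}\<close>, and a constant sequence of forms.\<close>

lemma solvable:
  assumes k: "form k"
    and inj: "\<And>z. z \<in> X \<Longrightarrow> (\<forall>w\<in>X. inner z w - k z w = 0) \<Longrightarrow> z = 0"
  obtains w where "w \<in> X" "\<And>y. y \<in> X \<Longrightarrow> inner (f + w) y - k (f + w) y = 0"
proof -
  interpret T: compact_forms X "{0}" J C
  proof
    show "\<exists>r. strict_mono r \<and> Cauchy (\<lambda>n. J (x (r n)))" if "\<And>n. x n \<in> X" "\<And>n. norm (x n) \<le> 1" for x :: "nat \<Rightarrow> 'a"
      by (rule J_compact[OF that])
  qed (use X J C in \<open>auto simp: linear_add linear_scale\<close>)
  have Tk: "T.form k" using k unfolding form_def T.form_def .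
  have "\<exists>c N. c > 0 \<and> (\<forall>n\<ge>N::nat. T.bounded_below c k)"
  proof (rule T.uniform_lower_bound)
    show "\<bar>k u v - k u v\<bar> \<le> 0 * norm u * norm v" for u v by simp
    show "z = 0" if "z \<in> X" "\<forall>w\<in>X. inner z w - k z w = 0" for z using inj that by blast
  qed (use Tk in auto)
  then obtain c where c: "c > 0" and low: "T.bounded_below c k" by blast
  note fm = form_inner_minus[OF k]
  define l where "l y = - (inner f y - k f y)" for y
  have l: "linear l" unfolding l_def using fm(1) unfolding bilinear_def by (intro linear_compose_neg) blast
  have lb: "\<bar>l x\<bar> \<le> ((1 + C) * norm f) * norm x" for x unfolding l_def using fm(3)[of f x] by simp
  obtain g w where gw: "g \<in> {0}" "w \<in> X" "\<And>y. y \<in> X \<Longrightarrow> inner (g + w) y - k (g + w) y = l y"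
    by (rule T.solve_with_control[OF Tk c low l lb lb]) (use C in auto)
  show ?thesis
  proof (rule that[OF gw(2)])
    fix y assume "y \<in> X"
    then show "inner (f + w) y - k (f + w) y = 0"
      using gw(1) gw(3)[of y] bilinear_ladd[OF fm(1), of f w y] by (simp add: l_def)
  qed
qed

end

section \<open>Gaussian integrals\<close>

lemma gaussian_cis_1d:
  fixes t e :: real
  assumes e: "e > 0"
  shows "integrable lborel (\<lambda>x. cis (t * x) * of_real (exp (- e * x\<^sup>2)))"
    and "(LINT x|lborel. cis (t * x) * of_real (exp (- e * x\<^sup>2))) = of_real (sqrt (pi / e) * exp (- t\<^sup>2 / (4 * e)))"
proof -
  \<comment> \<open>This scaling turns the exponent of the standard normal density into
    \<open>- e * x^2\<close>, so the integral is read off from its characteristic function.\<close>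
  define c where "c = sqrt (2 * e)"
  have c: "c > 0" "c\<^sup>2 = 2 * e" using e by (auto simp: c_def)
  have char: "(LINT x|lborel. std_normal_density x *\<^sub>R iexp (r * x)) = of_real (exp (- r\<^sup>2 / 2))" for r
  proof -
    have "(CLINT x|std_normal_distribution. iexp (r * x)) = (LINT x|lborel. std_normal_density x *\<^sub>R iexp (r * x))"
      by (subst integral_density) auto
    then show ?thesis using char_std_normal_distribution by (simp add: char_def fun_eq_iff)
  qed
  have int: "integrable lborel (\<lambda>x. std_normal_density x *\<^sub>R iexp (r * x))" for r
  proof (rule Bochner_Integration.integrable_bound)
    show "integrable lborel std_normal_density" by simp
  qed (auto simp: norm_exp_i_times mult.commute)
  have eq: "std_normal_density (c * x) *\<^sub>R iexp (t / c * (c * x)) =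
      of_real (1 / sqrt (2 * pi)) * (cis (t * x) * of_real (exp (- e * x\<^sup>2)))" for x
    using c e by (simp add: std_normal_density_def cis_conv_exp scaleR_conv_of_real power_mult_distrib mult_ac)
  have "integrable lborel (\<lambda>x. of_real (1 / sqrt (2 * pi)) * (cis (t * x) * of_real (exp (- e * x\<^sup>2))))"
    using lborel_integrable_real_affine[OF int[of "t/c"], of c 0] c(1) eq by simp
  from integrable_mult_right[OF this, of "of_real (sqrt (2 * pi))"]
  show "integrable lborel (\<lambda>x. cis (t * x) * of_real (exp (- e * x\<^sup>2)))"
    by (simp add: mult.assoc[symmetric])
  have "of_real (exp (- (t / c)\<^sup>2 / 2)) = (LINT x|lborel. std_normal_density x *\<^sub>R iexp (t / c * x))"
    by (rule char[symmetric])
  also have "\<dots> = \<bar>c\<bar> *\<^sub>R (LINT x|lborel. std_normal_density (0 + c * x) *\<^sub>R iexp (t / c * (0 + c * x)))"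
    by (rule lborel_integral_real_affine) (use c in simp)
  also have "\<dots> = of_real (c / sqrt (2 * pi)) * (LINT x|lborel. cis (t * x) * of_real (exp (- e * x\<^sup>2)))"
    using c(1) unfolding add_0 eq by (simp add: scaleR_conv_of_real)
  finally have *: "of_real (exp (- (t / c)\<^sup>2 / 2)) =
      of_real (c / sqrt (2 * pi)) * (LINT x|lborel. cis (t * x) * of_real (exp (- e * x\<^sup>2)))" .
  have "(LINT x|lborel. cis (t * x) * of_real (exp (- e * x\<^sup>2))) =
     of_real (sqrt (2 * pi) / c) * (of_real (c / sqrt (2 * pi)) * (LINT x|lborel. cis (t * x) * of_real (exp (- e * x\<^sup>2))))"
    using c(1) by simp
  also have "\<dots> = of_real (sqrt (2 * pi) / c * exp (- (t / c)\<^sup>2 / 2))"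
    unfolding *[symmetric] by simp
  also have "sqrt (2 * pi) / c = sqrt (pi / e)"
    using e by (simp add: c_def real_sqrt_divide real_sqrt_mult)
  also have "- (t / c)\<^sup>2 / 2 = - t\<^sup>2 / (4 * e)" using c by (simp add: power_divide)
  finally show "(LINT x|lborel. cis (t * x) * of_real (exp (- e * x\<^sup>2))) = of_real (sqrt (pi / e) * exp (- t\<^sup>2 / (4 * e)))" .
qed

lemma gaussian_cis:
  fixes \<xi> :: "'a::euclidean_space"
  assumes e: "e > 0"
  shows "integrable lborel (\<lambda>x::'a. cis (\<xi> \<bullet> x) * of_real (exp (- e * (norm x)\<^sup>2)))"
    and "(LINT x|lborel. cis (\<xi> \<bullet> x) * of_real (exp (- e * (norm (x::'a))\<^sup>2))) =
      of_real ((pi / e) powr (real DIM('a) / 2) * exp (- (norm \<xi>)\<^sup>2 / (4 * e)))"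
proof -
  define h where "h b y = cis ((\<xi> \<bullet> b) * y) * complex_of_real (exp (- e * y\<^sup>2))" for b y
  interpret P: product_sigma_finite "\<lambda>_::'a. lborel :: real measure" ..
  have fact: "cis (\<xi> \<bullet> x) * of_real (exp (- e * (norm x)\<^sup>2)) = (\<Prod>b\<in>Basis. h b (x \<bullet> b))" for x :: 'a
  proof -
    have "(norm x)\<^sup>2 = (\<Sum>b\<in>Basis. (x \<bullet> b)\<^sup>2)"
      unfolding power2_norm_eq_inner euclidean_inner[of x x] by (simp add: power2_eq_square)
    then have "- e * (norm x)\<^sup>2 = (\<Sum>b\<in>Basis. - e * (x \<bullet> b)\<^sup>2)" by (simp add: sum_distrib_left)
    then have 1: "exp (- e * (norm x)\<^sup>2) = (\<Prod>b\<in>Basis. exp (- e * (x \<bullet> b)\<^sup>2))" by (simp only: exp_sum finite_Basis)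
    have "cis (sum f A) = (\<Prod>b\<in>A. cis (f b))" if "finite A" for f and A :: "'a set"
      using that by induction (auto simp: cis_mult[symmetric])
    then have 2: "cis (\<xi> \<bullet> x) = (\<Prod>b\<in>Basis. cis ((\<xi> \<bullet> b) * (x \<bullet> b)))"
      by (subst euclidean_inner) simp
    show ?thesis unfolding 1 2 h_def by (simp add: prod.distrib)
  qed
  have coord: "(\<Sum>b\<in>Basis. f b *\<^sub>R b) \<bullet> b = f b" if "b \<in> Basis" for f and b :: 'a
    using that by (simp add: inner_sum_left inner_Basis if_distrib sum.delta cong: if_cong)
  have eq: "(\<Prod>b\<in>Basis. h b ((\<Sum>b\<in>Basis. f b *\<^sub>R b) \<bullet> b)) = (\<Prod>b\<in>Basis. h b (f b))" for f
    by (intro prod.cong refl) (simp add: coord)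
  have hm[measurable]: "h b \<in> borel_measurable borel" for b 
    unfolding h_def cis_conv_exp by measurable
  have hi: "integrable lborel (h b)" for b unfolding h_def by (rule gaussian_cis_1d(1)[OF e])
  have T: "(\<lambda>f. \<Sum>b\<in>Basis. f b *\<^sub>R b) \<in> measurable (Pi\<^sub>M (Basis::'a set) (\<lambda>b. lborel)) borel" by measurable
  have m: "(\<lambda>x::'a. \<Prod>b\<in>Basis. h b (x \<bullet> b)) \<in> borel_measurable borel" by measurable
  have "integrable (Pi\<^sub>M (Basis::'a set) (\<lambda>b. lborel)) (\<lambda>f. \<Prod>b\<in>Basis. h b (f b))"
    by (rule P.product_integrable_prod) (auto simp: hi)
  then have "integrable lborel (\<lambda>x::'a. \<Prod>b\<in>Basis. h b (x \<bullet> b))"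
    by (subst lborel_eq, subst integrable_distr_eq[OF T]) (auto simp: eq m)
  then show "integrable lborel (\<lambda>x::'a. cis (\<xi> \<bullet> x) * of_real (exp (- e * (norm x)\<^sup>2)))"
    by (simp only: fact)
  have "(LINT x|lborel. cis (\<xi> \<bullet> x) * of_real (exp (- e * (norm (x::'a))\<^sup>2))) =
        (LINT x|lborel. (\<Prod>b\<in>Basis. h b ((x::'a) \<bullet> b)))" by (simp only: fact)
  also have "\<dots> = (LINT f|Pi\<^sub>M (Basis::'a set) (\<lambda>b. lborel). (\<Prod>b\<in>Basis. h b (f b)))"
    by (subst lborel_eq, subst integral_distr[OF T]) (auto simp: eq m)
  also have "\<dots> = (\<Prod>b\<in>Basis. (LINT y|lborel. h b y))"
    by (rule P.product_integral_prod) (auto simp: hi)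
  also have "\<dots> = (\<Prod>b\<in>(Basis::'a set). of_real (sqrt (pi / e) * exp (- (\<xi> \<bullet> b)\<^sup>2 / (4 * e))))"
    unfolding h_def by (intro prod.cong refl gaussian_cis_1d(2)[OF e])
  also have "\<dots> = of_real (sqrt (pi / e) ^ DIM('a) * (\<Prod>b\<in>(Basis::'a set). exp (- (\<xi> \<bullet> b)\<^sup>2 / (4 * e))))"
    by (simp add: prod.distrib)
  also have "(\<Prod>b\<in>(Basis::'a set). exp (- (\<xi> \<bullet> b)\<^sup>2 / (4 * e))) = exp (- (norm \<xi>)\<^sup>2 / (4 * e))"
  proof -
    have "- (norm \<xi>)\<^sup>2 / (4 * e) = (\<Sum>b\<in>Basis. - (\<xi> \<bullet> b)\<^sup>2 / (4 * e))"
      unfolding power2_norm_eq_inner euclidean_inner[of \<xi> \<xi>]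
      by (simp add: power2_eq_square sum_divide_distrib sum_negf)
    then show ?thesis by (simp only: exp_sum finite_Basis)
  qed
  also have "sqrt (pi / e) ^ DIM('a) = (pi / e) powr (real DIM('a) / 2)"
    using e by (simp add: powr_half_sqrt[symmetric] powr_powr powr_realpow[symmetric] mult.commute)
  finally show "(LINT x|lborel. cis (\<xi> \<bullet> x) * of_real (exp (- e * (norm (x::'a))\<^sup>2))) =
      of_real ((pi / e) powr (real DIM('a) / 2) * exp (- (norm \<xi>)\<^sup>2 / (4 * e)))" .
qed

lemma gaussian_trig:
  fixes \<xi> :: "'a::euclidean_space"
  assumes e: "e > 0"
  shows "integrable lborel (\<lambda>x::'a. exp (- e * (norm x)\<^sup>2) * cos (x \<bullet> \<xi>))"
    and "integrable lborel (\<lambda>x::'a. exp (- e * (norm x)\<^sup>2) * sin (x \<bullet> \<xi>))"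
    and "(LINT x|lborel. exp (- e * (norm (x::'a))\<^sup>2) * cos (x \<bullet> \<xi>)) =
      (pi / e) powr (real DIM('a) / 2) * exp (- (norm \<xi>)\<^sup>2 / (4 * e))"
    and "(LINT x|lborel. exp (- e * (norm (x::'a))\<^sup>2) * sin (x \<bullet> \<xi>)) = 0"
proof -
  note g = gaussian_cis[OF e, of \<xi>]
  have eqs: "Re (cis (\<xi> \<bullet> x) * of_real (exp (- e * (norm x)\<^sup>2))) = exp (- e * (norm x)\<^sup>2) * cos (x \<bullet> \<xi>)"
    "Im (cis (\<xi> \<bullet> x) * of_real (exp (- e * (norm x)\<^sup>2))) = exp (- e * (norm x)\<^sup>2) * sin (x \<bullet> \<xi>)" for x
    by (simp_all add: inner_commute mult.commute)
  show "integrable lborel (\<lambda>x::'a. exp (- e * (norm x)\<^sup>2) * cos (x \<bullet> \<xi>))"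
    using integrable_Re[OF g(1)] by (simp only: eqs)
  show "integrable lborel (\<lambda>x::'a. exp (- e * (norm x)\<^sup>2) * sin (x \<bullet> \<xi>))"
    using integrable_Im[OF g(1)] by (simp only: eqs)
  show "(LINT x|lborel. exp (- e * (norm (x::'a))\<^sup>2) * cos (x \<bullet> \<xi>)) =
      (pi / e) powr (real DIM('a) / 2) * exp (- (norm \<xi>)\<^sup>2 / (4 * e))"
    using integral_Re[OF g(1)] unfolding g(2) by (simp only: eqs Re_complex_of_real)
  show "(LINT x|lborel. exp (- e * (norm (x::'a))\<^sup>2) * sin (x \<bullet> \<xi>)) = 0"
    using integral_Im[OF g(1)] unfolding g(2) by (simp only: eqs Im_complex_of_real)
qed

lemma gaussian_integrable:
  assumes "e > 0"
  shows "integrable lborel (\<lambda>x::'a::euclidean_space. exp (- e * (norm x)\<^sup>2))"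
    and "(LINT x|lborel. exp (- e * (norm (x::'a))\<^sup>2)) = (pi / e) powr (real DIM('a) / 2)"
  using gaussian_trig(1,3)[OF assms, of 0] by simp_all

lemma integrable_tensor:
  fixes f :: "'a::euclidean_space \<Rightarrow> real" and g :: "'b::euclidean_space \<Rightarrow> real"
  assumes f: "integrable lborel f" and g: "integrable lborel g"
  shows "integrable lborel (\<lambda>(x, y). f x * g y)"
    and "(LINT z|lborel. (case z of (x, y) \<Rightarrow> f x * g y)) = (LINT x|lborel. f x) * (LINT y|lborel. g y)"
proof -
  have [measurable]: "f \<in> borel_measurable borel" "g \<in> borel_measurable borel"
    using f g by (auto dest: borel_measurable_integrable)
  have "integrable (lborel \<Otimes>\<^sub>M lborel) (\<lambda>(x, y). f x * g y)"
  proof (rule lborel_pair.Fubini_integrable)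
    show "integrable lborel (\<lambda>x. LINT y|lborel. norm (case (x, y) of (x, y) \<Rightarrow> f x * g y))"
      using f by (simp add: abs_mult)
    show "AE x in lborel. integrable lborel (\<lambda>y. case (x, y) of (x, y) \<Rightarrow> f x * g y)"
      using g by simp
  qed measurable
  then show i: "integrable lborel (\<lambda>(x, y). f x * g y)" by (simp add: lborel_prod)
  have "(LINT z|lborel. (case z of (x, y) \<Rightarrow> f x * g y)) = (LINT x|lborel. LINT y|lborel. f x * g y)"
    using lborel_pair.integral_fst[of "\<lambda>x y. f x * g y"] i by (simp add: lborel_prod)
  then show "(LINT z|lborel. (case z of (x, y) \<Rightarrow> f x * g y)) = (LINT x|lborel. f x) * (LINT y|lborel. g y)"
    by simp
qed

section \<open>The Hartley transform\<close>

text \<open>For real functions the Hartley transform (kernel \<open>cos + sin\<close>) carries the same information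
  as the Fourier transform, but is real valued, symmetric and its own inverse.\<close>

definition cas :: "real \<Rightarrow> real" where "cas t = cos t + sin t"

definition hl :: "('a::euclidean_space \<Rightarrow> real) \<Rightarrow> 'a \<Rightarrow> real" where
  "hl f \<xi> = (2 * pi) powr (- real DIM('a) / 2) * (LINT x|lborel. cas (\<xi> \<bullet> x) * f x)"

definition heat :: "real \<Rightarrow> 'a::euclidean_space \<Rightarrow> real" where
  "heat e z = (4 * pi * e) powr (- real DIM('a) / 2) * exp (- (norm z)\<^sup>2 / (4 * e))"

lemma cas_bound: "\<bar>cas t\<bar> \<le> 2"
  unfolding cas_def using abs_sin_le_one[of t] abs_cos_le_one[of t] by linarith

lemma cas_measurable[measurable]: "cas \<in> borel_measurable borel"
  unfolding cas_def by measurable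

text \<open>Against an even Gaussian the term \<open>sin (a + b)\<close> integrates to zero. Only
  the cosine of the difference remains, so pairings of transforms are convolutions, as for the
  Fourier transform.\<close>

lemma cas_mult: "cas a * cas b = cos (a - b) + sin (a + b)"
  unfolding cas_def by (simp add: cos_diff sin_add algebra_simps)

lemma integrable_cas:
  fixes f :: "'a::euclidean_space \<Rightarrow> real"
  assumes "integrable lborel f"
  shows "integrable lborel (\<lambda>x. cas (\<xi> \<bullet> x) * f x)"
proof -
  have [measurable]: "f \<in> borel_measurable borel" using assms by (auto dest: borel_measurable_integrable)
  show ?thesis
    by (rule Bochner_Integration.integrable_bound[where f="\<lambda>x. 2 * f x"])
      (use assms in \<open>auto simp: abs_mult intro!: mult_right_mono cas_bound\<close>)
qed

lemma hl_measurable: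
  fixes f :: "'a::euclidean_space \<Rightarrow> real"
  assumes [measurable]: "f \<in> borel_measurable borel"
  shows "hl f \<in> borel_measurable borel"
proof -
  have "(\<lambda>\<xi>. LINT x|lborel. cas (\<xi> \<bullet> x) * f x) \<in> borel_measurable borel"
    by (rule lborel.borel_measurable_lebesgue_integral) measurable
  then show ?thesis unfolding hl_def by measurable
qed

lemma hl_bound:
  fixes f :: "'a::euclidean_space \<Rightarrow> real"
  assumes "integrable lborel f"
  shows "\<bar>hl f \<xi>\<bar> \<le> (2 * pi) powr (- real DIM('a) / 2) * 2 * (LINT x|lborel. \<bar>f x\<bar>)"
proof -
  have "\<bar>LINT x|lborel. cas (\<xi> \<bullet> x) * f x\<bar> \<le> (LINT x|lborel. \<bar>cas (\<xi> \<bullet> x) * f x\<bar>)"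
    using integral_norm_bound[of lborel "\<lambda>x. cas (\<xi> \<bullet> x) * f x"] by simp
  also have "\<dots> \<le> (LINT x|lborel. 2 * \<bar>f x\<bar>)"
    using integrable_cas[OF assms, of \<xi>] assms
    by (intro integral_mono integrable_abs integrable_mult_right) (auto simp: abs_mult intro!: mult_right_mono cas_bound)
  finally show ?thesis unfolding hl_def by (simp add: abs_mult mult.assoc mult_left_mono)
qed

lemma hl_diff:
  assumes "integrable lborel f" "integrable lborel g"
  shows "hl (\<lambda>x. f x - g x) \<xi> = hl f \<xi> - hl g \<xi>"
  unfolding hl_def using integrable_cas[OF assms(1)] integrable_cas[OF assms(2)]
  by (simp add: right_diff_distrib)

lemma hl_add:
  assumes "integrable lborel f" "integrable lborel g"
  shows "hl (\<lambda>x. f x + g x) \<xi> = hl f \<xi> + hl g \<xi>"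
  unfolding hl_def using integrable_cas[OF assms(1)] integrable_cas[OF assms(2)]
  by (simp add: distrib_left)

lemma hl_cmult: "hl (\<lambda>x. c * f x) \<xi> = c * hl f \<xi>"
  unfolding hl_def by (simp add: mult.left_commute)

text \<open>The Gaussian makes the triple integral absolutely convergent; integrating over \<xi>
  first produces the heat kernel. The limit \<open>e\<close> to 0 gives Plancherel, and with
  \<open>e\<close> as time variable the formula feeds the subordination argument.\<close>

lemma hl_gaussian_parseval:
  fixes f g :: "'a::euclidean_space \<Rightarrow> real"
  assumes f: "integrable lborel f" and g: "integrable lborel g" and e: "e > 0"
  shows "integrable lborel (\<lambda>\<xi>. exp (- e * (norm \<xi>)\<^sup>2) * (hl f \<xi> * hl g \<xi>))"
    and "(LINT \<xi>|lborel. exp (- e * (norm \<xi>)\<^sup>2) * (hl f \<xi> * hl g \<xi>)) =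
         (LINT z|lborel. (case z of (x, y) \<Rightarrow> f x * g y * heat e (x - y)))"
proof -
  have [measurable]: "f \<in> borel_measurable borel" "g \<in> borel_measurable borel"
    using f g by (auto dest: borel_measurable_integrable)
  define F where "F \<xi> z = exp (- e * (norm \<xi>)\<^sup>2) * (case z of (x, y) \<Rightarrow> (cas (\<xi> \<bullet> x) * f x) * (cas (\<xi> \<bullet> y) * g y))"
    for \<xi> :: 'a and z :: "'a \<times> 'a"
  define nf where "nf = (2 * pi) powr (- real DIM('a) / 2)"
  have i1: "integrable lborel (\<lambda>z. (case z of (x, y) \<Rightarrow> f x * g y))" by (rule integrable_tensor(1)[OF f g])
  have "integrable (lborel \<Otimes>\<^sub>M lborel) (case_prod F)"
  proof (rule Bochner_Integration.integrable_bound)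
    show "integrable (lborel \<Otimes>\<^sub>M lborel) (\<lambda>(\<xi>::'a, z). exp (- e * (norm \<xi>)\<^sup>2) * (4 * (case z of (x, y) \<Rightarrow> f x * g y)))"
      using integrable_tensor(1)[OF gaussian_integrable(1)[OF e] integrable_mult_right[OF i1, of 4]]
      by (simp add: lborel_prod)
    show "case_prod F \<in> borel_measurable (lborel \<Otimes>\<^sub>M lborel)"
      unfolding F_def lborel_prod[symmetric] by measurable
    have "\<bar>cas a * f x * (cas b * g y)\<bar> \<le> 4 * \<bar>f x * g y\<bar>" for a b x y
    proof -
      have "\<bar>cas a\<bar> * \<bar>cas b\<bar> \<le> 2 * 2" by (intro mult_mono cas_bound) auto
      then have "(\<bar>cas a\<bar> * \<bar>cas b\<bar>) * \<bar>f x * g y\<bar> \<le> 4 * \<bar>f x * g y\<bar>" by (intro mult_right_mono) auto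
      then show ?thesis by (simp add: abs_mult mult_ac)
    qed
    then show "AE p in lborel \<Otimes>\<^sub>M lborel. norm (case_prod F p) \<le>
        norm (case p of (\<xi>::'a, z) \<Rightarrow> exp (- e * (norm \<xi>)\<^sup>2) * (4 * (case z of (x, y) \<Rightarrow> f x * g y)))"
      by (intro AE_I2) (auto simp: F_def abs_mult split: prod.splits)
  qed
  note I = this
  have inner1: "(LINT z|lborel. F \<xi> z) = exp (- e * (norm \<xi>)\<^sup>2) * ((LINT x|lborel. cas (\<xi> \<bullet> x) * f x) * (LINT x|lborel. cas (\<xi> \<bullet> x) * g x))" for \<xi>
    unfolding F_def
    using integrable_tensor(2)[OF integrable_cas[OF f, of \<xi>] integrable_cas[OF g, of \<xi>]] by simp
  have inner2: "(LINT \<xi>|lborel. F \<xi> z) = (case z of (x, y) \<Rightarrow> f x * g y * ((pi / e) powr (real DIM('a) / 2) * exp (- (norm (x - y))\<^sup>2 / (4 * e))))" for z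
  proof (cases z)
    case (Pair x y)
    have "(LINT \<xi>|lborel. F \<xi> z) = (LINT \<xi>|lborel. (f x * g y) * (exp (- e * (norm \<xi>)\<^sup>2) * cos (\<xi> \<bullet> (x - y)) + exp (- e * (norm \<xi>)\<^sup>2) * sin (\<xi> \<bullet> (x + y))))"
    proof (intro Bochner_Integration.integral_cong refl)
      fix \<xi> :: 'a
      have "F \<xi> z = (f x * g y) * (exp (- e * (norm \<xi>)\<^sup>2) * (cas (\<xi> \<bullet> x) * cas (\<xi> \<bullet> y)))"
        unfolding F_def Pair by simp
      then show "F \<xi> z = (f x * g y) * (exp (- e * (norm \<xi>)\<^sup>2) * cos (\<xi> \<bullet> (x - y)) + exp (- e * (norm \<xi>)\<^sup>2) * sin (\<xi> \<bullet> (x + y)))"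
        unfolding cas_mult inner_diff_right inner_add_right by (simp add: distrib_left)
    qed
    also have "\<dots> = f x * g y * ((pi / e) powr (real DIM('a) / 2) * exp (- (norm (x - y))\<^sup>2 / (4 * e)))"
      using gaussian_trig[OF e, of "x - y"] gaussian_trig[OF e, of "x + y"] by simp
    finally show ?thesis by (simp add: Pair)
  qed
  have eqF: "exp (- e * (norm \<xi>)\<^sup>2) * (hl f \<xi> * hl g \<xi>) = nf\<^sup>2 * (LINT z|lborel. F \<xi> z)" for \<xi>
    unfolding inner1 hl_def nf_def by (simp add: power2_eq_square)
  show "integrable lborel (\<lambda>\<xi>. exp (- e * (norm \<xi>)\<^sup>2) * (hl f \<xi> * hl g \<xi>))"
    unfolding eqF using lborel_pair.integrable_fst[OF I] by simp
  have "(LINT \<xi>|lborel. exp (- e * (norm \<xi>)\<^sup>2) * (hl f \<xi> * hl g \<xi>)) = nf\<^sup>2 * (LINT \<xi>|lborel. LINT z|lborel. F \<xi> z)"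
    unfolding eqF by simp
  also have "(LINT \<xi>|lborel. LINT z|lborel. F \<xi> z) = (LINT z|lborel. LINT \<xi>|lborel. F \<xi> z)"
    by (rule lborel_pair.Fubini_integral[OF I, symmetric])
  also have "nf\<^sup>2 * \<dots> = (LINT z|lborel. (case z of (x, y) \<Rightarrow> f x * g y * heat e (x - y)))"
  proof -
    have "nf\<^sup>2 * (pi / e) powr (real DIM('a) / 2) = (4 * pi * e) powr (- real DIM('a) / 2)"
    proof -
      have "nf\<^sup>2 = ((2 * pi) * (2 * pi)) powr (- real DIM('a) / 2)"
        unfolding nf_def power2_eq_square by (subst powr_mult) auto
      moreover have "(pi / e) powr (real DIM('a) / 2) = (e / pi) powr (- real DIM('a) / 2)"
        using e by (simp add: powr_divide powr_minus_divide)
      ultimately have "nf\<^sup>2 * (pi / e) powr (real DIM('a) / 2) = (((2 * pi) * (2 * pi)) * (e / pi)) powr (- real DIM('a) / 2)"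
        using powr_mult[of "(2 * pi) * (2 * pi)" "e / pi" "- real DIM('a) / 2"] e by (simp only:)
      also have "((2 * pi) * (2 * pi)) * (e / pi) = 4 * pi * e" by simp
      finally show ?thesis .
    qed
    then show ?thesis unfolding inner2 integral_mult_right_zero[symmetric] heat_def
      by (intro Bochner_Integration.integral_cong refl) (auto split: prod.splits)
  qed
  finally show "(LINT \<xi>|lborel. exp (- e * (norm \<xi>)\<^sup>2) * (hl f \<xi> * hl g \<xi>)) =
         (LINT z|lborel. (case z of (x, y) \<Rightarrow> f x * g y * heat e (x - y)))" .
qed

section \<open>Plancherel's theorem for continuous functions with compact support\<close>

lemma lborel_affine_integral:
  fixes h :: "'a::euclidean_space \<Rightarrow> real" and x :: 'a
  assumes [measurable]: "h \<in> borel_measurable borel" and c: "c > 0"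
  shows "(LINT y|lborel. h y) = c ^ DIM('a) * (LINT z|lborel. h (x + c *\<^sub>R z))"
proof -
  have "(LINT y|lborel. h y) = (LINT y|density (distr lborel borel (\<lambda>z::'a. x + c *\<^sub>R z)) (\<lambda>_. ennreal (\<bar>c\<bar> ^ DIM('a))). h y)"
    using lborel_affine[of c x] c by simp
  also have "\<dots> = (LINT y|distr lborel borel (\<lambda>z::'a. x + c *\<^sub>R z). \<bar>c\<bar> ^ DIM('a) *\<^sub>R h y)"
    by (rule integral_density) auto
  also have "\<dots> = (LINT z|lborel. \<bar>c\<bar> ^ DIM('a) *\<^sub>R h (x + c *\<^sub>R z))"
    by (rule integral_distr) auto
  finally show ?thesis using c by simp
qed

definition Cc :: "('a::euclidean_space \<Rightarrow> real) set" where
  "Cc = {f. continuous_on UNIV f \<and> (\<exists>R>0. \<forall>x. norm x > R \<longrightarrow> f x = 0)}"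

lemma Cc_bounded:
  fixes f :: "'a::euclidean_space \<Rightarrow> real"
  assumes "f \<in> Cc"
  obtains B where "B > 0" "\<And>x. \<bar>f x\<bar> \<le> B"
proof -
  obtain R where R: "continuous_on UNIV f" "R > 0" "\<And>x. norm x > R \<Longrightarrow> f x = 0" using assms by (auto simp: Cc_def)
  have "compact (f ` cball 0 R)" using R(1) by (intro compact_continuous_image compact_cball) (auto intro: continuous_on_subset)
  then obtain B where B: "B > 0" "\<forall>y\<in>f ` cball 0 R. norm y \<le> B" using compact_imp_bounded bounded_pos by metis
  have "\<bar>f x\<bar> \<le> B" for x
    using B R(3)[of x] by (cases "norm x > R") (auto simp: not_less)
  then show ?thesis using that B(1) by blast
qed

lemma compact_support_integrable:
  fixes f :: "'a::euclidean_space \<Rightarrow> real"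
  assumes [measurable]: "f \<in> borel_measurable borel" and B: "\<And>x. \<bar>f x\<bar> \<le> B" and R: "\<And>x. norm x > R \<Longrightarrow> f x = 0"
  shows "integrable lborel f"
proof (rule Bochner_Integration.integrable_bound)
  show "integrable lborel (\<lambda>x::'a. B * indicator (cball 0 R) x)"
    using emeasure_lborel_cball_finite[of "0::'a" R] by (intro integrable_mult_right) (simp add: integrable_real_indicator)
  show "AE x in lborel. norm (f x) \<le> norm (B * indicator (cball (0::'a) R) x)"
  proof (rule AE_I2)
    fix x :: 'a
    have "0 \<le> B" using B[of x] by linarith
    then show "norm (f x) \<le> norm (B * indicator (cball (0::'a) R) x)"
      using B[of x] R[of x] by (cases "norm x > R") (auto simp: indicator_def)
  qed
qed simp

lemma Cc_measurable: "f \<in> Cc \<Longrightarrow> f \<in> borel_measurable borel"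
  unfolding Cc_def by (auto intro: borel_measurable_continuous_onI)

lemma Cc_integrable:
  fixes f :: "'a::euclidean_space \<Rightarrow> real"
  assumes f: "f \<in> Cc"
  shows "integrable lborel f" and "integrable lborel (\<lambda>x. (f x)\<^sup>2)" and "f \<in> sqint"
proof -
  obtain R where R: "\<And>x. norm x > R \<Longrightarrow> f x = 0" using f by (auto simp: Cc_def)
  obtain B where B: "B > 0" "\<And>x. \<bar>f x\<bar> \<le> B" using Cc_bounded[OF f] by blast
  note [measurable] = Cc_measurable[OF f]
  show "integrable lborel f" by (rule compact_support_integrable[OF _ B(2) R]) auto
  show 2: "integrable lborel (\<lambda>x. (f x)\<^sup>2)"
  proof (rule compact_support_integrable)
    show "\<bar>(f x)\<^sup>2\<bar> \<le> B\<^sup>2" for x using power_mono[OF B(2)[of x], of 2] by simp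
    show "(f x)\<^sup>2 = 0" if "norm x > R" for x using R[OF that] by simp
  qed measurable
  show "f \<in> sqint" by (rule sqint_borelI[OF _ 2]) measurable
qed

text \<open>Let \<open>e\<close> tend to 0 in the regularised identity. The heat kernel side
  converges by domination; the frequency side increases, so monotone convergence yields square
  integrability of the transform together with the identity.\<close>

lemma hl_plancherel_Cc:
  fixes f :: "'a::euclidean_space \<Rightarrow> real"
  assumes f: "f \<in> Cc"
  shows "hl f \<in> sqint" and "norm (cls (hl f)) = norm (cls f)"
proof -
  obtain B where B: "B > 0" "\<And>x. \<bar>f x\<bar> \<le> B" using Cc_bounded[OF f] by blast
  have cf: "continuous_on UNIV f" using f by (auto simp: Cc_def)
  note [measurable] = Cc_measurable[OF f] hl_measurable[OF Cc_measurable[OF f]]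
  note fi = Cc_integrable[OF f]
  define e where "e k = 1 / real (Suc k)" for k
  have e0: "e k > 0" for k by (simp add: e_def)
  have elim: "e \<longlonglongrightarrow> 0" unfolding e_def using LIMSEQ_inverse_real_of_nat by (simp add: inverse_eq_divide)
  \<comment> \<open>The heat kernel at time 1/4, of total mass 1: the fixed profile left after
    rescaling.\<close>
  define ph where "ph z = pi powr (- real DIM('a) / 2) * exp (- (1::real) * (norm (z::'a))\<^sup>2)" for z
  have phi: "integrable lborel ph" "(LINT z|lborel. ph z) = 1"
    unfolding ph_def using gaussian_integrable[of 1, where 'a='a] by (auto simp flip: powr_add)
  have [measurable]: "ph \<in> borel_measurable borel" unfolding ph_def by measurable
  have ph0: "ph z \<ge> 0" for z by (simp add: ph_def)
  define G where "G k = (\<lambda>(x, z). f x * f (x + (2 * sqrt (e k)) *\<^sub>R z) * ph z)" for k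
  have Gm[measurable]: "G k \<in> borel_measurable (lborel \<Otimes>\<^sub>M lborel)" for k unfolding G_def by measurable
  have dom: "integrable (lborel \<Otimes>\<^sub>M lborel) (\<lambda>(x, z). (B * \<bar>f x\<bar>) * ph z)"
    using integrable_tensor(1)[of "\<lambda>x. B * \<bar>f x\<bar>" ph] fi(1) phi(1) by (simp add: lborel_prod)
  have domb: "norm (G k p) \<le> (case p of (x, z) \<Rightarrow> (B * \<bar>f x\<bar>) * ph z)" for k p
  proof (cases p)
    case (Pair x z)
    have "(\<bar>f x\<bar> * \<bar>f (x + (2 * sqrt (e k)) *\<^sub>R z)\<bar>) * ph z \<le> (\<bar>f x\<bar> * B) * ph z"
      by (intro mult_right_mono mult_left_mono B(2) ph0) auto
    then show ?thesis using ph0[of z] by (simp add: G_def Pair abs_mult mult.commute)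
  qed
  have Gi: "integrable (lborel \<Otimes>\<^sub>M lborel) (G k)" for k
    by (rule Bochner_Integration.integrable_bound[OF dom Gm]) (intro AE_I2, rule order_trans[OF domb], simp)
  have lhs: "(LINT \<xi>|lborel. exp (- e k * (norm \<xi>)\<^sup>2) * (hl f \<xi> * hl f \<xi>)) = (LINT p|(lborel \<Otimes>\<^sub>M lborel). G k p)" for k
  proof -
    define K where "K = (\<lambda>(x, y). f x * f y * heat (e k) (x - y))"
    have hm[measurable]: "heat (e k) \<in> borel_measurable borel" for k unfolding heat_def by measurable
    have hb: "\<bar>heat (e k) z\<bar> \<le> (4 * pi * e k) powr (- real DIM('a) / 2)" for z :: 'a
      unfolding heat_def using e0[of k] by (auto simp: abs_mult intro!: mult_left_le)
    have Ki: "integrable (lborel \<Otimes>\<^sub>M lborel) K"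
    proof (rule Bochner_Integration.integrable_bound)
      show "integrable (lborel \<Otimes>\<^sub>M lborel) (\<lambda>z. (4 * pi * e k) powr (- real DIM('a) / 2) * (case z of (x, y) \<Rightarrow> f x * f y))"
        using integrable_mult_right[OF integrable_tensor(1)[OF fi(1) fi(1)]] by (simp add: lborel_prod)
      show "K \<in> borel_measurable (lborel \<Otimes>\<^sub>M lborel)" unfolding K_def by measurable
      show "AE z in lborel \<Otimes>\<^sub>M lborel. norm (K z) \<le> norm ((4 * pi * e k) powr (- real DIM('a) / 2) * (case z of (x, y) \<Rightarrow> f x * f y))"
      proof (rule AE_I2)
        fix z :: "'a \<times> 'a"
        obtain x y where z: "z = (x, y)" by (cases z)
        have "\<bar>f x * f y\<bar> * \<bar>heat (e k) (x - y)\<bar> \<le> \<bar>f x * f y\<bar> * (4 * pi * e k) powr (- real DIM('a) / 2)"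
          by (intro mult_left_mono hb) simp
        then show "norm (K z) \<le> norm ((4 * pi * e k) powr (- real DIM('a) / 2) * (case z of (x, y) \<Rightarrow> f x * f y))"
          by (simp add: K_def z abs_mult mult.commute)
      qed
    qed
    have "(LINT \<xi>|lborel. exp (- e k * (norm \<xi>)\<^sup>2) * (hl f \<xi> * hl f \<xi>)) = (LINT z|(lborel \<Otimes>\<^sub>M lborel). K z)"
      using hl_gaussian_parseval(2)[OF fi(1) fi(1) e0[of k]] by (simp add: K_def lborel_prod)
    also have "\<dots> = (LINT x|lborel. LINT y|lborel. f x * f y * heat (e k) (x - y))"
      using lborel_pair.integral_fst'[OF Ki] by (simp add: K_def)
    \<comment> \<open>Substitution \<open>y = x + 2 * sqrt (e k) * z\<close>. The Jacobian absorbs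
      the time dependence of the kernel, so \<open>k\<close> remains only in the argument of
      \<open>f\<close>.\<close>
    also have "\<dots> = (LINT x|lborel. LINT z|lborel. G k (x, z))"
    proof (rule Bochner_Integration.integral_cong[OF refl])
      fix x :: 'a
      have c: "2 * sqrt (e k) > 0" using e0[of k] by simp
      have "(2 * sqrt (e k)) ^ DIM('a) * heat (e k) (x - (x + (2 * sqrt (e k)) *\<^sub>R z)) = ph z" for z
      proof -
        have "(norm ((2 * sqrt (e k)) *\<^sub>R z))\<^sup>2 / (4 * e k) = (norm z)\<^sup>2"
          using e0[of k] by (simp add: power_mult_distrib)
        moreover have "(2 * sqrt (e k)) ^ DIM('a) * (4 * pi * e k) powr (- real DIM('a) / 2) = pi powr (- real DIM('a) / 2)"
        proof -
          have "(2 * sqrt (e k)) ^ DIM('a) = ((2 * sqrt (e k))\<^sup>2) powr (real DIM('a) / 2)"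
          proof -
            have "r ^ DIM('a) = (r\<^sup>2) powr (real DIM('a) / 2)" if "r > 0" for r :: real
            proof -
              have "r\<^sup>2 = r powr 2" using that by simp
              then show ?thesis using that by (simp only: powr_powr) (simp add: powr_realpow)
            qed
            from this[OF c] show ?thesis .
          qed
          also have "(2 * sqrt (e k))\<^sup>2 = 4 * e k" using e0[of k] by (simp add: power_mult_distrib)
          finally have "(2 * sqrt (e k)) ^ DIM('a) * (4 * pi * e k) powr (- real DIM('a) / 2) =
            (4 * e k) powr (real DIM('a) / 2) * ((4 * e k) powr (- real DIM('a) / 2) * pi powr (- real DIM('a) / 2))"
            using e0[of k] by (simp add: powr_mult[symmetric] mult_ac)
          then show ?thesis using e0[of k] by (simp add: mult.assoc[symmetric] powr_add[symmetric])
        qed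
        ultimately show ?thesis unfolding heat_def ph_def by (simp add: norm_minus_commute mult.assoc[symmetric])
      qed
      then have "(2 * sqrt (e k)) ^ DIM('a) * (f x * f (x + (2 * sqrt (e k)) *\<^sub>R z) * heat (e k) (x - (x + (2 * sqrt (e k)) *\<^sub>R z))) = G k (x, z)" for z
        unfolding G_def case_prod_conv mult.left_commute[of "(2 * sqrt (e k)) ^ DIM('a)" "f x * f (x + (2 * sqrt (e k)) *\<^sub>R z)" for z] by (simp only:)
      note * = this
      have "(LINT y|lborel. f x * f y * heat (e k) (x - y)) =
          (LINT z|lborel. (2 * sqrt (e k)) ^ DIM('a) * (f x * f (x + (2 * sqrt (e k)) *\<^sub>R z) * heat (e k) (x - (x + (2 * sqrt (e k)) *\<^sub>R z))))"
        by (subst lborel_affine_integral[OF _ c, of _ x]) auto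
      then show "(LINT y|lborel. f x * f y * heat (e k) (x - y)) = (LINT z|lborel. G k (x, z))"
        unfolding * .
    qed
    also have "\<dots> = (LINT p|(lborel \<Otimes>\<^sub>M lborel). G k p)" by (rule lborel_pair.integral_fst'[OF Gi])
    finally show ?thesis .
  qed
  have "(\<lambda>k. LINT p|(lborel \<Otimes>\<^sub>M lborel). G k p) \<longlonglongrightarrow> (LINT p|(lborel \<Otimes>\<^sub>M lborel). (case p of (x, z) \<Rightarrow> (f x)\<^sup>2 * ph z))"
  proof (rule integral_dominated_convergence[OF _ _ dom])
    show "AE p in lborel \<Otimes>\<^sub>M lborel. (\<lambda>k. G k p) \<longlonglongrightarrow> (case p of (x, z) \<Rightarrow> (f x)\<^sup>2 * ph z)"
    proof (rule AE_I2)
      fix p :: "'a \<times> 'a"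
      obtain x z where p: "p = (x, z)" by (cases p)
      have "(\<lambda>k. x + (2 * sqrt (e k)) *\<^sub>R z) \<longlonglongrightarrow> x + (2 * sqrt 0) *\<^sub>R z"
        by (intro tendsto_intros elim)
      then have "(\<lambda>k. f (x + (2 * sqrt (e k)) *\<^sub>R z)) \<longlonglongrightarrow> f x"
        using cf by (intro isCont_tendsto_compose[of x f]) (auto simp: continuous_on_eq_continuous_at)
      then show "(\<lambda>k. G k p) \<longlonglongrightarrow> (case p of (x, z) \<Rightarrow> (f x)\<^sup>2 * ph z)"
        unfolding G_def p by (auto simp: power2_eq_square intro!: tendsto_intros)
    qed
    show "AE p in lborel \<Otimes>\<^sub>M lborel. norm (G k p) \<le> (case p of (x, z) \<Rightarrow> (B * \<bar>f x\<bar>) * ph z)" for k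
      by (intro AE_I2 domb)
  qed measurable
  also have "(LINT p|(lborel \<Otimes>\<^sub>M lborel). (case p of (x, z) \<Rightarrow> (f x)\<^sup>2 * ph z)) = (LINT x|lborel. (f x)\<^sup>2)"
    using integrable_tensor(2)[OF fi(2) phi(1)] phi(2) by (simp add: lborel_prod)
  finally have lim: "(\<lambda>k. LINT \<xi>|lborel. exp (- e k * (norm \<xi>)\<^sup>2) * (hl f \<xi> * hl f \<xi>)) \<longlonglongrightarrow> (LINT x|lborel. (f x)\<^sup>2)"
    unfolding lhs .
  have mono: "AE \<xi> in lborel. mono (\<lambda>k. exp (- e k * (norm \<xi>)\<^sup>2) * (hl f \<xi> * hl f \<xi>))"
  proof (intro AE_I2 monoI mult_right_mono)
    fix \<xi> :: 'a and i j :: nat assume "i \<le> j"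
    then have "e j \<le> e i" unfolding e_def by (simp add: frac_le)
    then show "exp (- e i * (norm \<xi>)\<^sup>2) \<le> exp (- e j * (norm \<xi>)\<^sup>2)" by (simp add: mult_right_mono)
  qed simp
  have ptw: "AE \<xi> in lborel. (\<lambda>k. exp (- e k * (norm \<xi>)\<^sup>2) * (hl f \<xi> * hl f \<xi>)) \<longlonglongrightarrow> hl f \<xi> * hl f \<xi>"
  proof (rule AE_I2)
    fix \<xi> :: 'a
    have "(\<lambda>k. exp (- e k * (norm \<xi>)\<^sup>2) * (hl f \<xi> * hl f \<xi>)) \<longlonglongrightarrow> exp (- 0 * (norm \<xi>)\<^sup>2) * (hl f \<xi> * hl f \<xi>)"
      by (intro tendsto_intros elim)
    then show "(\<lambda>k. exp (- e k * (norm \<xi>)\<^sup>2) * (hl f \<xi> * hl f \<xi>)) \<longlonglongrightarrow> hl f \<xi> * hl f \<xi>" by simp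
  qed
  note mc = hl_gaussian_parseval(1)[OF fi(1) fi(1) e0] mono ptw lim
  have i: "integrable lborel (\<lambda>\<xi>. hl f \<xi> * hl f \<xi>)"
    by (rule integrable_monotone_convergence[OF mc]) measurable
  have eq: "(LINT \<xi>|lborel. hl f \<xi> * hl f \<xi>) = (LINT x|lborel. (f x)\<^sup>2)"
    by (rule integral_monotone_convergence[OF mc]) measurable
  show s: "hl f \<in> sqint" by (rule sqint_borelI) (use i in \<open>auto simp: power2_eq_square\<close>)
  have "(norm (cls (hl f)))\<^sup>2 = (norm (cls f))\<^sup>2"
    unfolding norm_cls_sq[OF s] norm_cls_sq[OF fi(3)] using eq
    by (subst (1 2) integral_completion) (auto simp: power2_eq_square)
  then show "norm (cls (hl f)) = norm (cls f)" by simp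
qed

section \<open>Limits in L2 and density of continuous functions with compact support\<close>

lemma L2_pointwise_limit:
  fixes F :: "nat \<Rightarrow> 'a::euclidean_space \<Rightarrow> real"
  assumes F: "\<And>n. F n \<in> sqint" and G: "G \<in> borel_measurable lebesgue"
    and lim: "(\<lambda>n. cls (F n)) \<longlonglongrightarrow> a" and ptw: "AE x in lborel. (\<lambda>n. F n x) \<longlonglongrightarrow> G x"
  shows "G \<in> sqint" and "cls G = a"
proof -
  define D where "D n x = F n x - fn a x" for n x
  have D: "D n \<in> sqint" for n unfolding D_def by (intro sqint_diff F fn_sqint)
  have clsD: "cls (D n) = cls (F n) - a" for n
    unfolding D_def using cls_diff[OF F fn_sqint] by simp
  have small: "(\<lambda>x. G x - fn a x) \<in> sqint \<and> norm (cls (\<lambda>x. G x - fn a x)) \<le> e" if e: "e > 0" for e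
  proof -
    obtain N where N: "\<And>n. n \<ge> N \<Longrightarrow> norm (cls (F n) - a) < e" using LIMSEQ_D[OF lim e] by blast
    have m: "(\<lambda>x. G x - fn a x) \<in> borel_measurable lebesgue"
      using G by (intro borel_measurable_diff) (auto intro: borel_measurable_lborel_lebesgue)
    have l: "AE x in lborel. (\<lambda>n. D (n + N) x) \<longlonglongrightarrow> G x - fn a x"
      using ptw unfolding D_def by eventually_elim (intro tendsto_intros LIMSEQ_ignore_initial_segment)
    have b: "norm (cls (D (n + N))) \<le> e" for n using N[of "n + N"] clsD[of "n + N"] by simp
    show ?thesis using sqint_limit[OF D m l b] by blast
  qed
  have "(\<lambda>x. (G x - fn a x) + fn a x) \<in> sqint" using small[of 1] by (intro sqint_add) auto
  then show Gs: "G \<in> sqint" by simp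
  have "norm (cls (\<lambda>x. G x - fn a x)) \<le> 0" by (rule field_le_epsilon) (use small in auto)
  then show "cls G = a" using cls_diff[OF Gs fn_sqint, of a] by simp
qed

lemma cball_borel[measurable]: "cball c r \<in> sets borel"
  by (simp add: borel_closed)

lemma L2_dominated:
  fixes F :: "nat \<Rightarrow> 'a::euclidean_space \<Rightarrow> real"
  assumes m[measurable]: "\<And>n. F n \<in> borel_measurable borel" "g \<in> borel_measurable borel"
    and g: "integrable lborel (\<lambda>x. (g x)\<^sup>2)" and dom: "\<And>n x. \<bar>F n x\<bar> \<le> g x"
    and lim: "AE x in lborel. (\<lambda>n. F n x) \<longlonglongrightarrow> 0"
  shows "\<And>n. F n \<in> sqint" and "(\<lambda>n. cls (F n)) \<longlonglongrightarrow> 0"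
proof -
  have d: "(F n x)\<^sup>2 \<le> (g x)\<^sup>2" for n x using power_mono[OF dom[of n x], of 2] by simp
  have i: "integrable lborel (\<lambda>x. (F n x)\<^sup>2)" for n
    by (rule Bochner_Integration.integrable_bound[OF g]) (auto simp: d)
  show s: "F n \<in> sqint" for n by (rule sqint_borelI[OF _ i]) measurable
  have "(\<lambda>n. LINT x|lborel. (F n x)\<^sup>2) \<longlonglongrightarrow> (LINT x|(lborel :: 'a measure). (0::real))"
  proof (rule integral_dominated_convergence[where w="\<lambda>x. (g x)\<^sup>2" and s="\<lambda>n x. (F n x)\<^sup>2" and f="\<lambda>_. 0"])
    show "integrable lborel (\<lambda>x. (g x)\<^sup>2)" by (rule g)
    show "AE x in lborel. (\<lambda>n. (F n x)\<^sup>2) \<longlonglongrightarrow> 0"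
      using lim by eventually_elim (auto intro: tendsto_eq_intros)
    show "AE x in lborel. norm ((F n x)\<^sup>2) \<le> (g x)\<^sup>2" for n by (simp add: d)
  qed measurable
  moreover have "(norm (cls (F n)))\<^sup>2 = (LINT x|lborel. (F n x)\<^sup>2)" for n
    unfolding norm_cls_sq[OF s] by (rule integral_completion) measurable
  ultimately have "(\<lambda>n. (norm (cls (F n)))\<^sup>2) \<longlonglongrightarrow> 0" by simp
  from tendsto_real_sqrt[OF this] have "(\<lambda>n. norm (cls (F n))) \<longlonglongrightarrow> 0" by simp
  then show "(\<lambda>n. cls (F n)) \<longlonglongrightarrow> 0" by (simp add: tendsto_norm_zero_iff)
qed

lemma indicator_square_integrable:
  "integrable lborel (\<lambda>x::'a::euclidean_space. (B * indicator (cball 0 R) x :: real)\<^sup>2)"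
proof -
  have "(\<lambda>x::'a. (B * indicator (cball 0 R) x :: real)\<^sup>2) = (\<lambda>x. B\<^sup>2 * indicator (cball 0 R) x)"
    by (auto simp: indicator_def)
  then show ?thesis using emeasure_lborel_cball_finite[of "0::'a" R]
    by (auto intro!: integrable_mult_right simp: integrable_real_indicator)
qed

text \<open>A measurable function is almost everywhere a limit of continuous ones. Clipping these to
  \<open>[- B, B]\<close> and cutting them off makes them dominated without changing the limit, as
  \<open>f\<close> obeys the same bounds.\<close>

lemma Cc_approx_bounded:
  fixes f :: "'a::euclidean_space \<Rightarrow> real"
  assumes fm[measurable]: "f \<in> borel_measurable borel" and fB: "\<And>x. \<bar>f x\<bar> \<le> B"
    and R: "R > 0" "\<And>x. norm x > R \<Longrightarrow> f x = 0" and e: "e > 0"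
  obtains h where "h \<in> Cc" "\<And>x. norm x > R + 1 \<Longrightarrow> h x = 0" "norm (cls f - cls h) < e"
proof -
  have B0: "B \<ge> 0" using fB[of 0] by linarith
  have "f measurable_on UNIV"
    by (rule lebesgue_measurable_imp_measurable_on) (auto intro: borel_measurable_lborel_lebesgue)
  then obtain N g where N: "negligible N" and g: "\<And>n. continuous_on UNIV (g n)"
    and lim: "\<And>x. x \<notin> N \<Longrightarrow> (\<lambda>n. g n x) \<longlonglongrightarrow> f x"
    unfolding measurable_on_def by auto
  \<comment> \<open>Equal to 1 on the ball of radius \<open>R\<close>, where \<open>f\<close> lives,
    and 0 outside radius \<open>R + 1\<close>.\<close>
  define cut where "cut x = max 0 (min 1 (R + 1 - norm x))" for x :: 'a
  define h where "h n x = max (- B) (min B (g n x)) * cut x" for n x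
  have h0: "h n x = 0" if "norm x > R + 1" for n x using that by (simp add: h_def cut_def)
  have hC: "h n \<in> Cc" for n unfolding Cc_def mem_Collect_eq
  proof (intro conjI exI[of _ "R + 1"] allI impI)
    show "continuous_on UNIV (h n)" unfolding h_def cut_def by (intro continuous_intros g)
  qed (use R h0 in auto)
  have hm[measurable]: "h n \<in> borel_measurable borel" for n by (rule Cc_measurable[OF hC])
  have cutb: "0 \<le> cut x" "cut x \<le> 1" for x by (auto simp: cut_def)
  have hB: "\<bar>h n x\<bar> \<le> B" for n x
  proof -
    have "\<bar>max (- B) (min B (g n x))\<bar> * \<bar>cut x\<bar> \<le> B * 1" using B0 cutb[of x] by (intro mult_mono) auto
    then show ?thesis by (simp add: h_def abs_mult)
  qed
  have fs: "f \<in> sqint"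
  proof (rule sqint_borelI[OF fm])
    show "integrable lborel (\<lambda>x. (f x)\<^sup>2)"
    proof (rule compact_support_integrable)
      show "\<bar>(f x)\<^sup>2\<bar> \<le> B\<^sup>2" for x using power_mono[OF fB[of x], of 2] by simp
      show "(f x)\<^sup>2 = 0" if "norm x > R" for x using R(2)[OF that] by simp
    qed measurable
  qed
  have "(\<lambda>n. cls (\<lambda>x. f x - h n x)) \<longlonglongrightarrow> 0"
  proof (rule L2_dominated(2))
    show "integrable lborel (\<lambda>x::'a. ((2 * B) * indicator (cball 0 (R + 1)) x)\<^sup>2)"
      by (rule indicator_square_integrable)
    show "\<bar>f x - h n x\<bar> \<le> (2 * B) * indicator (cball 0 (R + 1)) x" for n x
      using fB[of x] hB[of n x] h0[of x n] R by (cases "norm x > R + 1") (auto simp: indicator_def)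
    have "AE x in lebesgue. x \<notin> N" using N by (auto simp: negligible_iff_null_sets intro: AE_not_in)
    then have "AE x in lborel. x \<notin> N" by (simp add: AE_lebesgue_iff)
    then show "AE x in lborel. (\<lambda>n. f x - h n x) \<longlonglongrightarrow> 0"
    proof eventually_elim
      case (elim x)
      have "(\<lambda>n. f x - h n x) \<longlonglongrightarrow> f x - max (- B) (min B (f x)) * cut x"
        unfolding h_def by (intro tendsto_intros lim elim)
      moreover have "max (- B) (min B (f x)) * cut x = f x"
        using fB[of x] R(2)[of x] B0 by (cases "norm x > R") (auto simp: cut_def)
      ultimately show ?case by simp
    qed
  qed measurable
  from LIMSEQ_D[OF this e] obtain n where "norm (cls (\<lambda>x. f x - h n x)) < e" by auto
  then have "norm (cls f - cls (h n)) < e" using cls_diff[OF fs Cc_integrable(3)[OF hC]] by simp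
  then show ?thesis using that hC h0 by blast
qed

lemma sqint_truncate:
  fixes f :: "'a::euclidean_space \<Rightarrow> real"
  assumes fm[measurable]: "f \<in> borel_measurable borel" and fs: "f \<in> sqint"
  shows "(\<lambda>n. cls (\<lambda>x. max (- real n) (min (real n) (f x)) * indicator (cball 0 (real n)) x)) \<longlonglongrightarrow> cls f"
proof -
  define F where "F n x = max (- real n) (min (real n) (f x)) * indicator (cball 0 (real n)) x" for n and x :: 'a
  have Fm[measurable]: "F n \<in> borel_measurable borel" for n unfolding F_def by measurable
  have fi: "integrable lborel (\<lambda>x. \<bar>f x\<bar>\<^sup>2)"
    using fs by (auto simp: sqint_def integrable_completion)
  have Fb: "\<bar>F n x\<bar> \<le> \<bar>f x\<bar>" for n x unfolding F_def by (auto simp: indicator_def)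
  have Fs: "F n \<in> sqint" for n
  proof (rule sqint_borelI)
    show "integrable lborel (\<lambda>x. (F n x)\<^sup>2)"
    proof (rule Bochner_Integration.integrable_bound[OF fi])
      show "AE x in lborel. norm ((F n x)\<^sup>2) \<le> norm (\<bar>f x\<bar>\<^sup>2)"
      proof (rule AE_I2)
        fix x show "norm ((F n x)\<^sup>2) \<le> norm (\<bar>f x\<bar>\<^sup>2)" using power_mono[OF Fb[of n x], of 2] by simp
      qed
    qed measurable
  qed measurable
  have "(\<lambda>n. cls (\<lambda>x. F n x - f x)) \<longlonglongrightarrow> 0"
  proof (rule L2_dominated(2)[OF _ _ fi])
    show "\<bar>F n x - f x\<bar> \<le> \<bar>f x\<bar>" for n x unfolding F_def by (auto simp: indicator_def)
    show "AE x in lborel. (\<lambda>n. F n x - f x) \<longlonglongrightarrow> 0"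
    proof (rule AE_I2)
      fix x :: 'a
      obtain N :: nat where N: "max \<bar>f x\<bar> (norm x) \<le> real N" using real_arch_simple by blast
      have "F n x - f x = 0" if "n \<ge> N" for n
      proof -
        have "\<bar>f x\<bar> \<le> real n" "norm x \<le> real n" using N that by (auto intro: order_trans)
        then show ?thesis unfolding F_def by auto
      qed
      then show "(\<lambda>n. F n x - f x) \<longlonglongrightarrow> 0"
        by (intro tendsto_eventually) (auto simp: eventually_sequentially)
    qed
  qed measurable
  then have "(\<lambda>n. cls (F n) - cls f) \<longlonglongrightarrow> 0" using cls_diff[OF Fs fs] by simp
  then show ?thesis unfolding F_def by (simp add: LIM_zero_iff)
qed

lemma Cc_approx_aux:
  fixes f :: "'a::euclidean_space \<Rightarrow> real"
  assumes fm[measurable]: "f \<in> borel_measurable borel" and fs: "f \<in> sqint" and e: "e > 0"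
  obtains F B n where "F \<in> borel_measurable borel" "\<And>x. \<bar>F x\<bar> \<le> B" "norm (cls F - cls f) < e"
    "\<And>x. f x = 0 \<Longrightarrow> F x = 0" "\<And>x. norm x > real n \<Longrightarrow> F x = 0"
proof -
  define F where "F n x = max (- real n) (min (real n) (f x)) * indicator (cball 0 (real n)) x" for n and x :: 'a
  have "(\<lambda>n. cls (F n)) \<longlonglongrightarrow> cls f" unfolding F_def by (rule sqint_truncate[OF fm fs])
  from LIMSEQ_D[OF this e] obtain n where n: "norm (cls (F n) - cls f) < e" by auto
  show ?thesis
  proof (rule that[of "F n" "real n" n])
    show "F n \<in> borel_measurable borel" unfolding F_def by measurable
    show "\<bar>F n x\<bar> \<le> real n" for x unfolding F_def by (auto simp: indicator_def)
  qed (use n in \<open>auto simp: F_def\<close>)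
qed

lemma Cc_approx_supp:
  fixes f :: "'a::euclidean_space \<Rightarrow> real"
  assumes fm: "f \<in> borel_measurable borel" and fs: "f \<in> sqint" and e: "e > 0"
    and R: "R > 0" "\<And>x. norm x > R \<Longrightarrow> f x = 0"
  obtains h where "h \<in> Cc" "\<And>x. norm x > R + 1 \<Longrightarrow> h x = 0" "norm (cls f - cls h) < e"
proof -
  have e2: "e / 2 > 0" using e by simp
  obtain F B n where F: "F \<in> borel_measurable borel" "\<And>x. \<bar>F x\<bar> \<le> B" "norm (cls F - cls f) < e / 2"
    "\<And>x. f x = 0 \<Longrightarrow> F x = 0" using Cc_approx_aux[OF fm fs e2] by metis
  have F0: "F x = 0" if "norm x > R" for x using F(4) R(2) that by blast
  obtain h where h: "h \<in> Cc" "\<And>x. norm x > R + 1 \<Longrightarrow> h x = 0" "norm (cls F - cls h) < e / 2"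
    using Cc_approx_bounded[OF F(1,2) R(1) F0 e2] by blast
  have "norm (cls f - cls h) < e"
    using norm_triangle_ineq[of "cls f - cls F" "cls F - cls h"] F(3) h(3) by (simp add: norm_minus_commute)
  then show ?thesis using that h by blast
qed

lemma Cc_dense:
  fixes a :: "'a::euclidean_space l2"
  assumes e: "e > 0"
  obtains h where "h \<in> Cc" "norm (a - cls h) < e"
proof -
  have e2: "e / 2 > 0" using e by simp
  obtain F B n where F: "F \<in> borel_measurable borel" "\<And>x. \<bar>F x\<bar> \<le> B" "norm (cls F - cls (fn a)) < e / 2"
    "\<And>x. norm x > real n \<Longrightarrow> F x = 0" using Cc_approx_aux[OF fn_measurable fn_sqint e2] by metis
  have F0: "F x = 0" if "norm x > real n + 1" for x using F(4) that by simp
  obtain h where h: "h \<in> Cc" "norm (cls F - cls h) < e / 2"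
    using Cc_approx_bounded[OF F(1,2) _ F0 e2] by (metis add_nonneg_pos of_nat_0_le_iff zero_less_one)
  have "norm (a - cls h) < e"
    using norm_triangle_ineq[of "a - cls F" "cls F - cls h"] F(3) h(2) by (simp add: norm_minus_commute)
  then show ?thesis using that h by blast
qed

lemma Cc_diff:
  assumes "f \<in> Cc" "g \<in> Cc"
  shows "(\<lambda>x. f x - g x) \<in> Cc"
proof -
  obtain R1 R2 where "R1 > 0" "R2 > 0" "\<And>x. norm x > R1 \<Longrightarrow> f x = 0" "\<And>x. norm x > R2 \<Longrightarrow> g x = 0"
    and c: "continuous_on UNIV f" "continuous_on UNIV g"
    using assms by (auto simp: Cc_def)
  then show ?thesis unfolding Cc_def
    by (auto intro!: continuous_intros exI[of _ "max R1 R2"])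
qed

lemma Cc_add:
  assumes "f \<in> Cc" "g \<in> Cc"
  shows "(\<lambda>x. f x + g x) \<in> Cc"
proof -
  obtain R1 R2 where "R1 > 0" "R2 > 0" "\<And>x. norm x > R1 \<Longrightarrow> f x = 0" "\<And>x. norm x > R2 \<Longrightarrow> g x = 0"
    and c: "continuous_on UNIV f" "continuous_on UNIV g"
    using assms by (auto simp: Cc_def)
  then show ?thesis unfolding Cc_def
    by (auto intro!: continuous_intros exI[of _ "max R1 R2"])
qed

lemma Cc_cmult: "f \<in> Cc \<Longrightarrow> (\<lambda>x. c * f x) \<in> Cc"
  unfolding Cc_def by (auto intro!: continuous_intros)

section \<open>The Hartley transform as an isometric involution of L2\<close>

lemma hl_isometric_Cc:
  assumes "f \<in> Cc" "g \<in> Cc"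
  shows "norm (cls (hl f) - cls (hl g)) = norm (cls f - cls g)"
proof -
  have eq: "hl (\<lambda>x. f x - g x) = (\<lambda>\<xi>. hl f \<xi> - hl g \<xi>)"
    by (rule ext, rule hl_diff) (use assms Cc_integrable in auto)
  have "cls (hl f) - cls (hl g) = cls (hl (\<lambda>x. f x - g x))"
    unfolding eq by (rule cls_diff[symmetric]) (use assms hl_plancherel_Cc in auto)
  moreover have "cls f - cls g = cls (\<lambda>x. f x - g x)"
    by (rule cls_diff[symmetric]) (use assms Cc_integrable in auto)
  ultimately show ?thesis using hl_plancherel_Cc(2)[OF Cc_diff[OF assms]] by simp
qed

text \<open>Continuous extension from a dense subset is unique, so the choice involves no
  arbitrariness.\<close>

definition hart :: "'a::euclidean_space l2 \<Rightarrow> 'a l2" where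
  "hart = (SOME H. continuous_on UNIV H \<and> (\<forall>f\<in>Cc. H (cls f) = cls (hl f)))"

lemma hart_exists: "\<exists>H :: 'a::euclidean_space l2 \<Rightarrow> 'a l2. continuous_on UNIV H \<and> (\<forall>f\<in>Cc. H (cls f) = cls (hl f))"
proof -
  define X where "X = cls ` (Cc :: ('a \<Rightarrow> real) set)"
  \<comment> \<open>A representative in \<open>Cc\<close> of each class. By the isometry the class
    of its transform does not depend on which one is taken.\<close>
  define c where "c a = (SOME f. f \<in> Cc \<and> cls f = a)" for a :: "'a l2"
  have c: "c a \<in> Cc" "cls (c a) = a" if "a \<in> X" for a
    using someI_ex[of "\<lambda>f. f \<in> Cc \<and> cls f = a"] that unfolding X_def c_def by auto
  define h where "h a = cls (hl (c a))" for a
  have iso: "dist (h a) (h b) = dist a b" if "a \<in> X" "b \<in> X" for a b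
    unfolding h_def dist_norm using hl_isometric_Cc[OF c(1)[OF that(1)] c(1)[OF that(2)]] c(2) that by simp
  have "uniformly_continuous_on X h" unfolding uniformly_continuous_on_def using iso by auto
  then obtain H where H: "uniformly_continuous_on (closure X) H" "\<And>a. a \<in> X \<Longrightarrow> h a = H a"
    using uniformly_continuous_on_extension_on_closure by metis
  have "closure X = UNIV"
  proof (rule set_eqI, simp)
    fix a :: "'a l2"
    show "a \<in> closure X" unfolding closure_approachable
    proof (intro allI impI)
      fix e :: real assume "e > 0"
      then obtain f where "f \<in> Cc" "norm (a - cls f) < e" using Cc_dense by blast
      then show "\<exists>y\<in>X. dist y a < e" unfolding X_def by (auto simp: dist_norm norm_minus_commute)
    qed
  qed
  moreover have "H (cls f) = cls (hl f)" if f: "f \<in> Cc" for f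
  proof -
    have fX: "cls f \<in> X" using f by (simp add: X_def)
    have "norm (cls (hl (c (cls f))) - cls (hl f)) = 0"
      using hl_isometric_Cc[OF c(1)[OF fX] f] c(2)[OF fX] by simp
    then show ?thesis using H(2)[OF fX] by (simp add: h_def)
  qed
  ultimately show ?thesis using uniformly_continuous_imp_continuous[OF H(1)] by metis
qed

lemma hart_continuous: "continuous_on UNIV hart" and hart_Cc: "f \<in> Cc \<Longrightarrow> hart (cls f) = cls (hl f)"
  using someI_ex[OF hart_exists] unfolding hart_def by blast+

lemma hart_tendsto: "X \<longlonglongrightarrow> a \<Longrightarrow> (\<lambda>n. hart (X n)) \<longlonglongrightarrow> hart a"
  using hart_continuous by (auto intro: continuous_on_tendsto_compose)

lemma Cc_sequence:
  fixes a :: "'a::euclidean_space l2"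
  obtains h where "\<And>n. h n \<in> Cc" "(\<lambda>n. cls (h n)) \<longlonglongrightarrow> a"
proof -
  have "\<exists>h\<in>Cc. norm (a - cls h) < 1 / Suc n" for n using Cc_dense[of "1 / Suc n" a] by auto
  then obtain h where h: "\<And>n. h n \<in> Cc" "\<And>n. norm (a - cls (h n)) < 1 / Suc n" by metis
  have "(\<lambda>n. a - cls (h n)) \<longlonglongrightarrow> 0"
    by (rule Lim_null_comparison[OF _ LIMSEQ_inverse_real_of_nat])
      (use h(2) in \<open>auto simp: inverse_eq_divide intro!: always_eventually less_imp_le\<close>)
  then have "(\<lambda>n. a - (a - cls (h n))) \<longlonglongrightarrow> a - 0" by (intro tendsto_intros)
  then have "(\<lambda>n. cls (h n)) \<longlonglongrightarrow> a" by simp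
  then show ?thesis by (rule that[OF h(1)])
qed

lemma hart_add: "hart (a + b) = hart a + hart b"
proof -
  obtain f where f: "\<And>n. f n \<in> Cc" "(\<lambda>n. cls (f n)) \<longlonglongrightarrow> a" using Cc_sequence by blast
  obtain g where g: "\<And>n. g n \<in> Cc" "(\<lambda>n. cls (g n)) \<longlonglongrightarrow> b" using Cc_sequence by blast
  have eq: "hart (cls (f n) + cls (g n)) = hart (cls (f n)) + hart (cls (g n))" for n
  proof -
    have h: "hl (\<lambda>x. f n x + g n x) = (\<lambda>\<xi>. hl (f n) \<xi> + hl (g n) \<xi>)"
      by (rule ext, rule hl_add) (use f g Cc_integrable in auto)
    have "hart (cls (f n) + cls (g n)) = hart (cls (\<lambda>x. f n x + g n x))"
      by (simp add: cls_add[OF Cc_integrable(3)[OF f(1)] Cc_integrable(3)[OF g(1)]])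
    also have "\<dots> = cls (hl (\<lambda>x. f n x + g n x))" by (intro hart_Cc Cc_add f g)
    also have "\<dots> = cls (hl (f n)) + cls (hl (g n))"
      unfolding h by (rule cls_add) (use f g hl_plancherel_Cc in auto)
    finally show ?thesis using f g by (simp add: hart_Cc)
  qed
  have "(\<lambda>n. hart (cls (f n) + cls (g n))) \<longlonglongrightarrow> hart (a + b)" by (intro hart_tendsto tendsto_intros f g)
  moreover have "(\<lambda>n. hart (cls (f n) + cls (g n))) \<longlonglongrightarrow> hart a + hart b"
    unfolding eq by (intro hart_tendsto tendsto_intros f g)
  ultimately show ?thesis by (rule LIMSEQ_unique)
qed

lemma hart_scaleR: "hart (c *\<^sub>R a) = c *\<^sub>R hart a"
proof -
  obtain f where f: "\<And>n. f n \<in> Cc" "(\<lambda>n. cls (f n)) \<longlonglongrightarrow> a" using Cc_sequence by blast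
  have eq: "hart (c *\<^sub>R cls (f n)) = c *\<^sub>R hart (cls (f n))" for n
  proof -
    have h: "hl (\<lambda>x. c * f n x) = (\<lambda>\<xi>. c * hl (f n) \<xi>)" by (rule ext, rule hl_cmult)
    have "hart (c *\<^sub>R cls (f n)) = hart (cls (\<lambda>x. c * f n x))"
      by (simp add: cls_cmult[OF Cc_integrable(3)[OF f(1)]])
    also have "\<dots> = cls (hl (\<lambda>x. c * f n x))" by (intro hart_Cc Cc_cmult f)
    also have "\<dots> = c *\<^sub>R cls (hl (f n))"
      unfolding h by (rule cls_cmult) (use f hl_plancherel_Cc in auto)
    finally show ?thesis using f by (simp add: hart_Cc)
  qed
  have "(\<lambda>n. hart (c *\<^sub>R cls (f n))) \<longlonglongrightarrow> hart (c *\<^sub>R a)" by (intro hart_tendsto tendsto_intros f)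
  moreover have "(\<lambda>n. hart (c *\<^sub>R cls (f n))) \<longlonglongrightarrow> c *\<^sub>R hart a"
    unfolding eq by (intro hart_tendsto tendsto_intros f)
  ultimately show ?thesis by (rule LIMSEQ_unique)
qed

lemma hart_linear: "linear hart"
  by (rule linearI) (auto simp: hart_add hart_scaleR)

lemma hart_norm: "norm (hart a) = norm a"
proof -
  obtain f where f: "\<And>n. f n \<in> Cc" "(\<lambda>n. cls (f n)) \<longlonglongrightarrow> a" using Cc_sequence by blast
  have eq: "norm (hart (cls (f n))) = norm (cls (f n))" for n
    using f(1)[of n] by (simp add: hart_Cc hl_plancherel_Cc)
  have "(\<lambda>n. norm (hart (cls (f n)))) \<longlonglongrightarrow> norm (hart a)" by (intro hart_tendsto tendsto_intros f)
  moreover have "(\<lambda>n. norm (hart (cls (f n)))) \<longlonglongrightarrow> norm a"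
    unfolding eq by (intro tendsto_intros f)
  ultimately show ?thesis by (rule LIMSEQ_unique)
qed

text \<open>Fubini with the symmetric kernel \<open>cas (\<xi> \<bullet> x)\<close> on
  \<open>Cc\<close>, then density.\<close>

lemma hart_symmetric: "inner (hart a) b = inner a (hart b)"
proof -
  obtain f where f: "\<And>n. f n \<in> Cc" "(\<lambda>n. cls (f n)) \<longlonglongrightarrow> a" using Cc_sequence by blast
  obtain g where g: "\<And>n. g n \<in> Cc" "(\<lambda>n. cls (g n)) \<longlonglongrightarrow> b" using Cc_sequence by blast
  have eq: "inner (hart (cls (f n))) (cls (g n)) = inner (cls (f n)) (hart (cls (g n)))" for n
  proof -
    note [measurable] = Cc_measurable[OF f(1)[of n]] Cc_measurable[OF g(1)[of n]]
      hl_measurable[OF Cc_measurable[OF f(1)[of n]]] hl_measurable[OF Cc_measurable[OF g(1)[of n]]]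
    define nf where "nf = (2 * pi) powr (- real DIM('a) / 2)"
    have I: "integrable (lborel \<Otimes>\<^sub>M lborel) (\<lambda>(\<xi>, x). cas (\<xi> \<bullet> x) * f n x * g n \<xi>)"
    proof (rule Bochner_Integration.integrable_bound)
      show "integrable (lborel \<Otimes>\<^sub>M lborel) (\<lambda>z. 2 * (case z of (\<xi>, x) \<Rightarrow> g n \<xi> * f n x))"
        using integrable_mult_right[OF integrable_tensor(1)[OF Cc_integrable(1)[OF g(1)[of n]] Cc_integrable(1)[OF f(1)[of n]]], of 2]
        by (simp add: lborel_prod)
      show "AE z in lborel \<Otimes>\<^sub>M lborel. norm (case z of (\<xi>, x) \<Rightarrow> cas (\<xi> \<bullet> x) * f n x * g n \<xi>) \<le> norm (2 * (case z of (\<xi>, x) \<Rightarrow> g n \<xi> * f n x))"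
      proof (rule AE_I2)
        fix z :: "'a \<times> 'a"
        obtain \<xi> x where z: "z = (\<xi>, x)" by (cases z)
        have "\<bar>cas (\<xi> \<bullet> x)\<bar> * \<bar>g n \<xi> * f n x\<bar> \<le> 2 * \<bar>g n \<xi> * f n x\<bar>" by (intro mult_right_mono cas_bound) simp
        then show "norm (case z of (\<xi>, x) \<Rightarrow> cas (\<xi> \<bullet> x) * f n x * g n \<xi>) \<le> norm (2 * (case z of (\<xi>, x) \<Rightarrow> g n \<xi> * f n x))"
          by (simp add: z abs_mult mult_ac)
      qed
    qed measurable
    have "inner (hart (cls (f n))) (cls (g n)) = (LINT \<xi>|lebesgue. hl (f n) \<xi> * g n \<xi>)"
      using f g by (simp add: hart_Cc inner_cls hl_plancherel_Cc Cc_integrable)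
    also have "\<dots> = (LINT \<xi>|lborel. hl (f n) \<xi> * g n \<xi>)" by (rule integral_completion) measurable
    also have "\<dots> = nf * (LINT \<xi>|lborel. LINT x|lborel. cas (\<xi> \<bullet> x) * f n x * g n \<xi>)"
    proof -
      have "hl (f n) \<xi> * g n \<xi> = nf * (LINT x|lborel. cas (\<xi> \<bullet> x) * f n x * g n \<xi>)" for \<xi>
        unfolding hl_def nf_def integral_mult_left_zero by (rule mult.assoc)
      note * = this
      show ?thesis unfolding * by (rule integral_mult_right_zero)
    qed
    also have "(LINT \<xi>|lborel. LINT x|lborel. cas (\<xi> \<bullet> x) * f n x * g n \<xi>) = (LINT x|lborel. LINT \<xi>|lborel. cas (\<xi> \<bullet> x) * f n x * g n \<xi>)"
      by (rule lborel_pair.Fubini_integral[OF I, symmetric])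
    also have "nf * \<dots> = (LINT x|lborel. f n x * hl (g n) x)"
      unfolding hl_def nf_def[symmetric] integral_mult_right_zero[symmetric]
      by (simp add: inner_commute mult_ac)
    also have "\<dots> = (LINT x|lebesgue. f n x * hl (g n) x)" by (rule integral_completion[symmetric]) measurable
    also have "\<dots> = inner (cls (f n)) (hart (cls (g n)))"
      using f g by (simp add: hart_Cc inner_cls hl_plancherel_Cc Cc_integrable)
    finally show ?thesis .
  qed
  have "(\<lambda>n. inner (hart (cls (f n))) (cls (g n))) \<longlonglongrightarrow> inner (hart a) b" by (intro hart_tendsto tendsto_intros f g)
  moreover have "(\<lambda>n. inner (hart (cls (f n))) (cls (g n))) \<longlonglongrightarrow> inner a (hart b)"
    unfolding eq by (intro hart_tendsto tendsto_intros f g)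
  ultimately show ?thesis by (rule LIMSEQ_unique)
qed

text \<open>A symmetric isometry is an involution: \<open>norm (H (H a) - a)\<^sup>2\<close> expands to zero.\<close>

lemma hart_hart[simp]: "hart (hart a) = a"
proof -
  have "(norm (hart (hart a) - a))\<^sup>2 = (norm (hart (hart a)))\<^sup>2 - 2 * inner (hart (hart a)) a + (norm a)\<^sup>2"
    by (simp add: power2_norm_eq_inner inner_diff_left inner_diff_right inner_commute)
  also have "\<dots> = (norm a)\<^sup>2 - 2 * inner (hart a) (hart a) + (norm a)\<^sup>2"
    unfolding hart_norm hart_symmetric[of "hart a" a] ..
  also have "\<dots> = 0" by (simp add: power2_norm_eq_inner[symmetric] hart_norm)
  finally show ?thesis by simp
qed

lemma hart_inner[simp]: "inner (hart a) (hart b) = inner a b"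
  by (simp add: hart_symmetric)

lemma compact_support_integrable_sqint:
  fixes f :: "'a::euclidean_space \<Rightarrow> real"
  assumes fm[measurable]: "f \<in> borel_measurable borel" and fs: "f \<in> sqint" and R: "\<And>x. norm x > R \<Longrightarrow> f x = 0"
  shows "integrable lborel f" and "(LINT x|lborel. \<bar>f x\<bar>) \<le> norm (cls f) * norm (cls (indicator (cball (0::'a) R)))"
proof -
  have ids: "(indicator (cball 0 R) :: 'a \<Rightarrow> real) \<in> sqint"
    by (rule sqint_borelI) (use indicator_square_integrable[of 1 R] in auto)
  have as: "(\<lambda>x. \<bar>f x\<bar>) \<in> sqint" using fs by (auto simp: sqint_def)
  have eq: "\<bar>f x\<bar> * indicator (cball 0 R) x = \<bar>f x\<bar>" for x using R[of x] by (cases "norm x > R") (auto simp: indicator_def)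
  have "integrable lebesgue (\<lambda>x. \<bar>f x\<bar>)" using sqint_mult_integrable[OF as ids] by (simp only: eq)
  then have "integrable lborel (\<lambda>x. \<bar>f x\<bar>)" by (simp add: integrable_completion)
  then show "integrable lborel f" by (simp add: integrable_abs_iff)
  have "(LINT x|lborel. \<bar>f x\<bar>) = (LINT x|lebesgue. \<bar>f x\<bar> * indicator (cball 0 R) x)"
    unfolding eq by (rule integral_completion[symmetric]) measurable
  also have "\<dots> = inner (cls (\<lambda>x. \<bar>f x\<bar>)) (cls (indicator (cball 0 R)))" by (rule inner_cls[OF as ids, symmetric])
  also have "\<dots> \<le> norm (cls (\<lambda>x. \<bar>f x\<bar>)) * norm (cls (indicator (cball (0::'a) R)))" by (rule norm_cauchy_schwarz)
  also have "norm (cls (\<lambda>x. \<bar>f x\<bar>)) = norm (cls f)"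
  proof -
    have "(norm (cls (\<lambda>x. \<bar>f x\<bar>)))\<^sup>2 = (norm (cls f))\<^sup>2" unfolding norm_cls_sq[OF as] norm_cls_sq[OF fs] by simp
    then show ?thesis by simp
  qed
  finally show "(LINT x|lborel. \<bar>f x\<bar>) \<le> norm (cls f) * norm (cls (indicator (cball (0::'a) R)))" .
qed

text \<open>The integral formula persists without continuity. Approximants supported in one fixed
  ball converge in L1 as well, so their transforms converge uniformly to \<open>hl f\<close> while
  they converge in L2 to the extended transform.\<close>

lemma hart_cls:
  fixes f :: "'a::euclidean_space \<Rightarrow> real"
  assumes fm[measurable]: "f \<in> borel_measurable borel" and fs: "f \<in> sqint" and R: "R > 0" "\<And>x. norm x > R \<Longrightarrow> f x = 0"
  shows "hl f \<in> sqint" and "hart (cls f) = cls (hl f)"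
proof -
  have "\<exists>h\<in>Cc. (\<forall>x. norm x > R + 1 \<longrightarrow> h x = 0) \<and> norm (cls f - cls h) < 1 / Suc n" for n
    using Cc_approx_supp[OF fm fs _ R, of "1 / Suc n"] by (metis of_nat_0_less_iff zero_less_Suc zero_less_divide_1_iff)
  then obtain h where h: "\<And>n. h n \<in> Cc" "\<And>n x. norm x > R + 1 \<Longrightarrow> h n x = 0" "\<And>n. norm (cls f - cls (h n)) < 1 / Suc n"
    by metis
  have l0: "(\<lambda>n. cls f - cls (h n)) \<longlonglongrightarrow> 0"
    by (rule Lim_null_comparison[OF _ LIMSEQ_inverse_real_of_nat])
      (use h(3) in \<open>auto simp: inverse_eq_divide intro!: always_eventually less_imp_le\<close>)
  have "(\<lambda>n. cls f - (cls f - cls (h n))) \<longlonglongrightarrow> cls f - 0" by (intro tendsto_intros l0)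
  then have l: "(\<lambda>n. cls (h n)) \<longlonglongrightarrow> cls f" by simp
  have lim: "(\<lambda>n. cls (hl (h n))) \<longlonglongrightarrow> hart (cls f)"
    using hart_tendsto[OF l] h(1) by (simp add: hart_Cc)
  define K where "K = (2 * pi) powr (- real DIM('a) / 2) * 2 * norm (cls (indicator (cball (0::'a) (R + 1))))"
  have fi: "integrable lborel f" by (rule compact_support_integrable_sqint(1)[OF fm fs R(2)])
  have est: "\<bar>hl f \<xi> - hl (h n) \<xi>\<bar> \<le> K * norm (cls f - cls (h n))" for n \<xi>
  proof -
    note [measurable] = Cc_measurable[OF h(1)[of n]]
    have ds: "(\<lambda>x. f x - h n x) \<in> sqint" by (intro sqint_diff fs Cc_integrable h)
    have d0: "f x - h n x = 0" if "norm x > R + 1" for x using h(2) R(2) that by simp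
    have "\<bar>hl f \<xi> - hl (h n) \<xi>\<bar> = \<bar>hl (\<lambda>x. f x - h n x) \<xi>\<bar>"
      using hl_diff[OF fi Cc_integrable(1)[OF h(1)]] by simp
    also have "\<dots> \<le> (2 * pi) powr (- real DIM('a) / 2) * 2 * (LINT x|lborel. \<bar>f x - h n x\<bar>)"
      by (intro hl_bound Bochner_Integration.integrable_diff fi Cc_integrable h)
    also have "\<dots> \<le> (2 * pi) powr (- real DIM('a) / 2) * 2 * (norm (cls (\<lambda>x. f x - h n x)) * norm (cls (indicator (cball (0::'a) (R + 1)))))"
      by (intro mult_left_mono compact_support_integrable_sqint(2) ds d0) auto
    also have "\<dots> = K * norm (cls f - cls (h n))"
      unfolding K_def using cls_diff[OF fs Cc_integrable(3)[OF h(1)]] by simp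
    finally show ?thesis .
  qed
  have ptw: "(\<lambda>n. hl (h n) \<xi>) \<longlonglongrightarrow> hl f \<xi>" for \<xi>
  proof -
    have "(\<lambda>n. hl f \<xi> - hl (h n) \<xi>) \<longlonglongrightarrow> 0"
    proof (rule Lim_null_comparison)
      show "\<forall>\<^sub>F n in sequentially. norm (hl f \<xi> - hl (h n) \<xi>) \<le> K * norm (cls f - cls (h n))" using est by simp
      have "(\<lambda>n. K * norm (cls f - cls (h n))) \<longlonglongrightarrow> K * norm (0 :: 'a l2)" by (intro tendsto_intros l0)
      then show "(\<lambda>n. K * norm (cls f - cls (h n))) \<longlonglongrightarrow> 0" by simp
    qed
    then have "(\<lambda>n. hl f \<xi> - (hl f \<xi> - hl (h n) \<xi>)) \<longlonglongrightarrow> hl f \<xi> - 0" by (intro tendsto_intros)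
    then show ?thesis by simp
  qed
  have m: "hl f \<in> borel_measurable lebesgue" by (intro borel_measurable_lborel_lebesgue hl_measurable fm)
  note L = L2_pointwise_limit[OF hl_plancherel_Cc(1)[OF h(1)] m lim]
  show "hl f \<in> sqint" by (rule L(1)) (simp add: ptw)
  show "hart (cls f) = cls (hl f)" by (rule L(2)[symmetric]) (simp add: ptw)
qed

section \<open>The Fourier transform in terms of the Hartley transform\<close>

lemma lborel_distr_uminus_euclidean: "distr lborel borel uminus = (lborel :: 'a::euclidean_space measure)"
proof -
  have "lborel = density (distr lborel borel (\<lambda>x::'a. - x)) (\<lambda>_. 1)"
    using lborel_affine[of "- 1" "0::'a"] by simp
  then show ?thesis by (simp add: density_1)
qed

lemma nn_integral_uminus:
  fixes f :: "'a::euclidean_space \<Rightarrow> ennreal"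
  assumes [measurable]: "f \<in> borel_measurable borel"
  shows "(\<integral>\<^sup>+x. f (- x) \<partial>lborel) = (\<integral>\<^sup>+x. f x \<partial>lborel)"
proof -
  have "(\<integral>\<^sup>+x. f x \<partial>lborel) = (\<integral>\<^sup>+x. f x \<partial>(distr lborel borel uminus))"
    by (simp add: lborel_distr_uminus_euclidean)
  also have "\<dots> = (\<integral>\<^sup>+x. f (- x) \<partial>lborel)" by (rule nn_integral_distr) auto
  finally show ?thesis by simp
qed

lemma AE_lborel_uminus:
  fixes P :: "'a::euclidean_space \<Rightarrow> bool"
  assumes "AE x in lborel. P x"
  shows "AE x in lborel. P (- x)"
proof -
  from AE_E[OF assms] obtain N where N: "{x \<in> space lborel. \<not> P x} \<subseteq> N" "emeasure lborel N = 0" "N \<in> sets lborel"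
    by metis
  have "emeasure lborel (uminus -` N) = emeasure (distr lborel borel uminus) N"
    using N(3) by (subst emeasure_distr) auto
  also have "\<dots> = 0" using N(2) by (simp add: lborel_distr_uminus_euclidean)
  finally have "uminus -` N \<in> null_sets lborel"
    using N(3) by (auto simp: null_sets_def intro!: measurable_sets_borel[of uminus borel])
  then show ?thesis by (rule AE_I'[where N="uminus -` N"]) (use N(1) in auto)
qed

definition hf :: "('a::euclidean_space \<Rightarrow> real) \<Rightarrow> 'a \<Rightarrow> real" where
  "hf u = fn (hart (cls u))"

text \<open>Recovers the Fourier transform of a real function from its Hartley transform: the even
  part is the cosine transform, the odd part the sine transform, which enters with a minus
  sign.\<close>

definition cpx :: "('a::euclidean_space \<Rightarrow> real) \<Rightarrow> 'a \<Rightarrow> complex" where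
  "cpx V \<xi> = Complex ((V \<xi> + V (- \<xi>)) / 2) (- ((V \<xi> - V (- \<xi>)) / 2))"

lemma hf_measurable[measurable]: "hf u \<in> borel_measurable borel"
  unfolding hf_def by measurable

lemma hf_sqint[simp]: "hf u \<in> sqint"
  unfolding hf_def by simp

lemma cls_hf: "cls (hf u) = hart (cls u)"
  unfolding hf_def by simp

lemma cpx_measurable:
  fixes V :: "'a::euclidean_space \<Rightarrow> real"
  assumes [measurable]: "V \<in> borel_measurable borel"
  shows "cpx V \<in> borel_measurable borel"
  unfolding cpx_def complex_eq_iff[abs_def] Complex_eq by measurable

lemma cpx_norm: "(norm (cpx V \<xi>))\<^sup>2 = ((V \<xi>)\<^sup>2 + (V (- \<xi>))\<^sup>2) / 2"
  unfolding cpx_def cmod_power2 by (simp add: power2_eq_square field_simps)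

lemma cpx_diff: "cpx V \<xi> - cpx W \<xi> = cpx (\<lambda>\<xi>. V \<xi> - W \<xi>) \<xi>"
  unfolding cpx_def by (simp add: complex_eq_iff field_simps)

lemma cpx_recover: "Re (cpx V \<xi>) - Im (cpx V \<xi>) = V \<xi>"
  unfolding cpx_def by (simp add: field_simps)

text \<open>The squared modulus is the mean of the squares at \<xi> and \<open>- \<xi>\<close>; a
  reflection recombines them, which is why the weight has to be even.\<close>

lemma nn_integral_cpx:
  fixes V m :: "'a::euclidean_space \<Rightarrow> real"
  assumes [measurable]: "V \<in> borel_measurable borel" "m \<in> borel_measurable borel"
    and m: "\<And>\<xi>. m \<xi> \<ge> 0" "\<And>\<xi>. m (- \<xi>) = m \<xi>"
  shows "(\<integral>\<^sup>+\<xi>. ennreal (m \<xi> * (norm (cpx V \<xi>))\<^sup>2) \<partial>lborel) = (\<integral>\<^sup>+\<xi>. ennreal (m \<xi> * (V \<xi>)\<^sup>2) \<partial>lborel)"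
proof -
  have "(\<integral>\<^sup>+\<xi>. ennreal (m \<xi> * (norm (cpx V \<xi>))\<^sup>2) \<partial>lborel) =
        (\<integral>\<^sup>+\<xi>. ennreal (1/2) * ennreal (m \<xi> * (V \<xi>)\<^sup>2) + ennreal (1/2) * ennreal (m (- \<xi>) * (V (- \<xi>))\<^sup>2) \<partial>lborel)"
  proof (rule nn_integral_cong)
    fix \<xi>
    have "m \<xi> * (norm (cpx V \<xi>))\<^sup>2 = 1/2 * (m \<xi> * (V \<xi>)\<^sup>2) + 1/2 * (m (- \<xi>) * (V (- \<xi>))\<^sup>2)"
      unfolding cpx_norm m(2) by (simp add: field_simps)
    moreover have "ennreal (1/2 * A + 1/2 * B) = ennreal (1/2) * ennreal A + ennreal (1/2) * ennreal B" if "A \<ge> 0" "B \<ge> 0" for A B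
    proof -
      have "ennreal (1/2 * A + 1/2 * B) = ennreal (1/2 * A) + ennreal (1/2 * B)"
        using that by (intro ennreal_plus) auto
      then show ?thesis using ennreal_mult'[of "1/2" A] ennreal_mult'[of "1/2" B] by simp
    qed
    ultimately show "ennreal (m \<xi> * (norm (cpx V \<xi>))\<^sup>2) = ennreal (1/2) * ennreal (m \<xi> * (V \<xi>)\<^sup>2) + ennreal (1/2) * ennreal (m (- \<xi>) * (V (- \<xi>))\<^sup>2)"
      using m(1) by simp
  qed
  also have "\<dots> = ennreal (1/2) * (\<integral>\<^sup>+\<xi>. ennreal (m \<xi> * (V \<xi>)\<^sup>2) \<partial>lborel) + ennreal (1/2) * (\<integral>\<^sup>+\<xi>. ennreal (m (- \<xi>) * (V (- \<xi>))\<^sup>2) \<partial>lborel)"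
    by (subst nn_integral_add) (auto simp: nn_integral_cmult)
  also have "(\<integral>\<^sup>+\<xi>. ennreal (m (- \<xi>) * (V (- \<xi>))\<^sup>2) \<partial>lborel) = (\<integral>\<^sup>+\<xi>. ennreal (m \<xi> * (V \<xi>)\<^sup>2) \<partial>lborel)"
    by (rule nn_integral_uminus[where f="\<lambda>\<xi>. ennreal (m \<xi> * (V \<xi>)\<^sup>2)"]) measurable
  also have "ennreal (1/2) * I + ennreal (1/2) * I = I" for I
  proof -
    have "ennreal (1/2) * I + ennreal (1/2) * I = (ennreal (1/2) + ennreal (1/2)) * I" by (simp add: distrib_right)
    also have "ennreal (1/2) + ennreal (1/2) = 1" by (subst ennreal_plus[symmetric]) auto
    finally show ?thesis by simp
  qed
  finally show ?thesis .
qed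

lemma L2_sqint: "L2 = sqint"
  unfolding L2_def sqint_def by simp

lemma hl_uminus: "hl f (- \<xi>) = (2 * pi) powr (- real DIM('a) / 2) * (LINT x|lborel. (cos (\<xi> \<bullet> x) - sin (\<xi> \<bullet> x)) * f (x::'a::euclidean_space))"
  unfolding hl_def cas_def by simp

lemma fourier_L1_hl:
  fixes f g :: "real ^ 'n \<Rightarrow> real"
  assumes g: "integrable lborel g" and eq: "AE x in lborel. f x = g x" and f: "f \<in> borel_measurable lebesgue"
  shows "fourier_L1 f \<xi> = cpx (hl g) \<xi>"
proof -
  have [measurable]: "g \<in> borel_measurable borel" using g by auto
  define nf where "nf = (2 * pi) powr (- real DIM(real ^ 'n) / 2)"
  have c: "integrable lborel (\<lambda>x. cos (\<xi> \<bullet> x) * g x)" "integrable lborel (\<lambda>x. sin (\<xi> \<bullet> x) * g x)"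
    by (rule Bochner_Integration.integrable_bound[OF g]; simp add: abs_mult mult_left_le_one_le)+
  have m: "(\<lambda>x. cis (- (\<xi> \<bullet> x))) \<in> borel_measurable borel"
    by (intro borel_measurable_continuous_onI continuous_intros)
  have i: "integrable lborel (\<lambda>x. cis (- (\<xi> \<bullet> x)) * complex_of_real (g x))"
    by (rule Bochner_Integration.integrable_bound[OF g]) (use m in \<open>auto simp: norm_mult\<close>)
  have "(LINT x|lebesgue. cis (- (\<xi> \<bullet> x)) * complex_of_real (f x)) = (LINT x|lebesgue. cis (- (\<xi> \<bullet> x)) * complex_of_real (g x))"
  proof (rule integral_cong_AE)
    show "(\<lambda>x. cis (- (\<xi> \<bullet> x)) * complex_of_real (f x)) \<in> borel_measurable lebesgue"
    proof -
      have "(\<lambda>x. cis (- (\<xi> \<bullet> x))) \<in> borel_measurable lebesgue" using m by (simp add: measurable_completion)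
      then show ?thesis using f by measurable
    qed
    show "(\<lambda>x. cis (- (\<xi> \<bullet> x)) * complex_of_real (g x)) \<in> borel_measurable lebesgue"
      using m by (intro measurable_completion) auto
    show "AE x in lebesgue. cis (- (\<xi> \<bullet> x)) * complex_of_real (f x) = cis (- (\<xi> \<bullet> x)) * complex_of_real (g x)"
      unfolding AE_lebesgue_iff using eq by eventually_elim simp
  qed
  also have "\<dots> = (LINT x|lborel. cis (- (\<xi> \<bullet> x)) * complex_of_real (g x))"
    using i by (intro integral_completion) auto
  finally have F: "fourier_L1 f \<xi> = of_real nf * (LINT x|lborel. cis (- (\<xi> \<bullet> x)) * complex_of_real (g x))"
    unfolding fourier_L1_def nf_def by simp
  have Re: "Re (LINT x|lborel. cis (- (\<xi> \<bullet> x)) * complex_of_real (g x)) = (LINT x|lborel. cos (\<xi> \<bullet> x) * g x)"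
    using integral_Re[OF i] by simp
  have Im: "Im (LINT x|lborel. cis (- (\<xi> \<bullet> x)) * complex_of_real (g x)) = - (LINT x|lborel. sin (\<xi> \<bullet> x) * g x)"
    using integral_Im[OF i] by simp
  have h1: "hl g \<xi> = nf * ((LINT x|lborel. cos (\<xi> \<bullet> x) * g x) + (LINT x|lborel. sin (\<xi> \<bullet> x) * g x))"
    unfolding hl_def cas_def nf_def using c by (simp add: distrib_right)
  have h2: "hl g (- \<xi>) = nf * ((LINT x|lborel. cos (\<xi> \<bullet> x) * g x) - (LINT x|lborel. sin (\<xi> \<bullet> x) * g x))"
    unfolding hl_uminus nf_def using c by (simp add: left_diff_distrib)
  show ?thesis unfolding F cpx_def by (rule complex_eqI) (simp_all add: Re Im h1 h2, simp_all add: algebra_simps)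
qed

lemma truncation_tendsto:
  fixes f :: "'a::euclidean_space \<Rightarrow> real"
  assumes fm[measurable]: "f \<in> borel_measurable borel" and fi: "integrable lborel (\<lambda>x. (f x)\<^sup>2)"
  shows "((\<lambda>R. norm (cls f - cls (\<lambda>x. indicator (cball 0 R) x * f x))) \<longlongrightarrow> 0) at_top"
proof -
  have fs: "f \<in> sqint" by (rule sqint_borelI[OF fm fi])
  define F where "F R x = f x - indicator (cball 0 R) x * f x" for R and x :: 'a
  have ts: "(\<lambda>x. indicator (cball 0 R) x * f x) \<in> sqint" for R
    by (rule sqint_bounded_mult[OF fs, where C=1]) (auto simp: indicator_def intro!: borel_measurable_lborel_lebesgue)
  have Fs: "F R \<in> sqint" for R unfolding F_def by (intro sqint_diff fs ts)
  have [measurable]: "F R \<in> borel_measurable borel" for R unfolding F_def by measurable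
  have "((\<lambda>R. LINT x|lborel. (F R x)\<^sup>2) \<longlongrightarrow> (LINT x|(lborel :: 'a measure). (0::real))) at_top"
  proof (rule integral_dominated_convergence_at_top[where w="\<lambda>x. (f x)\<^sup>2"])
    show "\<forall>\<^sub>F R in at_top. AE x in lborel. norm ((F R x)\<^sup>2) \<le> (f x)\<^sup>2"
      by (intro always_eventually allI AE_I2) (auto simp: F_def indicator_def)
    show "AE x in lborel. ((\<lambda>R. (F R x)\<^sup>2) \<longlongrightarrow> 0) at_top"
    proof (rule AE_I2)
      fix x :: 'a
      have "\<forall>\<^sub>F R in at_top. (F R x)\<^sup>2 = 0"
        using eventually_ge_at_top[of "norm x"] by eventually_elim (auto simp: F_def)
      then show "((\<lambda>R. (F R x)\<^sup>2) \<longlongrightarrow> 0) at_top" by (rule tendsto_eventually)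
    qed
  qed (use fi in measurable)
  moreover have "(norm (cls f - cls (\<lambda>x. indicator (cball 0 R) x * f x)))\<^sup>2 = (LINT x|lborel. (F R x)\<^sup>2)" for R
  proof -
    have "cls f - cls (\<lambda>x. indicator (cball 0 R) x * f x) = cls (F R)"
      unfolding F_def by (rule cls_diff[OF fs ts, symmetric])
    then show ?thesis by (simp add: norm_cls_sq[OF Fs]) (rule integral_completion, measurable)
  qed
  ultimately have "((\<lambda>R. (norm (cls f - cls (\<lambda>x. indicator (cball 0 R) x * f x)))\<^sup>2) \<longlongrightarrow> 0) at_top" by simp
  from tendsto_real_sqrt[OF this] show ?thesis by simp
qed

text \<open>Truncated functions are integrable, so their transforms are honest integrals and equal
  \<open>cpx\<close> of Hartley transforms. The isometry then reduces convergence of the transforms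
  to convergence of the truncations.\<close>

lemma fourier_truncated:
  fixes u :: "real ^ 'n \<Rightarrow> real"
  assumes u: "u \<in> L2"
  shows "\<exists>G. (\<forall>R. G R \<in> borel_measurable borel) \<and>
    (\<forall>R \<xi>. fourier_L1 (\<lambda>x. indicator (cball 0 R) x * u x) \<xi> = G R \<xi>) \<and>
    ((\<lambda>R. \<integral>\<^sup>+\<xi>. ennreal ((norm (cpx (hf u) \<xi> - G R \<xi>))\<^sup>2) \<partial>lborel) \<longlongrightarrow> 0) at_top"
proof -
  have us: "u \<in> sqint" using u by (simp add: L2_sqint)
  define f where "f = fn (cls u)"
  have [measurable]: "f \<in> borel_measurable borel" unfolding f_def by measurable
  have fu: "AE x in lborel. f x = u x" unfolding f_def by (rule fn_cls[OF us])
  have fi: "integrable lborel (\<lambda>x. (f x)\<^sup>2)" unfolding f_def by (rule fn_square_integrable)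
  have fs: "f \<in> sqint" unfolding f_def by simp
  define t where "t R x = indicator (cball 0 R) x * f x" for R and x :: "real ^ 'n"
  have tm[measurable]: "t R \<in> borel_measurable borel" for R unfolding t_def by measurable
  have ts: "t R \<in> sqint" for R unfolding t_def
    by (rule sqint_bounded_mult[OF fs, where C=1]) (auto simp: indicator_def intro!: borel_measurable_lborel_lebesgue)
  have t0: "t R x = 0" if "norm x > \<bar>R\<bar> + 1" for R x using that by (auto simp: t_def indicator_def)
  have ti: "integrable lborel (t R)" for R by (rule compact_support_integrable_sqint(1)[OF tm ts t0])
  have ht: "hl (t R) \<in> sqint" "hart (cls (t R)) = cls (hl (t R))" for R
    using hart_cls[where R="\<bar>R\<bar> + 1", OF tm[of R] ts[of R] _ t0[of R]] by auto
  have [measurable]: "hl (t R) \<in> borel_measurable borel" for R by (rule hl_measurable) measurable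
  show ?thesis
  proof (intro exI[of _ "\<lambda>R. cpx (hl (t R))"] conjI allI)
    show "cpx (hl (t R)) \<in> borel_measurable borel" for R by (rule cpx_measurable) measurable
    show "fourier_L1 (\<lambda>x. indicator (cball 0 R) x * u x) \<xi> = cpx (hl (t R)) \<xi>" for R \<xi>
    proof (rule fourier_L1_hl[OF ti])
      show "AE x in lborel. indicator (cball 0 R) x * u x = t R x" using fu by eventually_elim (simp add: t_def)
      show "(\<lambda>x. indicator (cball 0 R) x * u x) \<in> borel_measurable lebesgue"
        using us by (intro borel_measurable_times) (auto simp: sqint_def intro!: borel_measurable_lborel_lebesgue)
    qed
    have eq: "(\<integral>\<^sup>+\<xi>. ennreal ((norm (cpx (hf u) \<xi> - cpx (hl (t R)) \<xi>))\<^sup>2) \<partial>lborel) = ennreal ((norm (cls f - cls (t R)))\<^sup>2)" for R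
    proof -
      define W where "W \<xi> = hf u \<xi> - hl (t R) \<xi>" for \<xi>
      have [measurable]: "W \<in> borel_measurable borel" unfolding W_def by measurable
      have Ws: "W \<in> sqint" unfolding W_def by (intro sqint_diff hf_sqint ht)
      have Wi: "integrable lborel (\<lambda>x. (W x)\<^sup>2)" using Ws by (auto simp: sqint_def integrable_completion)
      have "(\<integral>\<^sup>+\<xi>. ennreal ((norm (cpx (hf u) \<xi> - cpx (hl (t R)) \<xi>))\<^sup>2) \<partial>lborel) = (\<integral>\<^sup>+\<xi>. ennreal ((W \<xi>)\<^sup>2) \<partial>lborel)"
        unfolding cpx_diff W_def[symmetric] using nn_integral_cpx[of W "\<lambda>_. 1"] by simp
      also have "\<dots> = ennreal (LINT x|lborel. (W x)\<^sup>2)" by (rule nn_integral_eq_integral[OF Wi]) simp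
      also have "(LINT x|lborel. (W x)\<^sup>2) = (norm (cls W))\<^sup>2"
        unfolding norm_cls_sq[OF Ws] by (rule integral_completion[symmetric]) measurable
      also have "cls W = hart (cls f) - hart (cls (t R))"
        unfolding W_def cls_diff[OF hf_sqint ht(1)] ht(2) cls_hf by (simp add: f_def)
      also have "\<dots> = hart (cls f - cls (t R))" by (simp add: linear_diff[OF hart_linear])
      finally show ?thesis by (simp add: hart_norm)
    qed
    have "((\<lambda>R. ennreal ((norm (cls f - cls (t R)))\<^sup>2)) \<longlongrightarrow> ennreal (0\<^sup>2)) at_top"
      unfolding t_def by (intro tendsto_ennrealI tendsto_power truncation_tendsto fi) measurable
    then show "((\<lambda>R. \<integral>\<^sup>+\<xi>. ennreal ((norm (cpx (hf u) \<xi> - cpx (hl (t R)) \<xi>))\<^sup>2) \<partial>lborel) \<longlongrightarrow> 0) at_top"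
      unfolding eq by simp
  qed
qed

text \<open>\<open>fourier\<close> is a choice: \<open>cpx (hf u)\<close> shows that a candidate
  exists, and uniqueness of L2 limits shows that any chosen candidate agrees with it almost
  everywhere.\<close>

lemma fourier_hf:
  fixes u :: "real ^ 'n \<Rightarrow> real"
  assumes u: "u \<in> L2"
  shows "AE \<xi> in lborel. fourier u \<xi> = cpx (hf u) \<xi>" and "fourier u \<in> borel_measurable lebesgue"
proof -
  obtain G where G[measurable]: "\<And>R. G R \<in> borel_measurable borel"
    and GF: "\<And>R \<xi>. fourier_L1 (\<lambda>x. indicator (cball 0 R) x * u x) \<xi> = G R \<xi>"
    and Glim: "((\<lambda>R. \<integral>\<^sup>+\<xi>. ennreal ((norm (cpx (hf u) \<xi> - G R \<xi>))\<^sup>2) \<partial>lborel) \<longlongrightarrow> 0) at_top"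
    using fourier_truncated[OF u] by blast
  have cm[measurable]: "cpx (hf u) \<in> borel_measurable borel" by (rule cpx_measurable) measurable
  have i: "integrable lborel (\<lambda>\<xi>. (norm (cpx (hf u) \<xi>))\<^sup>2)"
  proof (rule integrableI_nonneg)
    have "(\<integral>\<^sup>+\<xi>. ennreal ((norm (cpx (hf u) \<xi>))\<^sup>2) \<partial>lborel) = (\<integral>\<^sup>+\<xi>. ennreal ((hf u \<xi>)\<^sup>2) \<partial>lborel)"
      using nn_integral_cpx[of "hf u" "\<lambda>_. 1"] by simp
    also have "\<dots> < \<infinity>"
      using fn_square_integrable[of "hart (cls u)"] unfolding hf_def
      by (subst nn_integral_eq_integral) auto
    finally show "(\<integral>\<^sup>+\<xi>. ennreal ((norm (cpx (hf u) \<xi>))\<^sup>2) \<partial>lborel) < \<infinity>" .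
  qed (auto intro!: borel_measurable_power borel_measurable_norm cm)
  have "is_fourier u (cpx (hf u))"
    unfolding is_fourier_def GF
  proof (intro conjI)
    show "cpx (hf u) \<in> borel_measurable lebesgue" using cm by (simp add: measurable_completion)
    show "integrable lebesgue (\<lambda>\<xi>. (norm (cpx (hf u) \<xi>))\<^sup>2)"
      using integrable_completion[OF borel_measurable_integrable[OF i]] i by simp
    show "((\<lambda>R. \<integral>\<^sup>+\<xi>. ennreal ((norm (cpx (hf u) \<xi> - G R \<xi>))\<^sup>2) \<partial>lebesgue) \<longlongrightarrow> 0) at_top"
      using Glim by (simp add: nn_integral_completion)
  qed
  then have F: "is_fourier u (fourier u)" unfolding fourier_def by (rule someI[of "is_fourier u"])
  then show m: "fourier u \<in> borel_measurable lebesgue" by (simp add: is_fourier_def)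
  have GL[measurable]: "G R \<in> borel_measurable lebesgue" "cpx (hf u) \<in> borel_measurable lebesgue" for R
    using G cm by (auto simp: measurable_completion)
  have Flim: "((\<lambda>R. \<integral>\<^sup>+\<xi>. ennreal ((norm (fourier u \<xi> - G R \<xi>))\<^sup>2) \<partial>lebesgue) \<longlongrightarrow> 0) at_top"
    using F unfolding is_fourier_def GF by blast
  define D where "D = (\<integral>\<^sup>+\<xi>. ennreal ((norm (fourier u \<xi> - cpx (hf u) \<xi>))\<^sup>2) \<partial>lebesgue)"
  \<comment> \<open>From \<open>(a + b)^2 \<le> 2 * a^2 + 2 * b^2\<close>, inside extended
    nonnegative integrals, where no integrability has to be known.\<close>
  have "D \<le> 2 * (\<integral>\<^sup>+\<xi>. ennreal ((norm (fourier u \<xi> - G R \<xi>))\<^sup>2) \<partial>lebesgue) +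
            2 * (\<integral>\<^sup>+\<xi>. ennreal ((norm (cpx (hf u) \<xi> - G R \<xi>))\<^sup>2) \<partial>lebesgue)" for R
  proof -
    have "D \<le> (\<integral>\<^sup>+\<xi>. 2 * ennreal ((norm (fourier u \<xi> - G R \<xi>))\<^sup>2) + 2 * ennreal ((norm (cpx (hf u) \<xi> - G R \<xi>))\<^sup>2) \<partial>lebesgue)"
      unfolding D_def
    proof (rule nn_integral_mono)
      fix \<xi>
      define a b where "a = norm (fourier u \<xi> - G R \<xi>)" and "b = norm (cpx (hf u) \<xi> - G R \<xi>)"
      have "norm (fourier u \<xi> - cpx (hf u) \<xi>) \<le> a + b"
        unfolding a_def b_def using norm_triangle_ineq4[of "fourier u \<xi> - G R \<xi>" "cpx (hf u) \<xi> - G R \<xi>"] by simp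
      then have "(norm (fourier u \<xi> - cpx (hf u) \<xi>))\<^sup>2 \<le> (a + b)\<^sup>2" by (intro power_mono) auto
      also have "\<dots> \<le> 2 * a\<^sup>2 + 2 * b\<^sup>2" using sum_squares_bound[of a b] by (simp add: power2_sum)
      finally have "ennreal ((norm (fourier u \<xi> - cpx (hf u) \<xi>))\<^sup>2) \<le> ennreal (2 * a\<^sup>2 + 2 * b\<^sup>2)" by (rule ennreal_leI)
      also have "\<dots> = 2 * ennreal (a\<^sup>2) + 2 * ennreal (b\<^sup>2)" by (simp add: ennreal_plus ennreal_mult)
      finally show "ennreal ((norm (fourier u \<xi> - cpx (hf u) \<xi>))\<^sup>2) \<le> 2 * ennreal ((norm (fourier u \<xi> - G R \<xi>))\<^sup>2) + 2 * ennreal ((norm (cpx (hf u) \<xi> - G R \<xi>))\<^sup>2)"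
        unfolding a_def b_def .
    qed
    also have "\<dots> = 2 * (\<integral>\<^sup>+\<xi>. ennreal ((norm (fourier u \<xi> - G R \<xi>))\<^sup>2) \<partial>lebesgue) +
            2 * (\<integral>\<^sup>+\<xi>. ennreal ((norm (cpx (hf u) \<xi> - G R \<xi>))\<^sup>2) \<partial>lebesgue)"
      using m by (simp add: nn_integral_add nn_integral_cmult)
    finally show ?thesis .
  qed
  moreover have "((\<lambda>R. 2 * (\<integral>\<^sup>+\<xi>. ennreal ((norm (fourier u \<xi> - G R \<xi>))\<^sup>2) \<partial>lebesgue) +
            2 * (\<integral>\<^sup>+\<xi>. ennreal ((norm (cpx (hf u) \<xi> - G R \<xi>))\<^sup>2) \<partial>lebesgue)) \<longlongrightarrow> 2 * 0 + 2 * 0) at_top"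
    using Flim Glim by (intro tendsto_add ennreal_tendsto_cmult) (auto simp: nn_integral_completion)
  ultimately have "D \<le> 2 * 0 + 2 * 0"
    by (intro tendsto_lowerbound[of _ _ at_top]) (auto intro!: always_eventually)
  then have "D = 0" by simp
  then have "AE \<xi> in lebesgue. ennreal ((norm (fourier u \<xi> - cpx (hf u) \<xi>))\<^sup>2) = 0"
    unfolding D_def using m by (subst (asm) nn_integral_0_iff_AE) auto
  then show "AE \<xi> in lborel. fourier u \<xi> = cpx (hf u) \<xi>"
    unfolding AE_lebesgue_iff by eventually_elim simp
qed

lemma fourier_weighted:
  fixes u :: "real ^ 'n \<Rightarrow> real" and m :: "real ^ 'n \<Rightarrow> real"
  assumes u: "u \<in> L2" and mm[measurable]: "m \<in> borel_measurable borel"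
    and m: "\<And>\<xi>. m \<xi> \<ge> 0" "\<And>\<xi>. m (- \<xi>) = m \<xi>"
  shows "integrable lebesgue (\<lambda>\<xi>. m \<xi> * (norm (fourier u \<xi>))\<^sup>2) \<longleftrightarrow> integrable lborel (\<lambda>\<xi>. m \<xi> * (hf u \<xi>)\<^sup>2)"
    and "(LINT \<xi>|lebesgue. m \<xi> * (norm (fourier u \<xi>))\<^sup>2) = (LINT \<xi>|lborel. m \<xi> * (hf u \<xi>)\<^sup>2)"
proof -
  have ml[measurable]: "m \<in> borel_measurable lebesgue" by (rule borel_measurable_lborel_lebesgue[OF mm])
  note [measurable] = fourier_hf(2)[OF u]
  have eq: "(\<integral>\<^sup>+\<xi>. ennreal (m \<xi> * (norm (fourier u \<xi>))\<^sup>2) \<partial>lebesgue) = (\<integral>\<^sup>+\<xi>. ennreal (m \<xi> * (hf u \<xi>)\<^sup>2) \<partial>lborel)"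
  proof -
    have "(\<integral>\<^sup>+\<xi>. ennreal (m \<xi> * (norm (fourier u \<xi>))\<^sup>2) \<partial>lebesgue) = (\<integral>\<^sup>+\<xi>. ennreal (m \<xi> * (norm (cpx (hf u) \<xi>))\<^sup>2) \<partial>lebesgue)"
      by (rule nn_integral_cong_AE, unfold AE_lebesgue_iff, use fourier_hf(1)[OF u] in eventually_elim) simp
    also have "\<dots> = (\<integral>\<^sup>+\<xi>. ennreal (m \<xi> * (norm (cpx (hf u) \<xi>))\<^sup>2) \<partial>lborel)" by (rule nn_integral_completion)
    also have "\<dots> = (\<integral>\<^sup>+\<xi>. ennreal (m \<xi> * (hf u \<xi>)\<^sup>2) \<partial>lborel)" by (rule nn_integral_cpx) (auto simp: m)
    finally show ?thesis .
  qed
  have nn: "m \<xi> * (norm (fourier u \<xi>))\<^sup>2 \<ge> 0" "m \<xi> * (hf u \<xi>)\<^sup>2 \<ge> 0" for \<xi> using m(1)[of \<xi>] by auto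
  show "integrable lebesgue (\<lambda>\<xi>. m \<xi> * (norm (fourier u \<xi>))\<^sup>2) \<longleftrightarrow> integrable lborel (\<lambda>\<xi>. m \<xi> * (hf u \<xi>)\<^sup>2)"
    unfolding integrable_iff_bounded using nn eq by (simp add: abs_of_nonneg)
  show "(LINT \<xi>|lebesgue. m \<xi> * (norm (fourier u \<xi>))\<^sup>2) = (LINT \<xi>|lborel. m \<xi> * (hf u \<xi>)\<^sup>2)"
    using nn eq by (subst (1 2) integral_eq_nn_integral) auto
qed

text \<open>A real even multiplier acts separately on even and odd parts, hence commutes with
  \<open>cpx\<close>.\<close>

lemma fourier_multiplier:
  fixes u w :: "real ^ 'n \<Rightarrow> real" and m :: "real ^ 'n \<Rightarrow> real"
  assumes u: "u \<in> L2" and w: "w \<in> L2" and m: "\<And>\<xi>. m (- \<xi>) = m \<xi>"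
  shows "(AE \<xi> in lebesgue. fourier w \<xi> = of_real (m \<xi>) * fourier u \<xi>) \<longleftrightarrow> (AE \<xi> in lborel. hf w \<xi> = m \<xi> * hf u \<xi>)"
proof
  assume "AE \<xi> in lebesgue. fourier w \<xi> = of_real (m \<xi>) * fourier u \<xi>"
  then have "AE \<xi> in lborel. fourier w \<xi> = of_real (m \<xi>) * fourier u \<xi>" by (simp add: AE_lebesgue_iff)
  then show "AE \<xi> in lborel. hf w \<xi> = m \<xi> * hf u \<xi>"
    using fourier_hf(1)[OF u] fourier_hf(1)[OF w]
  proof eventually_elim
    case (elim \<xi>)
    then have c: "cpx (hf w) \<xi> = of_real (m \<xi>) * cpx (hf u) \<xi>" by simp
    have "hf w \<xi> = Re (cpx (hf w) \<xi>) - Im (cpx (hf w) \<xi>)" by (rule cpx_recover[symmetric])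
    also have "\<dots> = m \<xi> * (Re (cpx (hf u) \<xi>) - Im (cpx (hf u) \<xi>))" unfolding c by (simp add: algebra_simps)
    finally show ?case by (simp only: cpx_recover)
  qed
next
  assume *: "AE \<xi> in lborel. hf w \<xi> = m \<xi> * hf u \<xi>"
  show "AE \<xi> in lebesgue. fourier w \<xi> = of_real (m \<xi>) * fourier u \<xi>"
    unfolding AE_lebesgue_iff using * AE_lborel_uminus[OF *] fourier_hf(1)[OF u] fourier_hf(1)[OF w]
  proof eventually_elim
    case (elim \<xi>)
    show ?case unfolding elim(3,4) cpx_def elim(1,2) m by (simp add: complex_eq_iff field_simps)
  qed
qed

section \<open>Multiplication operators\<close>

definition bdd_mult :: "real \<Rightarrow> ('a::euclidean_space \<Rightarrow> real) \<Rightarrow> bool" where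
  "bdd_mult C m \<longleftrightarrow> m \<in> borel_measurable lebesgue \<and> (AE x in lborel. \<bar>m x\<bar> \<le> C)"

definition mulop :: "('a::euclidean_space \<Rightarrow> real) \<Rightarrow> 'a l2 \<Rightarrow> 'a l2" where
  "mulop m a = cls (\<lambda>x. m x * fn a x)"

lemma sqint_AE:
  assumes f: "f \<in> sqint" and g: "g \<in> borel_measurable borel" and ae: "AE x in lborel. f x = g x"
  shows "g \<in> sqint"
proof (rule sqint_borelI[OF g])
  have [measurable]: "g \<in> borel_measurable borel" by (rule g)
  show "integrable lborel (\<lambda>x. (g x)\<^sup>2)"
    by (rule integrable_lborel_cong(1)[where f="\<lambda>x. (f x)\<^sup>2"])
      (use f ae in \<open>auto simp: sqint_def elim!: eventually_mono\<close>)
qed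

lemma bdd_multI: "m \<in> borel_measurable borel \<Longrightarrow> (\<And>x. \<bar>m x\<bar> \<le> C) \<Longrightarrow> bdd_mult C m"
  unfolding bdd_mult_def by (auto intro: borel_measurable_lborel_lebesgue)

lemma bdd_mult_sqint: "bdd_mult C m \<Longrightarrow> f \<in> sqint \<Longrightarrow> (\<lambda>x. m x * f x) \<in> sqint"
  unfolding bdd_mult_def by (rule sqint_bounded_mult) auto

lemma bdd_mult_diff: "bdd_mult C m \<Longrightarrow> bdd_mult D k \<Longrightarrow> bdd_mult (C + D) (\<lambda>x. m x - k x)"
  unfolding bdd_mult_def by (auto elim!: AE_mp[rotated])

lemma fn_mulop:
  assumes "bdd_mult C m"
  shows "AE x in lborel. fn (mulop m a) x = m x * fn a x"
  unfolding mulop_def by (rule fn_cls[OF bdd_mult_sqint[OF assms fn_sqint]])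

lemma mulop_cls:
  assumes "bdd_mult C m" "f \<in> sqint"
  shows "mulop m (cls f) = cls (\<lambda>x. m x * f x)"
  unfolding mulop_def by (rule cls_cong, use fn_cls[OF assms(2)] in eventually_elim) simp

lemma mulop_linear:
  assumes m: "bdd_mult C m"
  shows "linear (mulop m)"
proof (rule linearI)
  show "mulop m (a + b) = mulop m a + mulop m b" for a b
    by (rule l2_eqI, use fn_mulop[OF m, of "a + b"] fn_mulop[OF m, of a] fn_mulop[OF m, of b] fn_add[of a b]
      fn_add[of "mulop m a" "mulop m b"] in eventually_elim) (simp add: distrib_left)
  show "mulop m (r *\<^sub>R a) = r *\<^sub>R mulop m a" for r a
    by (rule l2_eqI, use fn_mulop[OF m, of "r *\<^sub>R a"] fn_mulop[OF m, of a] fn_scaleR[of r a]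
      fn_scaleR[of r "mulop m a"] in eventually_elim) simp
qed

lemma inner_mulop:
  assumes m: "bdd_mult C m"
  shows "inner (mulop m a) b = (LINT x|lebesgue. m x * fn a x * fn b x)"
proof -
  have "inner (cls (\<lambda>x. m x * fn a x)) (cls (fn b)) = (LINT x|lebesgue. m x * fn a x * fn b x)"
    by (rule inner_cls[OF bdd_mult_sqint[OF m fn_sqint] fn_sqint])
  then show ?thesis by (simp add: mulop_def)
qed

lemma mulop_symmetric: "bdd_mult C m \<Longrightarrow> inner (mulop m a) b = inner (mulop m b) a"
  by (simp add: inner_mulop mult_ac)

lemma mulop_norm:
  assumes m: "bdd_mult C m" and C: "C \<ge> 0"
  shows "norm (mulop m a) \<le> C * norm a"
proof (rule power2_le_imp_le)
  have s: "(\<lambda>x. m x * fn a x) \<in> sqint" by (rule bdd_mult_sqint[OF m fn_sqint])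
  have s2: "(\<lambda>x. C * fn a x) \<in> sqint" by (rule sqint_cmult) simp
  have "(norm (mulop m a))\<^sup>2 = (LINT x|lebesgue. (m x * fn a x)\<^sup>2)" unfolding mulop_def by (rule norm_cls_sq[OF s])
  also have "\<dots> \<le> (LINT x|lebesgue. (C * fn a x)\<^sup>2)"
  proof (rule integral_mono_AE)
    show "AE x in lebesgue. (m x * fn a x)\<^sup>2 \<le> (C * fn a x)\<^sup>2"
      unfolding AE_lebesgue_iff using m[unfolded bdd_mult_def, THEN conjunct2]
    proof eventually_elim
      case (elim x)
      then have "\<bar>m x\<bar>\<^sup>2 \<le> C\<^sup>2" by (intro power_mono) auto
      then show ?case by (simp add: power_mult_distrib mult_right_mono)
    qed
  qed (use s s2 in \<open>auto simp: sqint_def\<close>)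
  also have "\<dots> = (norm (cls (\<lambda>x. C * fn a x)))\<^sup>2" by (rule norm_cls_sq[OF s2, symmetric])
  also have "\<dots> = (C * norm a)\<^sup>2" using C by (simp add: cls_cmult)
  finally show "(norm (mulop m a))\<^sup>2 \<le> (C * norm a)\<^sup>2" .
qed (use C in auto)

section \<open>Sobolev spaces\<close>

text \<open>The square of the Japanese bracket, hence the exponents \<open>s / 2\<close> where the
  bracket has exponent \<open>s\<close>.\<close>

definition jap :: "'a::euclidean_space \<Rightarrow> real" where "jap \<xi> = 1 + (norm \<xi>)\<^sup>2"

lemma jap_ge1: "jap \<xi> \<ge> 1" and jap_pos: "jap \<xi> > 0"
  by (auto simp: jap_def add_pos_nonneg)

lemma jap_measurable[measurable]: "jap \<in> borel_measurable borel"
  unfolding jap_def by measurable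

lemma jap_powr_le1: "t \<le> 0 \<Longrightarrow> \<bar>jap \<xi> powr t\<bar> \<le> 1"
  using powr_mono[of t 0 "jap \<xi>"] jap_ge1[of \<xi>] jap_pos[of \<xi>] by auto

lemma jap_mult: "t \<le> 0 \<Longrightarrow> bdd_mult 1 (\<lambda>\<xi>. jap \<xi> powr t)"
  by (rule bdd_multI[OF _ jap_powr_le1]) auto

text \<open>The isometry from the Sobolev space of order \<open>s\<close> onto L2, which allows the
  whole Dirichlet problem to be treated inside \<open>l2\<close>.\<close>

definition sob :: "real \<Rightarrow> ('a::euclidean_space \<Rightarrow> real) \<Rightarrow> 'a l2" where
  "sob s u = cls (\<lambda>\<xi>. jap \<xi> powr (s / 2) * hf u \<xi>)"

text \<open>The inverse of \<open>sob\<close> followed by the inclusion of the Sobolev space in L2;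
  on functions supported in a bounded open set this is the map that Rellich's theorem makes
  compact.\<close>

definition emb :: "real \<Rightarrow> 'a::euclidean_space l2 \<Rightarrow> 'a l2" where
  "emb s a = hart (mulop (\<lambda>\<xi>. jap \<xi> powr (- (s / 2))) a)"

lemma emb_linear: "s \<ge> 0 \<Longrightarrow> linear (emb s)"
  unfolding emb_def by (intro linear_compose[OF mulop_linear[OF jap_mult] hart_linear, unfolded o_def]) auto

lemma emb_norm: "s \<ge> 0 \<Longrightarrow> norm (emb s a) \<le> norm a"
  unfolding emb_def hart_norm using mulop_norm[OF jap_mult, of "- (s / 2)" a] by simp

definition in_Hs :: "real \<Rightarrow> ('a::euclidean_space \<Rightarrow> real) \<Rightarrow> bool" where
  "in_Hs s u \<longleftrightarrow> u \<in> sqint \<and> (\<lambda>\<xi>. jap \<xi> powr (s / 2) * hf u \<xi>) \<in> sqint"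

lemma fn_sob: "in_Hs s u \<Longrightarrow> AE \<xi> in lborel. fn (sob s u) \<xi> = jap \<xi> powr (s / 2) * hf u \<xi>"
  unfolding sob_def in_Hs_def by (rule fn_cls) simp

lemma jap_cancel: "jap \<xi> powr (- (s / 2)) * (jap \<xi> powr (s / 2) * x) = x" "jap \<xi> powr (s / 2) * (jap \<xi> powr (- (s / 2)) * x) = x"
  using jap_pos[of \<xi>] by (simp_all add: mult.assoc[symmetric] powr_add[symmetric])

lemma hart_emb_sob:
  assumes s: "s \<ge> 0" and u: "in_Hs s u"
  shows "mulop (\<lambda>\<xi>. jap \<xi> powr (- (s / 2))) (sob s u) = hart (cls u)"
proof -
  have "mulop (\<lambda>\<xi>. jap \<xi> powr (- (s / 2))) (sob s u) = cls (hf u)"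
    unfolding mulop_def by (rule cls_cong, use fn_sob[OF u] in eventually_elim) (simp add: jap_cancel)
  then show ?thesis by (simp add: cls_hf)
qed

lemma emb_sob: "s \<ge> 0 \<Longrightarrow> in_Hs s u \<Longrightarrow> emb s (sob s u) = cls u"
  unfolding emb_def by (simp add: hart_emb_sob)

lemma sob_emb:
  fixes a :: "'a::euclidean_space l2"
  assumes s: "s \<ge> 0"
  shows "in_Hs s (fn (emb s a))" and "sob s (fn (emb s a)) = a"
proof -
  have m: "bdd_mult 1 (\<lambda>\<xi>::'a. jap \<xi> powr (- (s / 2)))" using s by (intro jap_mult) simp
  have "hf (fn (emb s a)) = fn (mulop (\<lambda>\<xi>. jap \<xi> powr (- (s / 2))) a)"
    unfolding hf_def emb_def by simp
  then have ae: "AE \<xi> in lborel. jap \<xi> powr (s / 2) * hf (fn (emb s a)) \<xi> = fn a \<xi>"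
    using fn_mulop[OF m, of a] by (auto elim!: eventually_mono simp: jap_cancel)
  have "AE \<xi> in lborel. fn a \<xi> = jap \<xi> powr (s / 2) * hf (fn (emb s a)) \<xi>" using ae by eventually_elim simp
  then have "(\<lambda>\<xi>. jap \<xi> powr (s / 2) * hf (fn (emb s a)) \<xi>) \<in> sqint"
    by (rule sqint_AE[OF fn_sqint, rotated]) measurable
  then show "in_Hs s (fn (emb s a))" unfolding in_Hs_def by simp
  show "sob s (fn (emb s a)) = a" unfolding sob_def using cls_cong[OF ae] by simp
qed

lemma sob_cong: "AE x in lborel. u x = v x \<Longrightarrow> sob s u = sob s v"
  unfolding sob_def hf_def by (simp add: cls_cong)

lemma in_Hs_diff:
  assumes u: "in_Hs s u" and v: "in_Hs s v"
  shows "in_Hs s (\<lambda>x. u x - v x)" and "sob s (\<lambda>x. u x - v x) = sob s u - sob s v"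
proof -
  have us: "u \<in> sqint" "v \<in> sqint" using u v by (auto simp: in_Hs_def)
  have hfd: "AE \<xi> in lborel. hf (\<lambda>x. u x - v x) \<xi> = hf u \<xi> - hf v \<xi>"
    unfolding hf_def cls_diff[OF us] linear_diff[OF hart_linear] by (rule fn_diff)
  have ss: "(\<lambda>\<xi>. jap \<xi> powr (s / 2) * hf u \<xi> - jap \<xi> powr (s / 2) * hf v \<xi>) \<in> sqint"
    using u v unfolding in_Hs_def by (intro sqint_diff) auto
  have ae: "AE \<xi> in lborel. jap \<xi> powr (s / 2) * hf u \<xi> - jap \<xi> powr (s / 2) * hf v \<xi> = jap \<xi> powr (s / 2) * hf (\<lambda>x. u x - v x) \<xi>"
    using hfd by eventually_elim (simp add: right_diff_distrib)
  show "in_Hs s (\<lambda>x. u x - v x)" unfolding in_Hs_def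
    by (intro conjI sqint_diff us sqint_AE[OF ss _ ae]) measurable
  show "sob s (\<lambda>x. u x - v x) = sob s u - sob s v"
    unfolding sob_def using cls_cong[OF ae] u v by (simp add: cls_diff in_Hs_def)
qed

lemma in_Hs_cmult:
  assumes u: "in_Hs s u"
  shows "in_Hs s (\<lambda>x. c * u x)" and "sob s (\<lambda>x. c * u x) = c *\<^sub>R sob s u"
proof -
  have us: "u \<in> sqint" using u by (auto simp: in_Hs_def)
  have hfd: "AE \<xi> in lborel. hf (\<lambda>x. c * u x) \<xi> = c * hf u \<xi>"
    unfolding hf_def cls_cmult[OF us] hart_scaleR by (rule fn_scaleR)
  have ss: "(\<lambda>\<xi>. c * (jap \<xi> powr (s / 2) * hf u \<xi>)) \<in> sqint"
    using u unfolding in_Hs_def by (intro sqint_cmult) auto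
  have ae: "AE \<xi> in lborel. c * (jap \<xi> powr (s / 2) * hf u \<xi>) = jap \<xi> powr (s / 2) * hf (\<lambda>x. c * u x) \<xi>"
    using hfd by eventually_elim simp
  show "in_Hs s (\<lambda>x. c * u x)" unfolding in_Hs_def
    by (intro conjI sqint_cmult us sqint_AE[OF ss _ ae]) measurable
  show "sob s (\<lambda>x. c * u x) = c *\<^sub>R sob s u"
    unfolding sob_def using cls_cong[OF ae] u cls_cmult[of "\<lambda>\<xi>. jap \<xi> powr (s / 2) * hf u \<xi>" c] by (simp add: in_Hs_def)
qed

lemma in_Hs_zero: "in_Hs s (\<lambda>x::'a::euclidean_space. 0)" "sob s (\<lambda>x::'a. 0) = 0"
proof -
  have "hart (cls (\<lambda>x::'a. 0)) = 0" unfolding zero_l2_def[symmetric] by (rule linear_0[OF hart_linear])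
  then have ae: "AE \<xi> in lborel. hf (\<lambda>x::'a. 0) \<xi> = 0" unfolding hf_def using fn_zero by simp
  have z: "AE \<xi> in lborel. jap \<xi> powr (s / 2) * hf (\<lambda>x::'a. 0) \<xi> = 0" using ae by eventually_elim simp
  have z': "AE \<xi> in lborel. 0 = jap \<xi> powr (s / 2) * hf (\<lambda>x::'a. 0) \<xi>" using z by eventually_elim simp
  show "in_Hs s (\<lambda>x::'a. 0)" unfolding in_Hs_def
    by (intro conjI zero_sqint sqint_AE[OF zero_sqint _ z']) measurable
  show "sob s (\<lambda>x::'a. 0) = 0" unfolding sob_def cls_cong[OF z] zero_l2_def ..
qed

lemma Hs_iff: "u \<in> Hs s \<longleftrightarrow> in_Hs s (u :: real ^ 'n \<Rightarrow> real)"
  and Hs_norm_sob: "in_Hs s u \<Longrightarrow> Hs_norm s u = norm (sob s u)"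
proof -
  have sq: "(jap \<xi> powr (s / 2) * hf u \<xi>)\<^sup>2 = (1 + (norm \<xi>)\<^sup>2) powr s * (hf u \<xi>)\<^sup>2" for \<xi>
    using jap_pos[of \<xi>] unfolding power_mult_distrib power2_eq_square[of "jap \<xi> powr (s/2)"]
    by (simp add: jap_def flip: powr_add)
  have m: "(\<lambda>\<xi>::real ^ 'n. (1 + (norm \<xi>)\<^sup>2) powr s) \<in> borel_measurable borel" by measurable
  have j: "(\<lambda>\<xi>. jap \<xi> powr (s / 2) * hf u \<xi>) \<in> sqint \<longleftrightarrow> integrable lborel (\<lambda>\<xi>. (jap \<xi> powr (s / 2) * hf u \<xi>)\<^sup>2)"
  proof
    assume "(\<lambda>\<xi>. jap \<xi> powr (s / 2) * hf u \<xi>) \<in> sqint"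
    then show "integrable lborel (\<lambda>\<xi>. (jap \<xi> powr (s / 2) * hf u \<xi>)\<^sup>2)"
      by (auto simp: sqint_def integrable_completion)
  qed (rule sqint_borelI, measurable)
  show iff: "u \<in> Hs s \<longleftrightarrow> in_Hs s u"
  proof (cases "u \<in> L2")
    case True
    then show ?thesis using fourier_weighted(1)[OF True m] unfolding Hs_def in_Hs_def j sq by (simp add: L2_sqint)
  qed (simp add: Hs_def in_Hs_def L2_sqint)
  assume u: "in_Hs s u"
  then have L: "u \<in> L2" by (simp add: in_Hs_def L2_sqint)
  have "(norm (sob s u))\<^sup>2 = (LINT \<xi>|lebesgue. (jap \<xi> powr (s / 2) * hf u \<xi>)\<^sup>2)"
    unfolding sob_def using u by (intro norm_cls_sq) (simp add: in_Hs_def)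
  also have "\<dots> = (LINT \<xi>|lborel. (jap \<xi> powr (s / 2) * hf u \<xi>)\<^sup>2)" by (rule integral_completion) measurable
  also have "\<dots> = (LINT \<xi>|lebesgue. (1 + (norm \<xi>)\<^sup>2) powr s * (norm (fourier u \<xi>))\<^sup>2)"
    unfolding sq using fourier_weighted(2)[OF L m] by simp
  finally show "Hs_norm s u = norm (sob s u)" unfolding Hs_norm_def by (metis norm_ge_zero real_sqrt_abs abs_of_nonneg)
qed

section \<open>The bilinear form\<close>

text \<open>The symbol of the fractional Laplacian of order \<open>s / 2\<close>, seen from the L2
  side of the isometry \<open>sob\<close>.\<close>

definition symb :: "real \<Rightarrow> 'a::euclidean_space \<Rightarrow> real" where
  "symb s \<xi> = norm \<xi> powr s * jap \<xi> powr (- (s / 2))"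

text \<open>The difference between the weight of the Sobolev inner product and the symbol of the
  Dirichlet form. It is bounded for \<open>s \<le> 1\<close>, so the two forms differ by a term of
  order zero.\<close>

definition rho :: "real \<Rightarrow> 'a::euclidean_space \<Rightarrow> real" where
  "rho s \<xi> = jap \<xi> powr s - norm \<xi> powr (2 * s)"

lemma symb_measurable[measurable]: "symb s \<in> borel_measurable borel"
  unfolding symb_def by measurable

lemma rho_measurable[measurable]: "rho s \<in> borel_measurable borel"
  unfolding rho_def by measurable

lemma norm_powr_double: "norm x powr (2 * t) = (norm x)\<^sup>2 powr t"
proof (cases "norm x = 0")
  case False
  then have "(norm x)\<^sup>2 = norm x powr 2" by simp
  then show ?thesis by (simp only: powr_powr)
qed simp

lemma norm_powr_le_jap: "t \<ge> 0 \<Longrightarrow> norm \<xi> powr (2 * t) \<le> jap \<xi> powr t"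
proof -
  assume t: "t \<ge> 0"
  have "norm \<xi> powr (2 * t) = (norm \<xi>)\<^sup>2 powr t" by (rule norm_powr_double)
  also have "((norm \<xi>)\<^sup>2) powr t \<le> jap \<xi> powr t" using t by (intro powr_mono2) (auto simp: jap_def)
  finally show ?thesis .
qed

lemma symb_bdd: "s \<ge> 0 \<Longrightarrow> bdd_mult 1 (symb s)"
proof (rule bdd_multI)
  fix \<xi> :: 'a assume s: "s \<ge> 0"
  have "norm \<xi> powr s * jap \<xi> powr (- (s / 2)) \<le> jap \<xi> powr (s / 2) * jap \<xi> powr (- (s / 2))"
    using norm_powr_le_jap[of "s / 2" \<xi>] s by (intro mult_right_mono) auto
  also have "\<dots> = 1" using jap_pos[of \<xi>] by (simp flip: powr_add)
  finally show "\<bar>symb s \<xi>\<bar> \<le> 1" by (simp add: symb_def abs_mult)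
qed simp

lemma powr_one_plus_le:
  fixes x s :: real
  assumes "x \<ge> 0" "0 < s" "s \<le> 1"
  shows "(1 + x) powr s \<le> 1 + x powr s"
proof (cases "x = 0")
  case False
  \<comment> \<open>One factor \<open>1 + x\<close> is split off; the remaining power has the
    nonpositive exponent \<open>s - 1\<close> and therefore decreases in its base.\<close>
  then have x: "x > 0" using assms by simp
  have "(1 + x) powr s = (1 + x) powr 1 * (1 + x) powr (s - 1)" unfolding powr_add[symmetric] by simp
  also have "\<dots> = (1 + x) powr (s - 1) + x * (1 + x) powr (s - 1)" using x by (simp add: algebra_simps)
  also have "\<dots> \<le> 1 + x * x powr (s - 1)"
  proof (intro add_mono mult_left_mono)
    show "(1 + x) powr (s - 1) \<le> 1" using powr_mono[of "s - 1" 0 "1 + x"] x assms by simp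
    show "(1 + x) powr (s - 1) \<le> x powr (s - 1)" using x assms by (intro powr_mono2') auto
  qed (use x in auto)
  also have "x * x powr (s - 1) = x powr 1 * x powr (s - 1)" using x by simp
  also have "\<dots> = x powr s" unfolding powr_add[symmetric] by simp
  finally show ?thesis .
qed (use assms in auto)

lemma rho_bdd: assumes s: "0 < s" "s \<le> 1" shows "bdd_mult 1 (rho s :: 'a::euclidean_space \<Rightarrow> real)"
proof (rule bdd_multI)
  fix \<xi> :: 'a
  have "norm \<xi> powr (2 * s) = (norm \<xi>)\<^sup>2 powr s" by (rule norm_powr_double)
  then have "jap \<xi> powr s \<le> 1 + norm \<xi> powr (2 * s)"
    using powr_one_plus_le[of "(norm \<xi>)\<^sup>2" s] s by (simp add: jap_def)
  then show "\<bar>rho s \<xi>\<bar> \<le> 1" using norm_powr_le_jap[of s \<xi>] s by (simp add: rho_def)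
qed simp

lemma symb_rho: "(symb s \<xi>)\<^sup>2 = 1 - rho s \<xi> * (jap \<xi> powr (- (s / 2)))\<^sup>2"
proof -
  have "(jap \<xi> powr (- (s / 2)))\<^sup>2 = jap \<xi> powr (- s)" unfolding power2_eq_square by (simp flip: powr_add)
  moreover have "(norm \<xi> powr s)\<^sup>2 = norm \<xi> powr (2 * s)" unfolding power2_eq_square by (simp flip: powr_add)
  moreover have "jap \<xi> powr s * jap \<xi> powr (- s) = 1" using jap_pos[of \<xi>] by (simp flip: powr_add)
  ultimately show ?thesis unfolding symb_def rho_def power_mult_distrib by (simp add: left_diff_distrib)
qed

text \<open>The choice in \<open>frac_laplacian\<close> is handled by describing all candidates at
  once: by \<open>iff\<close> they are the square integrable functions of one single class.\<close>

lemma frac_laplacian_sob: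
  fixes u :: "real ^ 'n \<Rightarrow> real"
  assumes s: "s \<ge> 0" and u: "in_Hs s u"
  shows "frac_laplacian (s / 2) u \<in> sqint" and "cls (frac_laplacian (s / 2) u) = hart (mulop (symb s) (sob s u))"
proof -
  have uL: "u \<in> L2" using u by (simp add: in_Hs_def L2_sqint)
  define P where "P w \<longleftrightarrow> w \<in> L2 \<and> (AE \<xi> in lebesgue. fourier w \<xi> = of_real (norm \<xi> powr (2 * (s / 2))) * fourier u \<xi>)" for w
  have ae: "AE \<xi> in lborel. fn (mulop (symb s) (sob s u)) \<xi> = norm \<xi> powr (2 * (s / 2)) * hf u \<xi>"
    using fn_mulop[OF symb_bdd[OF s], of "sob s u"] fn_sob[OF u]
    by eventually_elim (simp add: symb_def mult.assoc jap_cancel)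
  have iff: "P w \<longleftrightarrow> w \<in> sqint \<and> cls w = hart (mulop (symb s) (sob s u))" for w
  proof (cases "w \<in> L2")
    case True
    then have ws: "w \<in> sqint" by (simp add: L2_sqint)
    have "P w \<longleftrightarrow> (AE \<xi> in lborel. hf w \<xi> = norm \<xi> powr (2 * (s / 2)) * hf u \<xi>)"
      unfolding P_def using fourier_multiplier[OF uL True, of "\<lambda>\<xi>. norm \<xi> powr (2 * (s / 2))"] True by simp
    also have "\<dots> \<longleftrightarrow> (AE \<xi> in lborel. hf w \<xi> = fn (mulop (symb s) (sob s u)) \<xi>)"
    proof
      assume *: "AE \<xi> in lborel. hf w \<xi> = norm \<xi> powr (2 * (s / 2)) * hf u \<xi>"
      show "AE \<xi> in lborel. hf w \<xi> = fn (mulop (symb s) (sob s u)) \<xi>" using * ae by eventually_elim simp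
    next
      assume *: "AE \<xi> in lborel. hf w \<xi> = fn (mulop (symb s) (sob s u)) \<xi>"
      show "AE \<xi> in lborel. hf w \<xi> = norm \<xi> powr (2 * (s / 2)) * hf u \<xi>" using * ae by eventually_elim simp
    qed
    also have "\<dots> \<longleftrightarrow> hart (cls w) = mulop (symb s) (sob s u)"
      unfolding hf_def by (auto intro: l2_eqI)
    also have "\<dots> \<longleftrightarrow> cls w = hart (mulop (symb s) (sob s u))" by (metis hart_hart)
    finally show ?thesis using ws by simp
  qed (auto simp: P_def L2_sqint)
  have "P (fn (hart (mulop (symb s) (sob s u))))" by (simp add: iff)
  then have "P (SOME w. P w)" by (rule someI[of P])
  moreover have "frac_laplacian (s / 2) u = (SOME w. P w)" unfolding frac_laplacian_def P_def ..
  ultimately have "P (frac_laplacian (s / 2) u)" by simp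
  then show "frac_laplacian (s / 2) u \<in> sqint" "cls (frac_laplacian (s / 2) u) = hart (mulop (symb s) (sob s u))"
    by (auto simp: iff)
qed

text \<open>What has to be subtracted from the Sobolev inner product to obtain the form of the
  potential \<open>m\<close>. Both terms see their arguments only through \<open>emb s\<close>, so
  this is the compact part.\<close>

definition kf :: "real \<Rightarrow> ('a::euclidean_space \<Rightarrow> real) \<Rightarrow> 'a l2 \<Rightarrow> 'a l2 \<Rightarrow> real" where
  "kf s m a b = inner (mulop (rho s) (hart (emb s a))) (hart (emb s b)) - inner (mulop m (emb s a)) (emb s b)"

definition res :: "'a set \<Rightarrow> ('a \<Rightarrow> real) \<Rightarrow> 'a \<Rightarrow> real" where
  "res \<Omega> q x = (if x \<in> \<Omega> then q x else 0)"

lemma symb_symb_inner: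
  fixes a b :: "'a::euclidean_space l2"
  assumes s: "0 < s" "s \<le> 1"
  shows "inner (mulop (symb s) a) (mulop (symb s) b) = inner a b - inner (mulop (rho s) (hart (emb s a))) (hart (emb s b))"
proof -
  define j where "j = (\<lambda>\<xi>::'a. jap \<xi> powr (- (s / 2)))"
  have j: "bdd_mult 1 j" unfolding j_def using s by (intro jap_mult) simp
  have [measurable]: "j \<in> borel_measurable borel" unfolding j_def by measurable
  have sy: "bdd_mult 1 (symb s :: 'a \<Rightarrow> real)" by (rule symb_bdd) (use s in simp)
  have r: "bdd_mult 1 (rho s :: 'a \<Rightarrow> real)" by (rule rho_bdd[OF s])
  have "inner (mulop (rho s) (hart (emb s a))) (hart (emb s b)) = inner (mulop (rho s) (mulop j a)) (mulop j b)"
    unfolding emb_def j_def by simp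
  also have "\<dots> = (LINT x|lborel. fn (mulop (rho s) (mulop j a)) x * fn (mulop j b) x)" by (rule inner_l2_def)
  also have "\<dots> = (LINT x|lborel. rho s x * (j x)\<^sup>2 * (fn a x * fn b x))"
    by (rule integral_cong_AE, measurable, use fn_mulop[OF r, of "mulop j a"] fn_mulop[OF j, of a] fn_mulop[OF j, of b] in eventually_elim)
      (simp add: power2_eq_square)
  finally have 1: "inner (mulop (rho s) (hart (emb s a))) (hart (emb s b)) = (LINT x|lborel. rho s x * (j x)\<^sup>2 * (fn a x * fn b x))" .
  have "inner (mulop (symb s) a) (mulop (symb s) b) = (LINT x|lborel. fn (mulop (symb s) a) x * fn (mulop (symb s) b) x)" by (rule inner_l2_def)
  also have "\<dots> = (LINT x|lborel. fn a x * fn b x - rho s x * (j x)\<^sup>2 * (fn a x * fn b x))"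
  proof (rule integral_cong_AE, measurable, use fn_mulop[OF sy, of a] fn_mulop[OF sy, of b] in eventually_elim)
    case (elim x)
    have "fn (mulop (symb s) a) x * fn (mulop (symb s) b) x = (symb s x)\<^sup>2 * (fn a x * fn b x)"
      by (simp add: elim power2_eq_square)
    then show ?case unfolding symb_rho j_def by (simp add: left_diff_distrib)
  qed
  also have "\<dots> = (LINT x|lborel. fn a x * fn b x) - (LINT x|lborel. rho s x * (j x)\<^sup>2 * (fn a x * fn b x))"
  proof (rule Bochner_Integration.integral_diff[OF fn_mult_integrable])
    show "integrable lborel (\<lambda>x. rho s x * (j x)\<^sup>2 * (fn a x * fn b x))"
    proof (rule Bochner_Integration.integrable_bound[OF fn_mult_integrable[of a b]])
      have "\<bar>rho s x * (j x)\<^sup>2\<bar> \<le> 1" for x :: 'a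
      proof -
        have "rho s x * (j x)\<^sup>2 \<le> 1" using symb_rho[of s x] unfolding j_def by (smt (verit) zero_le_power2)
        moreover have "0 \<le> rho s x * (j x)\<^sup>2" unfolding rho_def using norm_powr_le_jap[of s x] s by simp
        ultimately show ?thesis by simp
      qed
      then show "AE x in lborel. norm (rho s x * (j x)\<^sup>2 * (fn a x * fn b x)) \<le> norm (fn a x * fn b x)"
        by (intro AE_I2) (simp only: real_norm_def abs_mult[of "rho s _ * _"], simp add: mult_left_le_one_le)
    qed measurable
  qed
  finally show ?thesis by (simp only: 1 inner_l2_def[of a b])
qed

lemma bform_kf:
  fixes u v :: "real ^ 'n \<Rightarrow> real"
  assumes s: "0 < s" "s \<le> 1" and u: "in_Hs s u" and v: "in_Hs s v"
    and O: "\<Omega> \<in> sets lebesgue" and q: "bdd_mult C (res \<Omega> q)"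
  shows "bform s \<Omega> q u v = inner (sob s u) (sob s v) - kf s (res \<Omega> q) (sob s u) (sob s v)"
    and "inner_L2_on \<Omega> (\<lambda>x. q x * u x) v = inner (mulop (res \<Omega> q) (cls u)) (cls v)"
proof -
  have s0: "s \<ge> 0" using s by simp
  note fu = frac_laplacian_sob[OF s0 u] and fv = frac_laplacian_sob[OF s0 v]
  have us: "u \<in> sqint" "v \<in> sqint" using u v by (auto simp: in_Hs_def)
  have "inner_L2_on UNIV (frac_laplacian (s / 2) u) (frac_laplacian (s / 2) v) =
        inner (cls (frac_laplacian (s / 2) u)) (cls (frac_laplacian (s / 2) v))"
    unfolding inner_L2_on_def inner_cls[OF fu(1) fv(1)] by (simp add: lebesgue_on_UNIV_eq)
  also have "\<dots> = inner (mulop (symb s) (sob s u)) (mulop (symb s) (sob s v))" unfolding fu(2) fv(2) by simp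
  finally have 1: "inner_L2_on UNIV (frac_laplacian (s / 2) u) (frac_laplacian (s / 2) v) =
     inner (sob s u) (sob s v) - inner (mulop (rho s) (hart (emb s (sob s u)))) (hart (emb s (sob s v)))"
    by (simp only: symb_symb_inner[OF s])
  have "inner_L2_on \<Omega> (\<lambda>x. q x * u x) v = (LINT x|lebesgue. indicator \<Omega> x *\<^sub>R (q x * u x * v x))"
    unfolding inner_L2_on_def using O by (subst integral_restrict_space) auto
  also have "\<dots> = (LINT x|lebesgue. (res \<Omega> q x * u x) * v x)"
    by (intro Bochner_Integration.integral_cong refl) (auto simp: res_def indicator_def)
  also have "\<dots> = inner (cls (\<lambda>x. res \<Omega> q x * u x)) (cls v)" by (rule inner_cls[OF bdd_mult_sqint[OF q us(1)] us(2), symmetric])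
  finally show 2: "inner_L2_on \<Omega> (\<lambda>x. q x * u x) v = inner (mulop (res \<Omega> q) (cls u)) (cls v)"
    by (simp add: mulop_cls[OF q us(1)])
  show "bform s \<Omega> q u v = inner (sob s u) (sob s v) - kf s (res \<Omega> q) (sob s u) (sob s v)"
    unfolding bform_def 1 2 kf_def by (simp add: emb_sob[OF s0 u] emb_sob[OF s0 v])
qed

lemma kf_bilinear:
  assumes s: "0 < s" "s \<le> 1" and m: "bdd_mult C m"
  shows "bilinear (kf s m)"
proof -
  have s0: "s \<ge> 0" using s by simp
  note L = emb_linear[OF s0] hart_linear mulop_linear[OF m] mulop_linear[OF rho_bdd[OF s]]
  show ?thesis unfolding bilinear_def kf_def
    by (auto intro!: linearI simp: linear_add[OF L(1)] linear_add[OF L(2)] linear_add[OF L(3)] linear_add[OF L(4)]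
      linear_scale[OF L(1)] linear_scale[OF L(2)] linear_scale[OF L(3)] linear_scale[OF L(4)]
      inner_add_left inner_add_right right_diff_distrib)
qed

lemma kf_symmetric:
  assumes s: "0 < s" "s \<le> 1" and m: "bdd_mult C m"
  shows "kf s m a b = kf s m b a"
  unfolding kf_def mulop_symmetric[OF m, of "emb s a"] mulop_symmetric[OF rho_bdd[OF s], of "hart (emb s a)"] ..

lemma kf_bound:
  assumes s: "0 < s" "s \<le> 1" and m: "bdd_mult C m" and C: "C \<ge> 0"
  shows "\<bar>kf s m a b\<bar> \<le> (1 + C) * norm (emb s a) * norm b"
proof -
  have s0: "s \<ge> 0" using s by simp
  have "\<bar>inner (mulop (rho s) (hart (emb s a))) (hart (emb s b))\<bar> \<le> norm (mulop (rho s) (hart (emb s a))) * norm (hart (emb s b))"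
    by (rule Cauchy_Schwarz_ineq2)
  also have "\<dots> \<le> norm (emb s a) * norm b"
    using mulop_norm[OF rho_bdd[OF s], of "hart (emb s a)"] emb_norm[OF s0, of b]
    by (intro mult_mono) (auto simp: hart_norm)
  finally have 1: "\<bar>inner (mulop (rho s) (hart (emb s a))) (hart (emb s b))\<bar> \<le> norm (emb s a) * norm b" .
  have "\<bar>inner (mulop m (emb s a)) (emb s b)\<bar> \<le> norm (mulop m (emb s a)) * norm (emb s b)"
    by (rule Cauchy_Schwarz_ineq2)
  also have "\<dots> \<le> (C * norm (emb s a)) * norm b"
    using mulop_norm[OF m C, of "emb s a"] emb_norm[OF s0, of b] C by (intro mult_mono) auto
  finally show ?thesis using 1 unfolding kf_def by (simp add: algebra_simps)
qed

lemma kf_diff: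
  assumes s: "0 < s" "s \<le> 1" and m: "bdd_mult C m" and k: "bdd_mult C' k" and d: "bdd_mult D (\<lambda>x. m x - k x)" "D \<ge> 0"
  shows "\<bar>kf s m a b - kf s k a b\<bar> \<le> D * norm a * norm b"
proof -
  have s0: "s \<ge> 0" using s by simp
  have eq: "mulop m x - mulop k x = mulop (\<lambda>x. m x - k x) x" for x
    by (rule l2_eqI, use fn_mulop[OF m, of x] fn_mulop[OF k, of x] fn_mulop[OF d(1), of x] fn_diff[of "mulop m x" "mulop k x"] in eventually_elim)
      (simp add: left_diff_distrib)
  have "kf s m a b - kf s k a b = - inner (mulop (\<lambda>x. m x - k x) (emb s a)) (emb s b)"
    unfolding kf_def eq[symmetric] by (simp add: inner_diff_left)
  also have "\<bar>\<dots>\<bar> \<le> norm (mulop (\<lambda>x. m x - k x) (emb s a)) * norm (emb s b)"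
    unfolding abs_minus_cancel by (rule Cauchy_Schwarz_ineq2)
  also have "\<dots> \<le> (D * norm a) * norm b"
    using mulop_norm[OF d, of "emb s a"] emb_norm[OF s0, of a] emb_norm[OF s0, of b] d(2)
    by (intro mult_mono) (auto intro: order_trans mult_left_mono)
  finally show ?thesis .
qed

section \<open>Smooth functions\<close>

lemma Ck_derivative:
  assumes "Ck (Suc k) f"
  shows "(f has_derivative frechet_derivative f (at x)) (at x)"
  using assms by (simp add: frechet_derivative_works[symmetric])

lemma Ck_SucI:
  assumes "\<And>x. (f has_derivative D x) (at x)" "\<And>v. Ck k (\<lambda>x. D x v)"
  shows "Ck (Suc k) f"
proof -
  have "frechet_derivative f (at x) = D x" for x by (rule frechet_derivative_at[OF assms(1), symmetric])
  then show ?thesis using assms by (auto simp: differentiable_def)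
qed

lemma Ck_continuous: "Ck k f \<Longrightarrow> continuous_on UNIV f"
  by (cases k) (auto intro!: differentiable_imp_continuous_on simp: differentiable_on_def intro: differentiable_at_withinI)

lemma Ck_Suc_imp: "Ck (Suc k) f \<Longrightarrow> Ck k f"
proof (induction k arbitrary: f)
  case 0
  then show ?case using Ck_continuous by fastforce
next
  case (Suc k)
  have "Ck k (\<lambda>x. frechet_derivative f (at x) v)" for v
    by (rule Suc.IH) (use Suc.prems in simp)
  then show ?case using Suc.prems by simp
qed

lemma Ck_const: "Ck k (\<lambda>x. c)"
proof (induction k arbitrary: c)
  case (Suc k)
  show ?case by (rule Ck_SucI[where D="\<lambda>x v. 0"]) (auto intro: Suc.IH)
qed simp

lemma Ck_linear:
  assumes "bounded_linear f"
  shows "Ck k f"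
proof (cases k)
  case 0
  then show ?thesis using assms by (auto intro: linear_continuous_on)
next
  case (Suc j)
  show ?thesis unfolding Suc by (rule Ck_SucI[OF bounded_linear.has_derivative[OF assms has_derivative_ident]]) (rule Ck_const)
qed

lemma Ck_add: "Ck k f \<Longrightarrow> Ck k g \<Longrightarrow> Ck k (\<lambda>x. f x + g x)"
proof (induction k arbitrary: f g)
  case 0
  then show ?case by (auto intro: continuous_intros)
next
  case (Suc k)
  show ?case
  proof (rule Ck_SucI)
    show "((\<lambda>x. f x + g x) has_derivative (\<lambda>v. frechet_derivative f (at x) v + frechet_derivative g (at x) v)) (at x)" for x
      by (intro has_derivative_add Ck_derivative[OF Suc.prems(1)] Ck_derivative[OF Suc.prems(2)])
    show "Ck k (\<lambda>x. frechet_derivative f (at x) v + frechet_derivative g (at x) v)" for v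
      by (rule Suc.IH) (use Suc.prems in auto)
  qed
qed

lemma Ck_mult: "Ck k f \<Longrightarrow> Ck k g \<Longrightarrow> Ck k (\<lambda>x. f x * g x)"
proof (induction k arbitrary: f g)
  case 0
  then show ?case by (auto intro: continuous_intros)
next
  case (Suc k)
  show ?case
  proof (rule Ck_SucI)
    show "((\<lambda>x. f x * g x) has_derivative (\<lambda>v. f x * frechet_derivative g (at x) v + frechet_derivative f (at x) v * g x)) (at x)" for x
      by (intro has_derivative_mult Ck_derivative[OF Suc.prems(1)] Ck_derivative[OF Suc.prems(2)])
    have fg: "Ck k f" "Ck k g" by (rule Ck_Suc_imp[OF Suc.prems(1)], rule Ck_Suc_imp[OF Suc.prems(2)])
    have D: "Ck k (\<lambda>x. frechet_derivative f (at x) v)" "Ck k (\<lambda>x. frechet_derivative g (at x) v)" for v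
      using Suc.prems by auto
    show "Ck k (\<lambda>x. f x * frechet_derivative g (at x) v + frechet_derivative f (at x) v * g x)" for v
      by (rule Ck_add[OF Suc.IH[OF fg(1) D(2)] Suc.IH[OF D(1) fg(2)]])
  qed
qed

lemma smooth_const: "smooth (\<lambda>x. c)" and smooth_add: "smooth f \<Longrightarrow> smooth g \<Longrightarrow> smooth (\<lambda>x. f x + g x)"
  and smooth_mult: "smooth f \<Longrightarrow> smooth g \<Longrightarrow> smooth (\<lambda>x. f x * g x)"
  and smooth_linear: "bounded_linear h \<Longrightarrow> smooth h"
  unfolding smooth_def by (simp_all add: Ck_const Ck_add Ck_mult Ck_linear)

lemma smooth_minus: "smooth f \<Longrightarrow> smooth (\<lambda>x. - f x)"
  using smooth_mult[OF smooth_const[of "- 1"], of f] by simp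

lemma smooth_diff: "smooth f \<Longrightarrow> smooth g \<Longrightarrow> smooth (\<lambda>x. f x - g x)"
  using smooth_add[OF _ smooth_minus, of f g] by simp

lemma smooth_continuous: "smooth f \<Longrightarrow> continuous_on UNIV f"
  unfolding smooth_def using Ck_continuous by blast

text \<open>The family \<open>flat k\<close> is closed under differentiation up to linear combinations.\<close>

definition flat :: "nat \<Rightarrow> real \<Rightarrow> real" where
  "flat k t = (if t > 0 then (1 / t) ^ k * exp (- (1 / t)) else 0)"

lemma flat_tendsto_0: "(flat k \<longlongrightarrow> 0) (at 0)"
proof (rule filterlim_split_at)
  have "((\<lambda>t::real. 0::real) \<longlongrightarrow> 0) (at_left 0)" by simp
  then show "(flat k \<longlongrightarrow> 0) (at_left 0)"
    by (rule Lim_transform_eventually) (auto simp: eventually_at_left_field flat_def intro!: exI[of _ "-1"])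
  have "((\<lambda>t::real. (inverse t) ^ k / exp (inverse t)) \<longlongrightarrow> 0) (at_right 0)"
    by (rule filterlim_compose[OF tendsto_power_div_exp_0 filterlim_inverse_at_top_right])
  then show "(flat k \<longlongrightarrow> 0) (at_right 0)"
    by (rule Lim_transform_eventually)
      (auto simp: eventually_at_right_field flat_def exp_minus field_simps intro!: exI[of _ 1])
qed

lemma flat_derivative: "(flat k has_real_derivative (flat (k + 2) t - real k * flat (k + 1) t)) (at t)"
proof -
  consider "t < 0" | "t = 0" | "t > 0" by linarith
  then show ?thesis
  proof cases
    case 1
    have "((\<lambda>_. 0) has_real_derivative 0) (at t)" by simp
    then have "(flat k has_real_derivative 0) (at t)"
      by (rule has_field_derivative_transform_within_open[where S="{..<0}"]) (use 1 in \<open>auto simp: flat_def\<close>)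
    then show ?thesis using 1 by (simp add: flat_def)
  next
    case 2
    \<comment> \<open>Off zero, the difference quotient of \<open>flat k\<close> at 0 is
      \<open>flat (k + 1)\<close>.\<close>
    have "((\<lambda>h. (flat k (0 + h) - flat k 0) / h) \<longlongrightarrow> 0) (at 0)"
      by (rule Lim_transform_eventually[OF flat_tendsto_0[of "k + 1"]])
        (auto simp: flat_def eventually_at_filter)
    then show ?thesis using 2 by (simp add: DERIV_def flat_def)
  next
    case 3
    have "((\<lambda>t. (1 / t) ^ k * exp (- (1 / t))) has_real_derivative
        ((1 / t) ^ (k + 2) * exp (- (1 / t)) - real k * ((1 / t) ^ (k + 1) * exp (- (1 / t))))) (at t)"
    proof (cases k)
      case 0
      then show ?thesis using 3 by (auto intro!: derivative_eq_intros simp: power2_eq_square)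
    next
      case (Suc j)
      have y: "((\<lambda>t. 1 / t) has_real_derivative - ((1 / t) * (1 / t))) (at t)"
        using 3 by (auto intro!: derivative_eq_intros simp: power2_eq_square)
      have E: "((\<lambda>t. exp (- (1 / t))) has_real_derivative exp (- (1 / t)) * ((1 / t) * (1 / t))) (at t)"
        using DERIV_fun_exp[OF DERIV_minus[OF y]] by simp
      have p: "((\<lambda>t. (1 / t) ^ Suc j) has_real_derivative (1 + real j) * (- ((1 / t) * (1 / t)) * (1 / t) ^ j)) (at t)"
        by (rule DERIV_power_Suc[OF y])
      show ?thesis unfolding Suc
        by (rule DERIV_cong[OF DERIV_mult[OF p E]]) (simp add: algebra_simps)
    qed
    then have "(flat k has_real_derivative
        ((1 / t) ^ (k + 2) * exp (- (1 / t)) - real k * ((1 / t) ^ (k + 1) * exp (- (1 / t))))) (at t)"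
      by (rule has_field_derivative_transform_within_open[where S="{0<..}"]) (use 3 in \<open>auto simp: flat_def\<close>)
    then show ?thesis using 3 by (simp add: flat_def)
  qed
qed

text \<open>Each differentiation raises the index of \<open>flat\<close>, so the induction on the
  order runs over all \<open>k\<close> simultaneously.\<close>

lemma Ck_flat_comp:
  assumes "smooth q"
  shows "Ck j (\<lambda>x. flat k (q x))"
proof (induction j arbitrary: k)
  case 0
  have "continuous_on UNIV (flat k)"
    using DERIV_isCont[OF flat_derivative] by (simp add: continuous_on_eq_continuous_at)
  then show ?case using smooth_continuous[OF assms] by (auto intro: continuous_on_compose2)
next
  case (Suc j)
  have q: "Ck i q" for i using assms by (simp add: smooth_def)
  show ?case
  proof (rule Ck_SucI)
    show "((\<lambda>x. flat k (q x)) has_derivative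
       (\<lambda>v. frechet_derivative q (at x) v * (flat (k + 2) (q x) - real k * flat (k + 1) (q x)))) (at x)" for x
      using has_derivative_compose[OF Ck_derivative[OF q[of "Suc 0"], of x] flat_derivative[of k "q x", unfolded has_field_derivative_def]]
      by (simp add: mult.commute)
    have "Ck j (\<lambda>x. flat (k + 2) (q x) + (- real k) * flat (k + 1) (q x))"
      by (intro Ck_add Ck_mult Ck_const Suc.IH)
    then have f: "Ck j (\<lambda>x. flat (k + 2) (q x) - real k * flat (k + 1) (q x))" by simp
    show "Ck j (\<lambda>x. frechet_derivative q (at x) v * (flat (k + 2) (q x) - real k * flat (k + 1) (q x)))" for v
      by (rule Ck_mult[OF _ f]) (use q[of "Suc j"] in simp)
  qed
qed

section \<open>Bump functions and test functions\<close>

definition bump :: "'a::euclidean_space \<Rightarrow> real \<Rightarrow> 'a \<Rightarrow> real" where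
  "bump x0 r x = flat 0 (r\<^sup>2 - (norm (x - x0))\<^sup>2)"

lemma smooth_inner: "smooth (\<lambda>x. x \<bullet> v)"
  by (rule smooth_linear[OF bounded_linear_inner_left])

lemma smooth_norm_sq: "smooth (\<lambda>x::'a::euclidean_space. (norm (x - x0))\<^sup>2)"
proof -
  have "smooth (\<lambda>x. \<Sum>b\<in>B. (x \<bullet> b - x0 \<bullet> b) * (x \<bullet> b - x0 \<bullet> b))" if "finite B" for B :: "'a set"
    using that by induction (auto intro!: smooth_add smooth_mult smooth_diff smooth_inner smooth_const)
  from this[OF finite_Basis] show ?thesis
    unfolding power2_norm_eq_inner by (subst euclidean_inner) (simp add: inner_diff_left)
qed

lemma smooth_bump: "smooth (bump x0 r)"
  unfolding smooth_def bump_def[abs_def]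
  by (auto intro!: Ck_flat_comp smooth_diff smooth_const smooth_norm_sq)

lemma bump_pos: "r > 0 \<Longrightarrow> norm (x - x0) < r \<Longrightarrow> bump x0 r x > 0"
proof -
  assume "r > 0" "norm (x - x0) < r"
  then have "(norm (x - x0))\<^sup>2 < r\<^sup>2" by (intro power_strict_mono) auto
  then show ?thesis by (simp add: bump_def flat_def)
qed

lemma bump_zero: "r > 0 \<Longrightarrow> norm (x - x0) \<ge> r \<Longrightarrow> bump x0 r x = 0"
proof -
  assume "r > 0" "norm (x - x0) \<ge> r"
  then have "(norm (x - x0))\<^sup>2 \<ge> r\<^sup>2" by (intro power_mono) auto
  then show ?thesis by (simp add: bump_def flat_def)
qed

lemma bump_nonneg: "bump x0 r x \<ge> 0"
  by (simp add: bump_def flat_def)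

lemma test_funI:
  fixes \<phi> :: "real ^ 'n \<Rightarrow> real"
  assumes "smooth \<phi>" "\<And>x. \<phi> x \<noteq> 0 \<Longrightarrow> x \<in> cball x0 r" "cball x0 r \<subseteq> W"
  shows "\<phi> \<in> test_fun W"
proof -
  have "closure {x. \<phi> x \<noteq> 0} \<subseteq> cball x0 r" using assms(2) by (intro closure_minimal) auto
  then show ?thesis unfolding test_fun_def using assms(1,3)
    by (auto simp: compact_eq_bounded_closed intro: bounded_subset[OF bounded_cball])
qed

lemma test_fun_Cc:
  fixes \<phi> :: "real ^ 'n \<Rightarrow> real"
  assumes "\<phi> \<in> test_fun W"
  shows "\<phi> \<in> Cc" and "\<And>x. x \<notin> W \<Longrightarrow> \<phi> x = 0"
proof -
  have s: "smooth \<phi>" "compact (closure {x. \<phi> x \<noteq> 0})" "closure {x. \<phi> x \<noteq> 0} \<subseteq> W" using assms by (auto simp: test_fun_def)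
  obtain R where R: "R > 0" "\<forall>x\<in>closure {x. \<phi> x \<noteq> 0}. norm x \<le> R" using compact_imp_bounded[OF s(2)] bounded_pos by metis
  have "\<phi> x = 0" if "norm x > R" for x
    using R(2) that closure_subset[of "{x. \<phi> x \<noteq> 0}"] by (metis (mono_tags, lifting) mem_Collect_eq not_le subsetD)
  then show "\<phi> \<in> Cc" unfolding Cc_def using smooth_continuous[OF s(1)] R(1) by auto
  show "\<phi> x = 0" if "x \<notin> W" for x
    using that s(3) closure_subset[of "{x. \<phi> x \<noteq> 0}"] by blast
qed

section \<open>Test functions lie in the Sobolev spaces\<close>

lemma C1_Cc_lipschitz:
  fixes \<phi> :: "'a::euclidean_space \<Rightarrow> real"
  assumes C1: "Ck 1 \<phi>" and Cc: "\<phi> \<in> Cc"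
  obtains L where "L > 0" "\<And>x y. \<bar>\<phi> x - \<phi> y\<bar> \<le> L * norm (x - y)"
proof -
  obtain R where R: "R > 0" "\<And>x. norm x > R \<Longrightarrow> \<phi> x = 0" using Cc by (auto simp: Cc_def)
  define D where "D x = frechet_derivative \<phi> (at x)" for x
  have D: "(\<phi> has_derivative D x) (at x)" for x unfolding D_def by (rule Ck_derivative[of 0]) (use C1 in simp)
  have Dc: "continuous_on UNIV (\<lambda>x. D x v)" for v using C1 unfolding D_def by simp
  have "\<exists>M. \<forall>x\<in>cball 0 R. \<bar>D x b\<bar> \<le> M" for b
  proof -
    have "compact ((\<lambda>x. D x b) ` cball 0 R)" using Dc by (intro compact_continuous_image compact_cball) (auto intro: continuous_on_subset)
    from compact_imp_bounded[OF this] show ?thesis unfolding bounded_iff by auto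
  qed
  then obtain M where M: "\<And>b x. norm x \<le> R \<Longrightarrow> \<bar>D x b\<bar> \<le> M b" by (metis mem_cball_0)
  define L where "L = 1 + (\<Sum>b\<in>Basis. \<bar>M b\<bar>)"
  have L: "L > 0" unfolding L_def by (simp add: add_pos_nonneg sum_nonneg)
  have out: "D x v = 0" if "norm x > R" for x v
  proof -
    have "((\<lambda>_. 0) has_derivative (\<lambda>_. 0)) (at x)" by simp
    then have "(\<phi> has_derivative (\<lambda>_. 0)) (at x)"
      by (rule has_derivative_transform_within_open[of _ _ x UNIV "- cball 0 R"]) (use that R in auto)
    then have "D x = (\<lambda>_. 0)" using D has_derivative_unique by blast
    then show ?thesis by simp
  qed
  have "\<bar>D x v\<bar> \<le> L * norm v" for x v
  proof (cases "norm x > R")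
    case False
    have lin: "linear (D x)" using D[of x] by (simp add: has_derivative_linear)
    have "D x v = D x (\<Sum>b\<in>Basis. (v \<bullet> b) *\<^sub>R b)" by (simp add: euclidean_representation)
    also have "\<dots> = (\<Sum>b\<in>Basis. (v \<bullet> b) * D x b)" by (simp add: linear_sum[OF lin] linear_scale[OF lin])
    finally have "\<bar>D x v\<bar> \<le> (\<Sum>b\<in>Basis. \<bar>(v \<bullet> b) * D x b\<bar>)" by simp
    also have "\<dots> \<le> (\<Sum>b\<in>Basis. norm v * \<bar>M b\<bar>)"
      unfolding abs_mult using False by (intro sum_mono mult_mono Basis_le_norm) (auto intro!: order_trans[OF M abs_ge_self])
    also have "\<dots> = norm v * (\<Sum>b\<in>Basis. \<bar>M b\<bar>)" by (simp add: sum_distrib_left)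
    also have "\<dots> \<le> L * norm v" unfolding L_def by (simp add: algebra_simps)
    finally show ?thesis .
  qed (use out L in simp)
  then have on: "onorm (D x) \<le> L" for x by (intro onorm_le) (simp add: real_norm_def)
  have "norm (\<phi> x - \<phi> y) \<le> L * norm (x - y)" for x y
    by (rule differentiable_bound[of UNIV \<phi> D]) (use D on in auto)
  then show ?thesis using that L by simp
qed

text \<open>The symmetric difference is essential for a simple multiplier: shifts by
  \<open>h\<close> and \<open>- h\<close> leave a pure sine factor, at the cost of reflecting
  \<xi>.\<close>

lemma hl_central_difference:
  fixes f :: "'a::euclidean_space \<Rightarrow> real"
  assumes f: "integrable lborel f"
  shows "hl (\<lambda>x. f (x + h) - f (x - h)) \<xi> = - 2 * sin (\<xi> \<bullet> h) * hl f (- \<xi>)"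
proof -
  have [measurable]: "f \<in> borel_measurable borel" using f by auto
  define nf where "nf = (2 * pi) powr (- real DIM('a) / 2)"
  have tr: "(LINT x|lborel. g (x + k)) = (LINT x|lborel. g x)" if [measurable]: "g \<in> borel_measurable borel" for g :: "'a \<Rightarrow> real" and k
    using lborel_affine_integral[of g 1 k] by (simp add: add.commute)
  have ti: "integrable lborel (\<lambda>x. f (x + k))" for k
  proof -
    have "integrable (distr lborel borel (\<lambda>x. k + x)) f" using f lborel_affine[of 1 k] by (simp add: density_1 add.commute)
    then show ?thesis by (subst (asm) integrable_distr_eq) (auto simp: add.commute)
  qed
  have c: "(LINT x|lborel. cas (\<xi> \<bullet> x) * f (x + k)) = (LINT x|lborel. cas (\<xi> \<bullet> x - \<xi> \<bullet> k) * f x)" for k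
    using tr[of "\<lambda>x. cas (\<xi> \<bullet> x - \<xi> \<bullet> k) * f x" k] by (simp add: inner_add_right)
  have i: "integrable lborel (\<lambda>x. cas (\<xi> \<bullet> x + t) * f x)" for t
    by (rule Bochner_Integration.integrable_bound[OF integrable_mult_right[OF f, of 2]])
      (auto simp: abs_mult intro!: mult_right_mono cas_bound)
  have "hl (\<lambda>x. f (x + h) - f (x - h)) \<xi> = nf * ((LINT x|lborel. cas (\<xi> \<bullet> x) * f (x + h)) - (LINT x|lborel. cas (\<xi> \<bullet> x) * f (x + (- h))))"
    unfolding hl_def nf_def using integrable_cas[OF ti[of h], of \<xi>] integrable_cas[OF ti[of "- h"], of \<xi>]
    by (simp add: right_diff_distrib)
  also have "\<dots> = nf * (LINT x|lborel. cas (\<xi> \<bullet> x + (- (\<xi> \<bullet> h))) * f x - cas (\<xi> \<bullet> x + \<xi> \<bullet> h) * f x)"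
    unfolding c Bochner_Integration.integral_diff[OF i i] by simp
  also have "\<dots> = nf * (LINT x|lborel. (- 2 * sin (\<xi> \<bullet> h)) * ((cos (\<xi> \<bullet> x) - sin (\<xi> \<bullet> x)) * f x))"
  proof -
    have "cas (\<xi> \<bullet> x + (- (\<xi> \<bullet> h))) * f x - cas (\<xi> \<bullet> x + \<xi> \<bullet> h) * f x = (- 2 * sin (\<xi> \<bullet> h)) * ((cos (\<xi> \<bullet> x) - sin (\<xi> \<bullet> x)) * f x)" for x
      unfolding cas_def by (simp add: sin_add cos_add sin_diff cos_diff algebra_simps)
    then show ?thesis by simp
  qed
  also have "\<dots> = - 2 * sin (\<xi> \<bullet> h) * hl f (- \<xi>)"
    unfolding hl_uminus nf_def[symmetric] by simp
  finally show ?thesis .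
qed

lemma Cc_translate: "f \<in> Cc \<Longrightarrow> (\<lambda>x. f (x + h)) \<in> Cc"
proof -
  assume "f \<in> Cc"
  then obtain R where R: "continuous_on UNIV f" "R > 0" "\<And>x. norm x > R \<Longrightarrow> f x = 0" by (auto simp: Cc_def)
  have "f (x + h) = 0" if "norm x > R + norm h" for x
    using R(3)[of "x + h"] norm_triangle_ineq4[of "x + h" h] that by simp
  moreover have "continuous_on UNIV (\<lambda>x. f (x + h))"
    by (rule continuous_on_compose2[OF R(1)]) (auto intro: continuous_intros)
  moreover have "R + norm h > 0" using R(2) by (simp add: add_pos_nonneg)
  ultimately show ?thesis unfolding Cc_def by blast
qed

text \<open>The difference quotient criterion. Plancherel bounds the transforms of the quotients in
  direction \<open>b\<close> uniformly, and Fatou passes to the limit since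
  \<open>sin (t * (\<xi> \<bullet> b)) / t\<close> tends to
  \<open>\<xi> \<bullet> b\<close>.\<close>

lemma lipschitz_Cc_gradient:
  fixes f :: "'a::euclidean_space \<Rightarrow> real"
  assumes f: "f \<in> Cc" and L: "L > 0" "\<And>x y. \<bar>f x - f y\<bar> \<le> L * norm (x - y)" and b: "b \<in> Basis"
  shows "integrable lborel (\<lambda>\<xi>. (\<xi> \<bullet> b)\<^sup>2 * (hl f \<xi>)\<^sup>2)"
proof -
  obtain R where R: "R > 0" "\<And>x. norm x > R \<Longrightarrow> f x = 0" using f by (auto simp: Cc_def)
  note [measurable] = Cc_measurable[OF f] hl_measurable[OF Cc_measurable[OF f]]
  \<comment> \<open>Bounds the squared L2 norm of all quotients: they are at most
    \<open>2 * L\<close>, and steps of length at most 1 keep them supported in the ball of radius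
    \<open>R + 1\<close>.\<close>
  define K where "K = (LINT x|lborel. (2 * L * indicator (cball (0::'a) (R + 1)) x :: real)\<^sup>2)"
  define t where "t k = 1 / real (Suc k)" for k
  have t: "0 < t k" "t k \<le> 1" for k by (auto simp: t_def)
  have est: "(\<integral>\<^sup>+\<xi>. ennreal ((2 * sin (t k * (\<xi> \<bullet> b)) / t k * hl f (- \<xi>))\<^sup>2) \<partial>lborel) \<le> ennreal K" for k
  proof -
    define h where "h = t k *\<^sub>R b"
    have nh: "norm h = t k" using b t[of k] by (simp add: h_def)
    define d where "d x = f (x + h) - f (x - h)" for x
    have dC: "d \<in> Cc" unfolding d_def using Cc_diff[OF Cc_translate[OF f, of h] Cc_translate[OF f, of "- h"]] by simp
    have db: "\<bar>d x\<bar> \<le> t k * (2 * L * indicator (cball 0 (R + 1)) x)" for x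
    proof (cases "norm x > R + 1")
      case True
      have "norm (x + h) > R" "norm (x - h) > R"
        using True norm_triangle_ineq4[of "x + h" h] norm_triangle_ineq[of "x - h" h] nh t(2)[of k] by auto
      then show ?thesis using R(2) True by (simp add: d_def indicator_def)
    next
      case False
      have "\<bar>d x\<bar> \<le> L * norm ((x + h) - (x - h))" unfolding d_def by (rule L(2))
      also have "(x + h) - (x - h) = 2 *\<^sub>R h" by (simp add: scaleR_2)
      finally show ?thesis using False nh by (simp add: indicator_def mult_ac)
    qed
    have hd: "hl d \<xi> = - 2 * sin (t k * (\<xi> \<bullet> b)) * hl f (- \<xi>)" for \<xi>
      unfolding d_def hl_central_difference[OF Cc_integrable(1)[OF f]] by (simp add: h_def)
    have hs: "hl d \<in> sqint" by (rule hl_plancherel_Cc[OF dC])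
    note [measurable] = Cc_measurable[OF dC] hl_measurable[OF Cc_measurable[OF dC]]
    have hi: "integrable lborel (\<lambda>\<xi>. (hl d \<xi>)\<^sup>2)" using hs by (auto simp: sqint_def integrable_completion)
    have "(LINT \<xi>|lborel. (hl d \<xi>)\<^sup>2) = (LINT x|lborel. (d x)\<^sup>2)"
    proof -
      have "(norm (cls (hl d)))\<^sup>2 = (norm (cls d))\<^sup>2" using hl_plancherel_Cc(2)[OF dC] by simp
      then show ?thesis unfolding norm_cls_sq[OF hs] norm_cls_sq[OF Cc_integrable(3)[OF dC]]
        by (subst (asm) (1 2) integral_completion) auto
    qed
    also have "\<dots> \<le> (LINT x|lborel. (t k)\<^sup>2 * (2 * L * indicator (cball (0::'a) (R + 1)) x :: real)\<^sup>2)"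
    proof (rule integral_mono)
      show "integrable lborel (\<lambda>x. (t k)\<^sup>2 * (2 * L * indicator (cball (0::'a) (R + 1)) x :: real)\<^sup>2)"
        by (intro integrable_mult_right indicator_square_integrable)
      show "(d x)\<^sup>2 \<le> (t k)\<^sup>2 * (2 * L * indicator (cball (0::'a) (R + 1)) x :: real)\<^sup>2" for x
        using power_mono[OF db[of x], of 2] by (simp add: power_mult_distrib)
    qed (rule Cc_integrable(2)[OF dC])
    also have "\<dots> = (t k)\<^sup>2 * K" unfolding K_def by simp
    finally have I: "(LINT \<xi>|lborel. (hl d \<xi>)\<^sup>2) \<le> (t k)\<^sup>2 * K" .
    have "(\<integral>\<^sup>+\<xi>. ennreal ((2 * sin (t k * (\<xi> \<bullet> b)) / t k * hl f (- \<xi>))\<^sup>2) \<partial>lborel) = (\<integral>\<^sup>+\<xi>. ennreal (1 / (t k)\<^sup>2 * (hl d \<xi>)\<^sup>2) \<partial>lborel)"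
      using t(1)[of k] by (intro nn_integral_cong) (simp add: hd power_mult_distrib power_divide)
    also have "\<dots> = ennreal (1 / (t k)\<^sup>2 * (LINT \<xi>|lborel. (hl d \<xi>)\<^sup>2))"
      using hi by (subst nn_integral_eq_integral) auto
    also have "\<dots> \<le> ennreal K" using I t(1)[of k] by (intro ennreal_leI) (simp add: field_simps)
    finally show ?thesis .
  qed
  have "(\<integral>\<^sup>+\<xi>. ennreal ((2 * (\<xi> \<bullet> b) * hl f (- \<xi>))\<^sup>2) \<partial>lborel) =
        (\<integral>\<^sup>+\<xi>. liminf (\<lambda>k. ennreal ((2 * sin (t k * (\<xi> \<bullet> b)) / t k * hl f (- \<xi>))\<^sup>2)) \<partial>lborel)"
  proof (rule nn_integral_cong)
    fix \<xi> :: 'a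
    have "((\<lambda>h. sin (h * (\<xi> \<bullet> b)) / h) \<longlongrightarrow> \<xi> \<bullet> b) (at 0)"
    proof -
      have "((\<lambda>h. sin (h * (\<xi> \<bullet> b))) has_real_derivative \<xi> \<bullet> b) (at 0)"
        by (auto intro!: derivative_eq_intros)
      then show ?thesis by (simp add: DERIV_def)
    qed
    moreover have "filterlim t (at 0) sequentially"
      unfolding filterlim_at using LIMSEQ_inverse_real_of_nat t(1)
      by (auto simp: t_def[abs_def] inverse_eq_divide less_imp_neq[symmetric])
    ultimately have "(\<lambda>k. sin (t k * (\<xi> \<bullet> b)) / t k) \<longlonglongrightarrow> \<xi> \<bullet> b" by (rule filterlim_compose)
    then have "(\<lambda>k. (2 * (sin (t k * (\<xi> \<bullet> b)) / t k) * hl f (- \<xi>))\<^sup>2) \<longlonglongrightarrow> (2 * (\<xi> \<bullet> b) * hl f (- \<xi>))\<^sup>2"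
      by (intro tendsto_intros)
    then have "(\<lambda>k. ennreal ((2 * sin (t k * (\<xi> \<bullet> b)) / t k * hl f (- \<xi>))\<^sup>2)) \<longlonglongrightarrow> ennreal ((2 * (\<xi> \<bullet> b) * hl f (- \<xi>))\<^sup>2)"
      by (intro tendsto_ennrealI) simp
    then show "ennreal ((2 * (\<xi> \<bullet> b) * hl f (- \<xi>))\<^sup>2) = liminf (\<lambda>k. ennreal ((2 * sin (t k * (\<xi> \<bullet> b)) / t k * hl f (- \<xi>))\<^sup>2))"
      by (intro lim_imp_Liminf[symmetric]) auto
  qed
  also have "\<dots> \<le> liminf (\<lambda>k. \<integral>\<^sup>+\<xi>. ennreal ((2 * sin (t k * (\<xi> \<bullet> b)) / t k * hl f (- \<xi>))\<^sup>2) \<partial>lborel)"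
    by (rule nn_integral_liminf) measurable
  also have "\<dots> \<le> ennreal K" by (rule Liminf_le) (use est in auto)
  finally have fin: "(\<integral>\<^sup>+\<xi>. ennreal ((2 * (\<xi> \<bullet> b) * hl f (- \<xi>))\<^sup>2) \<partial>lborel) \<le> ennreal K" .
  have "(\<integral>\<^sup>+\<xi>. ennreal ((2 * ((- \<xi>) \<bullet> b) * hl f \<xi>)\<^sup>2) \<partial>lborel) = (\<integral>\<^sup>+\<xi>. ennreal ((2 * (\<xi> \<bullet> b) * hl f (- \<xi>))\<^sup>2) \<partial>lborel)"
    using nn_integral_uminus[of "\<lambda>\<xi>. ennreal ((2 * ((- \<xi>) \<bullet> b) * hl f \<xi>)\<^sup>2)"] by simp
  then have "(\<integral>\<^sup>+\<xi>. ennreal ((2 * ((- \<xi>) \<bullet> b) * hl f \<xi>)\<^sup>2) \<partial>lborel) < \<infinity>"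
    using fin le_less_trans by fastforce
  then have "integrable lborel (\<lambda>\<xi>. (2 * ((- \<xi>) \<bullet> b) * hl f \<xi>)\<^sup>2)"
    by (intro integrableI_nonneg) auto
  then have "integrable lborel (\<lambda>\<xi>. (1/4) * (2 * ((- \<xi>) \<bullet> b) * hl f \<xi>)\<^sup>2)" by (rule integrable_mult_right)
  then show ?thesis by (simp add: power_mult_distrib)
qed

text \<open>The gradient bounds in all coordinate directions give the Sobolev space of order 1, and
  the weight of order \<open>s \<le> 1\<close> is smaller.\<close>

lemma lipschitz_Cc_in_Hs:
  fixes f :: "'a::euclidean_space \<Rightarrow> real"
  assumes f: "f \<in> Cc" and L: "L > 0" "\<And>x y. \<bar>f x - f y\<bar> \<le> L * norm (x - y)" and s: "0 \<le> s" "s \<le> 1"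
  shows "in_Hs s f"
proof -
  obtain R where R: "R > 0" "\<And>x. norm x > R \<Longrightarrow> f x = 0" using f by (auto simp: Cc_def)
  note [measurable] = Cc_measurable[OF f] hl_measurable[OF Cc_measurable[OF f]]
  have hfhl: "AE \<xi> in lborel. hl f \<xi> = hf f \<xi>"
    unfolding hf_def hart_Cc[OF f] using fn_cls[OF hl_plancherel_Cc(1)[OF f]] by eventually_elim simp
  have i0: "integrable lborel (\<lambda>\<xi>. (hl f \<xi>)\<^sup>2)" using hl_plancherel_Cc(1)[OF f] by (auto simp: sqint_def integrable_completion)
  have "integrable lborel (\<lambda>\<xi>. (hl f \<xi>)\<^sup>2 + (\<Sum>b\<in>Basis. (\<xi> \<bullet> b)\<^sup>2 * (hl f \<xi>)\<^sup>2))"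
    by (intro Bochner_Integration.integrable_add i0 Bochner_Integration.integrable_sum lipschitz_Cc_gradient[OF f L])
  also have "(\<lambda>\<xi>. (hl f \<xi>)\<^sup>2 + (\<Sum>b\<in>Basis. (\<xi> \<bullet> b)\<^sup>2 * (hl f \<xi>)\<^sup>2)) = (\<lambda>\<xi>. jap \<xi> * (hl f \<xi>)\<^sup>2)"
  proof
    fix \<xi> :: 'a
    have "(norm \<xi>)\<^sup>2 = (\<Sum>b\<in>Basis. (\<xi> \<bullet> b)\<^sup>2)"
      unfolding power2_norm_eq_inner euclidean_inner[of \<xi> \<xi>] by (simp add: power2_eq_square)
    then show "(hl f \<xi>)\<^sup>2 + (\<Sum>b\<in>Basis. (\<xi> \<bullet> b)\<^sup>2 * (hl f \<xi>)\<^sup>2) = jap \<xi> * (hl f \<xi>)\<^sup>2"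
      unfolding jap_def by (simp add: sum_distrib_right distrib_right)
  qed
  finally have i1: "integrable lborel (\<lambda>\<xi>. jap \<xi> * (hl f \<xi>)\<^sup>2)" .
  have "(\<lambda>\<xi>. jap \<xi> powr (s / 2) * hl f \<xi>) \<in> sqint"
  proof (rule sqint_borelI)
    show "integrable lborel (\<lambda>\<xi>. (jap \<xi> powr (s / 2) * hl f \<xi>)\<^sup>2)"
    proof (rule Bochner_Integration.integrable_bound[OF i1])
      show "AE \<xi> in lborel. norm ((jap \<xi> powr (s / 2) * hl f \<xi>)\<^sup>2) \<le> norm (jap \<xi> * (hl f \<xi>)\<^sup>2)"
      proof (rule AE_I2)
        fix \<xi> :: 'a
        have "(jap \<xi> powr (s / 2))\<^sup>2 = jap \<xi> powr s" unfolding power2_eq_square by (simp flip: powr_add)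
        also have "\<dots> \<le> jap \<xi> powr 1" using s jap_ge1[of \<xi>] by (intro powr_mono) auto
        finally show "norm ((jap \<xi> powr (s / 2) * hl f \<xi>)\<^sup>2) \<le> norm (jap \<xi> * (hl f \<xi>)\<^sup>2)"
          using jap_pos[of \<xi>] by (simp add: power_mult_distrib abs_mult mult_right_mono)
      qed
    qed measurable
  qed measurable
  then have "(\<lambda>\<xi>. jap \<xi> powr (s / 2) * hf f \<xi>) \<in> sqint"
    by (rule sqint_AE) (use hfhl in \<open>measurable, auto elim!: eventually_mono\<close>)
  then show ?thesis unfolding in_Hs_def using Cc_integrable(3)[OF f] by simp
qed

lemma test_fun_in_Hs:
  fixes \<phi> :: "real ^ 'n \<Rightarrow> real"
  assumes "\<phi> \<in> test_fun W" "0 \<le> s" "s \<le> 1"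
  shows "in_Hs s \<phi>"
proof -
  have "Ck 1 \<phi>" using assms(1) by (simp add: test_fun_def smooth_def)
  then obtain L where "L > 0" "\<And>x y. \<bar>\<phi> x - \<phi> y\<bar> \<le> L * norm (x - y)"
    using C1_Cc_lipschitz test_fun_Cc(1)[OF assms(1)] by blast
  then show ?thesis using lipschitz_Cc_in_Hs test_fun_Cc(1)[OF assms(1)] assms by blast
qed

section \<open>Vanishing integrals against a separating algebra\<close>

text \<open>Testing with clipped continuous approximations of the sign of \<open>v\<close> gives in
  the limit the L1 norm of \<open>v\<close>.\<close>

lemma integral_continuous_zero_imp_AE_zero:
  fixes v :: "'a::euclidean_space \<Rightarrow> real"
  assumes v: "integrable lborel v"
    and z: "\<And>g B. continuous_on UNIV g \<Longrightarrow> (\<And>x. \<bar>g x\<bar> \<le> B) \<Longrightarrow> (LINT x|lborel. v x * g x) = 0"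
  shows "AE x in lborel. v x = 0"
proof -
  have [measurable]: "v \<in> borel_measurable borel" using v by auto
  have "(\<lambda>x. sgn (v x)) measurable_on UNIV"
    by (rule lebesgue_measurable_imp_measurable_on) (auto intro!: borel_measurable_lborel_lebesgue simp: sgn_real_def)
  then obtain N g where N: "negligible N" and g: "\<And>n. continuous_on UNIV (g n)"
    and lim: "\<And>x. x \<notin> N \<Longrightarrow> (\<lambda>n. g n x) \<longlonglongrightarrow> sgn (v x)"
    unfolding measurable_on_def by auto
  define h where "h n x = max (- 1) (min 1 (g n x))" for n x
  have hc: "continuous_on UNIV (h n)" for n unfolding h_def by (intro continuous_intros g)
  have hb: "\<bar>h n x\<bar> \<le> 1" for n x by (auto simp: h_def)
  have [measurable]: "h n \<in> borel_measurable borel" for n using hc by (rule borel_measurable_continuous_onI)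
  have "(\<lambda>n. LINT x|lborel. v x * h n x) \<longlonglongrightarrow> (LINT x|lborel. \<bar>v x\<bar>)"
  proof (rule integral_dominated_convergence[where w="\<lambda>x. \<bar>v x\<bar>"])
    have "AE x in lebesgue. x \<notin> N" using N by (auto simp: negligible_iff_null_sets intro: AE_not_in)
    then have "AE x in lborel. x \<notin> N" by (simp add: AE_lebesgue_iff)
    then show "AE x in lborel. (\<lambda>n. v x * h n x) \<longlonglongrightarrow> \<bar>v x\<bar>"
    proof eventually_elim
      case (elim x)
      have "(\<lambda>n. v x * h n x) \<longlonglongrightarrow> v x * max (- 1) (min 1 (sgn (v x)))"
        unfolding h_def by (intro tendsto_intros lim elim)
      moreover have "v x * max (- 1) (min 1 (sgn (v x))) = \<bar>v x\<bar>" by (auto simp: sgn_real_def)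
      ultimately show ?case by simp
    qed
    show "AE x in lborel. norm (v x * h n x) \<le> \<bar>v x\<bar>" for n
      using hb by (intro AE_I2) (simp add: abs_mult mult_left_le)
  qed (use v in auto)
  moreover have "(LINT x|lborel. v x * h n x) = 0" for n by (rule z[OF hc hb])
  ultimately have "(LINT x|lborel. \<bar>v x\<bar>) = 0" by (simp add: LIMSEQ_const_iff)
  then have "AE x in lborel. \<bar>v x\<bar> = 0" using integral_nonneg_eq_0_iff_AE[OF integrable_abs[OF v]] by simp
  then show ?thesis by simp
qed

text \<open>By Stone-Weierstrass on the support, vanishing passes from the algebra to all continuous
  functions. The lemma serves both for Gaussians and for smooth functions.\<close>

lemma algebra_integral_zero_imp_AE_zero:
  fixes v :: "'a::euclidean_space \<Rightarrow> real"
  assumes v: "integrable lborel v" and K: "compact K" "\<And>x. x \<notin> K \<Longrightarrow> v x = 0"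
    and P: "\<And>c. P (\<lambda>x. c)" "\<And>f. P f \<Longrightarrow> continuous_on UNIV f"
      "\<And>f g. P f \<and> P g \<Longrightarrow> P (\<lambda>x. f x + g x)" "\<And>f g. P f \<and> P g \<Longrightarrow> P (\<lambda>x. f x * g x)"
      "\<And>x y. x \<in> K \<and> y \<in> K \<and> x \<noteq> y \<Longrightarrow> \<exists>f. P f \<and> f x \<noteq> f y"
    and z: "\<And>f. P f \<Longrightarrow> (LINT x|lborel. v x * f x) = 0"
  shows "AE x in lborel. v x = 0"
proof (rule integral_continuous_zero_imp_AE_zero[OF v])
  have [measurable]: "v \<in> borel_measurable borel" using v by auto
  have vi: "integrable lborel (\<lambda>x. v x * g x)" if g: "continuous_on UNIV g" for g :: "'a \<Rightarrow> real"
  proof -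
    have [measurable]: "g \<in> borel_measurable borel" using g by (rule borel_measurable_continuous_onI)
    have "compact (g ` K)" using g K by (intro compact_continuous_image) (auto intro: continuous_on_subset)
    from compact_imp_bounded[OF this] obtain M where M: "\<forall>y\<in>g ` K. norm y \<le> M" unfolding bounded_iff by blast
    show ?thesis
    proof (rule Bochner_Integration.integrable_bound[OF integrable_mult_right[OF v, of M]])
      show "AE x in lborel. norm (v x * g x) \<le> norm (M * v x)"
      proof (rule AE_I2)
        fix x
        show "norm (v x * g x) \<le> norm (M * v x)"
        proof (cases "x \<in> K")
          case True
          then have "\<bar>g x\<bar> \<le> \<bar>M\<bar>" using M by (auto intro: order_trans)
          then show ?thesis by (simp add: abs_mult mult.commute mult_right_mono)
        qed (use K in simp)
      qed
    qed measurable
  qed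
  fix g :: "'a \<Rightarrow> real" and B assume g: "continuous_on UNIV g"
  have "\<bar>LINT x|lborel. v x * g x\<bar> \<le> e" if e: "e > 0" for e
  proof -
    define I where "I = (LINT x|lborel. \<bar>v x\<bar>)"
    have I: "I \<ge> 0" unfolding I_def by simp
    define d where "d = e / (I + 1)"
    have d: "d > 0" using I e by (simp add: d_def)
    have "\<exists>f. P f \<and> (\<forall>x\<in>K. \<bar>g x - f x\<bar> < d)"
    proof (rule Stone_Weierstrass_HOL[where P=P and S=K])
      show "continuous_on K f" if "P f" for f using P(2)[OF that] by (rule continuous_on_subset) simp
      show "continuous_on K g" using g by (rule continuous_on_subset) simp
    qed (use K P d in auto)
    then obtain f where f: "P f" "\<And>x. x \<in> K \<Longrightarrow> \<bar>g x - f x\<bar> < d" by blast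
    have fc: "continuous_on UNIV f" by (rule P(2)[OF f(1)])
    have "(LINT x|lborel. v x * g x) = (LINT x|lborel. v x * g x - v x * f x)"
      using vi[OF g] vi[OF fc] z[OF f(1)] by simp
    also have "\<bar>\<dots>\<bar> \<le> (LINT x|lborel. \<bar>v x * g x - v x * f x\<bar>)"
      using integral_norm_bound[of lborel "\<lambda>x. v x * g x - v x * f x"] by simp
    also have "\<dots> \<le> (LINT x|lborel. d * \<bar>v x\<bar>)"
    proof (rule integral_mono)
      show "integrable lborel (\<lambda>x. \<bar>v x * g x - v x * f x\<bar>)" using vi[OF g] vi[OF fc] by simp
      show "integrable lborel (\<lambda>x. d * \<bar>v x\<bar>)" using v by simp
      show "\<bar>v x * g x - v x * f x\<bar> \<le> d * \<bar>v x\<bar>" for x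
      proof (cases "x \<in> K")
        case True
        have "v x * g x - v x * f x = (g x - f x) * v x" by (simp add: algebra_simps)
        then have "\<bar>v x * g x - v x * f x\<bar> = \<bar>g x - f x\<bar> * \<bar>v x\<bar>" by (simp add: abs_mult)
        also have "\<dots> \<le> d * \<bar>v x\<bar>" using f(2)[OF True] by (intro mult_right_mono) auto
        finally show ?thesis .
      qed (use K in simp)
    qed
    also have "\<dots> = d * I" unfolding I_def by simp
    also have "\<dots> \<le> e" unfolding d_def using I e by (simp add: field_simps)
    finally show ?thesis .
  qed
  then have "\<bar>LINT x|lborel. v x * g x\<bar> \<le> 0" by (rule field_le_epsilon[where y=0, simplified])
  then show "(LINT x|lborel. v x * g x) = 0" by simp
qed

section \<open>Subordination to the heat kernel\<close>

lemma powr_integral_near_0: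
  fixes a :: real
  assumes "a > -1"
  shows "(\<integral>\<^sup>+t. ennreal (indicator {0<..1} t * t powr a) \<partial>lborel) < \<infinity>"
proof -
  have "((\<lambda>t. t powr a) has_integral (1 powr (a + 1) / (a + 1))) {0..1}"
    using has_integral_powr_from_0[OF assms, of 1] by simp
  from nn_integral_has_integral_lebesgue[OF _ this]
  have "(\<integral>\<^sup>+t. ennreal (indicator {0..1} t * t powr a) \<partial>lborel) < \<infinity>"
    by simp
  moreover have "(\<integral>\<^sup>+t. ennreal (indicator {0<..1} t * t powr a) \<partial>lborel) \<le> (\<integral>\<^sup>+t. ennreal (indicator {0..1} t * t powr a) \<partial>lborel)"
    by (intro nn_integral_mono ennreal_leI) (auto simp: indicator_def)
  ultimately show ?thesis by (rule le_less_trans[rotated])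
qed

lemma powr_integral_near_inf:
  fixes a :: real
  assumes "a < -1"
  shows "(\<integral>\<^sup>+t. ennreal (indicator {1..} t * t powr a) \<partial>lborel) < \<infinity>"
proof -
  have "((\<lambda>t. t powr a) has_integral (- (1 powr (a + 1) / (a + 1)))) {1..}"
    using has_integral_powr_to_inf[OF assms, of 1] by simp
  from nn_integral_has_integral_lebesgue[OF _ this]
  show ?thesis by simp
qed

lemma nn_integral_pos_half_line:
  fixes \<phi> :: "real \<Rightarrow> real"
  assumes [measurable]: "\<phi> \<in> borel_measurable borel" and pos: "\<And>t. t > 0 \<Longrightarrow> \<phi> t > 0"
  shows "(\<integral>\<^sup>+t. ennreal (indicator {0<..} t * \<phi> t) \<partial>lborel) \<noteq> 0"
proof
  assume "(\<integral>\<^sup>+t. ennreal (indicator {0<..} t * \<phi> t) \<partial>lborel) = 0"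
  then have "AE t in lborel. ennreal (indicator {0<..} t * \<phi> t) = 0"
    by (subst (asm) nn_integral_0_iff_AE) auto
  then have "AE t in lborel. t \<notin> {0<..<1::real}"
  proof eventually_elim
    case (elim t)
    then have "indicator {0<..} t * \<phi> t \<le> 0" by (simp add: ennreal_eq_0_iff)
    then show ?case using pos[of t] by (auto simp: indicator_def split: if_splits)
  qed
  then have "emeasure lborel {0<..<1::real} = 0" by (subst (asm) AE_iff_measurable[of "{0<..<1}"]) auto
  then show False by simp
qed

text \<open>Both integrals are homogeneous in their parameter, so only their finiteness and positivity
  at parameter value \<open>1\<close> has to be known.\<close>

lemma subordination_symbol:
  fixes s :: real
  assumes s: "0 < s" "s < 1"
  obtains C where "C > 0" "\<And>\<rho>. \<rho> \<ge> 0 \<Longrightarrow>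
    has_bochner_integral lborel (\<lambda>t. indicator {0<..} t * ((1 - exp (- t * \<rho>)) * t powr (- 1 - s))) (C * \<rho> powr s)"
proof -
  define \<phi> where "\<phi> \<rho> t = indicator {0<..} t * ((1 - exp (- t * \<rho>)) * t powr (- 1 - s))" for \<rho> t :: real
  have m[measurable]: "\<phi> \<rho> \<in> borel_measurable borel" for \<rho> unfolding \<phi>_def by measurable
  define I where "I = (\<integral>\<^sup>+t. ennreal (\<phi> 1 t) \<partial>lborel)"
  \<comment> \<open>Near 0 use \<open>1 - exp (- t) \<le> t\<close>, near infinity
    \<open>1 - exp (- t) \<le> 1\<close>: \<open>s < 1\<close> makes the first power integrable,
    \<open>s > 0\<close> the second.\<close>
  have "I \<le> (\<integral>\<^sup>+t. ennreal (indicator {0<..1} t * t powr (- s)) + ennreal (indicator {1..} t * t powr (- 1 - s)) \<partial>lborel)"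
    unfolding I_def
  proof (rule nn_integral_mono)
    fix t :: real
    have "\<phi> 1 t \<le> indicator {0<..1} t * t powr (- s) + indicator {1..} t * t powr (- 1 - s)"
    proof (cases "t > 0")
      case True
      have "1 - exp (- t) \<le> t" using exp_ge_add_one_self[of "- t"] by simp
      then have "(1 - exp (- t)) * t powr (- 1 - s) \<le> t powr 1 * t powr (- 1 - s)" using True by (intro mult_right_mono) auto
      also have "\<dots> = t powr (- s)" unfolding powr_add[symmetric] by simp
      finally have 1: "(1 - exp (- t)) * t powr (- 1 - s) \<le> t powr (- s)" .
      have 2: "(1 - exp (- t)) * t powr (- 1 - s) \<le> t powr (- 1 - s)" using True by (simp add: mult_le_cancel_right1)
      have "(- 1 :: real) \<le> exp (- 1)" using exp_ge_zero[of "- 1 :: real"] by linarith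
      then show ?thesis using 1 2 True by (cases "t \<le> 1") (auto simp: \<phi>_def indicator_def)
    qed (simp add: \<phi>_def)
    then have "ennreal (\<phi> 1 t) \<le> ennreal (indicator {0<..1} t * t powr (- s) + indicator {1..} t * t powr (- 1 - s))"
      by (rule ennreal_leI)
    also have "\<dots> = ennreal (indicator {0<..1} t * t powr (- s)) + ennreal (indicator {1..} t * t powr (- 1 - s))"
      by (rule ennreal_plus) auto
    finally show "ennreal (\<phi> 1 t) \<le> ennreal (indicator {0<..1} t * t powr (- s)) + ennreal (indicator {1..} t * t powr (- 1 - s))" .
  qed
  also have "\<dots> = (\<integral>\<^sup>+t. ennreal (indicator {0<..1} t * t powr (- s)) \<partial>lborel) + (\<integral>\<^sup>+t. ennreal (indicator {1..} t * t powr (- 1 - s)) \<partial>lborel)"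
    by (rule nn_integral_add) auto
  also have "\<dots> < \<infinity>" using powr_integral_near_0[of "- s"] powr_integral_near_inf[of "- 1 - s"] s by simp
  finally have fin: "I < \<infinity>" .
  have I0: "I \<noteq> 0" unfolding I_def \<phi>_def by (rule nn_integral_pos_half_line) (auto simp: mult_pos_pos)
  define C where "C = enn2real I"
  have IC: "I = ennreal C" unfolding C_def using fin by simp
  have C: "C > 0" unfolding C_def using fin I0 by (simp add: enn2real_positive_iff zero_less_iff_neq_zero)
  have scale: "(\<integral>\<^sup>+t. ennreal (\<phi> \<rho> t) \<partial>lborel) = ennreal (C * \<rho> powr s)" if r: "\<rho> \<ge> 0" for \<rho>
  proof (cases "\<rho> = 0")
    case True
    then show ?thesis by (simp add: \<phi>_def)
  next
    case False
    then have r: "\<rho> > 0" using r by simp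
    have "(\<integral>\<^sup>+t. ennreal (\<phi> \<rho> t) \<partial>lborel) = \<bar>1 / \<rho>\<bar> * (\<integral>\<^sup>+t. ennreal (\<phi> \<rho> (0 + 1 / \<rho> * t)) \<partial>lborel)"
      by (rule nn_integral_real_affine) (use r in auto)
    also have "(\<lambda>t. ennreal (\<phi> \<rho> (0 + 1 / \<rho> * t))) = (\<lambda>t. ennreal (\<rho> powr (1 + s)) * ennreal (\<phi> 1 t))"
    proof
      fix t :: real
      have "\<phi> \<rho> (0 + 1 / \<rho> * t) = \<rho> powr (1 + s) * \<phi> 1 t"
      proof (cases "t > 0")
        case True
        have "(t / \<rho>) powr (- 1 - s) = t powr (- 1 - s) * \<rho> powr (1 + s)"
          using True r powr_minus_divide[of \<rho> "1 + s"] by (simp add: powr_divide)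
        then show ?thesis using True r by (simp add: \<phi>_def indicator_def)
      next
        case False
        then have "\<not> t / \<rho> > 0" using r by (simp add: divide_pos_neg zero_less_divide_iff)
        then show ?thesis using False by (simp add: \<phi>_def)
      qed
      then show "ennreal (\<phi> \<rho> (0 + 1 / \<rho> * t)) = ennreal (\<rho> powr (1 + s)) * ennreal (\<phi> 1 t)" by (simp add: ennreal_mult')
    qed
    also have "(\<integral>\<^sup>+t. ennreal (\<rho> powr (1 + s)) * ennreal (\<phi> 1 t) \<partial>lborel) = ennreal (\<rho> powr (1 + s)) * I"
      unfolding I_def by (rule nn_integral_cmult) measurable
    also have "\<bar>1 / \<rho>\<bar> * (ennreal (\<rho> powr (1 + s)) * I) = ennreal (\<bar>1 / \<rho>\<bar> * (\<rho> powr (1 + s) * C))"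
      using C r unfolding IC by (simp only: ennreal_mult'[symmetric] abs_ge_zero powr_ge_zero less_imp_le mult_nonneg_nonneg)
    also have "\<bar>1 / \<rho>\<bar> * (\<rho> powr (1 + s) * C) = C * \<rho> powr s" using r by (simp add: powr_add)
    finally show ?thesis .
  qed
  have nn: "0 \<le> \<phi> \<rho> t" if "\<rho> \<ge> 0" for \<rho> t using that by (auto simp: \<phi>_def indicator_def)
  show ?thesis
  proof (rule that[OF C])
    fix \<rho> :: real assume r: "\<rho> \<ge> 0"
    show "has_bochner_integral lborel (\<lambda>t. indicator {0<..} t * ((1 - exp (- t * \<rho>)) * t powr (- 1 - s))) (C * \<rho> powr s)"
      unfolding \<phi>_def[symmetric]
      by (rule has_bochner_integral_nn_integral[OF _ _ _ scale[OF r]]) (use nn[OF r] C in auto)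
  qed
qed

text \<open>For \<open>r = norm (x - y)\<close> the integrand is \<open>t powr (- 1 - s)\<close>
  times the heat kernel at time \<open>t\<close>, up to the factor
  \<open>(4 * pi) powr (n / 2)\<close>.\<close>

lemma subordination_kernel:
  fixes s :: real and n :: nat
  assumes s: "0 < s"
  obtains D where "D > 0" "\<And>r. r > 0 \<Longrightarrow>
    has_bochner_integral lborel (\<lambda>t. indicator {0<..} t * (t powr (- 1 - s - real n / 2) * exp (- r\<^sup>2 / (4 * t)))) (D * r powr (- (real n + 2 * s)))"
proof -
  define a where "a = 1 + s + real n / 2"
  have a: "a > 1" using s by (simp add: a_def add_pos_nonneg)
  define \<phi> where "\<phi> r t = indicator {0<..} t * (t powr (- a) * exp (- r\<^sup>2 / (4 * t)))" for r t :: real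
  have m[measurable]: "\<phi> r \<in> borel_measurable borel" for r unfolding \<phi>_def by measurable
  define I where "I = (\<integral>\<^sup>+t. ennreal (\<phi> 1 t) \<partial>lborel)"
  obtain N :: nat where N: "a \<le> real N" using real_arch_simple by blast
  \<comment> \<open>From \<open>y ^ N \<le> fact N * exp y\<close> at
    \<open>y = 1 / (4 * t)\<close>: the exponential absorbs the singular power, so the integrand is
    at most \<open>B\<close> on the unit interval.\<close>
  define B :: real where "B = fact N * 4 ^ N"
  have "I \<le> (\<integral>\<^sup>+t. ennreal (B * (indicator {0<..1} t * t powr 0)) + ennreal (indicator {1..} t * t powr (- a)) \<partial>lborel)"
    unfolding I_def
  proof (rule nn_integral_mono)
    fix t :: real
    have "\<phi> 1 t \<le> B * (indicator {0<..1} t * t powr 0) + indicator {1..} t * t powr (- a)"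
    proof (cases "t > 0")
      case True
      show ?thesis
      proof (cases "t \<le> 1")
        case t1: True
        have y: "y ^ N \<le> fact N * exp y" if "y \<ge> 0" for y :: real
        proof -
          have "sum (\<lambda>n. y ^ n /\<^sub>R fact n) {N} \<le> (\<Sum>n. y ^ n /\<^sub>R fact n)"
            by (rule sum_le_suminf[OF sums_summable[OF exp_converges]]) (use that in auto)
          also have "\<dots> = exp y" using exp_converges[of y] by (simp add: sums_iff)
          finally show ?thesis by (simp add: field_simps)
        qed
        have "t powr (- a) = (1 / t) powr a" using True by (simp add: powr_divide powr_minus_divide)
        also have "\<dots> \<le> (1 / t) powr real N" using True t1 N by (intro powr_mono) auto
        also have "\<dots> = 4 ^ N * (1 / (4 * t)) ^ N" using True by (simp add: powr_realpow power_divide power_mult_distrib)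
        also have "\<dots> \<le> 4 ^ N * (fact N * exp (1 / (4 * t)))" using True by (intro mult_left_mono y) auto
        finally have "t powr (- a) * exp (- 1 / (4 * t)) \<le> (4 ^ N * (fact N * exp (1 / (4 * t)))) * exp (- 1 / (4 * t))"
          by (rule mult_right_mono) simp
        also have "\<dots> = B" unfolding B_def by (simp add: exp_minus)
        finally have "t powr (- a) * exp (- 1 / (4 * t)) \<le> B" .
        moreover have "\<phi> 1 t = t powr (- a) * exp (- 1 / (4 * t))" using True by (simp add: \<phi>_def)
        moreover have "B * (indicator {0<..1} t * t powr 0) = B" using True t1 by simp
        moreover have "0 \<le> indicator {1..} t * t powr (- a)" by simp
        ultimately show ?thesis by linarith
      next
        case False
        then have "t powr (- a) * exp (- 1 / (4 * t)) \<le> t powr (- a)" using True by (intro mult_left_le) auto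
        then show ?thesis using False True by (simp add: \<phi>_def indicator_def)
      qed
    qed (simp add: \<phi>_def B_def)
    then have "ennreal (\<phi> 1 t) \<le> ennreal (B * (indicator {0<..1} t * t powr 0) + indicator {1..} t * t powr (- a))"
      by (rule ennreal_leI)
    also have "\<dots> = ennreal (B * (indicator {0<..1} t * t powr 0)) + ennreal (indicator {1..} t * t powr (- a))"
      by (rule ennreal_plus) (auto simp: B_def)
    finally show "ennreal (\<phi> 1 t) \<le> ennreal (B * (indicator {0<..1} t * t powr 0)) + ennreal (indicator {1..} t * t powr (- a))" .
  qed
  also have "\<dots> = (\<integral>\<^sup>+t. ennreal B * ennreal (indicator {0<..1} t * t powr 0) \<partial>lborel) + (\<integral>\<^sup>+t. ennreal (indicator {1..} t * t powr (- a)) \<partial>lborel)"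
    by (subst nn_integral_add) (auto simp: ennreal_mult' B_def)
  also have "(\<integral>\<^sup>+t. ennreal B * ennreal (indicator {0<..1} t * t powr 0) \<partial>lborel) = ennreal B * (\<integral>\<^sup>+t. ennreal (indicator {0<..1} t * t powr 0) \<partial>lborel)"
    by (rule nn_integral_cmult) measurable
  also have "ennreal B * (\<integral>\<^sup>+t. ennreal (indicator {0<..1} t * t powr 0) \<partial>lborel) + (\<integral>\<^sup>+t. ennreal (indicator {1..} t * t powr (- a)) \<partial>lborel) < \<infinity>"
    using powr_integral_near_0[of 0] powr_integral_near_inf[of "- a"] a by (simp add: ennreal_mult_less_top)
  finally have fin: "I < \<infinity>" .
  have I0: "I \<noteq> 0" unfolding I_def \<phi>_def by (rule nn_integral_pos_half_line) auto
  define D where "D = enn2real I"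
  have ID: "I = ennreal D" unfolding D_def using fin by simp
  have D: "D > 0" unfolding D_def using fin I0 by (simp add: enn2real_positive_iff zero_less_iff_neq_zero)
  have scale: "(\<integral>\<^sup>+t. ennreal (\<phi> r t) \<partial>lborel) = ennreal (D * r powr (- (real n + 2 * s)))" if r: "r > 0" for r
  proof -
    have r2: "r\<^sup>2 > 0" using r by simp
    have "(\<integral>\<^sup>+t. ennreal (\<phi> r t) \<partial>lborel) = \<bar>r\<^sup>2\<bar> * (\<integral>\<^sup>+t. ennreal (\<phi> r (0 + r\<^sup>2 * t)) \<partial>lborel)"
      by (rule nn_integral_real_affine) (use r in auto)
    also have "(\<lambda>t. ennreal (\<phi> r (0 + r\<^sup>2 * t))) = (\<lambda>t. ennreal ((r\<^sup>2) powr (- a)) * ennreal (\<phi> 1 t))"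
    proof
      fix t :: real
      have "\<phi> r (0 + r\<^sup>2 * t) = (r\<^sup>2) powr (- a) * \<phi> 1 t"
      proof (cases "t > 0")
        case True
        then have "(r\<^sup>2 * t) powr (- a) = (r\<^sup>2) powr (- a) * t powr (- a)" using r2 by (simp add: powr_mult)
        then show ?thesis using True r2 r by (simp add: \<phi>_def indicator_def field_simps)
      next
        case False
        then have "\<not> r\<^sup>2 * t > 0" using r2 by (simp add: zero_less_mult_iff)
        then show ?thesis using False by (simp add: \<phi>_def)
      qed
      then show "ennreal (\<phi> r (0 + r\<^sup>2 * t)) = ennreal ((r\<^sup>2) powr (- a)) * ennreal (\<phi> 1 t)" by (simp add: ennreal_mult')
    qed
    also have "(\<integral>\<^sup>+t. ennreal ((r\<^sup>2) powr (- a)) * ennreal (\<phi> 1 t) \<partial>lborel) = ennreal ((r\<^sup>2) powr (- a)) * I"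
      unfolding I_def by (rule nn_integral_cmult) measurable
    also have "\<bar>r\<^sup>2\<bar> * (ennreal ((r\<^sup>2) powr (- a)) * I) = ennreal (\<bar>r\<^sup>2\<bar> * ((r\<^sup>2) powr (- a) * D))"
      using D unfolding ID by (simp only: ennreal_mult'[symmetric] abs_ge_zero powr_ge_zero less_imp_le mult_nonneg_nonneg)
    also have "\<bar>r\<^sup>2\<bar> * ((r\<^sup>2) powr (- a) * D) = D * r powr (- (real n + 2 * s))"
    proof -
      have "\<bar>r\<^sup>2\<bar> * (r\<^sup>2) powr (- a) = (r\<^sup>2) powr 1 * (r\<^sup>2) powr (- a)" using r2 by simp
      also have "\<dots> = (r\<^sup>2) powr (1 - a)" unfolding powr_add[symmetric] by simp
      also have "\<dots> = r powr (2 * (1 - a))" using norm_powr_double[of r "1 - a"] r by simp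
      also have "2 * (1 - a) = - (real n + 2 * s)" unfolding a_def by simp
      finally show ?thesis by simp
    qed
    finally show ?thesis .
  qed
  have nn: "0 \<le> \<phi> r t" for r t by (auto simp: \<phi>_def indicator_def)
  have aeq: "- 1 - s - real n / 2 = - a" by (simp add: a_def)
  show ?thesis
  proof (rule that[OF D])
    fix r :: real assume r: "r > 0"
    show "has_bochner_integral lborel (\<lambda>t. indicator {0<..} t * (t powr (- 1 - s - real n / 2) * exp (- r\<^sup>2 / (4 * t)))) (D * r powr (- (real n + 2 * s)))"
      unfolding aeq \<phi>_def[symmetric]
      by (rule has_bochner_integral_nn_integral[OF _ _ _ scale[OF r]]) (use nn D in auto)
  qed
qed

text \<open>The symbol and the kernel are time integrals of the same heat semigroup:
  \<open>1 - exp (- t * norm \<xi>^2)\<close> and the heat kernel, both against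
  \<open>t powr (- 1 - s)\<close>. Fubini on the frequency side and on the space side identifies the
  two pairings up to a nonzero constant; the separation \<open>\<delta>\<close> keeps the kernel
  bounded on the supports.\<close>

lemma riesz_kernel_pairing:
  fixes f v h :: "'a::euclidean_space \<Rightarrow> real"
  assumes s: "0 < s" "s < 1" and f: "integrable lborel f" and v: "integrable lborel v"
    and sep: "\<delta> > 0" "\<And>x y. f x \<noteq> 0 \<Longrightarrow> v y \<noteq> 0 \<Longrightarrow> norm (x - y) \<ge> \<delta>"
    and h: "integrable lborel h" "(LINT \<xi>|lborel. h \<xi>) = 0" "integrable lborel (\<lambda>\<xi>. norm \<xi> powr (2 * s) * h \<xi>)"
    and heat: "\<And>e. e > 0 \<Longrightarrow> (LINT \<xi>|lborel. exp (- e * (norm \<xi>)\<^sup>2) * h \<xi>) = (LINT z|lborel. (case z of (x, y) \<Rightarrow> f x * v y * heat e (x - y)))"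
    and zero: "(LINT \<xi>|lborel. norm \<xi> powr (2 * s) * h \<xi>) = 0"
  shows "(LINT z|lborel. (case z of (x, y) \<Rightarrow> f x * v y * norm (x - y) powr (- (real DIM('a) + 2 * s)))) = 0"
proof -
  have [measurable]: "f \<in> borel_measurable borel" "v \<in> borel_measurable borel" "h \<in> borel_measurable borel"
    using f v h by auto
  obtain C where C: "C > 0" "\<And>\<rho>. \<rho> \<ge> 0 \<Longrightarrow>
    has_bochner_integral lborel (\<lambda>t. indicator {0<..} t * ((1 - exp (- t * \<rho>)) * t powr (- 1 - s))) (C * \<rho> powr s)"
    using subordination_symbol[OF s] by blast
  obtain D where D: "D > 0" "\<And>r. r > 0 \<Longrightarrow>
    has_bochner_integral lborel (\<lambda>t. indicator {0<..} t * (t powr (- 1 - s - real DIM('a) / 2) * exp (- r\<^sup>2 / (4 * t)))) (D * r powr (- (real DIM('a) + 2 * s)))"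
    using subordination_kernel[OF s(1), of "DIM('a)"] by blast
  define A where "A = (\<lambda>\<rho> t::real. indicator {0<..} t * ((1 - exp (- t * \<rho>)) * t powr (- 1 - s)))"
  define \<Phi> where "\<Phi> = (\<lambda>(\<xi>::'a) t. A ((norm \<xi>)\<^sup>2) t * h \<xi>)"
  have A0: "A \<rho> t \<ge> 0" if "\<rho> \<ge> 0" for \<rho> t using that by (auto simp: A_def indicator_def)
  have AI: "integrable lborel (A ((norm \<xi>)\<^sup>2))" "(LINT t|lborel. A ((norm \<xi>)\<^sup>2) t) = C * norm \<xi> powr (2 * s)" for \<xi> :: 'a
    using C(2)[of "(norm \<xi>)\<^sup>2"] norm_powr_double[of \<xi> s] unfolding A_def has_bochner_integral_iff by auto
  have \<Phi>I: "integrable (lborel \<Otimes>\<^sub>M lborel) (\<lambda>(\<xi>, t). \<Phi> \<xi> t)"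
  proof (rule lborel_pair.Fubini_integrable)
    show "(\<lambda>(\<xi>, t). \<Phi> \<xi> t) \<in> borel_measurable (lborel \<Otimes>\<^sub>M lborel)" unfolding \<Phi>_def A_def by measurable
    have "(LINT t|lborel. norm (case (\<xi>, t) of (\<xi>, t) \<Rightarrow> \<Phi> \<xi> t)) = C * \<bar>norm \<xi> powr (2 * s) * h \<xi>\<bar>" for \<xi>
    proof -
      have "(LINT t|lborel. norm (case (\<xi>, t) of (\<xi>, t) \<Rightarrow> \<Phi> \<xi> t)) = (LINT t|lborel. A ((norm \<xi>)\<^sup>2) t * \<bar>h \<xi>\<bar>)"
        using A0 by (simp add: \<Phi>_def abs_mult)
      then show ?thesis by (simp add: AI abs_mult)
    qed
    then show "integrable lborel (\<lambda>\<xi>. LINT t|lborel. norm (case (\<xi>, t) of (\<xi>, t) \<Rightarrow> \<Phi> \<xi> t))"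
      using h(3) by simp
    show "AE \<xi> in lborel. integrable lborel (\<lambda>t. case (\<xi>, t) of (\<xi>, t) \<Rightarrow> \<Phi> \<xi> t)"
      by (intro AE_I2) (simp add: \<Phi>_def AI)
  qed
  define nf where "nf = (4 * pi) powr (- real DIM('a) / 2)"
  define E where "E = (\<lambda>r t::real. indicator {0<..} t * (t powr (- 1 - s - real DIM('a) / 2) * exp (- r\<^sup>2 / (4 * t))))"
  define \<Psi> where "\<Psi> = (\<lambda>(z::'a\<times>'a) t. nf * (E (norm (fst z - snd z)) t * (f (fst z) * v (snd z))))"
  have E0: "E r t \<ge> 0" for r t by (auto simp: E_def indicator_def)
  have EI: "integrable lborel (E r)" "(LINT t|lborel. E r t) = D * r powr (- (real DIM('a) + 2 * s))" if "r > 0" for r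
    using D(2)[OF that] unfolding E_def has_bochner_integral_iff by auto
  have pos: "norm (fst z - snd z) \<ge> \<delta>" if "f (fst z) * v (snd z) \<noteq> 0" for z using sep(2) that by auto
  have fv: "integrable lborel (\<lambda>z::'a\<times>'a. f (fst z) * v (snd z))"
    using integrable_tensor(1)[OF f v] by (simp add: case_prod_unfold)
  have kb: "\<bar>norm (fst z - snd z) powr (- (real DIM('a) + 2 * s)) * (f (fst z) * v (snd z))\<bar> \<le> \<delta> powr (- (real DIM('a) + 2 * s)) * \<bar>f (fst z) * v (snd z)\<bar>" for z
  proof (cases "f (fst z) * v (snd z) = 0")
    case False
    have "norm (fst z - snd z) powr (- (real DIM('a) + 2 * s)) \<le> \<delta> powr (- (real DIM('a) + 2 * s))"
      using pos[OF False] sep(1) s by (intro powr_mono2') auto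
    then show ?thesis by (simp only: abs_mult[of "norm _ powr _"]) (auto intro: mult_right_mono)
  qed auto
  have kI: "integrable lborel (\<lambda>z::'a\<times>'a. norm (fst z - snd z) powr (- (real DIM('a) + 2 * s)) * (f (fst z) * v (snd z)))"
  proof (rule Bochner_Integration.integrable_bound)
    show "integrable lborel (\<lambda>z::'a\<times>'a. \<delta> powr (- (real DIM('a) + 2 * s)) * \<bar>f (fst z) * v (snd z)\<bar>)"
      using fv by simp
    show "(\<lambda>z::'a\<times>'a. norm (fst z - snd z) powr (- (real DIM('a) + 2 * s)) * (f (fst z) * v (snd z))) \<in> borel_measurable lborel"
      by (simp add: borel_prod[symmetric])
  qed (use kb in \<open>auto intro!: AE_I2 order_trans[OF kb] simp: abs_mult\<close>)
  have in_t: "integrable lborel (\<Psi> z)" "(LINT t|lborel. norm (\<Psi> z t)) = nf * D * \<bar>norm (fst z - snd z) powr (- (real DIM('a) + 2 * s)) * (f (fst z) * v (snd z))\<bar>"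
    "(LINT t|lborel. \<Psi> z t) = nf * D * (norm (fst z - snd z) powr (- (real DIM('a) + 2 * s)) * (f (fst z) * v (snd z)))" for z
  proof -
    have "integrable lborel (\<Psi> z) \<and> (LINT t|lborel. norm (\<Psi> z t)) = nf * D * \<bar>norm (fst z - snd z) powr (- (real DIM('a) + 2 * s)) * (f (fst z) * v (snd z))\<bar> \<and>
      (LINT t|lborel. \<Psi> z t) = nf * D * (norm (fst z - snd z) powr (- (real DIM('a) + 2 * s)) * (f (fst z) * v (snd z)))"
    proof (cases "f (fst z) * v (snd z) = 0")
      case True
      then have \<Psi>0: "\<Psi> z = (\<lambda>t. 0)" by (auto simp: \<Psi>_def fun_eq_iff)
      show ?thesis unfolding \<Psi>0 True by simp
    next
      case False
      have r: "norm (fst z - snd z) > 0" using pos[OF False] sep(1) by linarith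
      have n: "norm (\<Psi> z t) = nf * (E (norm (fst z - snd z)) t * \<bar>f (fst z) * v (snd z)\<bar>)" for t
        using E0 by (simp add: \<Psi>_def abs_mult nf_def)
      show ?thesis unfolding n unfolding \<Psi>_def using EI[OF r] by (simp add: abs_mult)
    qed
    then show "integrable lborel (\<Psi> z)" "(LINT t|lborel. norm (\<Psi> z t)) = nf * D * \<bar>norm (fst z - snd z) powr (- (real DIM('a) + 2 * s)) * (f (fst z) * v (snd z))\<bar>"
    "(LINT t|lborel. \<Psi> z t) = nf * D * (norm (fst z - snd z) powr (- (real DIM('a) + 2 * s)) * (f (fst z) * v (snd z)))" by auto
  qed
  have \<Psi>I: "integrable (lborel \<Otimes>\<^sub>M lborel) (\<lambda>(z, t). \<Psi> z t)"
  proof (rule lborel_pair.Fubini_integrable)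
    show "(\<lambda>(z, t). \<Psi> z t) \<in> borel_measurable (lborel \<Otimes>\<^sub>M lborel)"
      unfolding \<Psi>_def E_def by (simp add: lborel_prod borel_prod[symmetric])
    show "integrable lborel (\<lambda>z. LINT t|lborel. norm (case (z, t) of (z, t) \<Rightarrow> \<Psi> z t))"
      using kI by (simp only: prod.case in_t(2)) simp
    show "AE z in lborel. integrable lborel (\<lambda>t. case (z, t) of (z, t) \<Rightarrow> \<Psi> z t)"
      by (intro AE_I2) (simp add: in_t(1))
  qed
  \<comment> \<open>The constant 1 in the subordination integrand contributes nothing because
    \<open>h\<close> has integral zero. This leaves minus the heat pairing.\<close>
  have link: "(LINT \<xi>|lborel. \<Phi> \<xi> t) = - (LINT z|lborel. \<Psi> z t)" for t
  proof (cases "t > 0")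
    case True
    have eh: "integrable lborel (\<lambda>\<xi>. exp (- t * (norm \<xi>)\<^sup>2) * h \<xi>)"
      by (rule Bochner_Integration.integrable_bound[OF h(1)]) (use True in \<open>auto simp: abs_mult mult_left_le_one_le\<close>)
    have "(LINT \<xi>|lborel. \<Phi> \<xi> t) = (LINT \<xi>|lborel. t powr (- 1 - s) * (h \<xi> - exp (- t * (norm \<xi>)\<^sup>2) * h \<xi>))"
      using True by (intro Bochner_Integration.integral_cong) (auto simp: \<Phi>_def A_def algebra_simps)
    also have "\<dots> = - (t powr (- 1 - s) * (LINT z|lborel. (case z of (x, y) \<Rightarrow> f x * v y * heat t (x - y))))"
      using h(1,2) eh heat[OF True] by simp
    also have "t powr (- 1 - s) * (LINT z|lborel. (case z of (x, y) \<Rightarrow> f x * v y * heat t (x - y))) = (LINT z|lborel. \<Psi> z t)"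
    proof -
      have "t powr (- 1 - s) * (case z of (x, y) \<Rightarrow> f x * v y * heat t (x - y)) = \<Psi> z t" for z
      proof -
        have "t powr (- 1 - s - real DIM('a) / 2) = t powr (- 1 - s) * t powr (- real DIM('a) / 2)"
          unfolding powr_add[symmetric] by simp
        moreover have "(4 * pi * t) powr (- real DIM('a) / 2) = nf * t powr (- real DIM('a) / 2)"
          unfolding nf_def using True by (simp add: powr_mult)
        ultimately show ?thesis using True by (simp add: \<Psi>_def E_def heat_def case_prod_unfold)
      qed
      then show ?thesis by (simp flip: integral_mult_right_zero)
    qed
    finally show ?thesis .
  qed (simp add: \<Phi>_def A_def \<Psi>_def E_def)
  have "nf * D * (LINT z|lborel. norm (fst z - snd z) powr (- (real DIM('a) + 2 * s)) * (f (fst z) * v (snd z))) = (LINT z|lborel. LINT t|lborel. \<Psi> z t)"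
    unfolding in_t(3) by simp
  also have "\<dots> = (LINT t|lborel. LINT z|lborel. \<Psi> z t)" by (rule lborel_pair.Fubini_integral[OF \<Psi>I, symmetric])
  also have "\<dots> = - (LINT t|lborel. LINT \<xi>|lborel. \<Phi> \<xi> t)" unfolding link by simp
  also have "(LINT t|lborel. LINT \<xi>|lborel. \<Phi> \<xi> t) = (LINT \<xi>|lborel. LINT t|lborel. \<Phi> \<xi> t)" by (rule lborel_pair.Fubini_integral[OF \<Phi>I])
  also have "\<dots> = (LINT \<xi>|lborel. C * (norm \<xi> powr (2 * s) * h \<xi>))" unfolding \<Phi>_def by (simp add: AI mult.assoc)
  also have "\<dots> = 0" using zero by simp
  finally have "(LINT z|lborel. norm (fst z - snd z) powr (- (real DIM('a) + 2 * s)) * (f (fst z) * v (snd z))) = 0"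
    using D(1) by (simp add: nf_def)
  then show ?thesis by (simp add: case_prod_unfold mult.commute)
qed

section \<open>Injectivity of Riesz potentials away from the support\<close>

lemma AE_lborel_closed: "closed C \<Longrightarrow> (AE x in lborel. x \<in> C) \<Longrightarrow> x \<in> C"
  using mem_closed_if_AE_lebesgue[of C x] by (simp add: AE_lebesgue_iff)

lemma bump_Cc: "r > 0 \<Longrightarrow> bump c r \<in> Cc"
  unfolding Cc_def
proof (intro CollectI conjI exI[of _ "norm c + r"] allI impI)
  assume r: "r > 0"
  show "continuous_on UNIV (bump c r)" by (rule smooth_continuous[OF smooth_bump])
  show "norm c + r > 0" using r by (simp add: add_nonneg_pos)
  fix x :: 'a assume "norm x > norm c + r"
  then have "norm (x - c) \<ge> r" using norm_triangle_ineq[of "x - c" c] by simp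
  then show "bump c r x = 0" using bump_zero[OF r] by blast
qed

lemma bump_integral_pos:
  assumes r: "r > 0"
  shows "(LINT x|lborel. bump c r x) > 0"
proof -
  have i: "integrable lborel (bump c r)" by (rule Cc_integrable[OF bump_Cc[OF r]])
  have "(LINT x|lborel. bump c r x) \<noteq> 0"
  proof
    assume "(LINT x|lborel. bump c r x) = 0"
    then have "AE x in lborel. x \<in> {x. bump c r x = 0}"
      using integral_nonneg_eq_0_iff_AE[OF i] bump_nonneg by auto
    moreover have "closed {x. bump c r x = 0}"
      using continuous_closed_vimage[of "{0::real}" "bump c r"] smooth_continuous[OF smooth_bump[of c r]]
      by (auto simp: vimage_def continuous_on_eq_continuous_at)
    ultimately have "c \<in> {x. bump c r x = 0}" using AE_lborel_closed by blast
    then show False using bump_pos[OF r, of c c] r by simp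
  qed
  moreover have "(LINT x|lborel. bump c r x) \<ge> 0" by (intro integral_nonneg_AE AE_I2 bump_nonneg)
  ultimately show ?thesis by linarith
qed

locale separated_density =
  fixes v :: "'a::euclidean_space \<Rightarrow> real" and K :: "'a set" and x0 :: 'a and r0 \<delta> :: real
  assumes v: "integrable lborel v" and K: "compact K" "\<And>y. y \<notin> K \<Longrightarrow> v y = 0"
    and r0: "r0 > 0" and \<delta>: "\<delta> > 0" "\<And>x y. x \<in> ball x0 r0 \<Longrightarrow> y \<in> K \<Longrightarrow> \<delta> \<le> norm (x - y)"
begin

lemma v_measurable[measurable]: "v \<in> borel_measurable borel"
  using v by auto

lemma integrable_v_mult:
  assumes [measurable]: "k \<in> borel_measurable borel" and B: "\<And>y. y \<in> K \<Longrightarrow> \<bar>k y\<bar> \<le> B"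
  shows "integrable lborel (\<lambda>y. v y * k y)" and "norm (v y * k y) \<le> \<bar>B\<bar> * \<bar>v y\<bar>"
proof -
  show b: "norm (v y * k y) \<le> \<bar>B\<bar> * \<bar>v y\<bar>" for y
  proof (cases "y \<in> K")
    case True
    have "\<bar>k y\<bar> \<le> \<bar>B\<bar>" using B[OF True] by linarith
    then show ?thesis by (simp add: abs_mult mult.commute mult_right_mono)
  qed (use K in simp)
  show "integrable lborel (\<lambda>y. v y * k y)"
    by (rule Bochner_Integration.integrable_bound[of _ "\<lambda>y. \<bar>B\<bar> * \<bar>v y\<bar>"]) (use v b in \<open>auto simp: abs_mult\<close>)
qed

definition pot :: "real \<Rightarrow> 'a \<Rightarrow> real" where
  "pot b x = (LINT y|lborel. v y * norm (x - y) powr (- b))"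

lemma kernel_bound: "x \<in> ball x0 r0 \<Longrightarrow> y \<in> K \<Longrightarrow> b \<ge> 0 \<Longrightarrow> \<bar>norm (x - y) powr (- b)\<bar> \<le> \<delta> powr (- b)"
  using \<delta> powr_mono2'[of "- b" \<delta> "norm (x - y)"] by auto

lemma pot_continuous:
  assumes x: "x \<in> ball x0 r0" and b: "b \<ge> 0"
  shows "isCont (pot b) x"
proof -
  have "continuous_on (ball x0 r0) (pot b)"
    unfolding continuous_on_sequentially
  proof (intro allI ballI impI, elim conjE)
    fix u and c assume c: "c \<in> ball x0 r0" and u: "\<forall>n. u n \<in> ball x0 r0" "u \<longlonglongrightarrow> c"
    show "(pot b \<circ> u) \<longlonglongrightarrow> pot b c" unfolding pot_def o_def
    proof (rule integral_dominated_convergence[where w="\<lambda>y. \<bar>\<delta> powr (- b)\<bar> * \<bar>v y\<bar>"])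
      show "integrable lborel (\<lambda>y. \<bar>\<delta> powr (- b)\<bar> * \<bar>v y\<bar>)" using v by simp
      show "AE y in lborel. (\<lambda>n. v y * norm (u n - y) powr (- b)) \<longlonglongrightarrow> v y * norm (c - y) powr (- b)"
      proof (rule AE_I2)
        fix y show "(\<lambda>n. v y * norm (u n - y) powr (- b)) \<longlonglongrightarrow> v y * norm (c - y) powr (- b)"
        proof (cases "y \<in> K")
          case True
          then have "norm (c - y) \<noteq> 0" using \<delta>(2)[OF c] \<delta>(1) by fastforce
          then show ?thesis by (intro tendsto_intros u) auto
        qed (use K in simp)
      qed
      show "AE y in lborel. norm (v y * norm (u n - y) powr (- b)) \<le> \<bar>\<delta> powr (- b)\<bar> * \<bar>v y\<bar>" for n
        by (intro AE_I2 integrable_v_mult(2) kernel_bound) (use u(1) b in auto)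
    qed measurable
  qed
  then show ?thesis using x by (simp add: continuous_on_eq_continuous_at)
qed

text \<open>The potential is continuous, so near a point where it does not vanish it keeps its sign,
  and a small bump there has a nonzero pairing.\<close>

lemma pot_zero_of_bumps:
  assumes b: "b \<ge> 0"
    and z: "\<And>c r. r > 0 \<Longrightarrow> cball c r \<subseteq> ball x0 r0 \<Longrightarrow>
      (LINT z|lborel. (case z of (x, y) \<Rightarrow> bump c r x * v y * norm (x - y) powr (- b))) = 0"
    and c: "c \<in> ball x0 r0"
  shows "pot b c = 0"
proof (rule ccontr)
  assume nz: "pot b c \<noteq> 0"
  define \<sigma> where "\<sigma> = sgn (pot b c)"
  have \<sigma>: "\<sigma> * pot b c = \<bar>pot b c\<bar>" "\<bar>\<sigma>\<bar> = 1" unfolding \<sigma>_def using nz by (auto simp: sgn_real_def)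
  have "\<bar>pot b c\<bar> / 2 > 0" using nz by simp
  then obtain d where d: "d > 0" "\<And>x. dist x c < d \<Longrightarrow> dist (pot b x) (pot b c) < \<bar>pot b c\<bar> / 2"
    using pot_continuous[OF c b] unfolding continuous_at_eps_delta by blast
  define r where "r = min (d / 2) ((r0 - dist x0 c) / 2)"
  have p: "r0 - dist x0 c > 0" using c by simp
  have r: "r > 0" "r < d" "r < r0 - dist x0 c" using d(1) p unfolding r_def min_def by auto
  have sub: "cball c r \<subseteq> ball x0 r0"
  proof
    fix x assume "x \<in> cball c r"
    then show "x \<in> ball x0 r0" using r(3) dist_triangle[of x0 x c] by simp
  qed
  note [measurable] = Cc_measurable[OF bump_Cc[OF r(1), of c]]
  have bi: "integrable lborel (bump c r)" by (rule Cc_integrable[OF bump_Cc[OF r(1)]])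
  have I: "integrable (lborel \<Otimes>\<^sub>M lborel) (\<lambda>(x, y). bump c r x * v y * norm (x - y) powr (- b))"
  proof (rule Bochner_Integration.integrable_bound)
    show "integrable (lborel \<Otimes>\<^sub>M lborel) (\<lambda>z. \<delta> powr (- b) * (case z of (x, y) \<Rightarrow> bump c r x * v y))"
      using integrable_mult_right[OF integrable_tensor(1)[OF bi v]] by (simp add: lborel_prod)
    show "AE z in lborel \<Otimes>\<^sub>M lborel. norm (case z of (x, y) \<Rightarrow> bump c r x * v y * norm (x - y) powr (- b)) \<le> norm (\<delta> powr (- b) * (case z of (x, y) \<Rightarrow> bump c r x * v y))"
    proof (rule AE_I2)
      fix z :: "'a \<times> 'a"
      obtain x y where z: "z = (x, y)" by (cases z)
      have "\<bar>bump c r x * v y\<bar> * \<bar>norm (x - y) powr (- b)\<bar> \<le> \<bar>bump c r x * v y\<bar> * \<delta> powr (- b)"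
      proof (cases "bump c r x * v y = 0")
        case False
        then have "y \<in> K" "norm (x - c) < r" using K(2) bump_zero[OF r(1), where ?x0.0=c and x=x] by (auto intro: ccontr)
        then have "y \<in> K" "x \<in> cball c r" by (auto simp: dist_norm norm_minus_commute)
        then show ?thesis using sub b by (intro mult_left_mono kernel_bound) auto
      qed auto
      then show "norm (case z of (x, y) \<Rightarrow> bump c r x * v y * norm (x - y) powr (- b)) \<le> norm (\<delta> powr (- b) * (case z of (x, y) \<Rightarrow> bump c r x * v y))"
        by (simp add: z abs_mult mult.commute)
    qed
  qed measurable
  have inner: "(LINT y|lborel. bump c r x * v y * norm (x - y) powr (- b)) = bump c r x * pot b x" for x
    unfolding pot_def by (simp add: mult.assoc)
  have int: "integrable lborel (\<lambda>x. bump c r x * pot b x)"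
    using lborel_pair.integrable_fst[OF I] by (simp add: inner)
  have "(LINT x|lborel. bump c r x * pot b x) = 0"
    using lborel_pair.integral_fst[OF I] z[OF r(1) sub] by (simp add: inner lborel_prod)
  then have zero: "(LINT x|lborel. \<sigma> * (bump c r x * pot b x)) = 0" by simp
  have "(LINT x|lborel. bump c r x * (\<bar>pot b c\<bar> / 2)) \<le> (LINT x|lborel. \<sigma> * (bump c r x * pot b x))"
  proof (rule integral_mono)
    show "integrable lborel (\<lambda>x. bump c r x * (\<bar>pot b c\<bar> / 2))" using bi by simp
    show "integrable lborel (\<lambda>x. \<sigma> * (bump c r x * pot b x))" using int by simp
    fix x
    show "bump c r x * (\<bar>pot b c\<bar> / 2) \<le> \<sigma> * (bump c r x * pot b x)"
    proof (cases "dist x c < r")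
      case True
      then have "\<bar>pot b x - pot b c\<bar> < \<bar>pot b c\<bar> / 2" using d(2)[of x] r(2) by (simp add: dist_real_def)
      then have "\<bar>\<sigma> * (pot b x - pot b c)\<bar> < \<bar>pot b c\<bar> / 2" using \<sigma>(2) by (simp add: abs_mult)
      then have "\<bar>pot b c\<bar> / 2 \<le> \<sigma> * pot b x" using \<sigma>(1) unfolding right_diff_distrib abs_less_iff by linarith
      from mult_left_mono[OF this bump_nonneg[of c r x]] show ?thesis by (simp add: mult.left_commute)
    qed (use bump_zero[OF r(1), of x c] in \<open>auto simp: dist_norm not_less\<close>)
  qed
  moreover have "(LINT x|lborel. bump c r x * (\<bar>pot b c\<bar> / 2)) > 0"
    using bump_integral_pos[OF r(1), of c] nz by simp
  ultimately show False using zero by linarith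
qed

end

section \<open>Iterated Laplacians of the Riesz kernel and approximation by Gaussians\<close>

lemma powr_kernel_second_difference:
  fixes z e :: "'a::euclidean_space" and b \<delta> :: real
  defines "Q \<equiv> \<lambda>t. (norm (z + t *\<^sub>R e))\<^sup>2"
  defines "\<psi> \<equiv> \<lambda>t. - b * Q t powr (- b / 2 - 1) + b * (b + 2) * (z \<bullet> e + t)\<^sup>2 * Q t powr (- b / 2 - 2)"
  assumes e: "norm e = 1" and b: "b > 0" and \<delta>: "\<delta> > 0" "norm z \<ge> \<delta>"
  shows "\<And>t. 0 < t \<Longrightarrow> t \<le> \<delta> / 2 \<Longrightarrow> \<exists>\<theta> \<theta>'. \<bar>\<theta>\<bar> \<le> t \<and> \<bar>\<theta>'\<bar> \<le> t \<and>
      (norm (z + t *\<^sub>R e) powr (- b) + norm (z - t *\<^sub>R e) powr (- b) - 2 * norm z powr (- b)) / t\<^sup>2 = (\<psi> \<theta> + \<psi> \<theta>') / 2"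
    and "\<And>t. \<bar>t\<bar> \<le> \<delta> / 2 \<Longrightarrow> \<bar>\<psi> t\<bar> \<le> (b + b * (b + 2)) * (\<delta> / 2) powr (- b - 2)"
    and "isCont \<psi> 0"
proof -
  define f where "f t = Q t powr (- b / 2)" for t
  define f' where "f' t = - b * (z \<bullet> e + t) * Q t powr (- b / 2 - 1)" for t
  have Qe: "Q t = (norm z)\<^sup>2 + 2 * (z \<bullet> e) * t + t\<^sup>2" for t
    unfolding Q_def power2_norm_eq_inner using e
    by (simp add: inner_add_left inner_add_right inner_commute power2_eq_square norm_eq_1 algebra_simps)
  \<comment> \<open>The step is at most half the distance of \<open>z\<close> from the singularity,
    so the segment stays at distance \<open>\<delta> / 2\<close>. This makes the bound on \<psi>
    independent of \<open>z\<close>, as dominated convergence will require.\<close>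
  have big: "norm (z + t *\<^sub>R e) \<ge> \<delta> / 2" if "\<bar>t\<bar> \<le> \<delta> / 2" for t
    using norm_triangle_ineq2[of z "- (t *\<^sub>R e)"] e \<delta> that by simp
  have Qpos: "Q t > 0" if "\<bar>t\<bar> \<le> \<delta> / 2" for t
    using big[OF that] \<delta>(1) unfolding Q_def by (intro zero_less_power) linarith
  have Qd: "(Q has_real_derivative 2 * (z \<bullet> e + t)) (at t)" for t
    unfolding Qe[abs_def] by (auto intro!: derivative_eq_intros)
  have d1: "(f has_real_derivative f' t) (at t)" if "\<bar>t\<bar> \<le> \<delta> / 2" for t
    unfolding f_def f'_def
    by (rule DERIV_cong[OF DERIV_fun_powr[OF Qd Qpos[OF that]]]) (simp add: algebra_simps)
  have d2: "(f' has_real_derivative \<psi> t) (at t)" if "\<bar>t\<bar> \<le> \<delta> / 2" for t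
  proof -
    have l: "((\<lambda>t. - b * (z \<bullet> e + t)) has_real_derivative - b) (at t)" by (auto intro!: derivative_eq_intros)
    have p: "((\<lambda>t. Q t powr (- b / 2 - 1)) has_real_derivative (- b / 2 - 1) * Q t powr (- b / 2 - 1 - 1) * (2 * (z \<bullet> e + t))) (at t)"
      by (rule DERIV_cong[OF DERIV_fun_powr[OF Qd Qpos[OF that]]]) simp
    show ?thesis unfolding f'_def \<psi>_def
      proof (rule DERIV_cong[OF DERIV_mult[OF l p]])
      have e: "- b / 2 - 1 - 1 = - b / 2 - (2::real)" by simp
      show "- b * Q t powr (- b / 2 - 1) + (- b / 2 - 1) * Q t powr (- b / 2 - 1 - 1) * (2 * (z \<bullet> e + t)) * (- b * (z \<bullet> e + t)) =
        - b * Q t powr (- b / 2 - 1) + b * (b + 2) * (z \<bullet> e + t)\<^sup>2 * Q t powr (- b / 2 - 2)"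
        unfolding e by (simp add: power2_eq_square field_simps)
    qed
  qed
  have fn: "f t = norm (z + t *\<^sub>R e) powr (- b)" for t
    unfolding f_def Q_def using norm_powr_double[of "z + t *\<^sub>R e" "- b / 2"] by simp
  show "\<exists>\<theta> \<theta>'. \<bar>\<theta>\<bar> \<le> t \<and> \<bar>\<theta>'\<bar> \<le> t \<and>
      (norm (z + t *\<^sub>R e) powr (- b) + norm (z - t *\<^sub>R e) powr (- b) - 2 * norm z powr (- b)) / t\<^sup>2 = (\<psi> \<theta> + \<psi> \<theta>') / 2"
    if t: "0 < t" "t \<le> \<delta> / 2" for t
  proof -
    define df where "df m = (if m = 0 then f else if m = 1 then f' else \<psi>)" for m :: nat
    have df: "\<forall>m u. m < 2 \<and> - t \<le> u \<and> u \<le> t \<longrightarrow> DERIV (df m) u :> df (Suc m) u"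
      using d1 d2 t by (auto simp: df_def less_2_cases_iff)
    have T: "\<exists>u. \<bar>u\<bar> \<le> t \<and> f x = f 0 + f' 0 * x + \<psi> u / 2 * x\<^sup>2" if x: "x = t \<or> x = - t" for x
    proof -
      have "\<exists>u. (if x < 0 then x < u \<and> u < 0 else 0 < u \<and> u < x) \<and>
          f x = (\<Sum>m<2. df m 0 / fact m * (x - 0) ^ m) + df 2 u / fact 2 * (x - 0)\<^sup>2"
        by (rule Taylor[of 2 df f "- t" t 0 x]) (use df x t in \<open>auto simp: df_def\<close>)
      then obtain u where u: "if x < 0 then x < u \<and> u < 0 else 0 < u \<and> u < x"
        "f x = (\<Sum>m<2. df m 0 / fact m * (x - 0) ^ m) + df 2 u / fact 2 * (x - 0)\<^sup>2" by blast
      have "\<bar>u\<bar> \<le> t" using u(1) x t by (auto split: if_splits)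
      moreover have "f x = f 0 + f' 0 * x + \<psi> u / 2 * x\<^sup>2"
        using u(2) by (simp add: df_def numeral_2_eq_2 lessThan_Suc)
      ultimately show ?thesis by blast
    qed
    obtain u1 where u1: "\<bar>u1\<bar> \<le> t" "f t = f 0 + f' 0 * t + \<psi> u1 / 2 * t\<^sup>2" using T[of t] by auto
    obtain u2 where u2: "\<bar>u2\<bar> \<le> t" "f (- t) = f 0 + f' 0 * (- t) + \<psi> u2 / 2 * (- t)\<^sup>2" using T[of "- t"] by auto
    \<comment> \<open>In the sum of the two Taylor expansions the first order terms cancel, leaving
      only Lagrange remainders.\<close>
    have "f t + f (- t) - 2 * f 0 = (\<psi> u1 + \<psi> u2) / 2 * t\<^sup>2" unfolding u1(2) u2(2) by (simp add: algebra_simps)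
    then have "(f t + f (- t) - 2 * f 0) / t\<^sup>2 = (\<psi> u1 + \<psi> u2) / 2" using t by simp
    then show ?thesis using u1(1) u2(1) unfolding fn by auto
  qed
  show "\<bar>\<psi> t\<bar> \<le> (b + b * (b + 2)) * (\<delta> / 2) powr (- b - 2)" if t: "\<bar>t\<bar> \<le> \<delta> / 2" for t
  proof -
    have ze: "z \<bullet> e + t = (z + t *\<^sub>R e) \<bullet> e" using e by (simp add: inner_add_left norm_eq_1)
    have "(z \<bullet> e + t)\<^sup>2 \<le> Q t"
    proof -
      have "\<bar>z \<bullet> e + t\<bar> \<le> norm (z + t *\<^sub>R e)" unfolding ze using Cauchy_Schwarz_ineq2[of "z + t *\<^sub>R e" e] e by simp
      from power_mono[OF this, of 2] show ?thesis unfolding Q_def by simp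
    qed
    then have "(z \<bullet> e + t)\<^sup>2 * Q t powr (- b / 2 - 2) \<le> Q t * Q t powr (- b / 2 - 2)" by (intro mult_right_mono) auto
    also have "\<dots> = Q t powr 1 * Q t powr (- b / 2 - 2)" using Qpos[OF t] by simp
    also have "\<dots> = Q t powr (- b / 2 - 1)" unfolding powr_add[symmetric] by (rule arg_cong[where f="\<lambda>a. Q t powr a"]) simp
    finally have 1: "(z \<bullet> e + t)\<^sup>2 * Q t powr (- b / 2 - 2) \<le> Q t powr (- b / 2 - 1)" .
    have "\<bar>\<psi> t\<bar> \<le> b * Q t powr (- b / 2 - 1) + b * (b + 2) * ((z \<bullet> e + t)\<^sup>2 * Q t powr (- b / 2 - 2))"
      unfolding \<psi>_def using b by (intro order_trans[OF abs_triangle_ineq]) (simp add: abs_mult mult.assoc)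
    also have "\<dots> \<le> b * Q t powr (- b / 2 - 1) + b * (b + 2) * Q t powr (- b / 2 - 1)"
      using 1 b by (intro add_left_mono mult_left_mono) auto
    also have "\<dots> = (b + b * (b + 2)) * Q t powr (- b / 2 - 1)" by (simp add: algebra_simps)
    also have "Q t powr (- b / 2 - 1) = norm (z + t *\<^sub>R e) powr (- b - 2)"
      
    proof -
      have "2 * (- b / 2 - 1) = - b - 2" by simp
      then show ?thesis unfolding Q_def using norm_powr_double[of "z + t *\<^sub>R e" "- b / 2 - 1"] by simp
    qed
    also have "\<dots> \<le> (\<delta> / 2) powr (- b - 2)" using big[OF t] \<delta> b by (intro powr_mono2') auto
    finally show ?thesis using b by (simp add: mult_left_mono)
  qed
  have Q0: "isCont Q 0" using Qd by (rule DERIV_isCont)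
  show "isCont \<psi> 0" unfolding \<psi>_def
    by (intro continuous_intros Q0) (use Qpos[of 0] \<delta> in auto)
qed

context separated_density
begin

text \<open>Second difference quotients of the vanishing potential vanish; in the limit they give
  the pure second derivatives under the integral. Summing over the coordinates yields the Laplacian
  of the kernel, a multiple of the next power, and the second hypothesis on \<open>b\<close> makes
  the multiple nonzero.\<close>

lemma pot_zero_step:
  assumes b: "b > 0" "b + 2 > real DIM('a)" and z: "\<And>x. x \<in> ball x0 r0 \<Longrightarrow> pot b x = 0" and x: "x \<in> ball x0 r0"
  shows "pot (b + 2) x = 0"
proof -
  define \<psi> where "\<psi> e y t = - b * ((norm (x - y + t *\<^sub>R e))\<^sup>2) powr (- b / 2 - 1) +
     b * (b + 2) * ((x - y) \<bullet> e + t)\<^sup>2 * ((norm (x - y + t *\<^sub>R e))\<^sup>2) powr (- b / 2 - 2)" for e y t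
  define M where "M = (b + b * (b + 2)) * (\<delta> / 2) powr (- b - 2)"
  have M0: "M \<ge> 0" unfolding M_def using b by simp
  \<comment> \<open>Small enough for the Taylor bound on the kernel and for
    \<open>x + t *\<^sub>R e\<close> and \<open>x - t *\<^sub>R e\<close> to stay in the
    ball.\<close>
  define \<tau> where "\<tau> = min (\<delta> / 2) ((r0 - dist x0 x) / 2)"
  have p: "r0 - dist x0 x > 0" using x by simp
  have \<tau>: "\<tau> > 0" "\<tau> \<le> \<delta> / 2" "\<tau> < r0 - dist x0 x" using \<delta>(1) p unfolding \<tau>_def min_def by auto
  define t where "t k = \<tau> / real (Suc k)" for k
  have t: "0 < t k" "t k \<le> \<tau>" for k using \<tau>(1) by (auto simp: t_def divide_le_eq)
  have t0: "t \<longlonglongrightarrow> 0" unfolding t_def[abs_def] using LIMSEQ_Suc[OF lim_const_over_n[of \<tau>]] by simp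
  have one: "(LINT y|lborel. v y * \<psi> e y 0) = 0" if e: "e \<in> Basis" for e
  proof -
    have ne: "norm e = 1" using e by simp
    define G where "G k y = (norm (x - y + t k *\<^sub>R e) powr (- b) + norm (x - y - t k *\<^sub>R e) powr (- b) - 2 * norm (x - y) powr (- b)) / (t k)\<^sup>2" for k y
    have [measurable]: "G k \<in> borel_measurable borel" for k unfolding G_def[abs_def] by measurable
    have Gx: "\<exists>\<theta> \<theta>'. \<bar>\<theta>\<bar> \<le> t k \<and> \<bar>\<theta>'\<bar> \<le> t k \<and> G k y = (\<psi> e y \<theta> + \<psi> e y \<theta>') / 2" if y: "y \<in> K" for k y
      unfolding G_def \<psi>_def
      by (rule powr_kernel_second_difference(1)[OF ne b(1) \<delta>(1) \<delta>(2)[OF x y]]) (use t[of k] \<tau> in auto)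
    have \<psi>b: "\<bar>\<psi> e y u\<bar> \<le> M" if "y \<in> K" "\<bar>u\<bar> \<le> \<delta> / 2" for y u
      unfolding \<psi>_def M_def by (rule powr_kernel_second_difference(2)[OF ne b(1) \<delta>(1) \<delta>(2)[OF x that(1)] that(2)])
    have Gb: "\<bar>G k y\<bar> \<le> M" if y: "y \<in> K" for k y
    proof -
      obtain \<theta> \<theta>' where th: "\<bar>\<theta>\<bar> \<le> t k" "\<bar>\<theta>'\<bar> \<le> t k" "G k y = (\<psi> e y \<theta> + \<psi> e y \<theta>') / 2" using Gx[OF y] by blast
      have "\<bar>\<psi> e y \<theta>\<bar> \<le> M" "\<bar>\<psi> e y \<theta>'\<bar> \<le> M" using th(1,2) t(2)[of k] \<tau>(2) by (auto intro!: \<psi>b y)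
      then show ?thesis unfolding th(3) abs_le_iff by (auto simp: field_simps)
    qed
    have lim: "(\<lambda>k. G k y) \<longlonglongrightarrow> \<psi> e y 0" if y: "y \<in> K" for y
    proof -
      obtain \<theta> \<theta>' where th: "\<And>k. \<bar>\<theta> k\<bar> \<le> t k" "\<And>k. \<bar>\<theta>' k\<bar> \<le> t k" "\<And>k. G k y = (\<psi> e y (\<theta> k) + \<psi> e y (\<theta>' k)) / 2"
        using Gx[OF y] by metis
      have "\<theta> \<longlonglongrightarrow> 0" "\<theta>' \<longlonglongrightarrow> 0"
        by (rule Lim_null_comparison[OF _ t0], use th(1,2) in simp)+
      moreover have c: "isCont (\<psi> e y) 0"
        unfolding \<psi>_def by (rule powr_kernel_second_difference(3)[OF ne b(1) \<delta>(1) \<delta>(2)[OF x y]])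
      ultimately have "(\<lambda>k. (\<psi> e y (\<theta> k) + \<psi> e y (\<theta>' k)) / 2) \<longlonglongrightarrow> (\<psi> e y 0 + \<psi> e y 0) / 2"
        by (intro tendsto_intros isCont_tendsto_compose[OF c]) auto
      then show ?thesis unfolding th(3) by simp
    qed
    have "(\<lambda>k. LINT y|lborel. v y * G k y) \<longlonglongrightarrow> (LINT y|lborel. v y * \<psi> e y 0)"
    proof (rule integral_dominated_convergence[where w="\<lambda>y. \<bar>M\<bar> * \<bar>v y\<bar>"])
      show "(\<lambda>y. v y * \<psi> e y 0) \<in> borel_measurable lborel" unfolding \<psi>_def by measurable
      show "integrable lborel (\<lambda>y. \<bar>M\<bar> * \<bar>v y\<bar>)" using v by simp
      show "AE y in lborel. (\<lambda>k. v y * G k y) \<longlonglongrightarrow> v y * \<psi> e y 0"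
      proof (rule AE_I2)
        fix y show "(\<lambda>k. v y * G k y) \<longlonglongrightarrow> v y * \<psi> e y 0"
          by (cases "y \<in> K") (auto intro!: tendsto_intros lim simp: K)
      qed
      show "AE y in lborel. norm (v y * G k y) \<le> \<bar>M\<bar> * \<bar>v y\<bar>" for k
        by (intro AE_I2 integrable_v_mult(2) Gb) auto
    qed measurable
    moreover have "(LINT y|lborel. v y * G k y) = 0" for k
    proof -
      have in1: "x + t k *\<^sub>R e \<in> ball x0 r0" "x - t k *\<^sub>R e \<in> ball x0 r0"
        using \<tau>(3) t[of k] ne dist_triangle[of x0 "x + t k *\<^sub>R e" x] dist_triangle[of x0 "x - t k *\<^sub>R e" x]
        by (auto simp: dist_norm)
      have i: "integrable lborel (\<lambda>y. v y * norm (u - y) powr (- b))" if "u \<in> ball x0 r0" for u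
        by (rule integrable_v_mult(1)[OF _ kernel_bound[OF that]]) (use b in auto)
      have eqs: "x - y + t k *\<^sub>R e = (x + t k *\<^sub>R e) - y" "x - y - t k *\<^sub>R e = (x - t k *\<^sub>R e) - y" for y by auto
      have "(LINT y|lborel. v y * G k y) = (LINT y|lborel. (1 / (t k)\<^sup>2) * (v y * norm ((x + t k *\<^sub>R e) - y) powr (- b) +
          v y * norm ((x - t k *\<^sub>R e) - y) powr (- b) - 2 * (v y * norm (x - y) powr (- b))))"
        unfolding G_def eqs by (intro Bochner_Integration.integral_cong refl) (simp add: ring_distribs add_divide_distrib diff_divide_distrib mult.left_commute)
      also have "\<dots> = (1 / (t k)\<^sup>2) * (pot b (x + t k *\<^sub>R e) + pot b (x - t k *\<^sub>R e) - 2 * pot b x)"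
        unfolding pot_def using i[OF in1(1)] i[OF in1(2)] i[OF x] by simp
      also have "\<dots> = 0" using z in1 x by simp
      finally show ?thesis .
    qed
    ultimately show ?thesis by (simp add: LIMSEQ_const_iff)
  qed
  have \<psi>i: "integrable lborel (\<lambda>y. v y * \<psi> e y 0)" if e: "e \<in> Basis" for e
  proof (rule integrable_v_mult(1)[where B=M])
    show "(\<lambda>y. \<psi> e y 0) \<in> borel_measurable borel" unfolding \<psi>_def by measurable
    show "\<bar>\<psi> e y 0\<bar> \<le> M" if y: "y \<in> K" for y
      unfolding \<psi>_def M_def by (rule powr_kernel_second_difference(2)[OF _ b(1) \<delta>(1) \<delta>(2)[OF x y]]) (use e \<delta> in auto)
  qed
  \<comment> \<open>The squares of the coordinates of \<open>w\<close> sum to \<open>q\<close>, so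
    the two kinds of terms combine to the factor \<open>- n + (b + 2)\<close>.\<close>
  have lap: "(\<Sum>e\<in>Basis. \<psi> e y 0) = b * (b + 2 - real DIM('a)) * norm (x - y) powr (- (b + 2))" if y: "y \<in> K" for y
  proof -
    define w where "w = x - y"
    have w: "norm w > 0" using \<delta>(2)[OF x y] \<delta>(1) unfolding w_def by linarith
    define q where "q = (norm w)\<^sup>2"
    have q: "q > 0" unfolding q_def using w by simp
    have sq: "(\<Sum>e\<in>Basis. (w \<bullet> e)\<^sup>2) = q"
      unfolding q_def power2_norm_eq_inner euclidean_inner[of w w] by (simp add: power2_eq_square)
    have "(\<Sum>e\<in>Basis. \<psi> e y 0) = (\<Sum>e\<in>(Basis::'a set). - b * q powr (- b / 2 - 1) + (b * (b + 2) * q powr (- b / 2 - 2)) * (w \<bullet> e)\<^sup>2)"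
      unfolding \<psi>_def w_def[symmetric] by (intro sum.cong refl) (simp add: q_def)
    also have "\<dots> = - (real DIM('a) * (b * q powr (- b / 2 - 1))) + (b * (b + 2) * q powr (- b / 2 - 2)) * q"
      unfolding sum.distrib sum_distrib_left[symmetric] sq by simp
    also have "q powr (- b / 2 - 1) = q powr (- b / 2 - 2) * q"
    proof -
      have "q powr (- b / 2 - 2) * q = q powr (- b / 2 - 2) * q powr 1" using q by simp
      also have "\<dots> = q powr (- b / 2 - 1)" unfolding powr_add[symmetric] by (rule arg_cong[where f="\<lambda>a. q powr a"]) simp
      finally show ?thesis by simp
    qed
    also have "- (real DIM('a) * (b * (q powr (- b / 2 - 2) * q))) + (b * (b + 2) * q powr (- b / 2 - 2)) * q =
        b * (b + 2 - real DIM('a)) * (q powr (- b / 2 - 2) * q)" by (simp add: algebra_simps)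
    also have "q powr (- b / 2 - 2) * q = norm w powr (- (b + 2))"
    proof -
      have "q powr (- b / 2 - 2) * q = q powr (- b / 2 - 2) * q powr 1" using q by simp
      also have "\<dots> = q powr (- b / 2 - 1)" unfolding powr_add[symmetric] by (rule arg_cong[where f="\<lambda>a. q powr a"]) simp
      also have "\<dots> = norm w powr (2 * (- b / 2 - 1))" unfolding q_def by (rule norm_powr_double[symmetric])
      also have "2 * (- b / 2 - 1) = - (b + 2)" by simp
      finally show ?thesis .
    qed
    finally show ?thesis unfolding w_def .
  qed
  have "0 = (\<Sum>e\<in>Basis. LINT y|lborel. v y * \<psi> e y 0)" using one by simp
  also have "\<dots> = (LINT y|lborel. (\<Sum>e\<in>Basis. v y * \<psi> e y 0))"
    by (rule Bochner_Integration.integral_sum[symmetric]) (rule \<psi>i)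
  also have "\<dots> = (LINT y|lborel. (b * (b + 2 - real DIM('a))) * (v y * norm (x - y) powr (- (b + 2))))"
  proof (intro Bochner_Integration.integral_cong refl)
    fix y show "(\<Sum>e\<in>Basis. v y * \<psi> e y 0) = (b * (b + 2 - real DIM('a))) * (v y * norm (x - y) powr (- (b + 2)))"
    proof (cases "y \<in> K")
      case True
      show ?thesis unfolding sum_distrib_left[symmetric] lap[OF True] by simp
    qed (use K in simp)
  qed
  also have "\<dots> = (b * (b + 2 - real DIM('a))) * pot (b + 2) x" unfolding pot_def by simp
  finally show ?thesis using b by simp
qed

lemma pot_zero_all:
  assumes a: "a > 0" "a + 2 > real DIM('a)" and z: "\<And>x. x \<in> ball x0 r0 \<Longrightarrow> pot a x = 0"
  shows "x \<in> ball x0 r0 \<Longrightarrow> pot (a + 2 * real k) x = 0"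
proof (induction k arbitrary: x)
  case (Suc k)
  have "pot (a + 2 * real k + 2) x = 0" by (rule pot_zero_step) (use a Suc in auto)
  then show ?case by (simp add: algebra_simps)
qed (use z in simp)

text \<open>Polynomials in \<open>norm (x - y) powr (- 2)\<close> approximate the quotient of a Gaussian and the kernel
  uniformly on \<open>K\<close>.\<close>

lemma gaussian_mean_zero:
  assumes a: "a > 0" and z: "\<And>k. pot (a + 2 * real k) x = 0" and x: "x \<in> ball x0 r0"
  shows "(LINT y|lborel. v y * exp (- l * (norm (x - y))\<^sup>2)) = 0"
proof -
  have bdK: "bounded K" using K(1) by (rule compact_imp_bounded)
  then obtain R where R: "R > 0" "\<And>y. y \<in> K \<Longrightarrow> norm y \<le> R" using bounded_pos by metis
  define D where "D = norm x + R + \<delta>"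
  have D: "D > 0" using R \<delta> by (simp add: D_def add_nonneg_pos)
  have nD: "norm (x - y) \<le> D" if "y \<in> K" for y
    using norm_triangle_ineq4[of x y] R(2)[OF that] \<delta>(1) unfolding D_def by linarith
  \<comment> \<open>A compact interval of positive numbers containing all values of
    \<open>norm (x - y) powr (- 2)\<close> for \<open>y\<close> in \<open>K\<close>.\<close>
  define S where "S = {1 / D\<^sup>2 .. 1 / \<delta>\<^sup>2}"
  have S0: "u > 0" if "u \<in> S" for u 
  proof -
    have "0 < 1 / D\<^sup>2" using D by simp
    then show ?thesis using that unfolding S_def atLeastAtMost_iff by linarith
  qed
  \<comment> \<open>The Gaussian divided by the kernel, as a function of
    \<open>u = norm (x - y) powr (- 2)\<close>.\<close>
  define F where "F u = exp (- l / u) * u powr (- a / 2)" for u :: real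
  have Fc: "continuous_on S F" unfolding F_def[abs_def] by (intro continuous_intros) (use S0 in force)+
  define w where "w y = norm (x - y) powr (- a)" for y
  define \<tau> where "\<tau> y = norm (x - y) powr (- 2)" for y
  have wm[measurable]: "w \<in> borel_measurable borel" "\<tau> \<in> borel_measurable borel" unfolding w_def[abs_def] \<tau>_def[abs_def] by measurable
  have yK: "norm (x - y) > 0" "\<tau> y \<in> S" "\<tau> y = 1 / (norm (x - y))\<^sup>2" "w y = \<tau> y powr (a / 2)" if y: "y \<in> K" for y
  proof -
    show p: "norm (x - y) > 0" using \<delta>(2)[OF x y] \<delta>(1) by linarith
    show t: "\<tau> y = 1 / (norm (x - y))\<^sup>2" unfolding \<tau>_def using p by (simp add: powr_minus_divide)
    show "\<tau> y \<in> S" unfolding t S_def using p \<delta>(1) \<delta>(2)[OF x y] nD[OF y] D by (auto intro!: divide_left_mono power_mono)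
    show "w y = \<tau> y powr (a / 2)" unfolding w_def \<tau>_def using p by (simp add: powr_powr)
  qed
  have wF: "w y * F (\<tau> y) = exp (- l * (norm (x - y))\<^sup>2)" if y: "y \<in> K" for y
  proof -
    have "\<tau> y > 0" using yK[OF y] S0 by blast
    then have "\<tau> y powr (a / 2) * \<tau> y powr (- a / 2) = 1" by (simp flip: powr_add)
    then have "w y * F (\<tau> y) = exp (- l / \<tau> y)" unfolding F_def yK(4)[OF y] by simp
    then show ?thesis unfolding yK(3)[OF y] by simp
  qed
  have wb: "\<bar>w y\<bar> \<le> \<delta> powr (- a)" if "y \<in> K" for y unfolding w_def using kernel_bound[OF x that] a by simp
  have vw: "integrable lborel (\<lambda>y. v y * w y)" by (rule integrable_v_mult(1)[OF _ wb]) auto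
  \<comment> \<open>The \<open>k\<close>-th power of \<tau> times \<open>w\<close> is the kernel
    with exponent \<open>- (a + 2 * k)\<close>, whose potential vanishes at \<open>x\<close> by
    hypothesis.\<close>
  have pz: "integrable lborel (\<lambda>y. v y * (w y * poly p (\<tau> y))) \<and> (LINT y|lborel. v y * (w y * poly p (\<tau> y))) = 0" for p
  proof -
    have trm: "v y * (w y * (\<tau> y) ^ k) = v y * norm (x - y) powr (- (a + 2 * real k))" for k y
    proof (cases "y \<in> K")
      case True
      have "(\<tau> y) ^ k = norm (x - y) powr (- (2 * real k))"
        unfolding \<tau>_def using yK(1)[OF True] by (simp add: powr_realpow[symmetric] powr_powr)
      then show ?thesis unfolding w_def by (simp flip: powr_add)
    qed (use K in simp)
    have ti: "integrable lborel (\<lambda>y. v y * (w y * (\<tau> y) ^ k))" for k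
      unfolding trm by (rule integrable_v_mult(1)[OF _ kernel_bound[OF x]]) (use a in auto)
    have tz: "(LINT y|lborel. v y * (w y * (\<tau> y) ^ k)) = 0" for k
      using z[of k] unfolding trm pot_def .
    have eq: "v y * (w y * poly p (\<tau> y)) = (\<Sum>k\<le>degree p. coeff p k * (v y * (w y * (\<tau> y) ^ k)))" for y
      by (simp add: poly_altdef sum_distrib_left mult_ac)
    show ?thesis unfolding eq using ti tz by (auto simp: Bochner_Integration.integral_sum intro!: Bochner_Integration.integrable_sum)
  qed
  define I where "I = (LINT y|lborel. \<bar>v y * w y\<bar>)"
  have I: "I \<ge> 0" unfolding I_def by simp
  have gi: "integrable lborel (\<lambda>y. v y * exp (- l * (norm (x - y))\<^sup>2))"
  proof -
    have "compact (F ` S)" unfolding S_def by (intro compact_continuous_image) (use Fc in \<open>auto simp: S_def\<close>)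
    then obtain B where B: "\<And>u. u \<in> S \<Longrightarrow> \<bar>F u\<bar> \<le> B" 
      using compact_imp_bounded[of "F ` S"] unfolding bounded_iff by (auto simp: image_iff)
    show ?thesis
    proof (rule integrable_v_mult(1)[where B="\<delta> powr (- a) * B"])
      show "\<bar>exp (- l * (norm (x - y))\<^sup>2)\<bar> \<le> \<delta> powr (- a) * B" if "y \<in> K" for y
        unfolding wF[OF that, symmetric] abs_mult by (intro mult_mono wb B yK that) auto
    qed measurable
  qed
  have "\<bar>LINT y|lborel. v y * exp (- l * (norm (x - y))\<^sup>2)\<bar> \<le> e" if e: "e > 0" for e
  proof -
    define d where "d = e / (I + 1)"
    have d: "d > 0" using I e by (simp add: d_def)
    have "\<exists>g. (\<exists>p. g = poly p) \<and> (\<forall>u\<in>S. \<bar>F u - g u\<bar> < d)"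
    proof (rule Stone_Weierstrass_HOL[where P="\<lambda>g. \<exists>p. g = poly p" and S=S])
      show "compact S" by (simp add: S_def)
      show "\<exists>p. (\<lambda>x. c) = poly p" for c :: real by (rule exI[of _ "[:c:]"]) auto
      show "continuous_on S f" if "\<exists>p. f = poly p" for f :: "real \<Rightarrow> real" using that by (auto intro: continuous_intros)
      show "\<exists>p. (\<lambda>x. f x + g x) = poly p" if "(\<exists>p. f = poly p) \<and> (\<exists>p. g = poly p)" for f g :: "real \<Rightarrow> real"
      proof -
        from that obtain p q where "f = poly p" "g = poly q" by blast
        then have "(\<lambda>x. f x + g x) = poly (p + q)" by (simp add: fun_eq_iff)
        then show ?thesis by blast
      qed
      show "\<exists>p. (\<lambda>x. f x * g x) = poly p" if "(\<exists>p. f = poly p) \<and> (\<exists>p. g = poly p)" for f g :: "real \<Rightarrow> real"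
      proof -
        from that obtain p q where "f = poly p" "g = poly q" by blast
        then have "(\<lambda>x. f x * g x) = poly (p * q)" by (simp add: fun_eq_iff)
        then show ?thesis by blast
      qed
      show "\<exists>f. (\<exists>p. f = poly p) \<and> f x \<noteq> f y" if "x \<in> S \<and> y \<in> S \<and> x \<noteq> y" for x y :: real
        using that by (intro exI[of _ "poly [:0, 1:]"]) auto
    qed (use Fc d in auto)
    then obtain p where p: "\<And>u. u \<in> S \<Longrightarrow> \<bar>F u - poly p u\<bar> < d" by blast
    have pi: "integrable lborel (\<lambda>y. v y * (w y * poly p (\<tau> y)))" "(LINT y|lborel. v y * (w y * poly p (\<tau> y))) = 0"
      using pz[of p] by auto
    have "(LINT y|lborel. v y * exp (- l * (norm (x - y))\<^sup>2)) = (LINT y|lborel. v y * exp (- l * (norm (x - y))\<^sup>2) - v y * (w y * poly p (\<tau> y)))"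
      using gi pi by simp
    also have "\<bar>\<dots>\<bar> \<le> (LINT y|lborel. \<bar>v y * exp (- l * (norm (x - y))\<^sup>2) - v y * (w y * poly p (\<tau> y))\<bar>)"
      using integral_norm_bound[of lborel "\<lambda>y. v y * exp (- l * (norm (x - y))\<^sup>2) - v y * (w y * poly p (\<tau> y))"] by simp
    also have "\<dots> \<le> (LINT y|lborel. d * \<bar>v y * w y\<bar>)"
    proof (rule integral_mono)
      show "integrable lborel (\<lambda>y. \<bar>v y * exp (- l * (norm (x - y))\<^sup>2) - v y * (w y * poly p (\<tau> y))\<bar>)" using gi pi by simp
      show "integrable lborel (\<lambda>y. d * \<bar>v y * w y\<bar>)" using vw by simp
      show "\<bar>v y * exp (- l * (norm (x - y))\<^sup>2) - v y * (w y * poly p (\<tau> y))\<bar> \<le> d * \<bar>v y * w y\<bar>" for y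
      proof (cases "y \<in> K")
        case True
        have "v y * exp (- l * (norm (x - y))\<^sup>2) - v y * (w y * poly p (\<tau> y)) = (F (\<tau> y) - poly p (\<tau> y)) * (v y * w y)"
          unfolding wF[OF True, symmetric] by (simp add: algebra_simps)
        then show ?thesis using p[OF yK(2)[OF True]] by (simp add: abs_mult mult_right_mono)
      qed (use K in simp)
    qed
    also have "\<dots> = d * I" unfolding I_def by simp
    also have "\<dots> \<le> e" unfolding d_def using I e by (simp add: field_simps)
    finally show ?thesis .
  qed
  then have "\<bar>LINT y|lborel. v y * exp (- l * (norm (x - y))\<^sup>2)\<bar> \<le> 0 + e" if "e > 0" for e using that by simp
  then have "\<bar>LINT y|lborel. v y * exp (- l * (norm (x - y))\<^sup>2)\<bar> \<le> 0" by (rule field_le_epsilon)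
  then show ?thesis by simp
qed

text \<open>Gaussians centred in a convex set span an algebra: a product of two is a Gaussian centred at
  a convex combination of the centres.\<close>

inductive gauss :: "('a \<Rightarrow> real) \<Rightarrow> bool" where
  base: "l \<ge> 0 \<Longrightarrow> x \<in> ball x0 r0 \<Longrightarrow> gauss (\<lambda>y. c * exp (- l * (norm (x - y))\<^sup>2))"
| add: "gauss f \<Longrightarrow> gauss g \<Longrightarrow> gauss (\<lambda>y. f y + g y)"

lemma gauss_mult_base:
  assumes l1: "l1 \<ge> 0" "x1 \<in> ball x0 r0" and l2: "l2 \<ge> 0" "x2 \<in> ball x0 r0"
  shows "gauss (\<lambda>y. (c1 * exp (- l1 * (norm (x1 - y))\<^sup>2)) * (c2 * exp (- l2 * (norm (x2 - y))\<^sup>2)))"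
proof (cases "l1 + l2 = 0")
  case True
  \<comment> \<open>The product is constant. Constants are Gaussians with \<open>l = 0\<close>, and
    any centre in the ball will do.\<close>
  then have "l1 = 0" "l2 = 0" using l1 l2 by auto
  then show ?thesis using gauss.base[of 0 x0 "c1 * c2"] r0 by simp
next
  case False
  then have L: "l1 + l2 > 0" using l1 l2 by simp
  define L where "L = l1 + l2"
  have L0: "L > 0" using L by (simp add: L_def)
  \<comment> \<open>Completing the square: the centre of the product is the weighted mean, and the
    excess \<open>q\<close> does not depend on \<open>y\<close>.\<close>
  define xm where "xm = (l1 / L) *\<^sub>R x1 + (l2 / L) *\<^sub>R x2"
  have xm: "xm \<in> ball x0 r0"
    unfolding xm_def by (rule convexD[OF convex_ball]) (use l1 l2 L0 in \<open>auto simp: L_def add_divide_distrib[symmetric]\<close>)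
  define q where "q = l1 * (norm x1)\<^sup>2 + l2 * (norm x2)\<^sup>2 - L * (norm xm)\<^sup>2"
  have id: "l1 * (norm (x1 - y))\<^sup>2 + l2 * (norm (x2 - y))\<^sup>2 = L * (norm (xm - y))\<^sup>2 + q" for y
  proof -
    have ex: "(norm (u - y))\<^sup>2 = (norm u)\<^sup>2 - 2 * (u \<bullet> y) + (norm y)\<^sup>2" for u :: 'a
      by (simp add: power2_norm_eq_inner inner_diff_left inner_diff_right inner_commute)
    have "L * (xm \<bullet> y) = l1 * (x1 \<bullet> y) + l2 * (x2 \<bullet> y)"
      unfolding xm_def using L0 by (simp add: inner_add_left field_simps)
    then show ?thesis unfolding ex q_def by (simp add: algebra_simps L_def)
  qed
  have "(\<lambda>y. (c1 * exp (- l1 * (norm (x1 - y))\<^sup>2)) * (c2 * exp (- l2 * (norm (x2 - y))\<^sup>2))) =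
        (\<lambda>y. (c1 * c2 * exp (- q)) * exp (- L * (norm (xm - y))\<^sup>2))"
  proof
    fix y
    have "exp (- l1 * (norm (x1 - y))\<^sup>2) * exp (- l2 * (norm (x2 - y))\<^sup>2) = exp (- (l1 * (norm (x1 - y))\<^sup>2 + l2 * (norm (x2 - y))\<^sup>2))"
      by (simp flip: exp_add)
    also have "\<dots> = exp (- q) * exp (- L * (norm (xm - y))\<^sup>2)" unfolding id by (simp flip: exp_add)
    finally show "(c1 * exp (- l1 * (norm (x1 - y))\<^sup>2)) * (c2 * exp (- l2 * (norm (x2 - y))\<^sup>2)) =
        (c1 * c2 * exp (- q)) * exp (- L * (norm (xm - y))\<^sup>2)" by (simp add: mult_ac)
  qed
  then show ?thesis using gauss.base[OF less_imp_le[OF L0] xm, of "c1 * c2 * exp (- q)"] by simp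
qed

lemma gauss_mult: "gauss f \<Longrightarrow> gauss g \<Longrightarrow> gauss (\<lambda>y. f y * g y)"
proof (induction rule: gauss.induct)
  case (base l x c)
  from base.prems show ?case
  proof (induction rule: gauss.induct)
    case (base l' x' c')
    then show ?case using gauss_mult_base base.hyps \<open>l \<ge> 0\<close> \<open>x \<in> ball x0 r0\<close> by blast
  next
    case (add f g)
    then show ?case using gauss.add by (simp add: distrib_left)
  qed
next
  case (add f1 f2)
  then show ?case using gauss.add by (simp add: distrib_right)
qed

lemma gauss_continuous: "gauss f \<Longrightarrow> continuous_on UNIV f"
  by (induction rule: gauss.induct) (auto intro!: continuous_intros)

text \<open>All iterated potentials vanish on the ball, hence all means against Gaussians centred
  there; these span a separating algebra, so the density itself vanishes.\<close>

theorem riesz_potential_injective: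
  assumes a: "a > 0" "a + 2 > real DIM('a)" and z: "\<And>x. x \<in> ball x0 r0 \<Longrightarrow> pot a x = 0"
  shows "AE y in lborel. v y = 0"
proof (rule algebra_integral_zero_imp_AE_zero[where P=gauss, OF v K])
  show "gauss (\<lambda>x. c)" for c using gauss.base[of 0 x0 c] r0 by simp
  show "\<exists>f. gauss f \<and> f y1 \<noteq> f y2" if "y1 \<in> K \<and> y2 \<in> K \<and> y1 \<noteq> y2" for y1 y2
  proof -
    have ex: "(norm (x - y1))\<^sup>2 - (norm (x - y2))\<^sup>2 = (norm y1)\<^sup>2 - (norm y2)\<^sup>2 - 2 * (x \<bullet> (y1 - y2))" for x
      by (simp add: power2_norm_eq_inner inner_diff_left inner_diff_right inner_commute)
    \<comment> \<open>If all centres in the ball were equidistant from \<open>y1\<close> and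
      \<open>y2\<close>, moving the centre from \<open>x0\<close> in the direction
      \<open>y1 - y2\<close> would give a contradiction, since the difference of the squared
      distances is affine in the centre.\<close>
    have "\<exists>x\<in>ball x0 r0. (norm (x - y1))\<^sup>2 \<noteq> (norm (x - y2))\<^sup>2"
    proof (rule ccontr)
      assume "\<not> ?thesis"
      then have H: "(norm y1)\<^sup>2 - (norm y2)\<^sup>2 = 2 * (x \<bullet> (y1 - y2))" if "x \<in> ball x0 r0" for x
        using ex[of x] that by auto
      define d where "d = (r0 / (2 * norm (y1 - y2))) *\<^sub>R (y1 - y2)"
      have nd: "norm d < r0" unfolding d_def using that r0 by simp
      have "x0 + d \<in> ball x0 r0" "x0 \<in> ball x0 r0" using nd r0 by (auto simp: dist_norm)
      from H[OF this(1)] H[OF this(2)] have "d \<bullet> (y1 - y2) = 0" by (simp add: inner_add_left)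
      then show False unfolding d_def using that r0 by simp
    qed
    then obtain x where x: "x \<in> ball x0 r0" "(norm (x - y1))\<^sup>2 \<noteq> (norm (x - y2))\<^sup>2" by blast
    have "gauss (\<lambda>y. 1 * exp (- 1 * (norm (x - y))\<^sup>2))" by (rule gauss.base) (use x in auto)
    then show ?thesis using x(2) by (intro exI[of _ "\<lambda>y. 1 * exp (- 1 * (norm (x - y))\<^sup>2)"]) auto
  qed
  show "(LINT y|lborel. v y * f y) = 0" if "gauss f" for f
  proof -
    have "integrable lborel (\<lambda>y. v y * f y) \<and> (LINT y|lborel. v y * f y) = 0"
      using that
    proof induction
      case (base l x c)
      have "(LINT y|lborel. v y * exp (- l * (norm (x - y))\<^sup>2)) = 0"
        by (rule gaussian_mean_zero[OF a(1) pot_zero_all[OF a z] ]) (use base in auto)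
      moreover have "integrable lborel (\<lambda>y. v y * exp (- l * (norm (x - y))\<^sup>2))"
        by (rule integrable_v_mult(1)[where B=1]) (use base in auto)
      moreover have "(\<lambda>y. v y * (c * exp (- l * (norm (x - y))\<^sup>2))) = (\<lambda>y. c * (v y * exp (- l * (norm (x - y))\<^sup>2)))" by (auto simp: mult_ac)
      ultimately show ?case by simp
    next
      case (add f g)
      then show ?case by (simp add: distrib_left)
    qed
    then show ?thesis by blast
  qed
qed (auto intro: gauss.add gauss_mult gauss_continuous)

end

section \<open>The spaces of functions supported in an open set\<close>

definition htl :: "real \<Rightarrow> (real ^ 'n) set \<Rightarrow> (real ^ 'n) l2 set" where
  "htl s W = closure (sob s ` test_fun W)"

lemma test_fun_scale:
  fixes \<phi> :: "real ^ 'n \<Rightarrow> real"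
  assumes "\<phi> \<in> test_fun W"
  shows "(\<lambda>x. c * \<phi> x) \<in> test_fun W"
proof -
  have "closure {x. c * \<phi> x \<noteq> 0} \<subseteq> closure {x. \<phi> x \<noteq> 0}" by (rule closure_mono) auto
  moreover from this have "compact (closure {x. c * \<phi> x \<noteq> 0})"
    using assms compact_Int_closed[of "closure {x. \<phi> x \<noteq> 0}" "closure {x. c * \<phi> x \<noteq> 0}"]
    by (simp add: test_fun_def Int_absorb1)
  ultimately show ?thesis using assms unfolding test_fun_def by (auto intro: smooth_mult smooth_const)
qed

lemma test_fun_add:
  fixes \<phi> \<psi> :: "real ^ 'n \<Rightarrow> real"
  assumes "\<phi> \<in> test_fun W" "\<psi> \<in> test_fun W"
  shows "(\<lambda>x. \<phi> x + \<psi> x) \<in> test_fun W"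
proof -
  have sub: "closure {x. \<phi> x + \<psi> x \<noteq> 0} \<subseteq> closure {x. \<phi> x \<noteq> 0} \<union> closure {x. \<psi> x \<noteq> 0}"
    unfolding closure_Un[symmetric] by (rule closure_mono) auto
  have c: "compact (closure {x. \<phi> x \<noteq> 0} \<union> closure {x. \<psi> x \<noteq> 0})" using assms by (simp add: test_fun_def compact_Un)
  have "compact (closure {x. \<phi> x + \<psi> x \<noteq> 0})"
    using compact_Int_closed[OF c, of "closure {x. \<phi> x + \<psi> x \<noteq> 0}"] sub by (simp add: Int_absorb1)
  then show ?thesis using assms sub unfolding test_fun_def by (auto intro: smooth_add)
qed

lemma htl_iff:
  fixes u :: "real ^ 'n \<Rightarrow> real"
  assumes s: "0 \<le> s" "s \<le> 1"
  shows "u \<in> Hs_tilde s W \<longleftrightarrow> in_Hs s u \<and> sob s u \<in> htl s W"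
proof (cases "in_Hs s u")
  case True
  have d: "Hs_norm s (\<lambda>x. u x - \<phi> x) = dist (sob s \<phi>) (sob s u)" if "\<phi> \<in> test_fun W" for \<phi>
    using Hs_norm_sob[OF in_Hs_diff(1)[OF True test_fun_in_Hs[OF that s]]]
      in_Hs_diff(2)[OF True test_fun_in_Hs[OF that s]]
    by (simp add: dist_norm norm_minus_commute)
  have E: "(\<exists>\<phi>\<in>test_fun W. Hs_norm s (\<lambda>x. u x - \<phi> x) < \<epsilon>) \<longleftrightarrow> (\<exists>y\<in>sob s ` test_fun W. dist y (sob s u) < \<epsilon>)" for \<epsilon>
  proof
    assume "\<exists>\<phi>\<in>test_fun W. Hs_norm s (\<lambda>x. u x - \<phi> x) < \<epsilon>"
    then obtain \<phi> where "\<phi> \<in> test_fun W" "Hs_norm s (\<lambda>x. u x - \<phi> x) < \<epsilon>" by blast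
    then show "\<exists>y\<in>sob s ` test_fun W. dist y (sob s u) < \<epsilon>" using d by (intro bexI[of _ "sob s \<phi>"]) auto
  next
    assume "\<exists>y\<in>sob s ` test_fun W. dist y (sob s u) < \<epsilon>"
    then obtain \<phi> where "\<phi> \<in> test_fun W" "dist (sob s \<phi>) (sob s u) < \<epsilon>" by blast
    then show "\<exists>\<phi>\<in>test_fun W. Hs_norm s (\<lambda>x. u x - \<phi> x) < \<epsilon>" using d by (intro bexI[of _ \<phi>]) auto
  qed
  have "u \<in> Hs_tilde s W \<longleftrightarrow> (\<forall>\<epsilon>>0. \<exists>\<phi>\<in>test_fun W. Hs_norm s (\<lambda>x. u x - \<phi> x) < \<epsilon>)"
    using True by (simp add: Hs_tilde_def Hs_iff)
  also have "\<dots> \<longleftrightarrow> sob s u \<in> htl s W" unfolding htl_def closure_approachable by (simp only: E)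
  finally show ?thesis using True by simp
next
  case False
  then show ?thesis by (simp add: Hs_tilde_def Hs_iff)
qed

lemma htl_test_fun: "\<phi> \<in> test_fun W \<Longrightarrow> sob s \<phi> \<in> htl s W"
  unfolding htl_def by (intro subsetD[OF closure_subset] imageI)

lemma closed_htl: "closed (htl s W)" by (simp add: htl_def)

lemma subspace_htl:
  assumes s: "0 \<le> s" "s \<le> 1"
  shows "subspace (htl s W)"
  unfolding htl_def
proof (rule subspace_closure, rule subspaceI)
  have "(\<lambda>x. 0) \<in> test_fun W" by (simp add: test_fun_def smooth_const)
  from imageI[OF this, of "sob s"] show "0 \<in> sob s ` test_fun W" by (simp add: in_Hs_zero)
  show "c *\<^sub>R x \<in> sob s ` test_fun W" if x: "x \<in> sob s ` test_fun W" for c x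
  proof -
    obtain \<phi> where p: "\<phi> \<in> test_fun W" "x = sob s \<phi>" using x by blast
    show ?thesis using imageI[OF test_fun_scale[OF p(1), of c], of "sob s"]
      in_Hs_cmult(2)[OF test_fun_in_Hs[OF p(1) s], of c] p(2) by simp
  qed
  show "x + y \<in> sob s ` test_fun W" if x: "x \<in> sob s ` test_fun W" and y: "y \<in> sob s ` test_fun W" for x y
  proof -
    obtain \<phi> where p: "\<phi> \<in> test_fun W" "x = sob s \<phi>" using x by blast
    obtain \<psi> where q: "\<psi> \<in> test_fun W" "y = sob s \<psi>" using y by blast
    have m: "in_Hs s (\<lambda>x. (- 1) * \<psi> x)" "sob s (\<lambda>x. (- 1) * \<psi> x) = - y"
      using in_Hs_cmult[OF test_fun_in_Hs[OF q(1) s], of "- 1"] q(2) by simp_all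
    have "sob s (\<lambda>x. \<phi> x - (- 1) * \<psi> x) = x + y"
      using in_Hs_diff(2)[OF test_fun_in_Hs[OF p(1) s] m(1)] m(2) p(2) by simp
    then have "sob s (\<lambda>x. \<phi> x + \<psi> x) = x + y" by simp
    then show ?thesis using imageI[OF test_fun_add[OF p(1) q(1)], of "sob s"] by simp
  qed
qed

lemma indicator_mult: "A \<in> sets borel \<Longrightarrow> bdd_mult 1 (indicator A)"
  by (rule bdd_multI) (auto simp: indicator_def)

text \<open>Multiplication by the indicator of the complement is continuous on L2 and kills test
  functions, hence also their limits.\<close>

lemma htl_support:
  fixes a :: "(real ^ 'n) l2"
  assumes s: "0 \<le> s" "s \<le> 1" and W: "W \<in> sets borel" and a: "a \<in> htl s W"
  shows "mulop (indicator W) (emb s a) = emb s a"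
    and "AE x in lborel. x \<notin> W \<longrightarrow> fn (emb s a) x = 0"
proof -
  have W': "- W \<in> sets borel" using W by (rule borel_comp)
  note i = indicator_mult[OF W']
  have "norm (mulop (indicator (- W)) (emb s a)) \<le> 0 + e" if e: "e > 0" for e :: real
  proof -
    obtain \<phi> where p: "\<phi> \<in> test_fun W" "dist (sob s \<phi>) a < e"
      using a e unfolding htl_def closure_approachable by blast
    have h: "in_Hs s \<phi>" by (rule test_fun_in_Hs[OF p(1) s])
    have "\<phi> \<in> sqint" using h by (simp add: in_Hs_def)
    then have "mulop (indicator (- W)) (emb s (sob s \<phi>)) = cls (\<lambda>x. indicator (- W) x * \<phi> x)"
      unfolding emb_sob[OF s(1) h] by (rule mulop_cls[OF i])
    also have "(\<lambda>x. indicator (- W) x * \<phi> x) = (\<lambda>x. 0)" using test_fun_Cc(2)[OF p(1)] by (auto simp: indicator_def fun_eq_iff)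
    finally have z: "mulop (indicator (- W)) (emb s (sob s \<phi>)) = 0" by (simp add: zero_l2_def)
    have "mulop (indicator (- W)) (emb s a) = mulop (indicator (- W)) (emb s (a - sob s \<phi>))"
      using z by (simp add: linear_diff[OF emb_linear[OF s(1)]] linear_diff[OF mulop_linear[OF i]])
    also have "norm \<dots> \<le> 1 * norm (emb s (a - sob s \<phi>))" by (rule mulop_norm[OF i]) simp
    also have "\<dots> \<le> norm (a - sob s \<phi>)" using emb_norm[OF s(1)] by simp
    also have "\<dots> < e" using p(2) by (simp add: dist_norm norm_minus_commute)
    finally show ?thesis by simp
  qed
  then have "norm (mulop (indicator (- W)) (emb s a)) \<le> 0" by (rule field_le_epsilon)
  then have z: "mulop (indicator (- W)) (emb s a) = 0" by simp
  have "AE x in lborel. 0 = indicator (- W) x * fn (emb s a) x"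
    using fn_mulop[OF i, of "emb s a"] fn_zero unfolding z by eventually_elim simp
  then show ae: "AE x in lborel. x \<notin> W \<longrightarrow> fn (emb s a) x = 0" by eventually_elim auto
  show "mulop (indicator W) (emb s a) = emb s a"
  proof (rule l2_eqI)
    show "AE x in lborel. fn (mulop (indicator W) (emb s a)) x = fn (emb s a) x"
      using fn_mulop[OF indicator_mult[OF W], of "emb s a"] ae by eventually_elim (auto simp: indicator_def)
  qed
qed

text \<open>\<open>fn (emb s a)\<close> vanishes outside \<open>W\<close> only almost everywhere.
  Cutting it off with \<open>K\<close> gives a representative of bounded support, for which the
  transform is an integral defined at every point.\<close>

lemma htl_truncated:
  fixes a :: "(real ^ 'n) l2"
  assumes s: "0 \<le> s" "s \<le> 1" and W: "W \<in> sets borel" and a: "a \<in> htl s W"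
    and K: "W \<subseteq> K" "K \<in> sets borel" "K \<subseteq> cball 0 R" and R: "R > 0"
  defines "v \<equiv> \<lambda>x. indicator K x * fn (emb s a) x"
  shows "v \<in> borel_measurable borel" "v \<in> sqint" "cls v = emb s a" "integrable lborel v"
    "(LINT x|lborel. \<bar>v x\<bar>) \<le> norm a * norm (cls (indicator (cball (0::real ^ 'n) R)))"
    "hl v \<in> sqint" "hart (emb s a) = cls (hl v)" "AE \<xi> in lborel. hl v \<xi> = jap \<xi> powr (- (s / 2)) * fn a \<xi>"
proof -
  have iK[measurable]: "(indicator K :: _ \<Rightarrow> real) \<in> borel_measurable borel" using K(2) by simp
  show m: "v \<in> borel_measurable borel" unfolding v_def by measurable
  show sq: "v \<in> sqint" unfolding v_def by (rule bdd_mult_sqint[OF indicator_mult[OF K(2)] fn_sqint])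
  have "AE x in lborel. v x = fn (emb s a) x"
    using htl_support(2)[OF s W a] by eventually_elim (use K(1) in \<open>auto simp: v_def indicator_def\<close>)
  then show c: "cls v = emb s a" by (rule cls_eqI[OF sq])
  have R0: "v x = 0" if "norm x > R" for x using that K(3) by (auto simp: v_def indicator_def)
  show "integrable lborel v" by (rule compact_support_integrable_sqint(1)[OF m sq R0])
  have "(LINT x|lborel. \<bar>v x\<bar>) \<le> norm (cls v) * norm (cls (indicator (cball (0::real ^ 'n) R)))"
    by (rule compact_support_integrable_sqint(2)[OF m sq R0])
  also have "\<dots> \<le> norm a * norm (cls (indicator (cball (0::real ^ 'n) R)))"
    unfolding c using emb_norm[OF s(1)] by (intro mult_right_mono) auto
  finally show "(LINT x|lborel. \<bar>v x\<bar>) \<le> norm a * norm (cls (indicator (cball (0::real ^ 'n) R)))" .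
  show hs: "hl v \<in> sqint" by (rule hart_cls(1)[OF m sq R R0])
  show h: "hart (emb s a) = cls (hl v)" unfolding c[symmetric] by (rule hart_cls(2)[OF m sq R R0])
  have b: "bdd_mult 1 (\<lambda>\<xi>::real ^ 'n. jap \<xi> powr (- (s / 2)))" using s by (intro jap_mult) simp
  have m: "mulop (\<lambda>\<xi>. jap \<xi> powr (- (s / 2))) a = cls (hl v)" unfolding h[symmetric] by (simp add: emb_def)
  show "AE \<xi> in lborel. hl v \<xi> = jap \<xi> powr (- (s / 2)) * fn a \<xi>"
    using fn_mulop[OF b, of a] fn_cls[OF hs] unfolding m by eventually_elim simp
qed

section \<open>Rellich compactness\<close>

lemma Cauchy_of_approx:
  fixes y :: "nat \<Rightarrow> 'a::real_normed_vector"
  assumes "\<And>e. e > 0 \<Longrightarrow> \<exists>p N. \<forall>n\<ge>N. norm (y n - p) \<le> e"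
  shows "Cauchy y"
proof (rule metric_CauchyI)
  fix e :: real assume e: "e > 0"
  then obtain p N where p: "\<And>n. n \<ge> N \<Longrightarrow> norm (y n - p) \<le> e / 3" using assms[of "e / 3"] by auto
  have "dist (y m) (y n) < e" if "m \<ge> N" "n \<ge> N" for m n
  proof -
    have "dist (y m) (y n) \<le> dist (y m) p + dist (y n) p" by (rule dist_triangle2)
    then show ?thesis using p[OF that(1)] p[OF that(2)] e by (simp add: dist_norm)
  qed
  then show "\<exists>M. \<forall>m\<ge>M. \<forall>n\<ge>M. dist (y m) (y n) < e" by blast
qed

lemma cas_lipschitz: "\<bar>cas a - cas b\<bar> \<le> 2 * \<bar>a - b\<bar>"
proof -
  have "norm (cas a - cas b) \<le> 2 * norm (a - b)"
  proof (rule field_differentiable_bound[where S=UNIV and f'="\<lambda>t. - sin t + cos t"])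
    show "(cas has_field_derivative - sin t + cos t) (at t within UNIV)" for t
      unfolding cas_def[abs_def] by (auto intro!: derivative_eq_intros)
    show "norm (- sin t + cos t) \<le> 2" for t :: real
      using abs_sin_le_one[of t] abs_cos_le_one[of t] unfolding real_norm_def by linarith
  qed auto
  then show ?thesis by simp
qed

lemma hl_lipschitz:
  fixes f :: "'a::euclidean_space \<Rightarrow> real"
  assumes f: "integrable lborel f" and R: "\<And>x. norm x > R \<Longrightarrow> f x = 0"
  shows "\<bar>hl f \<xi> - hl f \<eta>\<bar> \<le> (2 * pi) powr (- real DIM('a) / 2) * (2 * R * (LINT x|lborel. \<bar>f x\<bar>)) * norm (\<xi> - \<eta>)"
proof -
  define k where "k = (2 * pi) powr (- real DIM('a) / 2)"
  have i: "integrable lborel (\<lambda>x. cas (\<zeta> \<bullet> x) * f x)" for \<zeta> by (rule integrable_cas[OF f])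
  have "hl f \<xi> - hl f \<eta> = k * (LINT x|lborel. cas (\<xi> \<bullet> x) * f x - cas (\<eta> \<bullet> x) * f x)"
    unfolding hl_def k_def[symmetric] using i by (simp add: right_diff_distrib)
  then have "\<bar>hl f \<xi> - hl f \<eta>\<bar> = k * \<bar>LINT x|lborel. cas (\<xi> \<bullet> x) * f x - cas (\<eta> \<bullet> x) * f x\<bar>"
    by (simp add: abs_mult k_def)
  also have "\<bar>LINT x|lborel. cas (\<xi> \<bullet> x) * f x - cas (\<eta> \<bullet> x) * f x\<bar> \<le> (LINT x|lborel. \<bar>cas (\<xi> \<bullet> x) * f x - cas (\<eta> \<bullet> x) * f x\<bar>)"
    using integral_norm_bound[of lborel "\<lambda>x. cas (\<xi> \<bullet> x) * f x - cas (\<eta> \<bullet> x) * f x"] by simp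
  also have "\<dots> \<le> (LINT x|lborel. (2 * R * norm (\<xi> - \<eta>)) * \<bar>f x\<bar>)"
  proof (rule integral_mono)
    show "integrable lborel (\<lambda>x. \<bar>cas (\<xi> \<bullet> x) * f x - cas (\<eta> \<bullet> x) * f x\<bar>)" using i by simp
    show "integrable lborel (\<lambda>x. (2 * R * norm (\<xi> - \<eta>)) * \<bar>f x\<bar>)" using f by simp
    fix x
    show "\<bar>cas (\<xi> \<bullet> x) * f x - cas (\<eta> \<bullet> x) * f x\<bar> \<le> (2 * R * norm (\<xi> - \<eta>)) * \<bar>f x\<bar>"
    proof (cases "norm x > R")
      case False
      have "\<bar>cas (\<xi> \<bullet> x) - cas (\<eta> \<bullet> x)\<bar> \<le> 2 * \<bar>(\<xi> - \<eta>) \<bullet> x\<bar>"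
        using cas_lipschitz[of "\<xi> \<bullet> x" "\<eta> \<bullet> x"] by (simp add: inner_diff_left)
      also have "\<dots> \<le> 2 * (norm (\<xi> - \<eta>) * norm x)" using Cauchy_Schwarz_ineq2[of "\<xi> - \<eta>" x] by simp
      also have "\<dots> \<le> 2 * (norm (\<xi> - \<eta>) * R)" using False by (intro mult_left_mono) auto
      finally have "\<bar>cas (\<xi> \<bullet> x) - cas (\<eta> \<bullet> x)\<bar> * \<bar>f x\<bar> \<le> (2 * R * norm (\<xi> - \<eta>)) * \<bar>f x\<bar>"
        by (intro mult_right_mono) (auto simp: mult_ac)
      then show ?thesis by (simp add: abs_mult[symmetric] left_diff_distrib)
    qed (use R in simp)
  qed
  also have "\<dots> = 2 * R * norm (\<xi> - \<eta>) * (LINT x|lborel. \<bar>f x\<bar>)" by simp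
  finally show ?thesis by (simp add: k_def mult_ac mult_left_mono)
qed

text \<open>A diagonal sequence converges on a countable dense set, and the common Lipschitz
  constant extends the convergence to every point.\<close>

lemma equilipschitz_convergent_subsequence:
  fixes f :: "nat \<Rightarrow> 'a::euclidean_space \<Rightarrow> real"
  assumes B: "\<And>n x. \<bar>f n x\<bar> \<le> B" and L: "\<And>n x y. \<bar>f n x - f n y\<bar> \<le> L * norm (x - y)"
  obtains r :: "nat \<Rightarrow> nat" and G where "strict_mono r" "\<And>x. (\<lambda>n. f (r n) x) \<longlonglongrightarrow> G x"
proof -
  obtain S :: "'a set" where S: "countable S" "\<And>X. open X \<Longrightarrow> X \<noteq> {} \<Longrightarrow> \<exists>d\<in>S. d \<in> X"
    using countable_dense_setE by blast
  obtain r :: "nat \<Rightarrow> nat" where r: "strict_mono r" "\<And>x. x \<in> S \<Longrightarrow> \<exists>l. (\<lambda>n. f (r n) x) \<longlonglongrightarrow> l"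
    using function_convergent_subsequence[OF S(1), of f B] B by (metis real_norm_def)
  have "\<exists>l. (\<lambda>n. f (r n) x) \<longlonglongrightarrow> l" for x
  proof -
    have "Cauchy (\<lambda>n. f (r n) x)"
    proof (rule Cauchy_of_approx)
      fix e :: real assume e: "e > 0"
      define d where "d = e / (2 * (\<bar>L\<bar> + 1))"
      have d: "d > 0" using e by (simp add: d_def add_nonneg_pos)
      obtain y where y: "y \<in> S" "y \<in> ball x d" using S(2)[of "ball x d"] d by auto
      obtain l where l: "(\<lambda>n. f (r n) y) \<longlonglongrightarrow> l" using r(2)[OF y(1)] by blast
      then obtain N where N: "\<And>n. n \<ge> N \<Longrightarrow> \<bar>f (r n) y - l\<bar> < e / 2"
        using e unfolding LIMSEQ_iff by (metis half_gt_zero real_norm_def)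
      have "L * norm (x - y) \<le> (\<bar>L\<bar> + 1) * d" using y(2) d by (intro mult_mono) (auto simp: dist_norm)
      also have "\<dots> = e / 2" unfolding d_def by (simp add: field_simps)
      finally have Ld: "L * norm (x - y) \<le> e / 2" .
      have "norm (f (r n) x - l) \<le> e" if "n \<ge> N" for n
        using N[OF that] L[of "r n" x y] Ld unfolding real_norm_def by linarith
      then show "\<exists>p N. \<forall>n\<ge>N. norm (f (r n) x - p) \<le> e" by blast
    qed
    then show ?thesis using Cauchy_convergent_iff convergent_def by blast
  qed
  then have "\<exists>G. \<forall>x. (\<lambda>n. f (r n) x) \<longlonglongrightarrow> G x" by metis
  then show ?thesis using that r(1) by blast
qed

text \<open>Functions bounded in L2 and supported in a fixed ball have uniformly bounded and
  equi-Lipschitz transforms, so a subsequence of the transforms converges pointwise. On low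
  frequencies this gives convergence in L2 by domination; high frequencies are uniformly small by
  the Sobolev weight.\<close>

theorem rellich:
  fixes x :: "nat \<Rightarrow> (real ^ 'n) l2"
  assumes s: "0 < s" "s \<le> 1" and W: "open W" "bounded W"
    and x: "\<And>n. x n \<in> htl s W" "\<And>n. norm (x n) \<le> 1"
  shows "\<exists>r::nat \<Rightarrow> nat. strict_mono r \<and> Cauchy (\<lambda>n. emb s (x (r n)))"
proof -
  have s0: "0 \<le> s" using s by simp
  obtain R where R: "R > 0" "W \<subseteq> cball 0 R" using W(2) unfolding bounded_pos by (auto simp: subset_iff)
  define v where "v n y = indicator (cball 0 R) y * fn (emb s (x n)) y" for n and y :: "real ^ 'n"
  have Wb: "W \<in> sets borel" using W(1) by simp
  note T = htl_truncated[OF s0 s(2) Wb x(1) R(2) _ order_refl R(1), folded v_def]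
  have cb: "cball (0::real ^ 'n) R \<in> sets borel" by simp
  note [measurable] = T(1)[OF cb]
  define k where "k = (2 * pi) powr (- real DIM(real ^ 'n) / 2)"
  have k: "k \<ge> 0" by (simp add: k_def)
  define I where "I = norm (cls (indicator (cball (0::real ^ 'n) R)))"
  have vI: "(LINT y|lborel. \<bar>v n y\<bar>) \<le> I" for n
    using T(5)[OF cb, of n] mult_right_mono[OF x(2)[of n], of I] unfolding I_def by simp
  have B: "\<bar>hl (v n) \<xi>\<bar> \<le> k * 2 * I" for n \<xi>

  proof -
    have "\<bar>hl (v n) \<xi>\<bar> \<le> k * 2 * (LINT y|lborel. \<bar>v n y\<bar>)" using hl_bound[OF T(4)[OF cb], of n \<xi>] unfolding k_def .
    also have "\<dots> \<le> k * 2 * I" using k by (intro mult_left_mono vI) simp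
    finally show ?thesis .
  qed
  have L: "\<bar>hl (v n) \<xi> - hl (v n) \<eta>\<bar> \<le> k * (2 * R * I) * norm (\<xi> - \<eta>)" for n \<xi> \<eta>
  proof -
    have "\<bar>hl (v n) \<xi> - hl (v n) \<eta>\<bar> \<le> k * (2 * R * (LINT y|lborel. \<bar>v n y\<bar>)) * norm (\<xi> - \<eta>)"
      unfolding k_def by (rule hl_lipschitz[OF T(4)[OF cb]]) (simp add: v_def)
    also have "\<dots> \<le> k * (2 * R * I) * norm (\<xi> - \<eta>)"
      using k R(1) vI[of n] by (intro mult_right_mono mult_left_mono) auto
    finally show ?thesis .
  qed
  obtain r G where r: "strict_mono (r::nat \<Rightarrow> nat)" and G: "\<And>\<xi>. (\<lambda>n. hl (v (r n)) \<xi>) \<longlonglongrightarrow> G \<xi>"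
    using equilipschitz_convergent_subsequence[of "\<lambda>n. hl (v n)", OF B L] by blast
  have hm[measurable]: "hl (v n) \<in> borel_measurable borel" for n by (rule hl_measurable) measurable
  have Gm[measurable]: "G \<in> borel_measurable borel"
    by (rule borel_measurable_LIMSEQ_real[OF G]) simp
  have GB: "\<bar>G \<xi>\<bar> \<le> k * 2 * I" for \<xi>
    by (rule LIMSEQ_le_const2[OF tendsto_rabs[OF G]]) (use B in auto)
  define j where "j = (\<lambda>\<xi>::real ^ 'n. jap \<xi> powr (- (s / 2)))"
  have jb: "bdd_mult 1 j" unfolding j_def using s by (intro jap_mult) simp
  have "Cauchy (\<lambda>n. cls (hl (v (r n))))"
  proof (rule Cauchy_of_approx)
    fix e :: real assume e: "e > 0"
    have "((\<lambda>\<rho>::real. (1 + \<rho>\<^sup>2) powr (- (s / 2))) \<longlongrightarrow> 0) at_top"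
      using s by (intro tendsto_neg_powr filterlim_tendsto_add_at_top[OF tendsto_const] filterlim_pow_at_top filterlim_ident) auto
    \<comment> \<open>Beyond radius \<rho> the weight is below \<open>e / 2\<close>, so for vectors
      of norm at most 1 the high frequency part has norm below \<open>e / 2\<close>.\<close>
    then have "\<forall>\<^sub>F \<rho>::real in at_top. (1 + \<rho>\<^sup>2) powr (- (s / 2)) < e / 2 \<and> \<rho> > 0"
      using e by (intro eventually_conj order_tendstoD(2)[where a="e / 2"] eventually_gt_at_top) auto
    then obtain \<rho> :: real where rho: "(1 + \<rho>\<^sup>2) powr (- (s / 2)) < e / 2" "\<rho> > 0"
      using eventually_happens by fastforce
    define \<tau> where "\<tau> = (1 + \<rho>\<^sup>2) powr (- (s / 2))"
    define B1 where "B1 = (\<lambda>\<xi>::real ^ 'n. indicator (cball 0 \<rho>) \<xi> * j \<xi>)"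
    define B2 where "B2 = (\<lambda>\<xi>::real ^ 'n. indicator (- cball 0 \<rho>) \<xi> * j \<xi>)"
    have b2: "bdd_mult \<tau> B2"
    proof (rule bdd_multI)
      show "B2 \<in> borel_measurable borel" unfolding B2_def j_def by measurable
      fix \<xi> :: "real ^ 'n"
      show "\<bar>B2 \<xi>\<bar> \<le> \<tau>"
      proof (cases "\<xi> \<in> cball 0 \<rho>")
        case False
        then have "1 + \<rho>\<^sup>2 \<le> jap \<xi>" using rho(2) by (auto simp: jap_def intro!: power_mono)
        then have "j \<xi> \<le> \<tau>" unfolding j_def \<tau>_def using s by (intro powr_mono2') (auto intro: add_pos_nonneg)
        then show ?thesis using False by (simp add: B2_def j_def)
      qed (simp add: B2_def \<tau>_def)
    qed
    define F where "F n \<xi> = indicator (cball 0 \<rho>) \<xi> * (hl (v (r n)) \<xi> - G \<xi>)" for n and \<xi> :: "real ^ 'n"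
    define p where "p = cls (\<lambda>\<xi>::real ^ 'n. indicator (cball 0 \<rho>) \<xi> * G \<xi>)"
    have fd: "\<bar>F n \<xi>\<bar> \<le> 2 * (k * 2 * I) * indicator (cball 0 \<rho>) \<xi>" for n \<xi>
      using B[of "r n" \<xi>] GB[of \<xi>] by (auto simp: F_def indicator_def)
    have fm: "F n \<in> borel_measurable borel" for n unfolding F_def[abs_def] by measurable
    have fl: "AE \<xi> in lborel. (\<lambda>n. F n \<xi>) \<longlonglongrightarrow> 0"
    proof (rule AE_I2)
      fix \<xi> show "(\<lambda>n. F n \<xi>) \<longlonglongrightarrow> 0"
        unfolding F_def using tendsto_mult_left[OF LIM_zero[OF G[of \<xi>]], of "indicator (cball 0 \<rho>) \<xi>"] by simp
    qed
    have F0: "(\<lambda>n. cls (F n)) \<longlonglongrightarrow> 0"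
      by (rule L2_dominated(2)[OF fm _ indicator_square_integrable fd fl]) measurable
    have Fs: "F n \<in> sqint" for n
      by (rule L2_dominated(1)[OF fm _ indicator_square_integrable fd fl]) measurable
    obtain N where N: "\<And>n. n \<ge> N \<Longrightarrow> norm (cls (F n)) < e / 2"
      using F0 e unfolding LIMSEQ_iff by (metis diff_zero half_gt_zero)
    have Gs: "(\<lambda>\<xi>. indicator (cball 0 \<rho>) \<xi> * G \<xi>) \<in> sqint"
    proof (rule sqint_borelI)
      show "integrable lborel (\<lambda>\<xi>. (indicator (cball 0 \<rho>) \<xi> * G \<xi>)\<^sup>2)"
      proof (rule Bochner_Integration.integrable_bound[OF indicator_square_integrable[of "k * 2 * I" \<rho>]])
        have "(indicator (cball 0 \<rho>) \<xi> * G \<xi>)\<^sup>2 \<le> (k * 2 * I * indicator (cball 0 \<rho>) \<xi>)\<^sup>2" for \<xi>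
          using power_mono[OF GB[of \<xi>], of 2] by (auto simp: indicator_def)
        then show "AE \<xi> in lborel. norm ((indicator (cball 0 \<rho>) \<xi> * G \<xi>)\<^sup>2) \<le> norm ((k * 2 * I * indicator (cball 0 \<rho>) \<xi>)\<^sup>2)"
          by (intro AE_I2) simp
      qed measurable
    qed measurable
    \<comment> \<open>Low frequency error plus high frequency tail; inside the ball the transform is
      compared with \<open>G\<close>, outside with 0.\<close>
    have split: "cls (hl (v (r n))) - p = cls (F n) + mulop B2 (x (r n))" for n
    proof -
      have "cls (hl (v (r n))) - p = cls (\<lambda>\<xi>. hl (v (r n)) \<xi> - indicator (cball 0 \<rho>) \<xi> * G \<xi>)"
        unfolding p_def by (rule cls_diff[symmetric, OF T(6)[OF cb] Gs])
      also have "\<dots> = cls (\<lambda>\<xi>. F n \<xi> + B2 \<xi> * fn (x (r n)) \<xi>)"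
      proof (rule cls_cong)
        show "AE \<xi> in lborel. hl (v (r n)) \<xi> - indicator (cball 0 \<rho>) \<xi> * G \<xi> = F n \<xi> + B2 \<xi> * fn (x (r n)) \<xi>"
          using T(8)[OF cb, of "r n"] by eventually_elim (auto simp: F_def B2_def j_def indicator_def)
      qed
      also have "\<dots> = cls (F n) + mulop B2 (x (r n))"
        unfolding mulop_def by (rule cls_add[OF Fs bdd_mult_sqint[OF b2 fn_sqint]])
      finally show ?thesis .
    qed
    have "norm (cls (hl (v (r n))) - p) \<le> e" if "n \<ge> N" for n
    proof -
      have "norm (mulop B2 (x (r n))) \<le> \<tau> * norm (x (r n))" by (rule mulop_norm[OF b2]) (simp add: \<tau>_def)
      also have "\<dots> \<le> \<tau> * 1" using x(2)[of "r n"] by (intro mult_left_mono) (simp_all add: \<tau>_def)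
      finally have "norm (mulop B2 (x (r n))) < e / 2" using rho(1) by (simp add: \<tau>_def)
      then show ?thesis unfolding split using N[OF that] norm_triangle_ineq[of "cls (F n)" "mulop B2 (x (r n))"] by linarith
    qed
    then show "\<exists>p N. \<forall>n\<ge>N. norm (cls (hl (v (r n))) - p) \<le> e" by blast
  qed
  then have "Cauchy (\<lambda>n. hart (emb s (x (r n))))" using T(7)[OF cb] by simp
  then have "Cauchy (\<lambda>n. emb s (x (r n)))"
    unfolding Cauchy_def dist_norm linear_diff[OF hart_linear, symmetric] hart_norm .
  then show ?thesis using r by blast
qed

section \<open>Unique continuation for the fractional Laplacian\<close>

lemma emb_eq_0:
  assumes s: "s \<ge> 0" and z: "emb s a = 0"
  shows "a = 0"
proof -
  have "AE x in lborel. fn (emb s a) x = 0" unfolding z by (rule fn_zero)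
  then have "sob s (fn (emb s a)) = sob s (\<lambda>x. 0)" by (rule sob_cong)
  then show ?thesis using sob_emb(2)[OF s, of a] by (simp add: in_Hs_zero)
qed

lemma nonempty_open_cball:
  fixes W :: "'a::metric_space set"
  assumes "open W" "W \<noteq> {}"
  obtains c r where "r > 0" "cball c r \<subseteq> W"
  using assms open_contains_cball by (metis ex_in_conv)

lemma bump_test_fun:
  fixes c :: "real ^ 'n"
  assumes "r > 0" "cball c r \<subseteq> W"
  shows "bump c r \<in> test_fun W"
proof (rule test_funI[OF smooth_bump _ assms(2)])
  fix x assume "bump c r x \<noteq> 0"
  then have "\<not> norm (x - c) \<ge> r" using bump_zero[OF assms(1)] by blast
  then show "x \<in> cball c r" by (simp add: dist_norm norm_minus_commute)
qed

text \<open>Testing with bumps in \<open>W\<close> removes the potential, which lives in \<Omega>,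
  and leaves the fractional Laplacian of \<open>v\<close> paired with the bump. Subordination turns
  this into vanishing Riesz potentials on a ball in \<open>W\<close>. No spectral condition on
  \<open>q\<close> enters.\<close>

theorem unique_continuation:
  fixes \<Omega> W :: "(real ^ 'n) set"
  assumes s: "0 < s" "s < 1" and O: "open \<Omega>" "bounded \<Omega>" and W: "open W" "W \<noteq> {}" "closure W \<inter> closure \<Omega> = {}"
    and q: "bdd_mult C q" "\<And>x. x \<notin> \<Omega> \<Longrightarrow> q x = 0" and z: "z \<in> htl s \<Omega>"
    and zero: "\<And>w. w \<in> htl s W \<Longrightarrow> inner z w - kf s q z w = 0"
  shows "z = 0"
proof -
  have s0: "0 \<le> s" and s1: "s \<le> 1" using s by auto
  define K where "K = closure \<Omega>"
  have K: "compact K" using O(2) by (simp add: K_def compact_closure)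
  obtain R where R: "R > 0" "K \<subseteq> cball 0 R" using compact_imp_bounded[OF K] unfolding bounded_pos by (auto simp: subset_iff)
  define v where "v x = indicator K x * fn (emb s z) x" for x
  have Ob: "\<Omega> \<in> sets borel" and Kb: "K \<in> sets borel" using O(1) K by (auto intro: borel_compact)
  have OK: "\<Omega> \<subseteq> K" unfolding K_def by (rule closure_subset)
  note T = htl_truncated[OF s0 s1 Ob z OK Kb R(2) R(1), folded v_def[abs_def]]
  obtain x0 r0 where xr: "r0 > 0" "cball x0 r0 \<subseteq> W" using nonempty_open_cball[OF W(1,2)] by blast
  obtain \<delta> where \<delta>: "\<delta> > 0" "\<And>y x. y \<in> K \<Longrightarrow> x \<in> closure W \<Longrightarrow> \<delta> \<le> dist y x"
    using separate_compact_closed[OF K closed_closure[of W]] W(3) unfolding K_def by (auto simp: Int_commute)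
  have sep: "\<delta> \<le> norm (x - y)" if "x \<in> W" "y \<in> K" for x y
    using \<delta>(2)[OF that(2), of x] subsetD[OF closure_subset that(1)] by (simp add: dist_norm norm_minus_commute)
  have WO: "W \<inter> \<Omega> = {}" using W(3) closure_subset by blast
  interpret separated_density v K x0 r0 \<delta>
  proof
    show "integrable lborel v" by (rule T(4))
    show "v y = 0" if "y \<notin> K" for y using that by (simp add: v_def)
    show "\<delta> \<le> norm (x - y)" if "x \<in> ball x0 r0" "y \<in> K" for x y
      by (rule sep) (use that xr(2) ball_subset_cball in blast)+
  qed (use K xr \<delta> in auto)
  define a where "a = real DIM(real ^ 'n) + 2 * s"
  have pair: "(LINT w|lborel. (case w of (x, y) \<Rightarrow> bump c r x * v y * norm (x - y) powr (- a))) = 0"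
    if r: "r > 0" and c: "cball c r \<subseteq> ball x0 r0" for c r
  proof -
    define f where "f = bump c r"
    have cW: "cball c r \<subseteq> W" using c xr(2) ball_subset_cball by blast
    have ft: "f \<in> test_fun W" unfolding f_def by (rule bump_test_fun[OF r cW])
    have fC: "f \<in> Cc" "\<And>x. x \<notin> W \<Longrightarrow> f x = 0" using test_fun_Cc[OF ft] by auto
    have fH: "in_Hs s f" by (rule test_fun_in_Hs[OF ft s0 s1])
    note fi = Cc_integrable[OF fC(1)]
    note [measurable] = Cc_measurable[OF fC(1)] T(1) hl_measurable[OF Cc_measurable[OF fC(1)]] hl_measurable[OF T(1)]
    have hfs: "hl f \<in> sqint" by (rule hl_plancherel_Cc(1)[OF fC(1)])
    define h where "h \<xi> = hl f \<xi> * hl v \<xi>" for \<xi>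
    have h2: "integrable lborel h"
    proof -
      have "integrable lebesgue h" unfolding h_def[abs_def] by (rule sqint_mult_integrable[OF hfs T(6)])
      then show ?thesis by (rule integrable_lborel_cong(1)) (auto simp: h_def[abs_def])
    qed
    have "AE \<xi> in lborel. fn (sob s f) \<xi> = jap \<xi> powr (s / 2) * hl f \<xi>"
      using fn_sob[OF fH] fn_cls[OF hfs] unfolding hf_def hart_Cc[OF fC(1)] by eventually_elim simp
    then have hlf: "AE \<xi> in lborel. hl f \<xi> = jap \<xi> powr (- (s / 2)) * fn (sob s f) \<xi>"
      by eventually_elim (simp add: jap_cancel)
    note sb = symb_bdd[OF s0]
    have sh: "AE \<xi> in lborel. norm \<xi> powr (2 * s) * h \<xi> = fn (mulop (symb s) z) \<xi> * fn (mulop (symb s) (sob s f)) \<xi>"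
      using hlf T(8) fn_mulop[OF sb, of z] fn_mulop[OF sb, of "sob s f"]
    proof eventually_elim
      case (elim \<xi>)
      have "norm \<xi> powr (2 * s) = norm \<xi> powr s * norm \<xi> powr s" by (simp flip: powr_add)
      then show ?case unfolding h_def elim symb_def by (simp add: mult_ac)
    qed
    have hm: "(\<lambda>\<xi>. norm \<xi> powr (2 * s) * h \<xi>) \<in> borel_measurable borel" unfolding h_def by measurable
    have ish: "integrable lborel (\<lambda>\<xi>. norm \<xi> powr (2 * s) * h \<xi>)"
      by (subst integrable_cong_AE[OF _ _ sh]) (use hm fn_mult_integrable in auto)
    have "(LINT \<xi>|lborel. norm \<xi> powr (2 * s) * h \<xi>) = inner (mulop (symb s) z) (mulop (symb s) (sob s f))"
      unfolding inner_l2_def by (rule integral_cong_AE) (use hm sh in auto)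
    \<comment> \<open>The Dirichlet form is the full form minus the potential term. The first
      vanishes by hypothesis, the second because \<open>f\<close> and \<open>q\<close> have disjoint
      supports.\<close>
    also have "\<dots> = inner z (sob s f) - kf s q z (sob s f) - inner (mulop q (emb s z)) (emb s (sob s f))"
      unfolding symb_symb_inner[OF s(1) s1] kf_def by simp
    also have "inner z (sob s f) - kf s q z (sob s f) = 0" by (rule zero[OF htl_test_fun[OF ft]])
    also have "inner (mulop q (emb s z)) (emb s (sob s f)) = 0"
    proof -
      have "AE x in lborel. fn (mulop q (emb s z)) x * fn (cls f) x = 0"
        using fn_mulop[OF q(1), of "emb s z"] fn_cls[OF fi(3)]
        by eventually_elim (use q(2) fC(2) WO in auto)
      then show ?thesis unfolding emb_sob[OF s0 fH] inner_l2_def by (intro integral_eq_zero_AE)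
    qed
    finally have zh: "(LINT \<xi>|lborel. norm \<xi> powr (2 * s) * h \<xi>) = 0" by simp
    \<comment> \<open>Parseval: the integral is the L2 product of \<open>f\<close> and
      \<open>v\<close>, whose supports are disjoint.\<close>
    have zh2: "(LINT \<xi>|lborel. h \<xi>) = 0"
    proof -
      have "(LINT \<xi>|lborel. h \<xi>) = (LINT \<xi>|lebesgue. hl f \<xi> * hl v \<xi>)"
        unfolding h_def by (rule integral_completion[symmetric]) measurable
      also have "\<dots> = inner (cls (hl f)) (cls (hl v))" by (rule inner_cls[symmetric, OF hfs T(6)])
      also have "\<dots> = inner (cls f) (cls v)" unfolding hart_Cc[OF fC(1), symmetric] T(7)[symmetric] T(3)[symmetric] by (rule hart_inner)
      also have "\<dots> = (LINT x|lebesgue. f x * v x)" by (rule inner_cls[OF fi(3) T(2)])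
      also have "(\<lambda>x. f x * v x) = (\<lambda>x. 0)"
      proof
        fix x show "f x * v x = 0"
          using fC(2)[of x] sep[of x x] \<delta>(1) by (cases "x \<in> K"; cases "x \<in> W") (auto simp: v_def)
      qed
      finally show ?thesis by simp
    qed
    show ?thesis unfolding a_def f_def[symmetric]
    proof (rule riesz_kernel_pairing[OF s fi(1) T(4) \<delta>(1) _ h2 zh2 ish _ zh])
      show "\<delta> \<le> norm (x - y)" if "f x \<noteq> 0" "v y \<noteq> 0" for x y
        by (rule sep) (use that fC(2) in \<open>auto simp: v_def indicator_def split: if_splits\<close>)
      show "(LINT \<xi>|lborel. exp (- e * (norm \<xi>)\<^sup>2) * h \<xi>) = (LINT z|lborel. (case z of (x, y) \<Rightarrow> f x * v y * heat e (x - y)))" if "e > 0" for e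
        unfolding h_def by (rule hl_gaussian_parseval(2)[OF fi(1) T(4) that])
    qed
  qed
  have pz: "pot a x = 0" if "x \<in> ball x0 r0" for x
    by (rule pot_zero_of_bumps[OF _ pair that]) (use s in \<open>auto simp: a_def\<close>)
  have "AE y in lborel. v y = 0" by (rule riesz_potential_injective[OF _ _ pz]) (use s in \<open>auto simp: a_def\<close>)
  then have "cls v = cls (\<lambda>x. 0)" by (rule cls_cong)
  then have "emb s z = 0" unfolding T(3) by (simp add: zero_l2_def)
  then show ?thesis by (rule emb_eq_0[OF s0])
qed

section \<open>The Dirichlet problem\<close>

locale dirichlet =
  fixes s :: real and \<Omega> :: "(real ^ 'n) set"
  assumes s: "0 < s" "s < 1" and \<Omega>: "open \<Omega>" "bounded \<Omega>"
begin

lemma s_le: "0 \<le> s" "s \<le> 1" using s by auto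

lemma \<Omega>_borel: "\<Omega> \<in> sets borel" using \<Omega> by simp

abbreviation X :: "(real ^ 'n) l2 set" where "X \<equiv> htl s \<Omega>"

definition bf :: "(real ^ 'n \<Rightarrow> real) \<Rightarrow> (real ^ 'n) l2 \<Rightarrow> (real ^ 'n) l2 \<Rightarrow> real" where
  "bf m u v = inner u v - kf s m u v"

lemma compact_forms_htl: "C \<ge> 0 \<Longrightarrow> compact_forms X (htl s W) (emb s) C"
  using rellich[OF s(1) s_le(2) \<Omega>] s_le
  by (intro compact_forms.intro) (auto intro: subspace_htl closed_htl emb_linear emb_norm)

lemma form_kf:
  fixes m :: "real ^ 'n \<Rightarrow> real"
  assumes m: "bdd_mult C m" "C \<ge> 0"
  shows "compact_forms.form (emb s) (1 + C) (kf s m)"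
proof -
  interpret T: compact_forms X X "emb s" "1 + C" by (rule compact_forms_htl) (use m in simp)
  show ?thesis unfolding T.form_def
    using kf_bilinear[OF s(1) s_le(2) m(1)] kf_symmetric[OF s(1) s_le(2) m(1)] kf_bound[OF s(1) s_le(2) m] by blast
qed

lemma bf_simps:
  assumes m: "bdd_mult C m"
  shows "bf m (u + v) w = bf m u w + bf m v w" "bf m w (u + v) = bf m w u + bf m w v"
    "bf m (u - v) w = bf m u w - bf m v w" "bf m w (u - v) = bf m w u - bf m w v"
    "bf m (c *\<^sub>R u) w = c * bf m u w" "bf m w (c *\<^sub>R u) = c * bf m w u" "bf m u v = bf m v u"
proof -
  note k = kf_bilinear[OF s(1) s_le(2) m]
  show "bf m (u + v) w = bf m u w + bf m v w" "bf m w (u + v) = bf m w u + bf m w v"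
    "bf m (u - v) w = bf m u w - bf m v w" "bf m w (u - v) = bf m w u - bf m w v"
    "bf m (c *\<^sub>R u) w = c * bf m u w" "bf m w (c *\<^sub>R u) = c * bf m w u"
    unfolding bf_def bilinear_ladd[OF k] bilinear_radd[OF k] bilinear_lsub[OF k] bilinear_rsub[OF k]
      bilinear_lmul[OF k] bilinear_rmul[OF k]
    by (simp_all add: inner_add_left inner_add_right inner_diff_left inner_diff_right right_diff_distrib)
  show "bf m u v = bf m v u" unfolding bf_def using kf_symmetric[OF s(1) s_le(2) m] by (simp add: inner_commute)
qed

lemma mulop_cong: "AE x in lborel. m x = k x \<Longrightarrow> mulop m a = mulop k a"
  unfolding mulop_def by (rule cls_cong) (auto elim!: eventually_mono)

text \<open>The multiplier \<open>m\<close> is kept apart from \<open>res \<Omega> q\<close> because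
  an element of the span is a combination of the basis only almost everywhere, whereas
  \<open>m\<close> can be the combination itself.\<close>

definition represents :: "real \<Rightarrow> (real ^ 'n \<Rightarrow> real) \<Rightarrow> (real ^ 'n \<Rightarrow> real) \<Rightarrow> bool" where
  "represents C m q \<longleftrightarrow> C \<ge> 0 \<and> bdd_mult C m \<and> bdd_mult C (res \<Omega> q) \<and> (\<forall>x. x \<notin> \<Omega> \<longrightarrow> m x = 0) \<and>
     (AE x in lborel. res \<Omega> q x = m x) \<and> zero_not_dirichlet_eigenvalue s \<Omega> q"

lemma bform_bf:
  assumes q: "represents C m q" and u: "in_Hs s u" and v: "in_Hs s v"
  shows "bform s \<Omega> q u v = bf m (sob s u) (sob s v)"
proof -
  have O: "\<Omega> \<in> sets lebesgue" using sets_completionI_sets[of \<Omega> lborel] \<Omega>_borel by simp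
  have qs: "bdd_mult C (res \<Omega> q)" "AE x in lborel. res \<Omega> q x = m x" using q by (auto simp: represents_def)
  have "kf s (res \<Omega> q) a b = kf s m a b" for a b unfolding kf_def mulop_cong[OF qs(2)] ..
  then show ?thesis unfolding bform_kf(1)[OF s(1) s_le(2) u v O qs(1)] bf_def by simp
qed

lemma bf_injective:
  assumes q: "represents C m q" and z: "z \<in> X" "\<And>w. w \<in> X \<Longrightarrow> bf m z w = 0"
  shows "z = 0"
proof -
  define u where "u = fn (emb s z)"
  have u: "in_Hs s u" "sob s u = z" using sob_emb[OF s_le(1), of z] by (auto simp: u_def)
  have "weak_solution s \<Omega> q (\<lambda>_. 0) u" unfolding weak_solution_def
  proof (intro conjI ballI)
    show "u \<in> Hs s" using u by (simp add: Hs_iff)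
    show "(\<lambda>x. u x - 0) \<in> Hs_tilde s \<Omega>" using u z(1) by (simp add: htl_iff[OF s_le])
    fix w assume "w \<in> Hs_tilde s \<Omega>"
    then have w: "in_Hs s w" "sob s w \<in> X" by (auto simp: htl_iff[OF s_le])
    show "bform s \<Omega> q u w = 0" unfolding bform_bf[OF q u(1) w(1)] u(2) by (rule z(2)[OF w(2)])
  qed
  then have "AE x in lborel. u x = 0"
    using q unfolding represents_def zero_not_dirichlet_eigenvalue_def AE_lebesgue_iff by blast
  then have "sob s u = sob s (\<lambda>x. 0)" by (rule sob_cong)
  then show ?thesis using u(2) by (simp add: in_Hs_zero)
qed

text \<open>\<open>solves m F U\<close>: \<open>U\<close> is the image under \<open>sob s\<close> of the solution with exterior value \<open>F\<close>.\<close>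

definition solves :: "(real ^ 'n \<Rightarrow> real) \<Rightarrow> (real ^ 'n) l2 \<Rightarrow> (real ^ 'n) l2 \<Rightarrow> bool" where
  "solves m F U \<longleftrightarrow> U - F \<in> X \<and> (\<forall>y\<in>X. bf m U y = 0)"

lemma solves_unique:
  assumes q: "represents C m q" and U: "solves m F U" and V: "solves m F V"
  shows "U = V"
proof -
  have bm: "bdd_mult C m" using q by (simp add: represents_def)
  have "(U - F) - (V - F) \<in> X" by (rule subspace_diff[OF subspace_htl[OF s_le]]) (use U V in \<open>auto simp: solves_def\<close>)
  then have "U - V \<in> X" by simp
  moreover have "bf m (U - V) w = 0" if "w \<in> X" for w using U V that by (simp add: solves_def bf_simps(3)[OF bm])
  ultimately have "U - V = 0" by (rule bf_injective[OF q])
  then show ?thesis by simp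
qed

lemma solves_exists:
  assumes q: "represents C m q"
  obtains U where "solves m F U"
proof -
  have c: "C \<ge> 0" "bdd_mult C m" using q by (auto simp: represents_def)
  interpret compact_forms X X "emb s" "1 + C" by (rule compact_forms_htl) (use c in simp)
  have "\<exists>w. w \<in> X \<and> (\<forall>y\<in>X. inner (F + w) y - kf s m (F + w) y = 0)"
    using solvable[OF form_kf[OF c(2,1)], of F] bf_injective[OF q] unfolding bf_def by metis
  then obtain w where "w \<in> X" "\<forall>y\<in>X. inner (F + w) y - kf s m (F + w) y = 0" by blast
  then have "solves m F (F + w)" by (simp add: solves_def bf_def)
  then show ?thesis using that by blast
qed

lemma weak_solution_iff:
  assumes q: "represents C m q" and f: "in_Hs s f"
  shows "weak_solution s \<Omega> q f u \<longleftrightarrow> in_Hs s u \<and> solves m (sob s f) (sob s u)"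
proof (cases "in_Hs s u")
  case True
  have "(\<forall>w\<in>Hs_tilde s \<Omega>. bform s \<Omega> q u w = 0) \<longleftrightarrow> (\<forall>y\<in>X. bf m (sob s u) y = 0)"
  proof (intro iffI ballI)
    fix y assume A: "\<forall>w\<in>Hs_tilde s \<Omega>. bform s \<Omega> q u w = 0" and y: "y \<in> X"
    have h: "in_Hs s (fn (emb s y))" "sob s (fn (emb s y)) = y" by (rule sob_emb[OF s_le(1)])+
    then have "fn (emb s y) \<in> Hs_tilde s \<Omega>" using y by (simp add: htl_iff[OF s_le])
    then have "bform s \<Omega> q u (fn (emb s y)) = 0" using A by blast
    then show "bf m (sob s u) y = 0" using bform_bf[OF q True h(1)] h(2) by simp
  next
    fix w assume A: "\<forall>y\<in>X. bf m (sob s u) y = 0" and "w \<in> Hs_tilde s \<Omega>"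
    then have w: "in_Hs s w" "sob s w \<in> X" by (auto simp: htl_iff[OF s_le])
    then show "bform s \<Omega> q u w = 0" using bform_bf[OF q True w(1)] A by simp
  qed
  then show ?thesis using True in_Hs_diff[OF True f]
    by (simp add: weak_solution_def solves_def Hs_iff htl_iff[OF s_le])
next
  case False
  then show ?thesis by (simp add: weak_solution_def Hs_iff)
qed

section \<open>The Dirichlet-to-Neumann pairing and the Alessandrini identity\<close>

lemma DN_map_eq:
  assumes q: "represents C m q" and f: "in_Hs s f" and g: "in_Hs s g" and U: "solves m (sob s f) U"
  shows "DN_map s \<Omega> q f g = bf m U (sob s g)"
proof -
  have "weak_solution s \<Omega> q f (fn (emb s U))" using U by (simp add: weak_solution_iff[OF q f] sob_emb[OF s_le(1)])
  \<comment> \<open>The chosen solution may differ from \<open>fn (emb s U)\<close> on a null set;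
    by \<open>solves_unique\<close> both have the same image under \<open>sob s\<close>, which is
    all that the form sees.\<close>
  then have "weak_solution s \<Omega> q f (solution s \<Omega> q f)" unfolding solution_def by (rule someI[where P="weak_solution s \<Omega> q f"])
  then have w: "in_Hs s (solution s \<Omega> q f)" "solves m (sob s f) (sob s (solution s \<Omega> q f))"
    by (simp_all add: weak_solution_iff[OF q f])
  show ?thesis unfolding DN_map_def bform_bf[OF q w(1) g] solves_unique[OF q w(2) U] by (rule refl)
qed

text \<open>The form of a solution vanishes on \<open>X\<close>, so the datum \<open>f2\<close> can
  be replaced by the solution \<open>U2\<close>. By symmetry and because \<open>U1 - V\<close> lies
  in \<open>X\<close>, the solution \<open>V\<close> can be replaced by \<open>U1\<close> in the
  second form. The Sobolev parts then cancel.\<close>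

lemma alessandrini:
  assumes q1: "represents C1 m1 q1" and q2: "represents C2 m2 q2" and f: "in_Hs s f1" "in_Hs s f2"
    and U1: "solves m1 (sob s f1) U1" and U2: "solves m2 (sob s f2) U2"
  shows "DN_map s \<Omega> q1 f1 f2 - DN_map s \<Omega> q2 f1 f2 = inner (mulop (\<lambda>x. m1 x - m2 x) (emb s U1)) (emb s U2)"
proof -
  have b: "bdd_mult C1 m1" "bdd_mult C2 m2" using q1 q2 by (auto simp: represents_def)
  obtain V where V: "solves m2 (sob s f1) V" using solves_exists[OF q2] by blast
  have "bf m1 U1 (U2 - sob s f2) = 0" using U1 U2 by (simp add: solves_def)
  then have 1: "bf m1 U1 (sob s f2) = bf m1 U1 U2" by (simp add: bf_simps(4)[OF b(1)])
  have "bf m2 V (U2 - sob s f2) = 0" using V U2 by (simp add: solves_def)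
  then have 2: "bf m2 V (sob s f2) = bf m2 U2 V" using bf_simps(7)[OF b(2), of U2 V] by (simp add: bf_simps(4)[OF b(2)])
  have "(U1 - sob s f1) - (V - sob s f1) \<in> X" by (rule subspace_diff[OF subspace_htl[OF s_le]]) (use U1 V in \<open>auto simp: solves_def\<close>)
  then have "U1 - V \<in> X" by simp
  then have "bf m2 U2 (U1 - V) = 0" using U2 by (simp add: solves_def)
  then have 3: "bf m2 U2 V = bf m2 U1 U2" using bf_simps(7)[OF b(2), of U1 U2] by (simp add: bf_simps(4)[OF b(2)])
  have "DN_map s \<Omega> q1 f1 f2 - DN_map s \<Omega> q2 f1 f2 = bf m1 U1 U2 - bf m2 U1 U2"
    unfolding DN_map_eq[OF q1 f U1] DN_map_eq[OF q2 f V] 1 2 3 ..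
  also have "\<dots> = inner (mulop m1 (emb s U1)) (emb s U2) - inner (mulop m2 (emb s U1)) (emb s U2)"
    unfolding bf_def kf_def by simp
  also have "\<dots> = inner (mulop (\<lambda>x. m1 x - m2 x) (emb s U1)) (emb s U2)"
  proof -
    have "mulop (\<lambda>x. m1 x - m2 x) (emb s U1) = mulop m1 (emb s U1) - mulop m2 (emb s U1)"
      unfolding mulop_def left_diff_distrib
      by (rule cls_diff) (rule bdd_mult_sqint[OF b(1) fn_sqint] bdd_mult_sqint[OF b(2) fn_sqint])+
    then show ?thesis by (simp add: inner_diff_left)
  qed
  finally show ?thesis .
qed

lemma mulop_exterior:
  assumes m: "bdd_mult C m" "\<And>x. x \<notin> \<Omega> \<Longrightarrow> m x = 0" and W: "open W" "W \<inter> \<Omega> = {}" and F: "F \<in> htl s W"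
  shows "mulop m (emb s F) = 0"
proof -
  have "AE x in lborel. m x * fn (emb s F) x = 0"
    using htl_support(2)[OF s_le borel_open[OF W(1)] F] by eventually_elim (use m(2) W(2) in auto)
  then have "mulop m (emb s F) = cls (\<lambda>x. 0)" unfolding mulop_def by (rule cls_cong)
  then show ?thesis by (simp add: zero_l2_def)
qed

text \<open>The difference of the multipliers vanishes outside \<Omega>, so of
  \<open>F1 + w1\<close> and \<open>F2 + w2\<close> only the interior parts enter. The factors
  \<open>c1\<close> and \<open>c2\<close> prepare the normalisation of the data.\<close>

lemma DN_difference:
  assumes q1: "represents C1 m1 q1" and q2: "represents C2 m2 q2"
    and W: "open W1" "W1 \<inter> \<Omega> = {}" "open W2" "W2 \<inter> \<Omega> = {}"
    and F: "F1 \<in> htl s W1" "F2 \<in> htl s W2" and w: "w1 \<in> X" "w2 \<in> X"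
    and U: "\<And>y. y \<in> X \<Longrightarrow> bf m1 (F1 + w1) y = 0" "\<And>y. y \<in> X \<Longrightarrow> bf m2 (F2 + w2) y = 0"
  shows "DN_map s \<Omega> q1 (fn (emb s (c1 *\<^sub>R F1))) (fn (emb s (c2 *\<^sub>R F2))) - DN_map s \<Omega> q2 (fn (emb s (c1 *\<^sub>R F1))) (fn (emb s (c2 *\<^sub>R F2))) =
    c1 * c2 * inner (mulop (\<lambda>x. m1 x - m2 x) (emb s w1)) (emb s w2)"
proof -
  have b: "bdd_mult C1 m1" "bdd_mult C2 m2" using q1 q2 by (auto simp: represents_def)
  note d = bdd_mult_diff[OF b]
  have d0: "m1 x - m2 x = 0" if "x \<notin> \<Omega>" for x using q1 q2 that by (simp add: represents_def)
  have S: "solves m (sob s (fn (emb s (c *\<^sub>R F)))) (c *\<^sub>R (F + w))"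
    if "bdd_mult C m" "w \<in> X" "\<And>y. y \<in> X \<Longrightarrow> bf m (F + w) y = 0" for C m c F w
  proof -
    have "c *\<^sub>R (F + w) - c *\<^sub>R F = c *\<^sub>R w" by (simp add: scaleR_add_right)
    then show ?thesis using that(3) subspace_scale[OF subspace_htl[OF s_le] that(2), of c]
      by (simp add: solves_def sob_emb(2)[OF s_le(1)] bf_simps(5)[OF that(1)] del: scaleR_add_right)
  qed
  note e = emb_linear[OF s_le(1)]
  note L = linear_add[OF e] linear_scale[OF e] linear_add[OF mulop_linear[OF d]] linear_scale[OF mulop_linear[OF d]]
  have "mulop (\<lambda>x. m1 x - m2 x) (emb s F1) = 0" by (rule mulop_exterior[OF d d0 W(1,2) F(1)])
  moreover have "inner (mulop (\<lambda>x. m1 x - m2 x) (emb s w1)) (emb s F2) = 0"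
    using mulop_symmetric[OF d, of "emb s w1" "emb s F2"] mulop_exterior[OF d d0 W(3,4) F(2)] by simp
  ultimately have "inner (mulop (\<lambda>x. m1 x - m2 x) (emb s (c1 *\<^sub>R (F1 + w1)))) (emb s (c2 *\<^sub>R (F2 + w2))) =
      c1 * c2 * inner (mulop (\<lambda>x. m1 x - m2 x) (emb s w1)) (emb s w2)"
    unfolding L by (simp add: inner_add_right)
  then show ?thesis
    using alessandrini[OF q1 q2 sob_emb(1)[OF s_le(1)] sob_emb(1)[OF s_le(1)] S[OF b(1) w(1) U(1), of c1] S[OF b(2) w(2) U(2), of c2]] by simp
qed

lemma DN_diff_norm_ge:
  assumes q1: "represents C1 m1 q1" and q2: "represents C2 m2 q2"
    and W: "open W1" "W1 \<inter> \<Omega> = {}" "open W2" "W2 \<inter> \<Omega> = {}"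
    and F: "F1 \<in> htl s W1" "F2 \<in> htl s W2" and w: "w1 \<in> X" "w2 \<in> X"
    and U: "\<And>y. y \<in> X \<Longrightarrow> bf m1 (F1 + w1) y = 0" "\<And>y. y \<in> X \<Longrightarrow> bf m2 (F2 + w2) y = 0"
    and F0: "F1 \<noteq> 0" "F2 \<noteq> 0"
  shows "ereal (\<bar>inner (mulop (\<lambda>x. m1 x - m2 x) (emb s w1)) (emb s w2)\<bar> / (norm F1 * norm F2)) \<le> DN_diff_norm s \<Omega> W1 W2 q1 q2"
proof -
  define V where "V = inner (mulop (\<lambda>x. m1 x - m2 x) (emb s w1)) (emb s w2)"
  \<comment> \<open>Normalises the second datum and carries the sign of \<open>V\<close>, so that
    the admissible pair attains the absolute value.\<close>
  define c2 where "c2 = (if V \<ge> 0 then 1 else - 1) / norm F2"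
  define f1 where "f1 = fn (emb s ((1 / norm F1) *\<^sub>R F1))"
  define f2 where "f2 = fn (emb s (c2 *\<^sub>R F2))"
  have 1: "DN_map s \<Omega> q1 f1 f2 - DN_map s \<Omega> q2 f1 f2 = \<bar>V\<bar> / (norm F1 * norm F2)"
  proof -
    have "1 / norm F1 * c2 * V = \<bar>V\<bar> / (norm F1 * norm F2)" by (simp add: c2_def)
    then show ?thesis using DN_difference[OF q1 q2 W F w U, of "1 / norm F1" c2] unfolding f1_def f2_def V_def by simp
  qed
  have n: "c *\<^sub>R F \<in> htl s W \<Longrightarrow> norm (c *\<^sub>R F) = 1 \<Longrightarrow> fn (emb s (c *\<^sub>R F)) \<in> Hs_tilde s W \<and> Hs_norm s (fn (emb s (c *\<^sub>R F))) = 1" for c F and W :: "(real ^ 'n) set"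
    by (simp add: htl_iff[OF s_le] sob_emb[OF s_le(1)] Hs_norm_sob[OF sob_emb(1)[OF s_le(1)]])
  have f1: "f1 \<in> Hs_tilde s W1 \<and> Hs_norm s f1 = 1" unfolding f1_def
    by (rule n) (use F F0 in \<open>auto intro: subspace_scale subspace_htl s_le\<close>)
  have f2: "f2 \<in> Hs_tilde s W2 \<and> Hs_norm s f2 = 1" unfolding f2_def
    by (rule n, rule subspace_scale[OF subspace_htl[OF s_le] F(2)]) (use F0 in \<open>auto simp: c2_def\<close>)
  show ?thesis unfolding DN_diff_norm_def V_def[symmetric] 1[symmetric]
    by (rule Sup_upper) (use f1 f2 in blast)
qed

end

section \<open>Potentials in a finite dimensional space\<close>

lemma cls_sum:
  fixes f :: "'i \<Rightarrow> 'a::euclidean_space \<Rightarrow> real"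
  assumes "finite I" "\<And>i. i \<in> I \<Longrightarrow> f i \<in> sqint"
  shows "(\<lambda>x. \<Sum>i\<in>I. c i * f i x) \<in> sqint \<and> cls (\<lambda>x. \<Sum>i\<in>I. c i * f i x) = (\<Sum>i\<in>I. c i *\<^sub>R cls (f i))"
  using assms
proof (induction I rule: finite_induct)
  case empty
  then show ?case by (simp add: zero_sqint zero_l2_def)
next
  case (insert i I)
  have i: "(\<lambda>x. c i * f i x) \<in> sqint" by (rule sqint_cmult) (use insert in auto)
  have I: "(\<lambda>x. \<Sum>i\<in>I. c i * f i x) \<in> sqint" "cls (\<lambda>x. \<Sum>i\<in>I. c i * f i x) = (\<Sum>i\<in>I. c i *\<^sub>R cls (f i))"
    using insert by auto
  have fi: "f i \<in> sqint" using insert by simp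
  show ?case using sqint_add[OF i I(1)] cls_add[OF i I(1)] cls_cmult[OF fi] I(2) insert.hyps by simp
qed

lemma res_scaleR: "res \<Omega> q = (\<lambda>x. indicator \<Omega> x *\<^sub>R q x)"
  by (auto simp: res_def indicator_def fun_eq_iff)

lemma res_measurable:
  "\<Omega> \<in> sets lebesgue \<Longrightarrow> q \<in> borel_measurable (lebesgue_on \<Omega>) \<Longrightarrow> res \<Omega> q \<in> borel_measurable lebesgue"
  unfolding res_scaleR using borel_measurable_restrict_space_iff[of \<Omega> lebesgue q] by simp

lemma AE_on_iff: "\<Omega> \<in> sets lebesgue \<Longrightarrow> (AE x in lebesgue_on \<Omega>. P x) \<longleftrightarrow> (AE x in lborel. x \<in> \<Omega> \<longrightarrow> P x)"
  using AE_restrict_space_iff[of \<Omega> lebesgue P] by (simp add: AE_lebesgue_iff)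

lemma bdd_mult_res:
  assumes \<Omega>: "\<Omega> \<in> sets lebesgue" and q: "q \<in> borel_measurable (lebesgue_on \<Omega>)" "Linf_norm \<Omega> q \<le> ereal C" "C \<ge> 0"
  shows "bdd_mult C (res \<Omega> q)"
  unfolding bdd_mult_def
proof
  show "res \<Omega> q \<in> borel_measurable lebesgue" by (rule res_measurable[OF \<Omega> q(1)])
  have "AE x in lebesgue_on \<Omega>. ereal \<bar>q x\<bar> \<le> Linf_norm \<Omega> q" unfolding Linf_norm_def by (rule esssup_AE)
  then have "AE x in lborel. x \<in> \<Omega> \<longrightarrow> ereal \<bar>q x\<bar> \<le> Linf_norm \<Omega> q" unfolding AE_on_iff[OF \<Omega>] .
  then show "AE x in lborel. \<bar>res \<Omega> q x\<bar> \<le> C"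
  proof eventually_elim
    case (elim x)
    then have "x \<in> \<Omega> \<longrightarrow> ereal \<bar>q x\<bar> \<le> ereal C" using q(2) order_trans by blast
    then show ?case using q(3) by (simp add: res_def)
  qed
qed

lemma Linf_norm_le:
  assumes \<Omega>: "\<Omega> \<in> sets lebesgue" and q: "q \<in> borel_measurable (lebesgue_on \<Omega>)"
    and b: "AE x in lborel. x \<in> \<Omega> \<longrightarrow> \<bar>q x\<bar> \<le> C"
  shows "Linf_norm \<Omega> q \<le> ereal C"
  unfolding Linf_norm_def
proof (rule esssup_I)
  show "(\<lambda>x. ereal \<bar>q x\<bar>) \<in> borel_measurable (lebesgue_on \<Omega>)" using q by measurable
  show "AE x in lebesgue_on \<Omega>. ereal \<bar>q x\<bar> \<le> ereal C" unfolding AE_on_iff[OF \<Omega>] using b by simp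
qed

text \<open>With \<beta> the bump and test functions \<open>\<beta> * f\<close> and \<beta>, the
  function \<open>k * \<beta>^2\<close> annihilates all smooth \<open>f\<close>, a separating
  algebra. Since \<beta> is positive on the open ball, \<open>k\<close> vanishes there.\<close>

lemma multiplier_zero_on_ball:
  fixes k :: "real ^ 'n \<Rightarrow> real"
  assumes k: "bdd_mult C k" and r: "r > 0"
    and z: "\<And>f. smooth f \<Longrightarrow> inner (mulop k (cls (\<lambda>x. bump c r x * f x))) (cls (bump c r)) = 0"
  shows "AE x in lborel. x \<in> ball c r \<longrightarrow> k x = 0"
proof -
  define \<beta> where "\<beta> = bump c r"
  have b0: "\<beta> x = 0" if "x \<notin> cball c r" for x
    using that bump_zero[OF r, where ?x0.0=c and x=x] by (simp add: \<beta>_def dist_norm norm_minus_commute)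
  have sm: "smooth f \<Longrightarrow> (\<lambda>x. \<beta> x * f x) \<in> Cc" for f
    by (rule test_fun_Cc(1)[OF test_funI[where W=UNIV and ?x0.0=c and r=r]])
       (use b0 in \<open>auto simp: \<beta>_def intro: smooth_mult smooth_bump\<close>)
  have bC: "\<beta> \<in> Cc" unfolding \<beta>_def by (rule bump_Cc[OF r])
  have bb: "(\<lambda>x. k x * (\<beta> x * \<beta> x)) \<in> sqint"
    by (rule bdd_mult_sqint[OF k Cc_integrable(3)[OF sm]]) (simp add: \<beta>_def smooth_bump)
  \<comment> \<open>A Borel representative of \<open>k * \<beta>^2\<close> that vanishes everywhere,
    not just almost everywhere, outside the ball.\<close>
  define v where "v x = indicator (cball c r) x * fn (cls (\<lambda>x. k x * (\<beta> x * \<beta> x))) x" for x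
  have vm[measurable]: "v \<in> borel_measurable borel" unfolding v_def[abs_def] by measurable
  have vae: "AE x in lborel. v x = k x * (\<beta> x * \<beta> x)"
    using fn_cls[OF bb] by eventually_elim (use b0 in \<open>auto simp: v_def indicator_def\<close>)
  have vs: "v \<in> sqint" by (rule sqint_AE[OF bb vm]) (use vae in eventually_elim, simp)
  have vi: "integrable lborel v"
  proof (rule compact_support_integrable_sqint(1)[OF vm vs])
    fix x :: "real ^ 'n" assume "norm x > norm c + r"
    then have "x \<notin> cball c r" using norm_triangle_ineq[of "x - c" c] by (simp add: dist_norm norm_minus_commute)
    then show "v x = 0" by (simp add: v_def)
  qed
  have "AE x in lborel. v x = 0"
  proof (rule algebra_integral_zero_imp_AE_zero[where P=smooth and K="cball c r", OF vi])
    show "compact (cball c r)" by simp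
    show "v x = 0" if "x \<notin> cball c r" for x using that by (simp add: v_def)
    show "\<exists>f. smooth f \<and> f x \<noteq> f y" if "x \<in> cball c r \<and> y \<in> cball c r \<and> x \<noteq> y" for x y
    proof (intro exI conjI)
      show "smooth (\<lambda>u. u \<bullet> (x - y))" by (rule smooth_inner)
      have "(x - y) \<bullet> (x - y) \<noteq> 0" using that by simp
      then show "x \<bullet> (x - y) \<noteq> y \<bullet> (x - y)" by (simp add: inner_diff_left)
    qed
    show "(LINT x|lborel. v x * f x) = 0" if f: "smooth f" for f
    proof -
      note fm[measurable] = borel_measurable_continuous_onI[OF smooth_continuous[OF f]]
      note fC = Cc_integrable(3)[OF sm[OF f]] and bs = Cc_integrable(3)[OF bC]
      have km: "k \<in> borel_measurable lebesgue" using k by (simp add: bdd_mult_def)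
      have "(LINT x|lborel. v x * f x) = (LINT x|lebesgue. v x * f x)"
        by (rule integral_completion[symmetric]) measurable
      also have "\<dots> = (LINT x|lebesgue. k x * fn (cls (\<lambda>x. \<beta> x * f x)) x * fn (cls \<beta>) x)"
      proof (rule integral_cong_AE)
        show "(\<lambda>x. v x * f x) \<in> borel_measurable lebesgue" by (rule borel_measurable_lborel_lebesgue) measurable
        show "(\<lambda>x. k x * fn (cls (\<lambda>x. \<beta> x * f x)) x * fn (cls \<beta>) x) \<in> borel_measurable lebesgue"
          by (intro borel_measurable_times km borel_measurable_lborel_lebesgue fn_measurable)
        show "AE x in lebesgue. v x * f x = k x * fn (cls (\<lambda>x. \<beta> x * f x)) x * fn (cls \<beta>) x"
          unfolding AE_lebesgue_iff using vae fn_cls[OF fC] fn_cls[OF bs] by eventually_elim simp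
      qed
      also have "\<dots> = inner (mulop k (cls (\<lambda>x. \<beta> x * f x))) (cls \<beta>)" by (rule inner_mulop[OF k, symmetric])
      also have "\<dots> = 0" unfolding \<beta>_def by (rule z[OF f])
      finally show ?thesis .
    qed
  qed (auto intro: smooth_const smooth_continuous smooth_add smooth_mult)
  then show ?thesis using vae
  proof eventually_elim
    case (elim x)
    then have "k x * (\<beta> x * \<beta> x) = 0" by simp
    moreover have "\<beta> x > 0" if "x \<in> ball c r"
      using that bump_pos[OF r, where ?x0.0=c and x=x] by (simp add: \<beta>_def dist_norm norm_minus_commute)
    ultimately show ?case by auto
  qed
qed

text \<open>By Lindelof countably many balls cover \<Omega>, so the exceptional null sets can be
  united.\<close>

lemma multiplier_zero:
  fixes k :: "real ^ 'n \<Rightarrow> real"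
  assumes k: "bdd_mult C k" "\<And>x. x \<notin> \<Omega> \<Longrightarrow> k x = 0" and \<Omega>: "open \<Omega>"
    and z: "\<And>\<psi>1 \<psi>2. \<psi>1 \<in> test_fun \<Omega> \<Longrightarrow> \<psi>2 \<in> test_fun \<Omega> \<Longrightarrow> inner (mulop k (cls \<psi>1)) (cls \<psi>2) = 0"
  shows "AE x in lborel. k x = 0"
proof -
  define F where "F = {B. \<exists>c r. B = ball c r \<and> r > 0 \<and> cball c r \<subseteq> \<Omega>}"
  obtain F' where F': "F' \<subseteq> F" "countable F'" "\<Union>F' = \<Union>F"
    by (rule Lindelof[of F]) (auto simp: F_def)
  have cover: "x \<in> \<Union>F" if x: "x \<in> \<Omega>" for x
  proof -
    obtain r where r: "r > 0" "cball x r \<subseteq> \<Omega>" using \<Omega> x open_contains_cball by blast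
    then have "ball x r \<in> F" unfolding F_def by blast
    moreover have "x \<in> ball x r" using r(1) by simp
    ultimately show ?thesis by blast
  qed
  have "AE x in lborel. x \<in> B \<longrightarrow> k x = 0" if B': "B \<in> F'" for B
  proof -
    obtain c r where B: "B = ball c r" "r > 0" "cball c r \<subseteq> \<Omega>" using B' F'(1) unfolding F_def by blast
    show ?thesis unfolding B(1)
    proof (rule multiplier_zero_on_ball[OF k(1) B(2)])
      fix f :: "real ^ 'n \<Rightarrow> real" assume f: "smooth f"
      show "inner (mulop k (cls (\<lambda>x. bump c r x * f x))) (cls (bump c r)) = 0"
      proof (rule z)
        show "(\<lambda>x. bump c r x * f x) \<in> test_fun \<Omega>"
        proof (rule test_funI[OF _ _ B(3)])
          show "smooth (\<lambda>x. bump c r x * f x)" by (intro smooth_mult smooth_bump f)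
          fix x assume "bump c r x * f x \<noteq> 0"
          then show "x \<in> cball c r"
            using bump_zero[OF B(2), where ?x0.0=c and x=x] by (force simp: dist_norm norm_minus_commute)
        qed
        show "bump c r \<in> test_fun \<Omega>" by (rule bump_test_fun[OF B(2,3)])
      qed
    qed
  qed
  then have "AE x in lborel. \<forall>B\<in>F'. x \<in> B \<longrightarrow> k x = 0" unfolding AE_ball_countable[OF F'(2)] by blast
  then show ?thesis
  proof eventually_elim
    case (elim x)
    show ?case
    proof (cases "x \<in> \<Omega>")
      case True
      then have "x \<in> \<Union>F'" using cover F'(3) by simp
      then show ?thesis using elim by blast
    qed (rule k(2))
  qed
qed

section \<open>Compactness in the coefficients and the stability estimate\<close>

locale finite_span = dirichlet s \<Omega> for s :: real and \<Omega> :: "(real ^ 'n) set" +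
  fixes m :: nat and g :: "nat \<Rightarrow> real ^ 'n \<Rightarrow> real" and W1 W2 :: "(real ^ 'n) set" and A C0 :: real
  assumes A: "A > 0" "\<And>i. i \<in> {1..m} \<Longrightarrow> bdd_mult A (res \<Omega> (g i))"
    and orth: "orthonormal_L2_on \<Omega> m g" and C0: "C0 > 0"
    and W1: "open W1" "W1 \<noteq> {}" "closure W1 \<inter> closure \<Omega> = {}"
    and W2: "open W2" "W2 \<noteq> {}" "closure W2 \<inter> closure \<Omega> = {}"
begin

definition Q :: "(nat \<Rightarrow> real) \<Rightarrow> real ^ 'n \<Rightarrow> real" where
  "Q c x = (\<Sum>i=1..m. c i * res \<Omega> (g i) x)"

definition N :: "(nat \<Rightarrow> real) \<Rightarrow> real" where "N c = (\<Sum>i=1..m. \<bar>c i\<bar>)"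

text \<open>The right side of the Alessandrini identity for the multiplier \<open>Q c\<close>,
  written as a sum so that linearity in the coefficients is immediate.\<close>

definition qf :: "(nat \<Rightarrow> real) \<Rightarrow> (real ^ 'n) l2 \<Rightarrow> (real ^ 'n) l2 \<Rightarrow> real" where
  "qf c u v = (\<Sum>i=1..m. c i * inner (mulop (res \<Omega> (g i)) (emb s u)) (emb s v))"

lemma \<Omega>_lebesgue: "\<Omega> \<in> sets lebesgue" using sets_completionI_sets[of \<Omega> lborel] \<Omega>_borel by simp

lemma N_nonneg: "N c \<ge> 0" unfolding N_def by (simp add: sum_nonneg)

lemma Q_exterior: "x \<notin> \<Omega> \<Longrightarrow> Q c x = 0" by (simp add: Q_def res_def)

lemma Q_bound: "bdd_mult (A * N c) (Q c)"
  unfolding bdd_mult_def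
proof
  have "res \<Omega> (g i) \<in> borel_measurable lebesgue" if "i \<in> {1..m}" for i using A(2)[OF that] by (simp add: bdd_mult_def)
  then show "Q c \<in> borel_measurable lebesgue" unfolding Q_def[abs_def] by (intro borel_measurable_sum borel_measurable_times) auto
  have "AE x in lborel. \<forall>i\<in>{1..m}. \<bar>res \<Omega> (g i) x\<bar> \<le> A"
    by (rule AE_finite_allI) (use A(2) in \<open>auto simp: bdd_mult_def\<close>)
  then show "AE x in lborel. \<bar>Q c x\<bar> \<le> A * N c"
  proof eventually_elim
    case (elim x)
    have "\<bar>Q c x\<bar> \<le> (\<Sum>i=1..m. \<bar>c i * res \<Omega> (g i) x\<bar>)" unfolding Q_def by (rule sum_abs)
    also have "\<dots> \<le> (\<Sum>i=1..m. A * \<bar>c i\<bar>)"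
    proof (rule sum_mono)
      fix i assume "i \<in> {1..m}"
      then have "\<bar>c i\<bar> * \<bar>res \<Omega> (g i) x\<bar> \<le> \<bar>c i\<bar> * A" using elim by (intro mult_left_mono) auto
      then show "\<bar>c i * res \<Omega> (g i) x\<bar> \<le> A * \<bar>c i\<bar>" by (simp add: abs_mult mult.commute)
    qed
    finally show ?case by (simp add: N_def sum_distrib_left)
  qed
qed

lemma Q_diff: "Q c x - Q d x = Q (\<lambda>i. c i - d i) x"
  unfolding Q_def by (simp add: sum_subtractf left_diff_distrib)

lemma mulop_Q: "mulop (Q c) a = (\<Sum>i=1..m. c i *\<^sub>R mulop (res \<Omega> (g i)) a)"
proof -
  have "(\<lambda>x. Q c x * fn a x) = (\<lambda>x. \<Sum>i=1..m. c i * (res \<Omega> (g i) x * fn a x))"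
    by (auto simp: Q_def sum_distrib_right mult.assoc)
  then show ?thesis unfolding mulop_def
    using cls_sum[of "{1..m}" "\<lambda>i x. res \<Omega> (g i) x * fn a x" c] bdd_mult_sqint[OF A(2) fn_sqint] by simp
qed

lemma qf_eq: "qf c u v = inner (mulop (Q c) (emb s u)) (emb s v)"
  unfolding qf_def mulop_Q by (simp add: inner_sum_left)

lemma qf_simps: "qf (\<lambda>i. c i - d i) u v = qf c u v - qf d u v" "qf (\<lambda>i. t * c i) u v = t * qf c u v"
  "qf c (u - u') v = qf c u v - qf c u' v" "qf c u (v - v') = qf c u v - qf c u v'" "qf c 0 v = 0" "qf c u 0 = 0"
proof -
  note e = emb_linear[OF s_le(1)] and M = mulop_linear[OF Q_bound[of c]]
  show "qf (\<lambda>i. c i - d i) u v = qf c u v - qf d u v" "qf (\<lambda>i. t * c i) u v = t * qf c u v"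
    unfolding qf_def by (simp_all add: sum_subtractf left_diff_distrib sum_distrib_left mult.assoc)
  show "qf c (u - u') v = qf c u v - qf c u' v" "qf c u (v - v') = qf c u v - qf c u v'" "qf c 0 v = 0" "qf c u 0 = 0"
    unfolding qf_eq linear_diff[OF e] linear_0[OF e] linear_diff[OF M] linear_0[OF M]
    by (simp_all add: inner_diff_left inner_diff_right)
qed

lemma qf_bound: "\<bar>qf c u v\<bar> \<le> A * N c * norm u * norm v"
proof -
  have "\<bar>qf c u v\<bar> \<le> norm (mulop (Q c) (emb s u)) * norm (emb s v)" unfolding qf_eq by (rule Cauchy_Schwarz_ineq2)
  also have "\<dots> \<le> (A * N c * norm (emb s u)) * norm (emb s v)"
    by (intro mult_right_mono mulop_norm[OF Q_bound]) (use A N_nonneg in auto)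
  also have "\<dots> \<le> A * N c * norm u * norm v"
    using A N_nonneg[of c] emb_norm[OF s_le(1)] by (intro mult_mono mult_left_mono) auto
  finally show ?thesis .
qed

lemma res_sqint: "i \<in> {1..m} \<Longrightarrow> res \<Omega> (g i) \<in> sqint"
proof -
  assume i: "i \<in> {1..m}"
  obtain R where R: "\<Omega> \<subseteq> cball 0 R" using \<Omega>(2) unfolding bounded_pos by (auto simp: subset_iff)
  have "(\<lambda>x. indicator (cball (0::real ^ 'n) R) x :: real) \<in> sqint"
    by (rule sqint_borelI) (use indicator_square_integrable[of 1 R] in auto)
  from bdd_mult_sqint[OF A(2)[OF i] this]
  have "(\<lambda>x. res \<Omega> (g i) x * indicator (cball 0 R) x) \<in> sqint" .
  moreover have "(\<lambda>x. res \<Omega> (g i) x * indicator (cball 0 R) x) = res \<Omega> (g i)"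
    using R by (auto simp: res_def indicator_def fun_eq_iff)
  ultimately show ?thesis by simp
qed

lemma gram: "i \<in> {1..m} \<Longrightarrow> j \<in> {1..m} \<Longrightarrow> inner (cls (res \<Omega> (g i))) (cls (res \<Omega> (g j))) = (if i = j then 1 else 0)"
proof -
  assume i: "i \<in> {1..m}" and j: "j \<in> {1..m}"
  have "inner (cls (res \<Omega> (g i))) (cls (res \<Omega> (g j))) = (LINT x|lebesgue. res \<Omega> (g i) x * res \<Omega> (g j) x)"
    by (rule inner_cls[OF res_sqint[OF i] res_sqint[OF j]])
  also have "(\<lambda>x. res \<Omega> (g i) x * res \<Omega> (g j) x) = (\<lambda>x. indicator \<Omega> x *\<^sub>R (g i x * g j x))"
    by (auto simp: res_def indicator_def)
  also have "(LINT x|lebesgue. indicator \<Omega> x *\<^sub>R (g i x * g j x)) = inner_L2_on \<Omega> (g i) (g j)"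
    unfolding inner_L2_on_def using integral_restrict_space[of \<Omega> lebesgue "\<lambda>x. g i x * g j x"] \<Omega>_lebesgue by simp
  also have "\<dots> = (if i = j then 1 else 0)" using orth i j unfolding orthonormal_L2_on_def by blast
  finally show ?thesis .
qed

lemma coefficient: "i \<in> {1..m} \<Longrightarrow> inner (cls (Q c)) (cls (res \<Omega> (g i))) = c i"
proof -
  assume i: "i \<in> {1..m}"
  have "cls (Q c) = (\<Sum>i=1..m. c i *\<^sub>R cls (res \<Omega> (g i)))"
    unfolding Q_def[abs_def] using cls_sum[of "{1..m}" "\<lambda>i. res \<Omega> (g i)" c] res_sqint by simp
  then have "inner (cls (Q c)) (cls (res \<Omega> (g i))) = (\<Sum>j\<in>{1..m}. c j * inner (cls (res \<Omega> (g j))) (cls (res \<Omega> (g i))))"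
    by (simp add: inner_sum_left)
  also have "\<dots> = (\<Sum>j\<in>{1..m}. if j = i then c j else 0)" by (rule sum.cong) (use gram i in auto)
  also have "\<dots> = c i" using i by simp
  finally show ?thesis .
qed

text \<open>Orthonormality recovers the coefficients as inner products, and on the bounded set
  \<Omega> the uniform bound \<open>C0\<close> controls the L2 norm. Admissible potentials thus have
  coefficients in a fixed bounded set.\<close>

lemma coefficient_bounds:
  obtains L where "L \<ge> 0" "\<And>c i. bdd_mult C0 (Q c) \<Longrightarrow> i \<in> {1..m} \<Longrightarrow> \<bar>c i\<bar> \<le> L"
proof -
  obtain R where R: "\<Omega> \<subseteq> cball 0 R" using \<Omega>(2) unfolding bounded_pos by (auto simp: subset_iff)
  define I where "I = cls (\<lambda>x. indicator (cball (0::real ^ 'n) R) x :: real)"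
  have Is: "(\<lambda>x. indicator (cball (0::real ^ 'n) R) x :: real) \<in> sqint"
    by (rule sqint_borelI) (use indicator_square_integrable[of 1 R] in auto)
  have "\<bar>c i\<bar> \<le> C0 * norm I" if c: "bdd_mult C0 (Q c)" and i: "i \<in> {1..m}" for c i
  proof -
    have "(\<lambda>x. Q c x * indicator (cball 0 R) x) = Q c"
    proof
      fix x show "Q c x * indicator (cball 0 R) x = Q c x"
        using R Q_exterior[of x c] by (cases "x \<in> \<Omega>") (auto simp: indicator_def)
    qed
    then have "mulop (Q c) I = cls (Q c)" unfolding I_def using mulop_cls[OF c Is] by simp
    then have n: "norm (cls (Q c)) \<le> C0 * norm I" using mulop_norm[OF c, of I] C0 by simp
    have u: "norm (cls (res \<Omega> (g i))) = 1" using gram[OF i i] by (simp add: norm_eq_1)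
    have "\<bar>c i\<bar> \<le> norm (cls (Q c)) * norm (cls (res \<Omega> (g i)))"
      using Cauchy_Schwarz_ineq2[of "cls (Q c)" "cls (res \<Omega> (g i))"] coefficient[OF i, of c] by simp
    then show ?thesis using n u by simp
  qed
  then show ?thesis using that[of "C0 * norm I"] C0 by simp
qed

text \<open>If all pairings of test functions vanished, \<open>Q d\<close> would be zero almost
  everywhere, and orthonormality would make every coefficient zero.\<close>

lemma nonzero_pairing:
  assumes d: "N d > 0"
  obtains \<Psi>1 \<Psi>2 where "\<Psi>1 \<in> X" "\<Psi>2 \<in> X" "qf d \<Psi>1 \<Psi>2 \<noteq> 0"
proof (rule ccontr)
  assume "\<not> thesis"
  then have z: "\<And>\<Psi>1 \<Psi>2. \<Psi>1 \<in> X \<Longrightarrow> \<Psi>2 \<in> X \<Longrightarrow> qf d \<Psi>1 \<Psi>2 = 0" using that by blast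
  have "AE x in lborel. Q d x = 0"
  proof (rule multiplier_zero[OF Q_bound Q_exterior \<Omega>(1)])
    fix \<psi>1 \<psi>2 assume t: "\<psi>1 \<in> test_fun \<Omega>" "\<psi>2 \<in> test_fun \<Omega>"
    have "qf d (sob s \<psi>1) (sob s \<psi>2) = 0" by (rule z; rule htl_test_fun; rule t)
    then show "inner (mulop (Q d) (cls \<psi>1)) (cls \<psi>2) = 0"
      unfolding qf_eq emb_sob[OF s_le(1) test_fun_in_Hs[OF t(1) s_le]] emb_sob[OF s_le(1) test_fun_in_Hs[OF t(2) s_le]] .
  qed
  then have "cls (Q d) = cls (\<lambda>x. 0)" by (rule cls_cong)
  then have "cls (Q d) = 0" by (simp add: zero_l2_def)
  then have "d i = 0" if "i \<in> {1..m}" for i using coefficient[OF that, of d] by simp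
  then have "N d = 0" by (simp add: N_def)
  then show False using d by simp
qed

lemma disjoint: "W1 \<inter> \<Omega> = {}" "W2 \<inter> \<Omega> = {}"
  using W1(3) W2(3) closure_subset by blast+

text \<open>Convergence of the coefficients gives convergence of the forms in norm, and unique
  continuation gives the injectivity for the limit \<open>a\<close>, even if zero is an eigenvalue
  for it.\<close>

lemma uniform_control:
  assumes W: "open W" "W \<noteq> {}" "closure W \<inter> closure \<Omega> = {}"
    and c: "\<And>n i. i \<in> {1..m} \<Longrightarrow> \<bar>c n i\<bar> \<le> L" "\<And>i. i \<in> {1..m} \<Longrightarrow> (\<lambda>n. c n i) \<longlonglongrightarrow> a i" and L: "L \<ge> 0"
    and psi: "\<psi> \<in> X" and e: "e > 0"
  obtains M n0 where "\<And>n. n \<ge> n0 \<Longrightarrow> \<exists>f\<in>htl s W. \<exists>w\<in>X. norm f \<le> M \<and> norm (w - \<psi>) \<le> e \<and>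
     (\<forall>y\<in>X. bf (Q (c n)) (f + w) y = 0)"
proof -
  \<comment> \<open>One bound for all potentials of the sequence and for their limit, so that a
    single constant \<open>1 + B\<close> serves all forms.\<close>
  define B where "B = A * (real m * L)"
  have B: "B \<ge> 0" unfolding B_def using A L by simp
  have bm: "bdd_mult B (Q b)" if "\<And>i. i \<in> {1..m} \<Longrightarrow> \<bar>b i\<bar> \<le> L" for b
  proof -
    have "N b \<le> real m * L" unfolding N_def using sum_bounded_above[of "{1..m}" "\<lambda>i. \<bar>b i\<bar>" L] that by simp
    then have "A * N b \<le> B" unfolding B_def using A by (intro mult_left_mono) auto
    then show ?thesis using Q_bound[of b] unfolding bdd_mult_def by (auto elim!: eventually_mono)
  qed
  have al: "\<bar>a i\<bar> \<le> L" if "i \<in> {1..m}" for i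
    by (rule LIMSEQ_le_const2[OF tendsto_rabs[OF c(2)[OF that]]]) (use c(1)[OF that] in auto)
  interpret T: compact_forms X "htl s W" "emb s" "1 + B" by (rule compact_forms_htl) (use B in simp)
  define \<delta> where "\<delta> n = A * N (\<lambda>i. c n i - a i)" for n
  have "(\<lambda>n. A * (\<Sum>i=1..m. \<bar>c n i - a i\<bar>)) \<longlonglongrightarrow> A * (\<Sum>i=1..m. \<bar>a i - a i\<bar>)"
    by (intro tendsto_intros c(2)) auto
  then have \<delta>: "\<delta> \<longlonglongrightarrow> 0" by (simp add: \<delta>_def[abs_def] N_def)
  note bc = bm[OF c(1)] and ba = bm[OF al]
  obtain M n0 where "\<And>n. n \<ge> n0 \<Longrightarrow> \<exists>f\<in>htl s W. \<exists>w\<in>X. norm f \<le> M \<and> norm (w - \<psi>) \<le> e \<and>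
     (\<forall>y\<in>X. inner (f + w) y - kf s (Q (c n)) (f + w) y = 0)"
  proof (rule T.uniform_runge[of "\<lambda>n. kf s (Q (c n))" "kf s (Q a)" \<delta> \<psi> e])
    show "T.form (kf s (Q (c n)))" for n by (rule form_kf[OF bc B])
    show "T.form (kf s (Q a))" by (rule form_kf[OF ba B])
    show "\<bar>kf s (Q (c n)) u v - kf s (Q a) u v\<bar> \<le> \<delta> n * norm u * norm v" for n u v
      unfolding \<delta>_def
    proof (rule kf_diff[OF s(1) s_le(2) bc ba])
      show "bdd_mult (A * N (\<lambda>i. c n i - a i)) (\<lambda>x. Q (c n) x - Q a x)" unfolding Q_diff by (rule Q_bound)
      show "A * N (\<lambda>i. c n i - a i) \<ge> 0" using A N_nonneg by simp
    qed
    show "z = 0" if "z \<in> X" "\<forall>w\<in>htl s W. inner z w - kf s (Q a) z w = 0" for z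
      by (rule unique_continuation[OF s \<Omega> W ba Q_exterior that(1)]) (use that(2) in auto)
  qed (use \<delta> psi e that in auto)
  then show ?thesis using that unfolding bf_def by blast
qed

text \<open>Normalised data exist because \<open>W1\<close> and \<open>W2\<close> contain bumps, so
  the supremum is not over the empty set, and the lower bound by an absolute value applies. This
  settles pairs with equal coefficients.\<close>

lemma DN_diff_norm_nonneg:
  assumes q: "represents C0 m1 q1" "represents C0 m2 q2"
  shows "0 \<le> DN_diff_norm s \<Omega> W1 W2 q1 q2"
proof -
  have ex: "\<exists>F\<in>htl s W. F \<noteq> 0" if W: "open W" "W \<noteq> {}" for W :: "(real ^ 'n) set"
  proof -
    obtain c r where r: "r > 0" "cball c r \<subseteq> W" using nonempty_open_cball[OF W] by blast
    have t: "bump c r \<in> test_fun W" by (rule bump_test_fun[OF r])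
    have "sob s (bump c r) \<noteq> 0"
    proof
      assume "sob s (bump c r) = 0"
      then have z0: "cls (bump c r) = 0"
        using emb_sob[OF s_le(1) test_fun_in_Hs[OF t s_le]] linear_0[OF emb_linear[OF s_le(1)]] by metis
      have "AE x in lborel. bump c r x = 0"
        using fn_cls[OF Cc_integrable(3)[OF bump_Cc[OF r(1), of c]]] fn_zero unfolding z0 by eventually_elim simp
      then have "(LINT x|lborel. bump c r x) = 0" by (rule integral_eq_zero_AE)
      then show False using bump_integral_pos[OF r(1), of c] by simp
    qed
    then show ?thesis using htl_test_fun[OF t] by blast
  qed
  obtain F1 where F1: "F1 \<in> htl s W1" "F1 \<noteq> 0" using ex[OF W1(1,2)] by blast
  obtain F2 where F2: "F2 \<in> htl s W2" "F2 \<noteq> 0" using ex[OF W2(1,2)] by blast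
  obtain U1 where U1: "solves m1 F1 U1" using solves_exists[OF q(1)] by blast
  obtain U2 where U2: "solves m2 F2 U2" using solves_exists[OF q(2)] by blast
  have "ereal 0 \<le> ereal (\<bar>inner (mulop (\<lambda>x. m1 x - m2 x) (emb s (U1 - F1))) (emb s (U2 - F2))\<bar> / (norm F1 * norm F2))" by simp
  also have "\<dots> \<le> DN_diff_norm s \<Omega> W1 W2 q1 q2"
    by (rule DN_diff_norm_ge[OF q W1(1) disjoint(1) W2(1) disjoint(2) F1(1) F2(1) _ _ _ _ F1(2) F2(2)])
       (use U1 U2 in \<open>auto simp: solves_def\<close>)
  finally show ?thesis by (simp add: zero_ereal_def)
qed

text \<open>The direction of the difference of the potentials converges along a subsequence; its limit is
  detected by a pair of test functions, which by the controllability are approximated by solutions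
  with bounded exterior data.\<close>

lemma DN_diff_norm_sequence:
  fixes c1 c2 :: "nat \<Rightarrow> nat \<Rightarrow> real" and q1 q2 :: "nat \<Rightarrow> real ^ 'n \<Rightarrow> real"
  assumes q: "\<And>n. represents C0 (Q (c1 n)) (q1 n)" "\<And>n. represents C0 (Q (c2 n)) (q2 n)"
    and pos: "\<And>n. N (\<lambda>i. c1 n i - c2 n i) > 0"
  shows "\<exists>\<kappa>>0. \<forall>n0. \<exists>n\<ge>n0. ereal (\<kappa> * N (\<lambda>i. c1 n i - c2 n i)) \<le> DN_diff_norm s \<Omega> W1 W2 (q1 n) (q2 n)"
proof -
  define \<nu> where "\<nu> n = N (\<lambda>i. c1 n i - c2 n i)" for n
  define d where "d n i = (c1 n i - c2 n i) / \<nu> n" for n i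
  have \<nu>: "\<nu> n > 0" for n using pos by (simp add: \<nu>_def)
  have Nd: "N (d n) = 1" for n
  proof -
    have "N (d n) = (\<Sum>i=1..m. \<bar>c1 n i - c2 n i\<bar>) / \<nu> n"
      unfolding N_def d_def sum_divide_distrib using \<nu>[of n] by (intro sum.cong) auto
    also have "\<dots> = \<nu> n / \<nu> n" unfolding \<nu>_def N_def ..
    finally show ?thesis using \<nu>[of n] by simp
  qed
  obtain L where L: "L \<ge> 0" "\<And>c i. bdd_mult C0 (Q c) \<Longrightarrow> i \<in> {1..m} \<Longrightarrow> \<bar>c i\<bar> \<le> L" using coefficient_bounds by blast
  have c1: "\<bar>c1 n i\<bar> \<le> L" and c2: "\<bar>c2 n i\<bar> \<le> L" if "i \<in> {1..m}" for n i
    using q[of n] that by (auto simp: represents_def intro: L)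
  have d1: "\<bar>d n i\<bar> \<le> 1" if "i \<in> {1..m}" for n i
    using member_le_sum[of i "{1..m}" "\<lambda>i. \<bar>d n i\<bar>"] that Nd[of n] by (simp add: N_def)
  \<comment> \<open>Both families of coefficients and the normalised difference are packed into one
    function, so that one extraction makes all three converge.\<close>
  define \<phi> where "\<phi> n p = (case p of (k, i) \<Rightarrow> if k = 0 then c1 n i else if k = 1 then c2 n i else d n i)" for n :: nat and p :: "nat \<times> nat"
  have "norm (\<phi> n p) \<le> L + 1" if "p \<in> {0, 1, 2} \<times> {1..m}" for n p
  proof -
    obtain k i where p: "p = (k, i)" "i \<in> {1..m}" using \<open>p \<in> _\<close> by blast
    show ?thesis using c1[OF p(2), of n] c2[OF p(2), of n] d1[OF p(2), of n] L(1) by (auto simp: \<phi>_def p(1))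
  qed
  then obtain r where r: "strict_mono (r::nat\<Rightarrow>nat)" "\<And>p. p \<in> {0, 1, 2} \<times> {1..m} \<Longrightarrow> \<exists>l. (\<lambda>n. \<phi> (r n) p) \<longlonglongrightarrow> l"
    using function_convergent_subsequence[of "{0, 1, 2} \<times> {1..m}" \<phi> "L + 1"] by (metis countable_finite finite_SigmaI finite_atLeastAtMost finite.emptyI finite_insert)
  define l where "l p = lim (\<lambda>n. \<phi> (r n) p)" for p
  have l: "(\<lambda>n. \<phi> (r n) p) \<longlonglongrightarrow> l p" if "p \<in> {0, 1, 2} \<times> {1..m}" for p
    using r(2)[OF that] unfolding l_def by (auto dest: limI)
  define a b where "a i = l (0, i)" and "b i = l (1, i)" for i
  define d' where "d' i = l (2, i)" for i
  have lim: "(\<lambda>n. c1 (r n) i) \<longlonglongrightarrow> a i" "(\<lambda>n. c2 (r n) i) \<longlonglongrightarrow> b i" "(\<lambda>n. d (r n) i) \<longlonglongrightarrow> d' i" if "i \<in> {1..m}" for i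
    using l[of "(0, i)"] l[of "(1, i)"] l[of "(2, i)"] that by (simp_all add: \<phi>_def a_def b_def d'_def)
  have "(\<lambda>n. N (d (r n))) \<longlonglongrightarrow> N d'" unfolding N_def by (intro tendsto_intros lim)
  then have Nd': "N d' = 1" unfolding Nd by (simp add: LIMSEQ_const_iff)
  obtain \<Psi>1 \<Psi>2 where \<Psi>: "\<Psi>1 \<in> X" "\<Psi>2 \<in> X" "qf d' \<Psi>1 \<Psi>2 \<noteq> 0" using nonzero_pairing[of d'] Nd' by auto
  define T where "T = \<bar>qf d' \<Psi>1 \<Psi>2\<bar>"
  have T: "T > 0" using \<Psi>(3) by (simp add: T_def)
  \<comment> \<open>Bounds \<open>w1\<close> and \<open>w2\<close>, which are within
    \<open>e \<le> 1\<close> of the two targets.\<close>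
  define P where "P = norm \<Psi>1 + norm \<Psi>2 + 1"
  have P: "P \<ge> 1" by (simp add: P_def)
  \<comment> \<open>Chosen so that replacing either target by its approximation changes the pairing
    with \<open>d'\<close> by at most \<open>T / 8\<close>. Exchanging \<open>d\<close> for
    \<open>d'\<close> costs \<open>T / 4\<close>, so half of \<open>T\<close> survives.\<close>
  define e where "e = min 1 (T / (8 * A * P))"
  have e: "e > 0" "e \<le> 1" "A * P * e \<le> T / 8"
  proof -
    have "T / (8 * A * P) > 0" using T A P by simp
    then show "e > 0" "e \<le> 1" by (auto simp: e_def)
    have "A * P * e \<le> A * P * (T / (8 * A * P))" using A P by (intro mult_left_mono) (auto simp: e_def)
    also have "\<dots> = T / 8" using A P by simp
    finally show "A * P * e \<le> T / 8" .
  qed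
  obtain M1 n1 where R1: "\<And>n. n \<ge> n1 \<Longrightarrow> \<exists>f\<in>htl s W1. \<exists>w\<in>X. norm f \<le> M1 \<and> norm (w - \<Psi>1) \<le> e \<and>
     (\<forall>y\<in>X. bf (Q (c1 (r n))) (f + w) y = 0)"
    by (rule uniform_control[OF W1 c1 lim(1) L(1) \<Psi>(1) e(1)]) auto
  obtain M2 n2 where R2: "\<And>n. n \<ge> n2 \<Longrightarrow> \<exists>f\<in>htl s W2. \<exists>w\<in>X. norm f \<le> M2 \<and> norm (w - \<Psi>2) \<le> e \<and>
     (\<forall>y\<in>X. bf (Q (c2 (r n))) (f + w) y = 0)"
    by (rule uniform_control[OF W2 c2 lim(2) L(1) \<Psi>(2) e(1)]) auto
  have "(\<lambda>n. A * (\<Sum>i=1..m. \<bar>d (r n) i - d' i\<bar>) * P * P) \<longlonglongrightarrow> A * (\<Sum>i=1..m. \<bar>d' i - d' i\<bar>) * P * P"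
    by (intro tendsto_intros lim)
  then have "(\<lambda>n. A * N (\<lambda>i. d (r n) i - d' i) * P * P) \<longlonglongrightarrow> 0" by (simp add: N_def)
  then have "\<forall>\<^sub>F n in sequentially. A * N (\<lambda>i. d (r n) i - d' i) * P * P < T / 4"
    by (rule order_tendstoD(2)) (use T in simp)
  then obtain n3 where n3: "\<And>n. n \<ge> n3 \<Longrightarrow> A * N (\<lambda>i. d (r n) i - d' i) * P * P < T / 4"
    unfolding eventually_sequentially by blast
  \<comment> \<open>\<open>T / 2\<close> over the bounds of the exterior data; the maxima with 1
    keep the denominator positive whatever \<open>M1\<close> and \<open>M2\<close> are.\<close>
  define \<kappa> where "\<kappa> = T / 2 / (max M1 1 * max M2 1)"
  have \<kappa>: "\<kappa> > 0" using T by (simp add: \<kappa>_def)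
  have "\<exists>n\<ge>n0. ereal (\<kappa> * \<nu> n) \<le> DN_diff_norm s \<Omega> W1 W2 (q1 n) (q2 n)" for n0
  proof -
    define n where "n = n0 + n1 + n2 + n3"
    define k where "k = r n"
    have k: "k \<ge> n0" using seq_suble[OF r(1), of n] by (simp add: k_def n_def)
    obtain f1 w1 where 1: "f1 \<in> htl s W1" "w1 \<in> X" "norm f1 \<le> M1" "norm (w1 - \<Psi>1) \<le> e" "\<forall>y\<in>X. bf (Q (c1 k)) (f1 + w1) y = 0"
      using R1[of n] unfolding k_def n_def by auto
    obtain f2 w2 where 2: "f2 \<in> htl s W2" "w2 \<in> X" "norm f2 \<le> M2" "norm (w2 - \<Psi>2) \<le> e" "\<forall>y\<in>X. bf (Q (c2 k)) (f2 + w2) y = 0"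
      using R2[of n] unfolding k_def n_def by auto
    define V where "V = qf (\<lambda>i. c1 k i - c2 k i) w1 w2"
    have "(\<lambda>i. c1 k i - c2 k i) = (\<lambda>i. \<nu> k * d k i)" using \<nu>[of k] by (simp add: d_def)
    then have Vd: "V = \<nu> k * qf (d k) w1 w2" unfolding V_def by (simp add: qf_simps)
    have w: "norm w1 \<le> P" "norm w2 \<le> P"
      unfolding P_def using 1(4) 2(4) e(2) norm_triangle_sub[of w1 \<Psi>1] norm_triangle_sub[of w2 \<Psi>2]
        norm_ge_zero[of \<Psi>1] norm_ge_zero[of \<Psi>2] by linarith+
    have "\<bar>qf (\<lambda>i. d k i - d' i) w1 w2\<bar> \<le> A * N (\<lambda>i. d k i - d' i) * norm w1 * norm w2" by (rule qf_bound)
    also have "\<dots> \<le> A * N (\<lambda>i. d k i - d' i) * P * P" using w A P N_nonneg by (intro mult_mono mult_left_mono mult_nonneg_nonneg) auto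
    also have "\<dots> < T / 4" unfolding k_def by (rule n3) (simp add: n_def)
    finally have t1: "\<bar>qf (\<lambda>i. d k i - d' i) w1 w2\<bar> < T / 4" .
    have "\<bar>qf d' (w1 - \<Psi>1) w2\<bar> \<le> A * N d' * norm (w1 - \<Psi>1) * norm w2" by (rule qf_bound)
    also have "\<dots> \<le> A * N d' * e * P" using w 1(4) A e(1) N_nonneg by (intro mult_mono mult_left_mono mult_nonneg_nonneg) auto
    also have "\<dots> \<le> T / 8" using e(3) unfolding Nd' by (simp add: mult_ac)
    finally have t2: "\<bar>qf d' (w1 - \<Psi>1) w2\<bar> \<le> T / 8" .
    have "\<bar>qf d' \<Psi>1 (w2 - \<Psi>2)\<bar> \<le> A * N d' * norm \<Psi>1 * norm (w2 - \<Psi>2)" by (rule qf_bound)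
    also have "\<dots> \<le> A * N d' * P * e" using 2(4) A e(1) N_nonneg P by (intro mult_mono mult_left_mono mult_nonneg_nonneg) (auto simp: P_def)
    also have "\<dots> \<le> T / 8" using e(3) unfolding Nd' by simp
    finally have t3: "\<bar>qf d' \<Psi>1 (w2 - \<Psi>2)\<bar> \<le> T / 8" .
    \<comment> \<open>Telescoping: exchange the direction first, then one argument at a
      time.\<close>
    have "qf (d k) w1 w2 = qf d' \<Psi>1 \<Psi>2 + qf (\<lambda>i. d k i - d' i) w1 w2 + qf d' (w1 - \<Psi>1) w2 + qf d' \<Psi>1 (w2 - \<Psi>2)"
      by (simp add: qf_simps)
    then have "\<bar>qf (d k) w1 w2\<bar> \<ge> T / 2" using t1 t2 t3 unfolding T_def by linarith
    then have V: "\<bar>V\<bar> \<ge> \<nu> k * (T / 2)" unfolding Vd abs_mult using \<nu>[of k] by (simp add: mult_left_mono)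
    moreover have "\<nu> k * (T / 2) > 0" using \<nu>[of k] T by simp
    ultimately have V0: "V \<noteq> 0" by auto
    have f1: "f1 \<noteq> 0"
    proof
      assume "f1 = 0"
      \<comment> \<open>Without exterior data \<open>w1\<close> solves the homogeneous Dirichlet
        problem, and zero is not an eigenvalue for the members of the sequence.\<close>
      then have "w1 = 0" using bf_injective[OF q(1)[of k] 1(2)] 1(5) by simp
      then show False using V0 by (simp add: V_def qf_simps)
    qed
    have f2: "f2 \<noteq> 0"
    proof
      assume "f2 = 0"
      then have "w2 = 0" using bf_injective[OF q(2)[of k] 2(2)] 2(5) by simp
      then show False using V0 by (simp add: V_def qf_simps)
    qed
    have V': "V = inner (mulop (\<lambda>x. Q (c1 k) x - Q (c2 k) x) (emb s w1)) (emb s w2)"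
      unfolding V_def qf_eq Q_diff ..
    have "\<kappa> * \<nu> k = \<nu> k * (T / 2) / (max M1 1 * max M2 1)" by (simp add: \<kappa>_def)
    also have "\<dots> \<le> \<bar>V\<bar> / (norm f1 * norm f2)"
    proof (rule frac_le)
      show "norm f1 * norm f2 \<le> max M1 1 * max M2 1" using 1(3) 2(3) by (intro mult_mono) auto
    qed (use V f1 f2 in auto)
    finally have "ereal (\<kappa> * \<nu> k) \<le> ereal (\<bar>V\<bar> / (norm f1 * norm f2))" by simp
    also have "\<dots> \<le> DN_diff_norm s \<Omega> W1 W2 (q1 k) (q2 k)"
      unfolding V'
      by (rule DN_diff_norm_ge[OF q W1(1) disjoint(1) W2(1) disjoint(2) 1(1) 2(1) 1(2) 2(2) _ _ f1 f2])
         (use 1(5) 2(5) in auto)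
    finally show ?thesis using k by blast
  qed
  then show ?thesis using \<kappa> unfolding \<nu>_def by blast
qed

lemma span_represents:
  assumes q: "q \<in> span_on \<Omega> m g" "Linf_norm \<Omega> q \<le> ereal C0" "zero_not_dirichlet_eigenvalue s \<Omega> q"
  obtains c where "represents C0 (Q c) q"
proof -
  obtain c where c: "AE x in lebesgue_on \<Omega>. q x = (\<Sum>i=1..m. c i * g i x)" and qm: "q \<in> borel_measurable (lebesgue_on \<Omega>)"
    using q(1) unfolding span_on_def by blast
  have b: "bdd_mult C0 (res \<Omega> q)" by (rule bdd_mult_res[OF \<Omega>_lebesgue qm q(2)]) (use C0 in simp)
  have ae: "AE x in lborel. res \<Omega> q x = Q c x"
    using c unfolding AE_on_iff[OF \<Omega>_lebesgue] by eventually_elim (auto simp: res_def Q_def)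
  have "AE x in lborel. \<bar>Q c x\<bar> \<le> C0"
  proof -
    have "AE x in lborel. \<bar>res \<Omega> q x\<bar> \<le> C0" using b by (simp add: bdd_mult_def)
    then show ?thesis using ae by eventually_elim simp
  qed
  then have "bdd_mult C0 (Q c)" using Q_bound[of c] by (simp add: bdd_mult_def)
  then show ?thesis using that[of c] b ae q(3) C0 Q_exterior unfolding represents_def by auto
qed

lemma span_diff_norm:
  assumes q: "q1 \<in> span_on \<Omega> m g" "q2 \<in> span_on \<Omega> m g" and r: "represents C0 (Q c1) q1" "represents C0 (Q c2) q2"
  shows "Linf_norm \<Omega> (\<lambda>x. q1 x - q2 x) \<le> ereal (A * N (\<lambda>i. c1 i - c2 i))"
proof (rule Linf_norm_le[OF \<Omega>_lebesgue])
  show "(\<lambda>x. q1 x - q2 x) \<in> borel_measurable (lebesgue_on \<Omega>)" using q by (auto simp: span_on_def)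
  have ae: "AE x in lborel. res \<Omega> q1 x = Q c1 x" "AE x in lborel. res \<Omega> q2 x = Q c2 x" using r by (auto simp: represents_def)
  have "AE x in lborel. \<bar>Q (\<lambda>i. c1 i - c2 i) x\<bar> \<le> A * N (\<lambda>i. c1 i - c2 i)" using Q_bound by (simp add: bdd_mult_def)
  then show "AE x in lborel. x \<in> \<Omega> \<longrightarrow> \<bar>q1 x - q2 x\<bar> \<le> A * N (\<lambda>i. c1 i - c2 i)"
    using ae by eventually_elim (auto simp: res_def Q_diff[symmetric])
qed

theorem lipschitz_stability:
  "\<exists>C1::real. C1 > 0 \<and>
    (\<forall>q1 \<in> span_on \<Omega> m g. \<forall>q2 \<in> span_on \<Omega> m g.
       Linf_norm \<Omega> q1 \<le> ereal C0 \<longrightarrow> Linf_norm \<Omega> q2 \<le> ereal C0 \<longrightarrow>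
       zero_not_dirichlet_eigenvalue s \<Omega> q1 \<longrightarrow> zero_not_dirichlet_eigenvalue s \<Omega> q2 \<longrightarrow>
       Linf_norm \<Omega> (\<lambda>x. q1 x - q2 x) \<le> ereal C1 * DN_diff_norm s \<Omega> W1 W2 q1 q2)"
proof (rule ccontr)
  assume neg: "\<not> ?thesis"
  \<comment> \<open>The violated constants are \<open>n + 1\<close>: positive for every
    \<open>n\<close>, and eventually larger than \<open>A / \<kappa>\<close>.\<close>
  define P where "P n q1 q2 c1 c2 \<longleftrightarrow> represents C0 (Q c1) q1 \<and> represents C0 (Q c2) q2 \<and>
      Linf_norm \<Omega> (\<lambda>x. q1 x - q2 x) \<le> ereal (A * N (\<lambda>i. c1 i - c2 i)) \<and>
      \<not> Linf_norm \<Omega> (\<lambda>x. q1 x - q2 x) \<le> ereal (real (Suc n)) * DN_diff_norm s \<Omega> W1 W2 q1 q2" for n q1 q2 c1 c2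
  have "\<exists>q1 q2 c1 c2. P n q1 q2 c1 c2" for n
  proof -
    have "real (Suc n) > 0" by simp
    with neg obtain q1 q2 where q: "q1 \<in> span_on \<Omega> m g" "q2 \<in> span_on \<Omega> m g" "Linf_norm \<Omega> q1 \<le> ereal C0" "Linf_norm \<Omega> q2 \<le> ereal C0"
      "zero_not_dirichlet_eigenvalue s \<Omega> q1" "zero_not_dirichlet_eigenvalue s \<Omega> q2"
      "\<not> Linf_norm \<Omega> (\<lambda>x. q1 x - q2 x) \<le> ereal (real (Suc n)) * DN_diff_norm s \<Omega> W1 W2 q1 q2" by blast
    obtain c1 where c1: "represents C0 (Q c1) q1" by (rule span_represents[OF q(1,3,5)])
    obtain c2 where c2: "represents C0 (Q c2) q2" by (rule span_represents[OF q(2,4,6)])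
    show ?thesis unfolding P_def using c1 c2 q(7) span_diff_norm[OF q(1,2) c1 c2] by blast
  qed
  then obtain q1 q2 c1 c2 where P: "\<And>n. P n (q1 n) (q2 n) (c1 n) (c2 n)" by metis
  have r: "\<And>n. represents C0 (Q (c1 n)) (q1 n)" "\<And>n. represents C0 (Q (c2 n)) (q2 n)"
    and le: "\<And>n. Linf_norm \<Omega> (\<lambda>x. q1 n x - q2 n x) \<le> ereal (A * N (\<lambda>i. c1 n i - c2 n i))"
    and gt: "\<And>n. \<not> Linf_norm \<Omega> (\<lambda>x. q1 n x - q2 n x) \<le> ereal (real (Suc n)) * DN_diff_norm s \<Omega> W1 W2 (q1 n) (q2 n)"
    using P unfolding P_def by blast+
  \<comment> \<open>With equal coefficients the left side of the estimate is at most 0 and the right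
    side nonnegative, so the pair would not be a counterexample.\<close>
  have "N (\<lambda>i. c1 n i - c2 n i) > 0" for n
  proof (rule ccontr)
    assume "\<not> ?thesis"
    then have "N (\<lambda>i. c1 n i - c2 n i) = 0" using N_nonneg[of "\<lambda>i. c1 n i - c2 n i"] by simp
    then have "Linf_norm \<Omega> (\<lambda>x. q1 n x - q2 n x) \<le> 0" using le[of n] by (simp add: zero_ereal_def)
    also have "0 \<le> ereal (real (Suc n)) * DN_diff_norm s \<Omega> W1 W2 (q1 n) (q2 n)"
      using DN_diff_norm_nonneg[OF r(1)[of n] r(2)[of n]] by (intro ereal_0_le_mult) auto
    finally show False using gt by blast
  qed
  then obtain \<kappa> where \<kappa>: "\<kappa> > 0" "\<And>n0. \<exists>n\<ge>n0. ereal (\<kappa> * N (\<lambda>i. c1 n i - c2 n i)) \<le> DN_diff_norm s \<Omega> W1 W2 (q1 n) (q2 n)"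
    using DN_diff_norm_sequence[of c1 q1 c2 q2, OF r] by metis
  obtain n0 :: nat where n0: "A / \<kappa> < real n0" using reals_Archimedean2 by blast
  obtain n where n: "n \<ge> n0" "ereal (\<kappa> * N (\<lambda>i. c1 n i - c2 n i)) \<le> DN_diff_norm s \<Omega> W1 W2 (q1 n) (q2 n)" using \<kappa>(2) by blast
  have "A \<le> real (Suc n) * \<kappa>"
  proof -
    have "A < real n0 * \<kappa>" using n0 \<kappa>(1) by (simp add: field_simps)
    also have "\<dots> \<le> real (Suc n) * \<kappa>" using n(1) \<kappa>(1) by (intro mult_right_mono) auto
    finally show ?thesis by simp
  qed
  then have "A * N (\<lambda>i. c1 n i - c2 n i) \<le> real (Suc n) * \<kappa> * N (\<lambda>i. c1 n i - c2 n i)"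
    using N_nonneg by (rule mult_right_mono)
  then have "Linf_norm \<Omega> (\<lambda>x. q1 n x - q2 n x) \<le> ereal (real (Suc n)) * ereal (\<kappa> * N (\<lambda>i. c1 n i - c2 n i))"
    using le[of n] by (simp add: mult.assoc order_trans)
  also have "\<dots> \<le> ereal (real (Suc n)) * DN_diff_norm s \<Omega> W1 W2 (q1 n) (q2 n)"
    by (rule ereal_mult_left_mono[OF n(2)]) simp
  finally show False using gt by blast
qed

end

theorem corollary3p4:
  fixes s C0 :: real and m :: nat
    and \<Omega> W1 W2 :: "(real ^ 'n) set"
    and g :: "nat \<Rightarrow> real ^ 'n \<Rightarrow> real"
  assumes "0 < s" and "s < 1" and "m \<ge> 1"
    and "bounded \<Omega>" and "smooth_domain \<Omega>"
    and "lipschitz_domain W1" and "W1 \<subseteq> - closure \<Omega>" and "closure W1 \<inter> closure \<Omega> = {}"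
    and "lipschitz_domain W2" and "W2 \<subseteq> - closure \<Omega>" and "closure W2 \<inter> closure \<Omega> = {}"
    and "\<forall>i\<in>{1..m}. g i \<in> Linf \<Omega>" and "orthonormal_L2_on \<Omega> m g"
    and "0 < C0"
  shows "\<exists>C1::real. C1 > 0 \<and>
    (\<forall>q1 \<in> span_on \<Omega> m g. \<forall>q2 \<in> span_on \<Omega> m g.
       Linf_norm \<Omega> q1 \<le> ereal C0 \<longrightarrow> Linf_norm \<Omega> q2 \<le> ereal C0 \<longrightarrow>
       zero_not_dirichlet_eigenvalue s \<Omega> q1 \<longrightarrow> zero_not_dirichlet_eigenvalue s \<Omega> q2 \<longrightarrow>
       Linf_norm \<Omega> (\<lambda>x. q1 x - q2 x) \<le> ereal C1 * DN_diff_norm s \<Omega> W1 W2 q1 q2)"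
proof -
  have dom: "open \<Omega>" "open W1" "W1 \<noteq> {}" "open W2" "W2 \<noteq> {}"
    using assms by (auto simp: smooth_domain_def lipschitz_domain_def is_domain_def)
  have \<Omega>: "\<Omega> \<in> sets lebesgue" using sets_completionI_sets[of \<Omega> lborel] dom(1) by simp
  \<comment> \<open>\<open>real_of_ereal\<close> sends infinite values to 0; since the norm is below
    \<open>\<infinity>\<close>, \<open>a i\<close> bounds it in every case.\<close>
  define a where "a i = max 0 (real_of_ereal (Linf_norm \<Omega> (g i)))" for i
  define A where "A = 1 + (\<Sum>i=1..m. a i)"
  have a0: "a i \<ge> 0" for i by (simp add: a_def)
  have A: "A > 0" unfolding A_def using a0 by (simp add: sum_nonneg add_pos_nonneg)
  have "bdd_mult A (res \<Omega> (g i))" if i: "i \<in> {1..m}" for i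
  proof (rule bdd_mult_res[OF \<Omega>])
    have g: "g i \<in> borel_measurable (lebesgue_on \<Omega>)" "Linf_norm \<Omega> (g i) < \<infinity>" using assms(12) i by (auto simp: Linf_def)
    show "g i \<in> borel_measurable (lebesgue_on \<Omega>)" by (rule g(1))
    have "Linf_norm \<Omega> (g i) \<le> ereal (a i)" using g(2) unfolding a_def by (cases "Linf_norm \<Omega> (g i)") auto
    also have "a i \<le> A" unfolding A_def using member_le_sum[of i "{1..m}" a] i a0 by simp
    finally show "Linf_norm \<Omega> (g i) \<le> ereal A" by simp
  qed (use A in simp)
  then interpret finite_span s \<Omega> m g W1 W2 A C0
    by unfold_locales (use assms dom A in auto)
  show ?thesis by (rule lipschitz_stability)
qed

end
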